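(* Let $Q$ be a quiver, $\underline d,\underline f,\underline k\in\mathbb{Z}_{\ge0}^{Q_0}$ with $k_v\le d_v$ for all $v$, and let $(\widehat X,\widehat Y,a,\widehat b)\in\mathrm{Rep}^{\underline k}(\underline d;\underline f)^{\mathrm{st}}_0$. Consider the maps $$\mathrm{Lie}(P_{\underline k})\xrightarrow{\ \jmath\ }\bigoplus_{e\in Q_1}\mathrm{Hom}(\widehat D_{\mathrm{out}(e)},D_{\mathrm{in}(e)})\oplus\mathrm{Hom}(\widehat D_{\mathrm{in}(e)},D_{\mathrm{out}(e)})\oplus\bigoplus_{v\in Q_0}\mathrm{Hom}(F_v,D_v)\oplus\mathrm{Hom}(\widehat D_v,F_v)\xrightarrow{\ d\mu\ }\bigoplus_{v\in Q_0}\mathrm{Hom}(\widehat D_v,D_v)$$ given by $$\jmath\big((\xi_v)_{v}\big)=\left(\xi_{\mathrm{in}(e)}\widehat X_e-\widehat X_e\widehat\xi_{\mathrm{out}(e)},\ \xi_{\mathrm{out}(e)}\widehat Y_e-\widehat Y_e\widehat\xi_{\mathrm{in}(e)},\ \xi_va_v,\ -\widehat b_v\widehat\xi_v\right),$$ $$d\mu(\widehat A,\widehat B,i,\widehat j)=\Big(\sum_{\mathrm{in}(e)=v}\big[\widehat A_e\pi_{\mathrm{out}(e)}\widehat Y_e+\widehat X_e\pi_{\mathrm{out}(e)}\widehat B_e\big]-\sum_{\mathrm{out}(e)=v}\big[\widehat Y_e\pi_{\mathrm{in}(e)}\widehat A_e+\widehat B_e\pi_{\mathrm{in}(e)}\widehat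 X_e\big]+i_v\widehat b_v+a_v\widehat j_v\Big)_{v\in Q_0},$$ where for $\xi_v\in\mathrm{Lie}(P_{\underline k})_v\subseteq\mathrm{End}(D_v)$, $\widehat\xi_v\in\mathrm{End}(\widehat D_v)$ denotes the induced endomorphism (so $\pi_v\xi_v=\widehat\xi_v\pi_v$). Then: (1) $\jmath$ is injective and $d\mu$ is surjective; (2) $d\mu\circ\jmath=0$; (3) the tangent space to $\mathcal{M}^{\underline k}_Q(\underline d;\underline f)$ at the $P_{\underline k}$-orbit of $(\widehat X,\widehat Y,a,\widehat b)$ is the homology (at the middle term) of this complex.
   Context: Everything is over $\mathbb{C}$. $Q=(Q_0,Q_1,\mathrm{out},\mathrm{in})$ is a quiver (loops and multiple arrows allowed); an arrow $e\in Q_1$ goes from $\mathrm{out}(e)$ to $\mathrm{in}(e)$. Fix vector spaces $D_v,F_v,\widehat D_v$ ($v\in Q_0$) of dimensions $d_v,f_v,d_v-k_v$, and surjections $\pi_v:D_v\twoheadrightarrow\widehat D_v$ with kernel $K_v$, $\dim K_v=k_v$. Put $$\mathrm{Rep}^{\underline k}(\underline d;\underline f)=\bigoplus_{e\in Q_1}\mathrm{Hom}(\widehat D_{\mathrm{out}(e)},D_{\mathrm{in}(e)})\oplus\mathrm{Hom}(\widehat D_{\mathrm{in}(e)},D_{\mathrm{out}(e)})\oplus\bigoplus_{v\in Q_0}\mathrm{Hom}(F_v,D_v)\oplus\mathrm{Hom}(\widehat D_v,F_v),$$ with elements written $(\widehat A_e,\widehat B_e,i_v,\widehat j_v)$, and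 the injective map $\iota(\widehat A_e,\widehat B_e,i_v,\widehat j_v)=(\widehat A_e\pi_{\mathrm{out}(e)},\widehat B_e\pi_{\mathrm{in}(e)},i_v,\widehat j_v\pi_v)=:(A_e,B_e,i_v,j_v)$, where $A_e:D_{\mathrm{out}(e)}\to D_{\mathrm{in}(e)}$, $B_e:D_{\mathrm{in}(e)}\to D_{\mathrm{out}(e)}$, $i_v:F_v\to D_v$, $j_v:D_v\to F_v$. A tuple $(A,B,i,j)$ satisfies the moment map equations if $\sum_{\mathrm{in}(e)=v}A_eB_e-\sum_{\mathrm{out}(e)=v}B_eA_e+i_vj_v=0$ for all $v$; it is stable if the only collection of subspaces $D'_v\subseteq D_v$ with $i_v(F_v)\subseteq D_v'$ for all $v$ and preserved by all $A_e,B_e$ is $D'_v=D_v$. $\mathrm{Rep}^{\underline k}(\underline d;\underline f)^{\mathrm{st}}_0$ is the set of elements whose image under $\iota$ is stable and satisfies the moment map equations. Fix a basis of $K_v$ and complete it to a basis of $D_v$, identifying $\mathrm{GL}(D_v)$ with $\mathrm{GL}(d_v)$. Let $P_v\subseteq\mathrm{GL}(d_v)$ be the group of $(k_v,d_v-k_v)$-block upper triangular matrices whose $k_v\times k_v$ block is upper triangular, and $P_{\underline k}=\prod_vP_v$. Each $g_v\in P_v$ preserves $K_v$ and induces $\widehat g_v\in\mathrm{GL}(\widehat D_v)$ with $\pi_vg_v=\widehat g_v\pi_v$. $P_{\underline k}$ acts on $\mathrm{Rep}^{\underline k}(\underline d;\underline f)$ by $g\cdot(\widehat A,\widehat B,i,\widehat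 j)=(g_{\mathrm{in}(e)}\widehat A_e\widehat g_{\mathrm{out}(e)}^{-1},g_{\mathrm{out}(e)}\widehat B_e\widehat g_{\mathrm{in}(e)}^{-1},g_vi_v,\widehat j_v\widehat g_v^{-1})$, and $\mathcal{M}^{\underline k}_Q(\underline d;\underline f):=\mathrm{Rep}^{\underline k}(\underline d;\underline f)^{\mathrm{st}}_0/P_{\underline k}$. *)

theory Defs
  imports
    Complex_Main
    "HOL-Library.FuncSet"
    "Graph_Theory.Digraph"
    "Jordan_Normal_Form.VS_Connect"
    "Jordan_Normal_Form.Gauss_Jordan_Elimination"
    "Jordan_Normal_Form.Matrix_Kernel"
begin

text \<open>
  A quiver is a finite multidigraph (loops and multiple arrows allowed); an arrow \<open>e\<close> goes from
  \<open>tail Q e\<close> (= out) to \<open>head Q e\<close> (= in). All spaces are coordinate spaces over the complex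
  numbers and linear maps are matrices: \<open>D v\<close>, \<open>F v\<close> and the quotient \<open>Dhat v\<close> have dimensions
  \<open>d v\<close>, \<open>f v\<close> and \<open>d v - k v\<close>. The basis of \<open>D v\<close> is one that extends a basis of the kernel
  of \<open>\<pi> v\<close>, so that this kernel is spanned by the first \<open>k v\<close> unit vectors; the basis of
  \<open>Dhat v\<close> is arbitrary, so \<open>\<pi> v\<close> is any surjection with that kernel.

  Tuples are extensional in their vertex and arrow arguments, so that equality of tuples is
  equality in the direct sum.
\<close>

record ('v, 'e) framed_tuple =
  arrA :: "'e \<Rightarrow> complex mat"   \<comment> \<open>along the arrow\<close>
  arrB :: "'e \<Rightarrow> complex mat"   \<comment> \<open>against the arrow\<close>
  frI :: "'v \<Rightarrow> complex mat"    \<comment> \<open>out of the framing\<close>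
  frJ :: "'v \<Rightarrow> complex mat"    \<comment> \<open>into the framing\<close>

locale framed_quiver = fin_digraph Q
  for Q :: "('v, 'e) pre_digraph" +
  fixes d f k :: "'v \<Rightarrow> nat" and \<pi> :: "'v \<Rightarrow> complex mat"
  assumes k_le_d: "v \<in> verts Q \<Longrightarrow> k v \<le> d v"
    and \<pi>_carrier: "v \<in> verts Q \<Longrightarrow> \<pi> v \<in> carrier_mat (d v - k v) (d v)"
    and \<pi>_surj: "v \<in> verts Q \<Longrightarrow> (\<lambda>w. \<pi> v *\<^sub>v w) ` carrier_vec (d v) = carrier_vec (d v - k v)"
    and \<pi>_kernel: "v \<in> verts Q \<Longrightarrow>
      mat_kernel (\<pi> v) = {w \<in> carrier_vec (d v). \<forall>r. k v \<le> r \<and> r < d v \<longrightarrow> w $ r = 0}"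
begin

abbreviation dhat :: "'v \<Rightarrow> nat" where
  "dhat v \<equiv> d v - k v"

section \<open>The representation space\<close>

definition Rep :: "('v, 'e) framed_tuple set" where
  "Rep = {x.
     arrA x \<in> (\<Pi>\<^sub>E e\<in>arcs Q. carrier_mat (d (head Q e)) (dhat (tail Q e))) \<and>
     arrB x \<in> (\<Pi>\<^sub>E e\<in>arcs Q. carrier_mat (d (tail Q e)) (dhat (head Q e))) \<and>
     frI x \<in> (\<Pi>\<^sub>E v\<in>verts Q. carrier_mat (d v) (f v)) \<and>
     frJ x \<in> (\<Pi>\<^sub>E v\<in>verts Q. carrier_mat (f v) (dhat v))}"

definition rep_add ::
  "('v, 'e) framed_tuple \<Rightarrow> ('v, 'e) framed_tuple \<Rightarrow> ('v, 'e) framed_tuple" where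
  "rep_add x y =
     \<lparr>arrA = (\<lambda>e\<in>arcs Q. arrA x e + arrA y e), arrB = (\<lambda>e\<in>arcs Q. arrB x e + arrB y e),
      frI = (\<lambda>v\<in>verts Q. frI x v + frI y v), frJ = (\<lambda>v\<in>verts Q. frJ x v + frJ y v)\<rparr>"

definition rep_smult :: "complex \<Rightarrow> ('v, 'e) framed_tuple \<Rightarrow> ('v, 'e) framed_tuple" where
  "rep_smult c x =
     \<lparr>arrA = (\<lambda>e\<in>arcs Q. c \<cdot>\<^sub>m arrA x e), arrB = (\<lambda>e\<in>arcs Q. c \<cdot>\<^sub>m arrB x e),
      frI = (\<lambda>v\<in>verts Q. c \<cdot>\<^sub>m frI x v), frJ = (\<lambda>v\<in>verts Q. c \<cdot>\<^sub>m frJ x v)\<rparr>"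

definition \<iota> :: "('v, 'e) framed_tuple \<Rightarrow> ('v, 'e) framed_tuple" where
  "\<iota> x =
     \<lparr>arrA = (\<lambda>e\<in>arcs Q. arrA x e * \<pi> (tail Q e)), arrB = (\<lambda>e\<in>arcs Q. arrB x e * \<pi> (head Q e)),
      frI = frI x, frJ = (\<lambda>v\<in>verts Q. frJ x v * \<pi> v)\<rparr>"

abbreviation mat_sum :: "nat \<Rightarrow> nat \<Rightarrow> ('e \<Rightarrow> complex mat) \<Rightarrow> 'e set \<Rightarrow> complex mat" where
  "mat_sum nr nc \<equiv> finsum (module_mat TYPE(complex) nr nc)"

definition satisfies_moment_map :: "('v, 'e) framed_tuple \<Rightarrow> bool" where
  "satisfies_moment_map y \<longleftrightarrow> (\<forall>v\<in>verts Q.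
     mat_sum (d v) (d v) (\<lambda>e. arrA y e * arrB y e) (in_arcs Q v)
     - mat_sum (d v) (d v) (\<lambda>e. arrB y e * arrA y e) (out_arcs Q v)
     + frI y v * frJ y v = 0\<^sub>m (d v) (d v))"

definition stable :: "('v, 'e) framed_tuple \<Rightarrow> bool" where
  "stable y \<longleftrightarrow> (\<forall>D'.
     (\<forall>v\<in>verts Q. subspace class_ring (D' v) (module_vec TYPE(complex) (d v))) \<and>
     (\<forall>v\<in>verts Q. \<forall>w\<in>carrier_vec (f v). frI y v *\<^sub>v w \<in> D' v) \<and>
     (\<forall>e\<in>arcs Q. \<forall>w\<in>D' (tail Q e). arrA y e *\<^sub>v w \<in> D' (head Q e)) \<and>
     (\<forall>e\<in>arcs Q. \<forall>w\<in>D' (head Q e). arrB y e *\<^sub>v w \<in> D' (tail Q e))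
     \<longrightarrow> (\<forall>v\<in>verts Q. D' v = carrier_vec (d v)))"

definition Rep_st0 :: "('v, 'e) framed_tuple set" where
  "Rep_st0 = {x \<in> Rep. stable (\<iota> x) \<and> satisfies_moment_map (\<iota> x)}"

section \<open>The group, its Lie algebra and the orbits\<close>

text \<open>
  One condition covers both requirements on the shape: the vanishing of the lower left
  \<open>(d v - k v) \<times> k v\<close> block, and upper triangularity of the \<open>k v \<times> k v\<close> block.
  The group consists of the invertible matrices in this linear space, hence is open in it, and
  the space is its Lie algebra.
\<close>

definition lieP :: "'v \<Rightarrow> complex mat set" where
  "lieP v = {\<xi> \<in> carrier_mat (d v) (d v).
     \<forall>r c. r < d v \<and> c < k v \<and> c < r \<longrightarrow> \<xi> $$ (r, c) = 0}"

definition LieP :: "('v \<Rightarrow> complex mat) set" where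
  "LieP = (\<Pi>\<^sub>E v\<in>verts Q. lieP v)"

definition GrpP :: "('v \<Rightarrow> complex mat) set" where
  "GrpP = (\<Pi>\<^sub>E v\<in>verts Q. {g \<in> lieP v. invertible_mat g})"

definition induced :: "'v \<Rightarrow> complex mat \<Rightarrow> complex mat" where
  "induced v \<xi> = (THE \<eta>. \<eta> \<in> carrier_mat (dhat v) (dhat v) \<and> \<pi> v * \<xi> = \<eta> * \<pi> v)"

definition induced_inv :: "'v \<Rightarrow> complex mat \<Rightarrow> complex mat" where
  "induced_inv v g = the (mat_inverse (induced v g))"

definition act :: "('v \<Rightarrow> complex mat) \<Rightarrow> ('v, 'e) framed_tuple \<Rightarrow> ('v, 'e) framed_tuple" where
  "act g x =
     \<lparr>arrA = (\<lambda>e\<in>arcs Q. g (head Q e) * arrA x e * induced_inv (tail Q e) (g (tail Q e))),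
      arrB = (\<lambda>e\<in>arcs Q. g (tail Q e) * arrB x e * induced_inv (head Q e) (g (head Q e))),
      frI = (\<lambda>v\<in>verts Q. g v * frI x v),
      frJ = (\<lambda>v\<in>verts Q. frJ x v * induced_inv v (g v))\<rparr>"

definition orbit :: "('v, 'e) framed_tuple \<Rightarrow> ('v, 'e) framed_tuple set" where
  "orbit x = (\<lambda>g. act g x) ` GrpP"

section \<open>The complex\<close>

definition jmap ::
  "('v, 'e) framed_tuple \<Rightarrow> ('v \<Rightarrow> complex mat) \<Rightarrow> ('v, 'e) framed_tuple" where
  "jmap x \<xi> =
     \<lparr>arrA = (\<lambda>e\<in>arcs Q. \<xi> (head Q e) * arrA x e - arrA x e * induced (tail Q e) (\<xi> (tail Q e))),
      arrB = (\<lambda>e\<in>arcs Q. \<xi> (tail Q e) * arrB x e - arrB x e * induced (head Q e) (\<xi> (head Q e))),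
      frI = (\<lambda>v\<in>verts Q. \<xi> v * frI x v),
      frJ = (\<lambda>v\<in>verts Q. - (frJ x v * induced v (\<xi> v)))\<rparr>"

definition dmu_target :: "('v \<Rightarrow> complex mat) set" where
  "dmu_target = (\<Pi>\<^sub>E v\<in>verts Q. carrier_mat (d v) (dhat v))"

definition dmu_zero :: "'v \<Rightarrow> complex mat" where
  "dmu_zero = (\<lambda>v\<in>verts Q. 0\<^sub>m (d v) (dhat v))"

definition dmu ::
  "('v, 'e) framed_tuple \<Rightarrow> ('v, 'e) framed_tuple \<Rightarrow> 'v \<Rightarrow> complex mat" where
  "dmu x u = (\<lambda>v\<in>verts Q.
     mat_sum (d v) (dhat v)
       (\<lambda>e. arrA u e * \<pi> (tail Q e) * arrB x e + arrA x e * \<pi> (tail Q e) * arrB u e) (in_arcs Q v)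
     - mat_sum (d v) (dhat v)
       (\<lambda>e. arrB x e * \<pi> (head Q e) * arrA u e + arrB u e * \<pi> (head Q e) * arrA x e) (out_arcs Q v)
     + frI u v * frJ x v + frI x v * frJ u v)"

definition cycles :: "('v, 'e) framed_tuple \<Rightarrow> ('v, 'e) framed_tuple set" where
  "cycles x = {u \<in> Rep. dmu x u = dmu_zero}"

definition boundaries :: "('v, 'e) framed_tuple \<Rightarrow> ('v, 'e) framed_tuple set" where
  "boundaries x = jmap x ` LieP"

definition hclass ::
  "('v, 'e) framed_tuple \<Rightarrow> ('v, 'e) framed_tuple \<Rightarrow> ('v, 'e) framed_tuple set" where
  "hclass x u = rep_add u ` boundaries x"

definition homology :: "('v, 'e) framed_tuple \<Rightarrow> ('v, 'e) framed_tuple set set" where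
  "homology x = hclass x ` cycles x"

section \<open>The moduli space as an algebraic variety\<close>

text \<open>
  The moduli space is the geometric quotient of the locally closed subvariety \<open>Rep_st0\<close> of the
  affine space \<open>Rep\<close>: its points are the orbits, it carries the quotient of the Zariski topology,
  and its regular functions on \<open>W\<close> are the functions whose pullback to the preimage of \<open>W\<close> is
  regular (i.e. the invariant regular functions on the preimage).
\<close>

definition moduli :: "('v, 'e) framed_tuple set set" where
  "moduli = orbit ` Rep_st0"

inductive_set polys :: "(('v, 'e) framed_tuple \<Rightarrow> complex) set" where
  const: "(\<lambda>x. c) \<in> polys"
| coordA: "\<lbrakk>e \<in> arcs Q; r < d (head Q e); s < dhat (tail Q e)\<rbrakk> \<Longrightarrow> (\<lambda>x. arrA x e $$ (r, s)) \<in> polys"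
| coordB: "\<lbrakk>e \<in> arcs Q; r < d (tail Q e); s < dhat (head Q e)\<rbrakk> \<Longrightarrow> (\<lambda>x. arrB x e $$ (r, s)) \<in> polys"
| coordI: "\<lbrakk>v \<in> verts Q; r < d v; s < f v\<rbrakk> \<Longrightarrow> (\<lambda>x. frI x v $$ (r, s)) \<in> polys"
| coordJ: "\<lbrakk>v \<in> verts Q; r < f v; s < dhat v\<rbrakk> \<Longrightarrow> (\<lambda>x. frJ x v $$ (r, s)) \<in> polys"
| add: "\<lbrakk>p \<in> polys; q \<in> polys\<rbrakk> \<Longrightarrow> (\<lambda>x. p x + q x) \<in> polys"
| mult: "\<lbrakk>p \<in> polys; q \<in> polys\<rbrakk> \<Longrightarrow> (\<lambda>x. p x * q x) \<in> polys"

definition zopen :: "('v, 'e) framed_tuple set \<Rightarrow> bool" where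
  "zopen U \<longleftrightarrow> (\<exists>S\<subseteq>polys. U = {x \<in> Rep_st0. \<exists>p\<in>S. p x \<noteq> 0})"

text \<open>\<open>h\<close> is given on \<open>U\<close> by the quotient of polynomials \<open>p / r\<close> with nowhere vanishing \<open>r\<close>.\<close>

definition fraction_on ::
  "('v, 'e) framed_tuple set \<Rightarrow> (('v, 'e) framed_tuple \<Rightarrow> complex) \<Rightarrow>
   (('v, 'e) framed_tuple \<Rightarrow> complex) \<Rightarrow> (('v, 'e) framed_tuple \<Rightarrow> complex) \<Rightarrow> bool" where
  "fraction_on U h p r \<longleftrightarrow> p \<in> polys \<and> r \<in> polys \<and> (\<forall>y\<in>U. r y \<noteq> 0 \<and> h y = p y / r y)"

definition regular_on ::
  "('v, 'e) framed_tuple set \<Rightarrow> (('v, 'e) framed_tuple \<Rightarrow> complex) \<Rightarrow> bool" where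
  "regular_on U h \<longleftrightarrow> (\<forall>y\<in>U. \<exists>U' p r. zopen U' \<and> y \<in> U' \<and> U' \<subseteq> U \<and> fraction_on U' h p r)"

definition preim :: "('v, 'e) framed_tuple set set \<Rightarrow> ('v, 'e) framed_tuple set" where
  "preim W = {x \<in> Rep_st0. orbit x \<in> W}"

definition mopen :: "('v, 'e) framed_tuple set set \<Rightarrow> bool" where
  "mopen W \<longleftrightarrow> W \<subseteq> moduli \<and> zopen (preim W)"

definition mregular_on ::
  "('v, 'e) framed_tuple set set \<Rightarrow> (('v, 'e) framed_tuple set \<Rightarrow> complex) \<Rightarrow> bool" where
  "mregular_on W h \<longleftrightarrow> regular_on (preim W) (h \<circ> orbit)"

text \<open>The local sections of the structure sheaf of the moduli space at \<open>m\<close>.\<close>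

definition sections ::
  "('v, 'e) framed_tuple set \<Rightarrow>
   (('v, 'e) framed_tuple set set \<times> (('v, 'e) framed_tuple set \<Rightarrow> complex)) set" where
  "sections m = {(W, h). mopen W \<and> m \<in> W \<and> mregular_on W h}"

definition germ ::
  "('v, 'e) framed_tuple set \<Rightarrow> ('v, 'e) framed_tuple set set \<Rightarrow>
   (('v, 'e) framed_tuple set \<Rightarrow> complex) \<Rightarrow>
   (('v, 'e) framed_tuple set set \<times> (('v, 'e) framed_tuple set \<Rightarrow> complex)) set" where
  "germ m W h = {(W', h') \<in> sections m.
     \<exists>W''. mopen W'' \<and> m \<in> W'' \<and> W'' \<subseteq> W \<inter> W' \<and> (\<forall>n\<in>W''. h n = h' n)}"

definition stalk ::
  "('v, 'e) framed_tuple set \<Rightarrow>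
   (('v, 'e) framed_tuple set set \<times> (('v, 'e) framed_tuple set \<Rightarrow> complex)) set set" where
  "stalk m = {germ m W h | W h. (W, h) \<in> sections m}"

text \<open>
  The (Zariski) tangent space at \<open>m\<close>: complex-valued derivations at \<open>m\<close> of the local ring
  \<open>stalk m\<close>. Any two germs have representatives on a common neighbourhood \<open>W\<close>. The vector space
  structure is the pointwise one.
\<close>

definition tangent_space ::
  "('v, 'e) framed_tuple set \<Rightarrow>
   ((('v, 'e) framed_tuple set set \<times> (('v, 'e) framed_tuple set \<Rightarrow> complex)) set \<Rightarrow> complex) set"
where
  "tangent_space m = {\<delta> \<in> extensional (stalk m).
     (\<forall>W g h. (W, g) \<in> sections m \<and> (W, h) \<in> sections m \<longrightarrow>
        \<delta> (germ m W (\<lambda>n. g n + h n)) = \<delta> (germ m W g) + \<delta> (germ m W h) \<and>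
        \<delta> (germ m W (\<lambda>n. g n * h n)) = \<delta> (germ m W g) * h m + g m * \<delta> (germ m W h)) \<and>
     (\<forall>W h c. (W, h) \<in> sections m \<longrightarrow> \<delta> (germ m W (\<lambda>n. c * h n)) = c * \<delta> (germ m W h))}"

section \<open>Maps from the homology to the tangent space\<close>

text \<open>Linearity, expressed on representatives of homology classes.\<close>

definition linear_on_homology ::
  "('v, 'e) framed_tuple \<Rightarrow>
   (('v, 'e) framed_tuple set \<Rightarrow>
    (('v, 'e) framed_tuple set set \<times> (('v, 'e) framed_tuple set \<Rightarrow> complex)) set \<Rightarrow> complex) \<Rightarrow> bool"
where
  "linear_on_homology x \<Psi> \<longleftrightarrow> (\<forall>u\<in>cycles x. \<forall>w\<in>cycles x. \<forall>c. \<forall>\<gamma>\<in>stalk (orbit x).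
     \<Psi> (hclass x (rep_add (rep_smult c u) w)) \<gamma> = c * \<Psi> (hclass x u) \<gamma> + \<Psi> (hclass x w) \<gamma>)"

text \<open>
  \<open>\<Psi>\<close> is induced by the differential at \<open>x\<close> of the quotient map: the derivation belonging to the
  class of \<open>u\<close> sends the germ of \<open>h\<close> to the derivative at \<open>x\<close>, in direction \<open>u\<close>, of any
  expression of the pullback of \<open>h\<close> near \<open>x\<close> as a quotient of polynomials.
\<close>

definition induced_by_quotient_map ::
  "('v, 'e) framed_tuple \<Rightarrow>
   (('v, 'e) framed_tuple set \<Rightarrow>
    (('v, 'e) framed_tuple set set \<times> (('v, 'e) framed_tuple set \<Rightarrow> complex)) set \<Rightarrow> complex) \<Rightarrow> bool"
where
  "induced_by_quotient_map x \<Psi> \<longleftrightarrow> (\<forall>u\<in>cycles x. \<forall>W h U p r.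
     (W, h) \<in> sections (orbit x) \<and> zopen U \<and> x \<in> U \<and> U \<subseteq> preim W \<and> fraction_on U (h \<circ> orbit) p r \<longrightarrow>
     ((\<lambda>t. p (rep_add x (rep_smult t u)) / r (rep_add x (rep_smult t u)))
        has_field_derivative \<Psi> (hclass x u) (germ (orbit x) W h)) (at 0))"

end

end

theory Submission
  imports Defs "Jordan_Normal_Form.Determinant"
begin

text \<open>
  The map \<open>dmu\<close> is symmetric and bilinear, and the moment map equations for \<open>y\<close> say that
  \<open>dmu y y\<close> vanishes. The image of \<open>jmap x\<close> consists of the velocities of curves in the orbit of
  \<open>x\<close>, along which these equations persist; by the Leibniz rule, \<open>dmu x (jmap x \<xi>)\<close> is the
  commutator of \<open>\<xi>\<close> with the moment map at \<open>x\<close>, which is zero (\<open>dmu_jmap\<close>).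

  Stability gives exactness at both ends. If \<open>jmap x\<close> takes the same value on \<open>\<xi>\<close> and \<open>\<zeta>\<close>, then
  the vectors on which \<open>\<xi> v\<close> and \<open>\<zeta> v\<close> agree form a family of subspaces that is preserved by the
  arrows and contains the image of the framing, so it is everything (\<open>jmap_inj\<close>). If \<open>\<zeta>\<close>
  annihilates the image of \<open>dmu x\<close> under the trace pairing, the same applies to the kernels of the
  \<open>\<zeta> v\<close> (\<open>annihilator_of_dmu_trivial\<close>), and a subspace with trivial annihilator is everything
  (\<open>dmu_surj\<close>).

  For the tangent space, the quotient is described near the orbit of \<open>x\<close> by a slice. Covariants are
  the vector-valued functions obtained from framing vectors by applying arrows; they are polynomial
  and equivariant, and stability of \<open>y\<close> means that their values at \<open>y\<close> fill the spaces
  (\<open>stable_iff_Cov\<close>). Covariants whose values at \<open>x\<close> are the unit vectors form a matrix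
  \<open>frame_mat v y\<close> which is the identity at \<open>x\<close> and on which the group acts by multiplication from
  the left. Gaussian elimination on its columns commutes with this action (\<open>column_reduced_mult\<close>)
  and, for \<open>y\<close> near \<open>x\<close>, ends in the group. The result \<open>\<phi> y\<close> satisfies \<open>\<phi> (g y) = g (\<phi> y)\<close>, is \<open>1\<close> at \<open>x\<close>, and its
  entries are quotients of polynomials. Therefore \<open>\<sigma> y = (\<phi> y)\<^sup>-\<^sup>1 y\<close> is an invariant retraction of a
  neighbourhood of the orbit onto the slice where \<open>\<phi>\<close> is \<open>1\<close>: every polynomial \<open>p\<close> gives a regular
  function \<open>p \<circ> \<sigma>\<close> on the quotient, and a regular function on the quotient that is \<open>p / r\<close> near \<open>x\<close>
  is \<open>(p \<circ> \<sigma>) / (r \<circ> \<sigma>)\<close> near the orbit.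

  Since \<open>dmu x\<close> is surjective, a contraction argument corrects the line \<open>x + t u\<close> to order \<open>t\<^sup>2\<close> so
  that it stays in the zero locus of the moment map, for each cycle \<open>u\<close> (\<open>tangent_curve\<close>). Hence
  the derivative of \<open>p / r\<close> at \<open>x\<close> in the direction \<open>u\<close> depends on the germ only, and defines a
  derivation. It vanishes if \<open>u\<close> is a boundary, because boundaries are velocities of curves in the
  orbit (\<open>orbit_curve\<close>). Conversely, if the derivation vanishes, then \<open>\<sigma>\<close> is constant to first
  order along a curve \<open>\<gamma>\<close> with velocity \<open>u\<close>, and differentiating \<open>\<gamma> = \<phi>(\<gamma>) \<sigma>(\<gamma>)\<close> shows that \<open>u\<close> is
  a boundary (\<open>slice_kernel\<close>). Finally, a derivation \<open>\<delta>\<close> of the stalk gives the derivation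
  \<open>p \<mapsto> \<delta> (p \<circ> \<sigma>)\<close> of the polynomials at \<open>x\<close>, hence a vector \<open>u\<close>; it kills the moment map, which
  vanishes on the slice, so \<open>u\<close> is a cycle, and it induces \<open>\<delta>\<close> (\<open>\<Psi>_surj\<close>).
\<close>

section \<open>Annihilators in finite dimension\<close>

lemma closed_under_finite_sums:
  fixes S :: "('i \<Rightarrow> complex) set"
  assumes zero: "(\<lambda>_. 0) \<in> S"
    and add: "\<And>a b. a \<in> S \<Longrightarrow> b \<in> S \<Longrightarrow> (\<lambda>i. a i + b i) \<in> S"
    and smult: "\<And>c a. a \<in> S \<Longrightarrow> (\<lambda>i. c * a i) \<in> S"
    and "finite J" "\<And>j. j \<in> J \<Longrightarrow> s j \<in> S"
  shows "(\<lambda>i. \<Sum>j\<in>J. c j * s j i) \<in> S"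
  using \<open>finite J\<close> assms(5)
proof (induction J rule: finite_induct)
  case empty
  then show ?case using zero by simp
next
  case (insert j J)
  then show ?case using add[OF smult[of "s j" "c j"] insert.IH] by simp
qed

text \<open>
  Induction on the index set \<open>insert a J\<close>. If some element of \<open>S\<close> vanishes on \<open>J\<close> but not at \<open>a\<close>,
  it corrects the value at \<open>a\<close>. Otherwise the value at \<open>a\<close> is a linear function of the values on
  \<open>J\<close>, and this linear relation is a nonzero annihilator.
\<close>

lemma full_if_annihilator_trivial:
  fixes S :: "('i \<Rightarrow> complex) set"
  assumes "finite I"
    and zero: "(\<lambda>_. 0) \<in> S"
    and add: "\<And>a b. a \<in> S \<Longrightarrow> b \<in> S \<Longrightarrow> (\<lambda>i. a i + b i) \<in> S"
    and smult: "\<And>c a. a \<in> S \<Longrightarrow> (\<lambda>i. c * a i) \<in> S"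
    and trivial: "\<And>l. (\<And>s. s \<in> S \<Longrightarrow> (\<Sum>i\<in>I. l i * s i) = 0) \<Longrightarrow> \<forall>i\<in>I. l i = 0"
  shows "\<exists>s\<in>S. \<forall>i\<in>I. s i = b i"
  using \<open>finite I\<close> trivial
proof (induction I arbitrary: b rule: finite_induct)
  case empty
  then show ?case using zero by auto
next
  case (insert a J)
  have IH: "\<exists>s\<in>S. \<forall>i\<in>J. s i = b i" for b
  proof (rule insert.IH)
    fix l :: "'i \<Rightarrow> complex"
    assume l: "\<And>s. s \<in> S \<Longrightarrow> (\<Sum>i\<in>J. l i * s i) = 0"
    have "\<forall>i\<in>insert a J. (if i = a then 0 else l i) = 0"
    proof (rule insert.prems)
      fix s assume "s \<in> S"
      have "(\<Sum>i\<in>J. (if i = a then 0 else l i) * s i) = (\<Sum>i\<in>J. l i * s i)"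
        using insert.hyps by (intro sum.cong) auto
      then show "(\<Sum>i\<in>insert a J. (if i = a then 0 else l i) * s i) = 0"
        using insert.hyps l[OF \<open>s \<in> S\<close>] by simp
    qed
    then show "\<forall>i\<in>J. l i = 0" using insert.hyps by (auto split: if_splits)
  qed
  show ?case
  proof (cases "\<exists>s\<in>S. s a \<noteq> 0 \<and> (\<forall>i\<in>J. s i = 0)")
    case True
    then obtain s where s: "s \<in> S" "s a \<noteq> 0" "\<forall>i\<in>J. s i = 0" by blast
    obtain t where t: "t \<in> S" "\<forall>i\<in>J. t i = b i" using IH by blast
    let ?z = "\<lambda>i. t i + (b a - t a) / s a * s i"
    have z: "?z \<in> S" by (intro add smult s t)
    have "\<forall>i\<in>insert a J. ?z i = b i" using s t by auto
    then show ?thesis using z by (rule bexI[of _ ?z])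
  next
    case False
    \<comment> \<open>The dual basis \<open>s j\<close> exhibits the value at \<open>a\<close> as a linear function of the values on \<open>J\<close>.\<close>
    have "\<exists>s. \<forall>j. s j \<in> S \<and> (\<forall>i\<in>J. s j i = (if i = j then 1 else 0))"
    proof (intro choice allI)
      fix j
      show "\<exists>t. t \<in> S \<and> (\<forall>i\<in>J. t i = (if i = j then 1 else 0))"
        using IH[of "\<lambda>i. if i = j then 1 else 0"] by blast
    qed
    then obtain s where s: "\<And>j. s j \<in> S" "\<And>i j. i \<in> J \<Longrightarrow> s j i = (if i = j then 1 else 0)"
      by blast
    have "\<forall>i\<in>insert a J. (if i = a then - 1 else s i a) = 0"
    proof (rule insert.prems)
      fix t assume t: "t \<in> S"
      let ?r = "\<lambda>i. t i + (- 1) * (\<Sum>j\<in>J. t j * s j i)"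
      have rS: "?r \<in> S"
        by (intro add smult t closed_under_finite_sums zero insert.hyps s)
      have rJ: "?r i = 0" if "i \<in> J" for i
      proof -
        have "(\<Sum>j\<in>J. t j * s j i) = (\<Sum>j\<in>J. if j = i then t j else 0)"
          using that by (intro sum.cong) (auto simp: s)
        then show ?thesis using that insert.hyps by simp
      qed
      have "?r a = 0" using False rJ bexI[of "\<lambda>s. s a \<noteq> 0 \<and> (\<forall>i\<in>J. s i = 0)" ?r, OF _ rS] by blast
      moreover have "(\<Sum>i\<in>J. (if i = a then - 1 else s i a) * t i) = (\<Sum>j\<in>J. t j * s j a)"
        using insert.hyps by (intro sum.cong) auto
      ultimately show "(\<Sum>i\<in>insert a J. (if i = a then - 1 else s i a) * t i) = 0"
        using insert.hyps by simp
    qed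
    then show ?thesis by simp
  qed
qed

section \<open>A fixed point theorem in coordinates\<close>

text \<open>
  Banach's argument, written out because \<open>nrm I\<close> is only a seminorm on functions: it sees the
  coordinates in \<open>I\<close> alone. The \<open>n\<close>-th step of the iteration from \<open>0\<close> has length at most
  \<open>\<rho> / 2 ^ (n + 1)\<close>, so the iterates stay in the ball of radius \<open>\<rho>\<close>.
\<close>

lemma contraction_has_fixed_point:
  fixes \<Phi> :: "('i \<Rightarrow> complex) \<Rightarrow> 'i \<Rightarrow> complex"
  defines "nrm I w \<equiv> \<Sum>i\<in>I. cmod (w i)"
  assumes "finite I" "\<rho> \<ge> 0"
    and start: "nrm I (\<Phi> (\<lambda>_. 0)) \<le> \<rho> / 2"
    and contr: "\<And>w w'. nrm I w \<le> \<rho> \<Longrightarrow> nrm I w' \<le> \<rho> \<Longrightarrow>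
      nrm I (\<lambda>i. \<Phi> w i - \<Phi> w' i) \<le> nrm I (\<lambda>i. w i - w' i) / 2"
  shows "\<exists>w. nrm I w \<le> \<rho> \<and> (\<forall>i\<in>I. \<Phi> w i = w i)"
proof -
  have tri: "nrm I w \<le> nrm I w' + nrm I (\<lambda>i. w i - w' i)" for w w' :: "'i \<Rightarrow> complex"
    unfolding nrm_def sum.distrib[symmetric]
    by (intro sum_mono) (metis add.commute norm_triangle_sub)
  define w where "w n = (\<Phi> ^^ n) (\<lambda>_. 0)" for n
  have w0: "w 0 = (\<lambda>_. 0)" and wS: "w (Suc n) = \<Phi> (w n)" for n by (simp_all add: w_def)
  have ball: "nrm I (w n) \<le> \<rho> \<and> nrm I (\<lambda>i. w (Suc n) i - w n i) \<le> \<rho> / 2 ^ Suc n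
      \<and> nrm I (w n) \<le> \<rho> * (1 - 1 / 2 ^ n)" for n
  proof (induction n)
    case 0
    then show ?case using \<open>\<rho> \<ge> 0\<close> start by (simp add: w0 wS nrm_def)
  next
    case (Suc n)
    have "nrm I (w (Suc n)) \<le> \<rho> * (1 - 1 / 2 ^ n) + \<rho> / 2 ^ Suc n"
      using tri[of "w (Suc n)" "w n"] Suc.IH by linarith
    also have "\<dots> = \<rho> * (1 - 1 / 2 ^ Suc n)" by (simp add: field_simps)
    finally have a: "nrm I (w (Suc n)) \<le> \<rho> * (1 - 1 / 2 ^ Suc n)" .
    have "\<rho> * (1 - 1 / 2 ^ Suc n) \<le> \<rho> * 1" using \<open>\<rho> \<ge> 0\<close> by (intro mult_left_mono) auto
    then have b: "nrm I (w (Suc n)) \<le> \<rho>" using a by linarith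
    have "nrm I (\<lambda>i. w (Suc (Suc n)) i - w (Suc n) i) \<le> nrm I (\<lambda>i. w (Suc n) i - w n i) / 2"
      using contr[OF b, of "w n"] Suc.IH by (simp add: wS)
    also have "\<dots> \<le> \<rho> / 2 ^ Suc (Suc n)" using Suc.IH by simp
    finally show ?case using a b by blast
  qed
  have ptw: "cmod (f i) \<le> nrm I f" if "i \<in> I" for f i
    using that \<open>finite I\<close> unfolding nrm_def by (intro member_le_sum) auto
  have "convergent (\<lambda>n. w n i)" if "i \<in> I" for i
  proof -
    have "summable (\<lambda>n. w (Suc n) i - w n i)"
    proof (rule summable_comparison_test')
      show "summable (\<lambda>n. \<rho> / 2 * (1 / 2) ^ n)"
        by (intro summable_mult summable_geometric) simp
      show "norm (w (Suc n) i - w n i) \<le> \<rho> / 2 * (1 / 2) ^ n" if "n \<ge> 0" for n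
        using ptw[OF \<open>i \<in> I\<close>, of "\<lambda>i. w (Suc n) i - w n i"] ball[of n]
        by (simp add: power_divide)
    qed
    then have "convergent (\<lambda>n. \<Sum>m<n. w (Suc m) i - w m i)" by (simp add: summable_iff_convergent)
    then show ?thesis by (simp add: sum_lessThan_telescope[of "\<lambda>n. w n i"] w0)
  qed
  then have "\<forall>i. \<exists>l. i \<in> I \<longrightarrow> (\<lambda>n. w n i) \<longlonglongrightarrow> l" by (auto simp: convergent_def)
  then obtain l where l: "\<And>i. i \<in> I \<Longrightarrow> (\<lambda>n. w n i) \<longlonglongrightarrow> l i" by metis
  have lim: "(\<lambda>n. nrm I (\<lambda>i. w n i - l i)) \<longlonglongrightarrow> 0"
  proof -
    have "(\<lambda>n. nrm I (\<lambda>i. w n i - l i)) \<longlonglongrightarrow> (\<Sum>i\<in>I. cmod (l i - l i))"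
      unfolding nrm_def by (intro tendsto_intros l)
    then show ?thesis by simp
  qed
  have l\<rho>: "nrm I l \<le> \<rho>"
  proof (rule LIMSEQ_le_const2)
    show "(\<lambda>n. nrm I (w n)) \<longlonglongrightarrow> nrm I l" unfolding nrm_def by (intro tendsto_intros l)
  qed (use ball in blast)
  have fix_bound: "nrm I (\<lambda>i. \<Phi> l i - l i) \<le> 0"
  proof (rule LIMSEQ_le_const)
    have "(\<lambda>n. nrm I (\<lambda>i. w n i - l i) / 2 + nrm I (\<lambda>i. w (Suc n) i - l i)) \<longlonglongrightarrow> 0 / 2 + 0"
      by (intro tendsto_add tendsto_divide tendsto_const lim LIMSEQ_Suc[OF lim]) simp
    then show "(\<lambda>n. nrm I (\<lambda>i. w n i - l i) / 2 + nrm I (\<lambda>i. w (Suc n) i - l i)) \<longlonglongrightarrow> 0" by simp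
    have "nrm I (\<lambda>i. \<Phi> l i - l i)
        \<le> nrm I (\<lambda>i. w n i - l i) / 2 + nrm I (\<lambda>i. w (Suc n) i - l i)" for n
    proof -
      have "nrm I (\<lambda>i. \<Phi> l i - l i) \<le> nrm I (\<lambda>i. w (Suc n) i - l i)
          + nrm I (\<lambda>i. (\<Phi> l i - l i) - (w (Suc n) i - l i))" by (rule tri)
      also have "nrm I (\<lambda>i. (\<Phi> l i - l i) - (w (Suc n) i - l i))
          = nrm I (\<lambda>i. \<Phi> (w n) i - \<Phi> l i)"
        unfolding nrm_def wS by (intro sum.cong) (auto simp: norm_minus_commute)
      also have "\<dots> \<le> nrm I (\<lambda>i. w n i - l i) / 2" using contr l\<rho> ball by blast
      finally show ?thesis by simp
    qed
    then show "\<exists>N. \<forall>n\<ge>N. nrm I (\<lambda>i. \<Phi> l i - l i)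
        \<le> nrm I (\<lambda>i. w n i - l i) / 2 + nrm I (\<lambda>i. w (Suc n) i - l i)" by blast
  qed
  have "\<Phi> l i = l i" if "i \<in> I" for i
  proof -
    have "cmod (\<Phi> l i - l i) \<le> 0"
      using ptw[OF that, of "\<lambda>i. \<Phi> l i - l i"] fix_bound by linarith
    then show ?thesis by simp
  qed
  then show ?thesis using l\<rho> by blast
qed

section \<open>Matrices in coordinates\<close>

lemma mult_mat_entry:
  assumes "A \<in> carrier_mat n m" "B \<in> carrier_mat m p" "i < n" "j < p"
  shows "(A * B) $$ (i, j) = (\<Sum>l<m. A $$ (i, l) * B $$ (l, j))"
  using assms by (auto simp: scalar_prod_def atLeast0LessThan intro!: sum.cong)

lemma mult_mat_vec_entry:
  assumes "A \<in> carrier_mat n m" "w \<in> carrier_vec m" "i < n"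
  shows "(A *\<^sub>v w) $ i = (\<Sum>l<m. A $$ (i, l) * w $ l)"
  using assms by (auto simp: scalar_prod_def atLeast0LessThan intro!: sum.cong)

lemma mult_mat_unit_vec:
  fixes A :: "complex mat"
  assumes "A \<in> carrier_mat n m" "j < m"
  shows "A *\<^sub>v unit_vec m j = col A j"
proof (rule eq_vecI)
  fix i assume "i < dim_vec (col A j)"
  then have i: "i < n" using assms by simp
  have "(A *\<^sub>v unit_vec m j) $ i = (\<Sum>l<m. if l = j then A $$ (i, l) else 0)"
    unfolding mult_mat_vec_entry[OF assms(1) unit_vec_carrier i]
    using assms by (intro sum.cong) (auto simp: unit_vec_def)
  then show "(A *\<^sub>v unit_vec m j) $ i = col A j $ i" using assms i by simp
qed (use assms in simp)

lemma mat_eqI_of_vec: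
  fixes A B :: "complex mat"
  assumes "A \<in> carrier_mat n m" "B \<in> carrier_mat n m"
    and "\<And>w. w \<in> carrier_vec m \<Longrightarrow> A *\<^sub>v w = B *\<^sub>v w"
  shows "A = B"
proof (rule eq_matI)
  fix i j assume "i < dim_row B" "j < dim_col B"
  then have ij: "i < n" "j < m" using assms by auto
  have "col A j = col B j"
    using assms(3)[OF unit_vec_carrier, of j] assms(1,2) ij by (simp add: mult_mat_unit_vec)
  then have "col A j $ i = col B j $ i" by simp
  then show "A $$ (i, j) = B $$ (i, j)" using assms(1,2) ij by simp
qed (use assms in auto)

lemma vec_eq_of_minus_zero:
  fixes a b :: "complex vec"
  assumes "a \<in> carrier_vec n" "b \<in> carrier_vec n" "a - b = 0\<^sub>v n"
  shows "a = b"
proof (rule eq_vecI)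
  fix i assume i: "i < dim_vec b"
  then have "(a - b) $ i = 0" using assms by simp
  then show "a $ i = b $ i" using i index_minus_vec(1)[OF i, of a] by simp
qed (use assms in auto)

lemma one_sided_inverse_unique:
  fixes A :: "complex mat"
  assumes "A \<in> carrier_mat n n" "B \<in> carrier_mat n n" "C \<in> carrier_mat n n"
    and "A * B = 1\<^sub>m n" "A * C = 1\<^sub>m n"
  shows "B = C"
proof -
  have "B * A = 1\<^sub>m n" using mat_mult_left_right_inverse assms by blast
  then have "C = (B * A) * C" using assms by simp
  also have "\<dots> = B * (A * C)" using assms by (intro assoc_mult_mat[of B n n A n C n])
  also have "\<dots> = B" using assms(2) unfolding assms(5) by (rule right_mult_one_mat)
  finally show ?thesis ..
qed

text \<open>
  The adjugate formula displays the entries of the inverse as quotients of polynomials in the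
  entries of the matrix.
\<close>

definition minv :: "complex mat \<Rightarrow> complex mat" where
  "minv A = (1 / det A) \<cdot>\<^sub>m adj_mat A"

lemma minv:
  assumes "A \<in> carrier_mat n n" "det A \<noteq> 0"
  shows "minv A \<in> carrier_mat n n" "A * minv A = 1\<^sub>m n" "minv A * A = 1\<^sub>m n"
proof -
  note adj = adj_mat[OF assms(1)]
  show "minv A \<in> carrier_mat n n" unfolding minv_def using adj by simp
  show "A * minv A = 1\<^sub>m n" unfolding minv_def mult_smult_distrib[OF assms(1) adj(1)] adj(2)
    using assms by (intro eq_matI) auto
  show "minv A * A = 1\<^sub>m n" unfolding minv_def mult_smult_assoc_mat[OF adj(1) assms(1)] adj(3)
    using assms by (intro eq_matI) auto
qed

lemma invertible_mat_iff_det: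
  fixes A :: "complex mat"
  assumes "A \<in> carrier_mat n n"
  shows "invertible_mat A \<longleftrightarrow> det A \<noteq> 0"
proof
  assume "invertible_mat A"
  then obtain B where B: "A * B = 1\<^sub>m (dim_row A)" "B * A = 1\<^sub>m (dim_row B)"
    unfolding invertible_mat_def inverts_mat_def by blast
  have "dim_col (A * B) = n" "dim_col (B * A) = dim_row B" using B assms by simp_all
  then have "B \<in> carrier_mat n n" using assms by auto
  then have "det A * det B = 1" using B assms det_mult[of A n B] by simp
  then show "det A \<noteq> 0" by auto
next
  assume "det A \<noteq> 0"
  then show "invertible_mat A"
    using minv[OF assms] assms unfolding invertible_mat_def inverts_mat_def by auto
qed

lemma det_nonzero_of_inverse:
  fixes A :: "complex mat"
  assumes "A \<in> carrier_mat n n" "B \<in> carrier_mat n n" "A * B = 1\<^sub>m n"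
  shows "det A \<noteq> 0"
  using det_mult[OF assms(1,2)] assms(3) by auto

lemma minv_unique:
  assumes "A \<in> carrier_mat n n" "B \<in> carrier_mat n n" "A * B = 1\<^sub>m n"
  shows "minv A = B"
  using minv[OF assms(1) det_nonzero_of_inverse[OF assms]] one_sided_inverse_unique[OF assms(1)] assms(2,3) by blast

lemma the_mat_inverse:
  fixes A :: "complex mat"
  assumes "A \<in> carrier_mat n n" "B \<in> carrier_mat n n" "A * B = 1\<^sub>m n"
  shows "the (mat_inverse A) = B"
proof (cases "mat_inverse A")
  case None
  have "B * A = 1\<^sub>m n" using mat_mult_left_right_inverse assms by blast
  then have "A \<in> Units (ring_mat TYPE(complex) n ())"
    using assms unfolding Units_def ring_mat_def by auto
  then show ?thesis using mat_inverse(1)[OF assms(1) None, of "()"] by blast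
next
  case (Some C)
  then show ?thesis
    using mat_inverse(2)[OF assms(1) Some] one_sided_inverse_unique[OF assms(1) _ assms(2) _ assms(3), of C]
    by simp
qed

text \<open>
  Associativity in a form whose side conditions are equations between dimensions, so that the
  simplifier can rebracket long products.
\<close>

lemma mult_assoc_dim:
  fixes A B C :: "complex mat"
  assumes "dim_col A = dim_row B" "dim_col B = dim_row C"
  shows "A * B * C = A * (B * C)"
  using assms by (intro assoc_mult_mat[of A "dim_row A" "dim_col A" B "dim_col B" C "dim_col C"]) auto

lemma mult_assoc_middle:
  fixes a b c e :: "complex mat"
  assumes "a \<in> carrier_mat n n" "b \<in> carrier_mat n n" "c \<in> carrier_mat n n" "e \<in> carrier_mat n n"
  shows "a * b * (c * e) = a * (b * c) * e"
  by (simp only: mult_assoc_dim index_mult_mat(2,3) assms[THEN carrier_matD(1)] assms[THEN carrier_matD(2)])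

section \<open>Algebras of functions\<close>

text \<open>
  A unital algebra of functions. The instances are polynomials, functions that agree with a
  polynomial on the representation space, quotients of polynomials, and functions differentiable at
  \<open>0\<close>; determinants and adjugates are handled for all of them at once.
\<close>

definition fun_algebra :: "('a \<Rightarrow> complex) set \<Rightarrow> bool" where
  "fun_algebra \<A> \<longleftrightarrow> (\<forall>c. (\<lambda>_. c) \<in> \<A>) \<and>
     (\<forall>f\<in>\<A>. \<forall>g\<in>\<A>. (\<lambda>x. f x + g x) \<in> \<A> \<and> (\<lambda>x. f x * g x) \<in> \<A>)"

lemma
  assumes "fun_algebra \<A>"
  shows fun_algebra_const: "(\<lambda>_. c) \<in> \<A>"
    and fun_algebra_add: "f \<in> \<A> \<Longrightarrow> g \<in> \<A> \<Longrightarrow> (\<lambda>x. f x + g x) \<in> \<A>"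
    and fun_algebra_mult: "f \<in> \<A> \<Longrightarrow> g \<in> \<A> \<Longrightarrow> (\<lambda>x. f x * g x) \<in> \<A>"
  using assms unfolding fun_algebra_def by auto

lemma fun_algebra_uminus:
  assumes "fun_algebra \<A>" "f \<in> \<A>"
  shows "(\<lambda>x. - f x) \<in> \<A>"
  using fun_algebra_mult[OF assms(1) fun_algebra_const[OF assms(1), of "- 1"] assms(2)] by simp

lemma fun_algebra_sum:
  assumes "fun_algebra \<A>" "\<And>i. i \<in> I \<Longrightarrow> f i \<in> \<A>"
  shows "(\<lambda>x. \<Sum>i\<in>I. f i x) \<in> \<A>"
  using assms(2)
proof (induction I rule: infinite_finite_induct)
  case (insert i I)
  then show ?case using fun_algebra_add[OF assms(1), of "f i" "\<lambda>x. \<Sum>i\<in>I. f i x"] by simp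
qed (simp_all add: fun_algebra_const[OF assms(1)])

lemma fun_algebra_prod:
  assumes "fun_algebra \<A>" "\<And>i. i \<in> I \<Longrightarrow> f i \<in> \<A>"
  shows "(\<lambda>x. \<Prod>i\<in>I. f i x) \<in> \<A>"
  using assms(2)
proof (induction I rule: infinite_finite_induct)
  case (insert i I)
  then show ?case using fun_algebra_mult[OF assms(1), of "f i" "\<lambda>x. \<Prod>i\<in>I. f i x"] by simp
qed (simp_all add: fun_algebra_const[OF assms(1)])

definition mat_in :: "('a \<Rightarrow> complex) set \<Rightarrow> nat \<Rightarrow> nat \<Rightarrow> ('a \<Rightarrow> complex mat) \<Rightarrow> bool" where
  "mat_in \<A> n m M \<longleftrightarrow> (\<forall>x. M x \<in> carrier_mat n m) \<and>
     (\<forall>i j. i < n \<and> j < m \<longrightarrow> (\<lambda>x. M x $$ (i, j)) \<in> \<A>)"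

lemma fun_algebra_det:
  assumes "fun_algebra \<A>" "mat_in \<A> n n M"
  shows "(\<lambda>x. det (M x)) \<in> \<A>"
proof -
  have "(\<lambda>x. \<Sum>p\<in>{p. p permutes {0..<n}}. signof p * (\<Prod>i = 0..<n. M x $$ (i, p i))) \<in> \<A>"
    using assms(2) unfolding mat_in_def
    by (intro fun_algebra_sum fun_algebra_prod fun_algebra_mult fun_algebra_const assms(1))
       (auto dest: permutes_in_image)
  then show ?thesis using assms(2) by (simp add: mat_in_def det_def'[of _ n])
qed

lemma fun_algebra_adj:
  assumes "fun_algebra \<A>" "mat_in \<A> n n M"
  shows "mat_in \<A> n n (\<lambda>x. adj_mat (M x))"
  unfolding mat_in_def
proof (intro conjI allI impI)
  have M: "M x \<in> carrier_mat n n" for x using assms(2) by (simp add: mat_in_def)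
  show "adj_mat (M x) \<in> carrier_mat n n" for x using adj_mat(1)[OF M] .
  fix i j assume "i < n \<and> j < n"
  then have ij: "i < n" "j < n" by auto
  have "mat_in \<A> (n - 1) (n - 1) (\<lambda>x. mat_delete (M x) j i)"
    unfolding mat_in_def
  proof (intro conjI allI impI)
    show "mat_delete (M x) j i \<in> carrier_mat (n - 1) (n - 1)" for x
      using mat_delete_carrier[OF M] .
    fix a b assume ab: "a < n - 1 \<and> b < n - 1"
    have "(\<lambda>x. M x $$ (r, s)) \<in> \<A>" if "r < n" "s < n" for r s
      using assms(2) that unfolding mat_in_def by auto
    note ent = this
    have "(\<lambda>x. M x $$ (if a < j then a else Suc a, if b < i then b else Suc b)) \<in> \<A>"
      by (rule ent) (use ab in auto)
    then show "(\<lambda>x. mat_delete (M x) j i $$ (a, b)) \<in> \<A>"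
      using ab M[THEN carrier_matD(1)] M[THEN carrier_matD(2)] by (simp add: mat_delete_def)
  qed
  then have "(\<lambda>x. (- 1) ^ (j + i) * det (mat_delete (M x) j i)) \<in> \<A>"
    by (intro fun_algebra_mult fun_algebra_const fun_algebra_det assms(1))
  then show "(\<lambda>x. adj_mat (M x) $$ (i, j)) \<in> \<A>"
    using ij M[THEN carrier_matD(1)] M[THEN carrier_matD(2)]
    by (simp add: adj_mat_def cofactor_def)
qed

section \<open>Sums and products of matrices\<close>

lemma finsum_mat:
  fixes f :: "'i \<Rightarrow> complex mat"
  assumes "finite S" "\<forall>e\<in>S. f e \<in> carrier_mat nr nc"
  shows "finsum (module_mat TYPE(complex) nr nc) f S = mat nr nc (\<lambda>(r, c). \<Sum>e\<in>S. f e $$ (r, c))"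
  using assms
proof (induction S rule: finite_induct)
  case empty
  interpret abelian_group "module_mat TYPE(complex) nr nc" by (rule abelian_group_mat)
  have "finsum (module_mat TYPE(complex) nr nc) f {} = 0\<^sub>m nr nc"
    using finsum_empty by (simp add: module_mat_simps)
  then show ?case by (auto intro!: eq_matI)
next
  case (insert e S)
  interpret abelian_group "module_mat TYPE(complex) nr nc" by (rule abelian_group_mat)
  have "finsum (module_mat TYPE(complex) nr nc) f (insert e S)
      = f e + finsum (module_mat TYPE(complex) nr nc) f S"
    using finsum_insert[of S e f] insert.hyps insert.prems by (simp add: module_mat_simps Pi_def)
  also have "finsum (module_mat TYPE(complex) nr nc) f S = mat nr nc (\<lambda>(r, c). \<Sum>e\<in>S. f e $$ (r, c))"
    by (rule insert.IH) (simp add: insert.prems)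
  finally show ?case using insert.hyps insert.prems by (auto intro!: eq_matI)
qed

lemma
  fixes f :: "'i \<Rightarrow> complex mat"
  assumes "finite S" "\<forall>e\<in>S. f e \<in> carrier_mat nr nc"
  shows finsum_mat_carrier: "finsum (module_mat TYPE(complex) nr nc) f S \<in> carrier_mat nr nc"
    and finsum_mat_entry: "r < nr \<Longrightarrow> c < nc \<Longrightarrow>
      finsum (module_mat TYPE(complex) nr nc) f S $$ (r, c) = (\<Sum>e\<in>S. f e $$ (r, c))"
  unfolding finsum_mat[OF assms] by simp_all

lemma finsum_mat_mult_left:
  fixes f :: "'i \<Rightarrow> complex mat"
  assumes S: "finite S" and f: "\<forall>e\<in>S. f e \<in> carrier_mat nr nc" and A: "A \<in> carrier_mat m nr"
  shows "finsum (module_mat TYPE(complex) m nc) (\<lambda>e. A * f e) S = A * finsum (module_mat TYPE(complex) nr nc) f S"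
proof (rule eq_matI)
  have Af: "\<forall>e\<in>S. A * f e \<in> carrier_mat m nc" using f A by simp
  note c = finsum_mat_carrier[of S "\<lambda>e. A * f e", OF S Af] finsum_mat_carrier[of S f, OF S f]
  fix i j assume "i < dim_row (A * finsum (module_mat TYPE(complex) nr nc) f S)"
    "j < dim_col (A * finsum (module_mat TYPE(complex) nr nc) f S)"
  then have ij: "i < m" "j < nc" using A c by auto
  have "(\<Sum>e\<in>S. (A * f e) $$ (i, j)) = (\<Sum>e\<in>S. \<Sum>l<nr. A $$ (i, l) * f e $$ (l, j))"
    by (intro sum.cong refl mult_mat_entry[OF A bspec[OF f] ij])
  also have "\<dots> = (\<Sum>l<nr. A $$ (i, l) * (\<Sum>e\<in>S. f e $$ (l, j)))"
    unfolding sum_distrib_left by (rule sum.swap)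
  also have "\<dots> = (A * finsum (module_mat TYPE(complex) nr nc) f S) $$ (i, j)"
    unfolding mult_mat_entry[OF A c(2) ij] by (intro sum.cong refl) (simp add: finsum_mat_entry[OF S f] ij)
  finally show "finsum (module_mat TYPE(complex) m nc) (\<lambda>e. A * f e) S $$ (i, j) = (A * finsum (module_mat TYPE(complex) nr nc) f S) $$ (i, j)"
    unfolding finsum_mat_entry[of S "\<lambda>e. A * f e", OF S Af ij] .
qed (use finsum_mat_carrier[of S "\<lambda>e. A * f e" m nc, OF S] finsum_mat_carrier[of S f, OF S f] f A in auto)

lemma finsum_mat_mult_right:
  fixes f :: "'i \<Rightarrow> complex mat"
  assumes S: "finite S" and f: "\<forall>e\<in>S. f e \<in> carrier_mat nr nc" and A: "A \<in> carrier_mat nc m"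
  shows "finsum (module_mat TYPE(complex) nr m) (\<lambda>e. f e * A) S = finsum (module_mat TYPE(complex) nr nc) f S * A"
proof -
  have Af: "\<forall>e\<in>S. f e * A \<in> carrier_mat nr m" using f A mult_carrier_mat by blast
  note c = finsum_mat_carrier[of S "\<lambda>e. f e * A", OF S Af] finsum_mat_carrier[of S f, OF S f]
  show ?thesis
  proof (rule eq_matI)
    fix i j assume "i < dim_row (finsum (module_mat TYPE(complex) nr nc) f S * A)"
      "j < dim_col (finsum (module_mat TYPE(complex) nr nc) f S * A)"
    then have ij: "i < nr" "j < m" using A c by auto
    have "(\<Sum>e\<in>S. (f e * A) $$ (i, j)) = (\<Sum>e\<in>S. \<Sum>l<nc. f e $$ (i, l) * A $$ (l, j))"
      by (intro sum.cong refl mult_mat_entry[OF bspec[OF f] A ij])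
    also have "\<dots> = (\<Sum>l<nc. (\<Sum>e\<in>S. f e $$ (i, l)) * A $$ (l, j))"
      unfolding sum_distrib_right by (rule sum.swap)
    also have "\<dots> = (finsum (module_mat TYPE(complex) nr nc) f S * A) $$ (i, j)"
      unfolding mult_mat_entry[OF c(2) A ij] by (intro sum.cong refl) (simp add: finsum_mat_entry[OF S f] ij)
    finally show "finsum (module_mat TYPE(complex) nr m) (\<lambda>e. f e * A) S $$ (i, j) = (finsum (module_mat TYPE(complex) nr nc) f S * A) $$ (i, j)"
      unfolding finsum_mat_entry[of S "\<lambda>e. f e * A", OF S Af ij] .
  qed (use c A in auto)
qed

text \<open>
  The Leibniz rule for the product \<open>X P Y\<close>: when \<open>X\<close> and \<open>Y\<close> change by commutators, so does the
  product. The two middle terms cancel because \<open>P\<close> intertwines \<open>Z\<close> and \<open>h\<close>.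
\<close>

lemma commutator_product:
  fixes \<xi> X h P Z Y g :: "complex mat"
  assumes c: "\<xi> \<in> carrier_mat n n" "X \<in> carrier_mat n m" "h \<in> carrier_mat m m" "P \<in> carrier_mat m p"
    "Z \<in> carrier_mat p p" "Y \<in> carrier_mat p q" "g \<in> carrier_mat q q"
    and PZ: "P * Z = h * P"
  shows "(\<xi> * X - X * h) * P * Y + X * P * (Z * Y - Y * g) = \<xi> * (X * P * Y) - X * P * Y * g"
proof -
  have "(\<xi> * X - X * h) * P * Y = \<xi> * X * P * Y - X * h * P * Y"
  proof -
    have k: "\<xi> * X \<in> carrier_mat n m" "X * h \<in> carrier_mat n m" using c by auto
    have "(\<xi> * X - X * h) * P = \<xi> * X * P - X * h * P" using k c(4) by (rule minus_mult_distrib_mat)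
    moreover have "(\<xi> * X * P - X * h * P) * Y = \<xi> * X * P * Y - X * h * P * Y"
      using mult_carrier_mat[OF k(1) c(4)] mult_carrier_mat[OF k(2) c(4)] c(6) by (rule minus_mult_distrib_mat)
    ultimately show ?thesis by simp
  qed
  moreover have "X * P * (Z * Y - Y * g) = X * P * (Z * Y) - X * P * (Y * g)"
    using c by (intro mult_minus_distrib_mat[of _ n p _ q]) auto
  moreover have "X * h * P * Y = X * P * (Z * Y)"
  proof -
    have "X * h * P * Y = X * (h * P) * Y" using c by (simp only: mult_assoc_dim index_mult_mat(2,3) c[THEN carrier_matD(1)] c[THEN carrier_matD(2)])
    also have "\<dots> = X * (P * Z) * Y" unfolding PZ ..
    also have "\<dots> = X * P * (Z * Y)" by (simp only: mult_assoc_dim index_mult_mat(2,3) c[THEN carrier_matD(1)] c[THEN carrier_matD(2)])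
    finally show ?thesis .
  qed
  moreover have "\<xi> * X * P * Y = \<xi> * (X * P * Y)" "X * P * (Y * g) = X * P * Y * g"
    by (simp_all only: mult_assoc_dim index_mult_mat(2,3) c[THEN carrier_matD(1)] c[THEN carrier_matD(2)])
  moreover have "A - B + (B - C) = A - C" if "A \<in> carrier_mat n q" "B \<in> carrier_mat n q" "C \<in> carrier_mat n q" for A B C :: "complex mat"
    using that by (intro eq_matI) auto
  moreover have "\<xi> * (X * P * Y) \<in> carrier_mat n q" "X * P * (Z * Y) \<in> carrier_mat n q" "X * P * Y * g \<in> carrier_mat n q"
    using c by auto
  ultimately show ?thesis by simp
qed

lemma finsum_mat_cong:
  fixes f g :: "'i \<Rightarrow> complex mat"
  assumes "finite S" "\<forall>e\<in>S. g e \<in> carrier_mat nr nc" "\<And>e. e \<in> S \<Longrightarrow> f e = g e"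
  shows "finsum (module_mat TYPE(complex) nr nc) f S = finsum (module_mat TYPE(complex) nr nc) g S"
proof -
  have "\<forall>e\<in>S. f e \<in> carrier_mat nr nc" using assms by simp
  then show ?thesis
    unfolding finsum_mat[OF assms(1,2)] using assms(1,3) by (subst finsum_mat) (auto intro!: eq_matI)
qed

lemma minus_add_entry:
  fixes A B C :: "complex mat"
  assumes "A \<in> carrier_mat n m" "B \<in> carrier_mat n m" "C \<in> carrier_mat n m" "r < n" "c < m"
  shows "(A - B + C) $$ (r, c) = A $$ (r, c) - B $$ (r, c) + C $$ (r, c)"
  using assms by simp

lemma conj_term:
  fixes g A a P h B b :: "complex mat"
  assumes c: "g \<in> carrier_mat n n" "A \<in> carrier_mat n m" "a \<in> carrier_mat m m" "P \<in> carrier_mat m p"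
    "h \<in> carrier_mat p p" "B \<in> carrier_mat p q" "b \<in> carrier_mat q q" and eq: "a * P * h = P"
  shows "(g * A * a) * P * (h * B * b) = g * (A * P * B) * b"
proof -
  have "(g * A * a) * P * (h * B * b) = g * A * (a * P * h) * B * b"
    by (simp only: mult_assoc_dim index_mult_mat(2,3) c[THEN carrier_matD(1)] c[THEN carrier_matD(2)])
  also have "\<dots> = g * A * P * B * b" unfolding eq ..
  also have "\<dots> = g * (A * P * B) * b"
    by (simp only: mult_assoc_dim index_mult_mat(2,3) c[THEN carrier_matD(1)] c[THEN carrier_matD(2)])
  finally show ?thesis .
qed

lemma linear_relation_entries:
  fixes a b X h l c :: "complex mat"
  assumes "a \<in> carrier_mat n n" "b \<in> carrier_mat n n" "X \<in> carrier_mat n m" "h \<in> carrier_mat m m" "l \<in> carrier_mat m m"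
  shows "(a + t \<cdot>\<^sub>m b) * X - X * (h + t \<cdot>\<^sub>m l) = (a * X - X * h) + t \<cdot>\<^sub>m (b * X - X * l)"
proof -
  have "(a + t \<cdot>\<^sub>m b) * X = a * X + t \<cdot>\<^sub>m (b * X)"
    using add_mult_distrib_mat[OF assms(1) _ assms(3), of "t \<cdot>\<^sub>m b"] mult_smult_assoc_mat[OF assms(2,3)] assms(2) by simp
  moreover have "X * (h + t \<cdot>\<^sub>m l) = X * h + t \<cdot>\<^sub>m (X * l)"
    using mult_add_distrib_mat[OF assms(3,4), of "t \<cdot>\<^sub>m l"] mult_smult_distrib[OF assms(3,5)] assms(5) by simp
  moreover have "a * X \<in> carrier_mat n m" "b * X \<in> carrier_mat n m" "X * h \<in> carrier_mat n m" "X * l \<in> carrier_mat n m"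
    using assms by auto
  moreover have "P + t \<cdot>\<^sub>m R - (S + t \<cdot>\<^sub>m T) = P - S + t \<cdot>\<^sub>m (R - T)"
    if "P \<in> carrier_mat n m" "R \<in> carrier_mat n m" "S \<in> carrier_mat n m" "T \<in> carrier_mat n m" for P R S T :: "complex mat"
    using that by (intro eq_matI) (auto simp: algebra_simps)
  ultimately show ?thesis by simp
qed

section \<open>Subspaces of coordinate spaces\<close>

lemma subspace_vecI:
  assumes "W \<subseteq> carrier_vec n" "0\<^sub>v n \<in> W"
    "\<And>a b. a \<in> W \<Longrightarrow> b \<in> W \<Longrightarrow> a + b \<in> W" "\<And>c a. a \<in> W \<Longrightarrow> c \<cdot>\<^sub>v a \<in> W"
  shows "VectorSpace.subspace class_ring W (module_vec TYPE(complex) n)"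
  unfolding VectorSpace.subspace_def LinearCombinations.submodule_def
  using assms vec_vs[of n] vec_module[of n] by (simp add: module_vec_simps)

lemma subspace_vecD:
  assumes "VectorSpace.subspace class_ring W (module_vec TYPE(complex) n)"
  shows "W \<subseteq> carrier_vec n" "0\<^sub>v n \<in> W"
    "a \<in> W \<Longrightarrow> b \<in> W \<Longrightarrow> a + b \<in> W" "a \<in> W \<Longrightarrow> c \<cdot>\<^sub>v a \<in> W"
  using assms unfolding VectorSpace.subspace_def LinearCombinations.submodule_def
  by (simp_all add: module_vec_simps)

lemma mult_mat_zero_vec:
  fixes A :: "complex mat"
  assumes "A \<in> carrier_mat n m"
  shows "A *\<^sub>v 0\<^sub>v m = 0\<^sub>v n"
  using assms by (intro eq_vecI) auto

lemma smult_zero_vec_complex: "(t::complex) \<cdot>\<^sub>v 0\<^sub>v n = 0\<^sub>v n"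
  by (intro eq_vecI) auto

lemma zero_mat_mult_vec: "w \<in> carrier_vec m \<Longrightarrow> 0\<^sub>m n m *\<^sub>v w = (0\<^sub>v n :: complex vec)"
  by (intro eq_vecI) auto

lemma sum_fibres:
  fixes h :: "'a \<Rightarrow> 'b \<Rightarrow> complex"
  assumes "finite S" "finite T" "\<And>e. e \<in> S \<Longrightarrow> p e \<in> T"
  shows "(\<Sum>v\<in>T. \<Sum>e | e \<in> S \<and> p e = v. h v e) = (\<Sum>e\<in>S. h (p e) e)"
proof -
  have "(\<Sum>v\<in>T. \<Sum>e | e \<in> S \<and> p e = v. h v e) = (\<Sum>v\<in>T. \<Sum>e | e \<in> S \<and> p e = v. h (p e) e)"
    by (intro sum.cong) auto
  also have "\<dots> = (\<Sum>e\<in>S. h (p e) e)" by (rule sum.group) (use assms in auto)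
  finally show ?thesis .
qed

lemma mult_mat_vec_in_closed:
  fixes M :: "complex mat"
  assumes M: "M \<in> carrier_mat n m" and u: "u \<in> carrier_vec m"
    and W: "0\<^sub>v n \<in> W" "\<And>a b. a \<in> W \<Longrightarrow> b \<in> W \<Longrightarrow> a + b \<in> W" "\<And>c a. a \<in> W \<Longrightarrow> c \<cdot>\<^sub>v a \<in> W"
    and col: "\<And>j. j < m \<Longrightarrow> col M j \<in> W"
  shows "M *\<^sub>v u \<in> W"
proof -
  have "vec n (\<lambda>r. \<Sum>l<j. M $$ (r, l) * u $ l) \<in> W" if "j \<le> m" for j
    using that
  proof (induction j)
    case 0
    have "vec n (\<lambda>r. \<Sum>l<0. M $$ (r, l) * u $ l) = 0\<^sub>v n" by (intro eq_vecI) auto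
    then show ?case using W(1) by simp
  next
    case (Suc j)
    have "vec n (\<lambda>r. \<Sum>l<Suc j. M $$ (r, l) * u $ l) = vec n (\<lambda>r. \<Sum>l<j. M $$ (r, l) * u $ l) + u $ j \<cdot>\<^sub>v col M j"
      using M Suc.prems by (intro eq_vecI) auto
    then show ?case using W(2)[OF Suc.IH W(3)[OF col]] Suc.prems by simp
  qed
  moreover have "M *\<^sub>v u = vec n (\<lambda>r. \<Sum>l<m. M $$ (r, l) * u $ l)"
    using M by (intro eq_vecI) (simp_all add: mult_mat_vec_entry[OF M u] del: index_mult_mat_vec)
  ultimately show ?thesis by simp
qed

section \<open>Triangular decomposition\<close>

definition trailing_block :: "nat \<Rightarrow> nat \<Rightarrow> complex mat \<Rightarrow> complex mat" where
  "trailing_block n c M = mat (n - c - 1) (n - c - 1) (\<lambda>(i, j). M $$ (c + 1 + i, c + 1 + j))"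

definition trailing_column :: "nat \<Rightarrow> nat \<Rightarrow> complex mat \<Rightarrow> complex vec" where
  "trailing_column n c M = vec (n - c - 1) (\<lambda>i. M $$ (c + 1 + i, c))"

text \<open>
  The coefficients of the combination of the columns after \<open>c\<close> that agrees with column \<open>c\<close> in all
  rows below row \<open>c\<close>, if the trailing block is invertible.
\<close>

definition column_coeffs :: "nat \<Rightarrow> nat \<Rightarrow> complex mat \<Rightarrow> complex vec" where
  "column_coeffs n c M = minv (trailing_block n c M) *\<^sub>v trailing_column n c M"

text \<open>
  Gaussian elimination on columns: each of the first \<open>kk\<close> columns is cleared below the diagonal by
  means of the columns to its right. This multiplies \<open>M\<close> from the right by a lower unitriangular
  matrix; so if the trailing blocks are invertible, \<open>M\<close> becomes a matrix of the shape that occurs in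
  the group times a lower unitriangular one.
\<close>

definition column_reduced :: "nat \<Rightarrow> nat \<Rightarrow> complex mat \<Rightarrow> complex mat" where
  "column_reduced n kk M = mat n n (\<lambda>(r, c). if c < kk
     then M $$ (r, c) - (\<Sum>s<n - c - 1. M $$ (r, c + 1 + s) * column_coeffs n c M $ s) else M $$ (r, c))"

lemma trailing_block_carrier: "trailing_block n c M \<in> carrier_mat (n - c - 1) (n - c - 1)"
  by (simp add: trailing_block_def)

lemma trailing_column_carrier: "trailing_column n c M \<in> carrier_vec (n - c - 1)"
  by (simp add: trailing_column_def)

lemma column_reduced_carrier: "column_reduced n kk M \<in> carrier_mat n n"
  by (simp add: column_reduced_def)

lemma sum_lessThan_shift:
  fixes h :: "nat \<Rightarrow> complex"
  shows "(\<Sum>l<a + m. h l) = (\<Sum>l<a. h l) + (\<Sum>s<m. h (a + s))"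
  by (induction m) (simp_all add: add.assoc)

lemma sum_trailing:
  fixes h :: "nat \<Rightarrow> complex"
  assumes "c < n" "\<And>l. l \<le> c \<Longrightarrow> h l = 0"
  shows "(\<Sum>l<n. h l) = (\<Sum>s<n - c - 1. h (c + 1 + s))"
proof -
  have "(\<Sum>l<(c + 1) + (n - c - 1). h l) = (\<Sum>l<c + 1. h l) + (\<Sum>s<n - c - 1. h (c + 1 + s))"
    by (rule sum_lessThan_shift)
  moreover have "(c + 1) + (n - c - 1) = n" using assms(1) by simp
  moreover have "(\<Sum>l<c + 1. h l) = 0" using assms(2) by (intro sum.neutral) auto
  ultimately show ?thesis by simp
qed

lemma
  assumes g: "g \<in> carrier_mat n n" and M: "M \<in> carrier_mat n n" and c: "c < n"
    and gz: "\<And>r l. r < n \<Longrightarrow> l \<le> c \<Longrightarrow> c < r \<Longrightarrow> g $$ (r, l) = 0"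
  shows trailing_block_mult: "trailing_block n c (g * M) = trailing_block n c g * trailing_block n c M"
    and trailing_column_mult: "trailing_column n c (g * M) = trailing_block n c g *\<^sub>v trailing_column n c M"
proof -
  have ent: "(g * M) $$ (c + 1 + i, j) = (\<Sum>s<n - c - 1. g $$ (c + 1 + i, c + 1 + s) * M $$ (c + 1 + s, j))"
    if "i < n - c - 1" "j < n" for i j
  proof -
    have r: "c + 1 + i < n" using that by simp
    show ?thesis unfolding mult_mat_entry[OF g M r that(2)]
      by (rule sum_trailing[OF c]) (use gz[OF r] in simp)
  qed
  show "trailing_block n c (g * M) = trailing_block n c g * trailing_block n c M"
  proof (rule eq_matI)
    fix i j assume "i < dim_row (trailing_block n c g * trailing_block n c M)" "j < dim_col (trailing_block n c g * trailing_block n c M)"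
    then have ij: "i < n - c - 1" "j < n - c - 1" by (simp_all add: trailing_block_def)
    then have j: "c + 1 + j < n" by simp
    show "trailing_block n c (g * M) $$ (i, j) = (trailing_block n c g * trailing_block n c M) $$ (i, j)"
      unfolding mult_mat_entry[OF trailing_block_carrier trailing_block_carrier ij]
      using ij ent[OF ij(1) j] by (simp add: trailing_block_def del: index_mult_mat(1))
  qed (simp_all add: trailing_block_def)
  show "trailing_column n c (g * M) = trailing_block n c g *\<^sub>v trailing_column n c M"
  proof (rule eq_vecI)
    fix i assume "i < dim_vec (trailing_block n c g *\<^sub>v trailing_column n c M)"
    then have i: "i < n - c - 1" by (simp add: trailing_block_def)
    show "trailing_column n c (g * M) $ i = (trailing_block n c g *\<^sub>v trailing_column n c M) $ i"
      unfolding mult_mat_vec_entry[OF trailing_block_carrier trailing_column_carrier i]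
      using i ent[OF i c] by (simp add: trailing_block_def trailing_column_def del: index_mult_mat(1))
  qed (simp add: trailing_block_def trailing_column_def)
qed

text \<open>
  If \<open>g\<close> vanishes below row \<open>c\<close> in the columns up to \<open>c\<close>, it acts on the rows below row \<open>c\<close> through
  its trailing block only. This block multiplies both sides of the linear system for the
  coefficients.
\<close>

lemma column_coeffs_mult:
  assumes g: "g \<in> carrier_mat n n" and M: "M \<in> carrier_mat n n" and c: "c < n"
    and gz: "\<And>r l. r < n \<Longrightarrow> l \<le> c \<Longrightarrow> c < r \<Longrightarrow> g $$ (r, l) = 0"
    and det: "det (trailing_block n c g) \<noteq> 0" "det (trailing_block n c M) \<noteq> 0"
  shows "column_coeffs n c (g * M) = column_coeffs n c M"
proof -
  let ?S = "trailing_block n c g" and ?T = "trailing_block n c M"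
  note S = trailing_block_carrier[of n c g] and T = trailing_block_carrier[of n c M]
  note s = minv[OF S det(1)] and t = minv[OF T det(2)]
  have "?S * ?T * (minv ?T * minv ?S) = ?S * (?T * minv ?T) * minv ?S"
    by (rule mult_assoc_middle[OF S T t(1) s(1)])
  also have "\<dots> = 1\<^sub>m (n - c - 1)" unfolding t(2) right_mult_one_mat[OF S] s(2) ..
  finally have inv: "minv (?S * ?T) = minv ?T * minv ?S"
    by (rule minv_unique[OF mult_carrier_mat[OF S T] mult_carrier_mat[OF t(1) s(1)]])
  have "column_coeffs n c (g * M) = (minv ?T * minv ?S) *\<^sub>v (?S *\<^sub>v trailing_column n c M)"
  proof -
    have "trailing_block n c (g * M) = ?S * ?T" by (rule trailing_block_mult[OF g M c]) (rule gz)
    moreover have "trailing_column n c (g * M) = ?S *\<^sub>v trailing_column n c M" by (rule trailing_column_mult[OF g M c]) (rule gz)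
    ultimately show ?thesis unfolding column_coeffs_def using inv by simp
  qed
  also have "\<dots> = minv ?T *\<^sub>v (minv ?S *\<^sub>v (?S *\<^sub>v trailing_column n c M))"
    by (rule assoc_mult_mat_vec[OF t(1) s(1) mult_mat_vec_carrier[OF S trailing_column_carrier]])
  also have "minv ?S *\<^sub>v (?S *\<^sub>v trailing_column n c M) = (minv ?S * ?S) *\<^sub>v trailing_column n c M"
    by (rule assoc_mult_mat_vec[symmetric, OF s(1) S trailing_column_carrier])
  also have "\<dots> = trailing_column n c M" unfolding s(3) by (rule one_mult_mat_vec[OF trailing_column_carrier])
  finally show ?thesis unfolding column_coeffs_def .
qed

text \<open>
  Column operations commute with multiplication from the left.
\<close>

lemma column_reduced_mult:
  assumes g: "g \<in> carrier_mat n n" and M: "M \<in> carrier_mat n n"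
    and "\<And>c. c < kk \<Longrightarrow> c < n \<Longrightarrow> column_coeffs n c (g * M) = column_coeffs n c M"
  shows "column_reduced n kk (g * M) = g * column_reduced n kk M"
proof (rule eq_matI)
  fix r c assume "r < dim_row (g * column_reduced n kk M)" "c < dim_col (g * column_reduced n kk M)"
  then have rc: "r < n" "c < n" using g by (simp_all add: column_reduced_def)
  show "column_reduced n kk (g * M) $$ (r, c) = (g * column_reduced n kk M) $$ (r, c)"
  proof (cases "c < kk")
    case True
    have "(g * column_reduced n kk M) $$ (r, c) = (\<Sum>l<n. g $$ (r, l) * (M $$ (l, c) - (\<Sum>s<n - c - 1. M $$ (l, c + 1 + s) * column_coeffs n c M $ s)))"
      unfolding mult_mat_entry[OF g column_reduced_carrier rc] using rc True by (intro sum.cong) (auto simp: column_reduced_def)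
    also have "\<dots> = (\<Sum>l<n. g $$ (r, l) * M $$ (l, c)) - (\<Sum>l<n. \<Sum>s<n - c - 1. g $$ (r, l) * M $$ (l, c + 1 + s) * column_coeffs n c M $ s)"
      by (simp add: right_diff_distrib sum_subtractf sum_distrib_left mult.assoc)
    also have "(\<Sum>l<n. \<Sum>s<n - c - 1. g $$ (r, l) * M $$ (l, c + 1 + s) * column_coeffs n c M $ s)
        = (\<Sum>s<n - c - 1. (\<Sum>l<n. g $$ (r, l) * M $$ (l, c + 1 + s)) * column_coeffs n c M $ s)"
      unfolding sum_distrib_right by (rule sum.swap)
    also have "\<dots> = (\<Sum>s<n - c - 1. (g * M) $$ (r, c + 1 + s) * column_coeffs n c M $ s)"
      by (intro sum.cong refl) (subst mult_mat_entry[OF g M rc(1)], use rc in auto)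
    also have "(\<Sum>l<n. g $$ (r, l) * M $$ (l, c)) = (g * M) $$ (r, c)" by (rule mult_mat_entry[symmetric, OF g M rc])
    finally show ?thesis using rc True assms(3)[OF True rc(2)] by (simp add: column_reduced_def del: index_mult_mat(1))
  next
    case False
    then show ?thesis
      unfolding mult_mat_entry[OF g column_reduced_carrier rc] using rc mult_mat_entry[OF g M rc]
      by (simp add: column_reduced_def del: index_mult_mat(1))
  qed
qed (use g in \<open>simp_all add: column_reduced_def\<close>)

lemma column_reduced_zero:
  assumes "c < kk" "c < r" "r < n" "det (trailing_block n c M) \<noteq> 0"
  shows "column_reduced n kk M $$ (r, c) = 0"
proof -
  define i where "i = r - c - 1"
  have i: "i < n - c - 1" and r: "r = c + 1 + i" using assms by (simp_all add: i_def)
  note T = trailing_block_carrier[of n c M] and t = minv[OF trailing_block_carrier assms(4)]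
  have "(\<Sum>s<n - c - 1. M $$ (r, c + 1 + s) * column_coeffs n c M $ s) = (trailing_block n c M *\<^sub>v column_coeffs n c M) $ i"
    unfolding column_coeffs_def mult_mat_vec_entry[OF T mult_mat_vec_carrier[OF t(1) trailing_column_carrier] i]
    using i by (intro sum.cong) (auto simp: trailing_block_def r)
  also have "trailing_block n c M *\<^sub>v column_coeffs n c M = (trailing_block n c M * minv (trailing_block n c M)) *\<^sub>v trailing_column n c M"
    unfolding column_coeffs_def by (rule assoc_mult_mat_vec[symmetric, OF T t(1) trailing_column_carrier])
  also have "\<dots> = trailing_column n c M" unfolding t(2) by (rule one_mult_mat_vec[OF trailing_column_carrier])
  also have "\<dots> $ i = M $$ (r, c)" using i by (simp add: trailing_column_def r)
  finally show ?thesis using assms by (simp add: column_reduced_def)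
qed

lemma trailing_block_one: "c < n \<Longrightarrow> trailing_block n c (1\<^sub>m n) = 1\<^sub>m (n - c - 1)"
  by (intro eq_matI) (auto simp: trailing_block_def)

lemma column_reduced_one: "column_reduced n kk (1\<^sub>m n) = 1\<^sub>m n"
proof (rule eq_matI)
  fix r c assume "r < dim_row (1\<^sub>m n :: complex mat)" "c < dim_col (1\<^sub>m n :: complex mat)"
  then have rc: "r < n" "c < n" by auto
  have "trailing_column n c (1\<^sub>m n) = 0\<^sub>v (n - c - 1)" using rc by (intro eq_vecI) (auto simp: trailing_column_def)
  moreover have "minv (trailing_block n c (1\<^sub>m n)) \<in> carrier_mat (n - c - 1) (n - c - 1)"
    using minv(1)[OF trailing_block_carrier[of n c "1\<^sub>m n"]] trailing_block_one[OF rc(2)] by simp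
  ultimately have "column_coeffs n c (1\<^sub>m n) = 0\<^sub>v (n - c - 1)" unfolding column_coeffs_def by (simp add: mult_mat_zero_vec)
  then show "column_reduced n kk (1\<^sub>m n) $$ (r, c) = 1\<^sub>m n $$ (r, c)" using rc by (simp add: column_reduced_def)
qed (simp_all add: column_reduced_def)

section \<open>Small solutions of quadratic equations\<close>

text \<open>
  For small \<open>t\<close> the quadratic map \<open>w \<mapsto> - bil (arg t w) (arg t w) / 2\<close> is a contraction of a ball
  whose radius is proportional to \<open>|t|\<^sup>2\<close>. It is used with \<open>a0\<close> a cycle and with \<open>R\<close> a right inverse
  of \<open>dmu x\<close>; the fixed point then moves \<open>x + t a0\<close> back to the zero locus of the moment map.
\<close>

lemma quadratic_fixed_point:
  fixes cf :: "'i \<Rightarrow> 'x \<Rightarrow> 'x \<Rightarrow> complex" and a0 :: "'x \<Rightarrow> complex" and R :: "'i \<Rightarrow> 'x \<Rightarrow> complex"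
  assumes I: "finite I" and X: "finite X"
  defines "arg t w \<equiv> (\<lambda>\<xi>. t * a0 \<xi> + (\<Sum>\<sigma>\<in>I. w \<sigma> * R \<sigma> \<xi>))"
    and "bil a b i \<equiv> (\<Sum>\<xi>\<in>X. \<Sum>\<eta>\<in>X. cf i \<xi> \<eta> * a \<xi> * b \<eta>)"
  shows "\<exists>\<epsilon>>0. \<exists>\<kappa>\<ge>0. \<forall>t. cmod t \<le> \<epsilon> \<longrightarrow>
    (\<exists>w. (\<Sum>i\<in>I. cmod (w i)) \<le> \<kappa> * (cmod t)\<^sup>2 \<and> (\<forall>i\<in>I. w i = - (bil (arg t w) (arg t w) i / 2)))"
proof -
  define N where "N a = (\<Sum>\<xi>\<in>X. cmod (a \<xi>))" for a :: "'x \<Rightarrow> complex"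
  define nrm where "nrm w = (\<Sum>i\<in>I. cmod (w i))" for w :: "'i \<Rightarrow> complex"
  define K where "K = (\<Sum>i\<in>I. \<Sum>\<xi>\<in>X. \<Sum>\<eta>\<in>X. cmod (cf i \<xi> \<eta>))"
  define C where "C = (\<Sum>\<sigma>\<in>I. N (R \<sigma>))"
  define n where "n = N a0"
  have nonneg: "N a \<ge> 0" "nrm w \<ge> 0" "K \<ge> 0" "C \<ge> 0" "n \<ge> 0" for a w
    unfolding N_def nrm_def K_def C_def n_def by (auto intro!: sum_nonneg)
  have Nle: "cmod (a \<xi>) \<le> N a" if "\<xi> \<in> X" for a \<xi>
    unfolding N_def using that X by (intro member_le_sum) auto
  have nrmle: "cmod (w i) \<le> nrm w" if "i \<in> I" for w i
    unfolding nrm_def using that I by (intro member_le_sum) auto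
  have bil_bound: "(\<Sum>i\<in>I. cmod (bil a b i)) \<le> K * (N a * N b)" for a b
  proof -
    have "(\<Sum>i\<in>I. cmod (bil a b i)) \<le> (\<Sum>i\<in>I. \<Sum>\<xi>\<in>X. \<Sum>\<eta>\<in>X. cmod (cf i \<xi> \<eta>) * (N a * N b))"
    proof (rule sum_mono)
      fix i assume "i \<in> I"
      have "cmod (bil a b i) \<le> (\<Sum>\<xi>\<in>X. cmod (\<Sum>\<eta>\<in>X. cf i \<xi> \<eta> * a \<xi> * b \<eta>))"
        unfolding bil_def by (rule norm_sum)
      also have "\<dots> \<le> (\<Sum>\<xi>\<in>X. \<Sum>\<eta>\<in>X. cmod (cf i \<xi> \<eta> * a \<xi> * b \<eta>))"
        by (intro sum_mono norm_sum)
      also have "\<dots> \<le> (\<Sum>\<xi>\<in>X. \<Sum>\<eta>\<in>X. cmod (cf i \<xi> \<eta>) * (N a * N b))"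
        unfolding norm_mult mult.assoc by (intro sum_mono mult_left_mono mult_mono Nle nonneg norm_ge_zero)
      finally show "cmod (bil a b i) \<le> (\<Sum>\<xi>\<in>X. \<Sum>\<eta>\<in>X. cmod (cf i \<xi> \<eta>) * (N a * N b))" .
    qed
    then show ?thesis unfolding K_def sum_distrib_right .
  qed
  have R_bound: "N (\<lambda>\<xi>. \<Sum>\<sigma>\<in>I. w \<sigma> * R \<sigma> \<xi>) \<le> C * nrm w" for w
  proof -
    have "N (\<lambda>\<xi>. \<Sum>\<sigma>\<in>I. w \<sigma> * R \<sigma> \<xi>) \<le> (\<Sum>\<xi>\<in>X. \<Sum>\<sigma>\<in>I. cmod (w \<sigma>) * cmod (R \<sigma> \<xi>))"
      unfolding N_def norm_mult[symmetric] by (intro sum_mono norm_sum)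
    also have "\<dots> = (\<Sum>\<sigma>\<in>I. cmod (w \<sigma>) * N (R \<sigma>))"
      unfolding N_def sum_distrib_left by (rule sum.swap)
    also have "\<dots> \<le> (\<Sum>\<sigma>\<in>I. nrm w * N (R \<sigma>))" by (intro sum_mono mult_right_mono nrmle nonneg)
    also have "\<dots> = C * nrm w" unfolding C_def sum_distrib_left[symmetric] by simp
    finally show ?thesis .
  qed
  have N_add: "N (\<lambda>\<xi>. a \<xi> + b \<xi>) \<le> N a + N b" for a b
    unfolding N_def sum.distrib[symmetric] by (intro sum_mono norm_triangle_ineq)
  have arg_bound: "N (arg t w) \<le> cmod t * n + C * nrm w" for t w
  proof -
    have "N (\<lambda>\<xi>. t * a0 \<xi>) = cmod t * n" unfolding N_def n_def by (simp add: norm_mult sum_distrib_left)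
    then show ?thesis unfolding arg_def using N_add[of "\<lambda>\<xi>. t * a0 \<xi>" "\<lambda>\<xi>. \<Sum>\<sigma>\<in>I. w \<sigma> * R \<sigma> \<xi>"] R_bound[of w] by simp
  qed
  \<comment> \<open>On the ball that is used, the quadratic map has Lipschitz constant at most \<open>L * cmod t / 2\<close>.\<close>
  define L where "L = 2 * K * C * (n + C * K * n\<^sup>2)"
  define \<epsilon> where "\<epsilon> = 1 / (1 + L)"
  have L: "L \<ge> 0" unfolding L_def using nonneg by simp
  have \<epsilon>: "\<epsilon> > 0" "\<epsilon> \<le> 1" "L * \<epsilon> \<le> 1" unfolding \<epsilon>_def using L by (simp_all add: field_simps)
  have "\<exists>w. nrm w \<le> K * n\<^sup>2 * (cmod t)\<^sup>2 \<and> (\<forall>i\<in>I. w i = - (bil (arg t w) (arg t w) i / 2))" if t: "cmod t \<le> \<epsilon>" for t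
  proof -
    define \<rho> where "\<rho> = K * n\<^sup>2 * (cmod t)\<^sup>2"
    define \<Phi> where "\<Phi> w i = - (bil (arg t w) (arg t w) i / 2)" for w i
    have \<rho>: "\<rho> \<ge> 0" unfolding \<rho>_def using nonneg by simp
    have "(cmod t)\<^sup>2 \<le> cmod t" using t \<epsilon>(2) by (simp add: power2_eq_square mult_left_le)
    then have "C * \<rho> \<le> C * K * n\<^sup>2 * cmod t"
      unfolding \<rho>_def using nonneg mult_left_mono[of "(cmod t)\<^sup>2" "cmod t" "C * (K * n\<^sup>2)"] by (simp add: mult.assoc)
    then have small: "cmod t * n + C * \<rho> \<le> (n + C * K * n\<^sup>2) * cmod t" by (simp add: algebra_simps)
    have "2 * K * C * (cmod t * n + C * \<rho>) \<le> 2 * K * C * ((n + C * K * n\<^sup>2) * cmod t)"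
      using nonneg small by (intro mult_left_mono) auto
    also have "\<dots> = L * cmod t" by (simp add: L_def)
    also have "\<dots> \<le> L * \<epsilon>" using t L by (intro mult_left_mono)
    also have "\<dots> \<le> 1" by (rule \<epsilon>)
    finally have contr_const: "2 * K * C * (cmod t * n + C * \<rho>) \<le> 1" .
    have "\<exists>w. (\<Sum>i\<in>I. cmod (w i)) \<le> \<rho> \<and> (\<forall>i\<in>I. \<Phi> w i = w i)"
    proof (rule contraction_has_fixed_point[OF I \<rho>])
      have "(\<Sum>i\<in>I. cmod (\<Phi> (\<lambda>_. 0) i)) = (\<Sum>i\<in>I. cmod (bil (arg t (\<lambda>_. 0)) (arg t (\<lambda>_. 0)) i)) / 2"
        unfolding \<Phi>_def by (simp add: norm_divide sum_divide_distrib)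
      also have "\<dots> \<le> K * (N (arg t (\<lambda>_. 0)) * N (arg t (\<lambda>_. 0))) / 2" using bil_bound by simp
      also have "\<dots> \<le> K * ((cmod t * n) * (cmod t * n)) / 2"
        using arg_bound[of t "\<lambda>_. 0"] nonneg by (intro divide_right_mono mult_left_mono mult_mono) (auto simp: nrm_def)
      also have "\<dots> = \<rho> / 2" by (simp add: \<rho>_def power2_eq_square)
      finally show "(\<Sum>i\<in>I. cmod (\<Phi> (\<lambda>_. 0) i)) \<le> \<rho> / 2" .
    next
      fix w w' :: "'i \<Rightarrow> complex"
      assume w: "(\<Sum>i\<in>I. cmod (w i)) \<le> \<rho>" and w': "(\<Sum>i\<in>I. cmod (w' i)) \<le> \<rho>"
      let ?a = "arg t w" and ?b = "arg t w'"
      define \<delta> where "\<delta> = (\<lambda>\<xi>. ?a \<xi> - ?b \<xi>)"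
      have \<delta>: "\<delta> = (\<lambda>\<xi>. \<Sum>\<sigma>\<in>I. (w \<sigma> - w' \<sigma>) * R \<sigma> \<xi>)"
        unfolding \<delta>_def arg_def by (simp add: left_diff_distrib sum_subtractf fun_eq_iff)
      have "bil ?a ?a i - bil ?b ?b i = bil \<delta> ?a i + bil ?b \<delta> i" for i
        unfolding bil_def sum_subtractf[symmetric] sum.distrib[symmetric] \<delta>_def
        by (intro sum.cong refl) (simp add: algebra_simps)
      then have "\<Phi> w i - \<Phi> w' i = - ((bil \<delta> ?a i + bil ?b \<delta> i) / 2)" for i
        unfolding \<Phi>_def by (metis (no_types) diff_divide_distrib minus_diff_commute minus_diff_minus)
      then have "(\<Sum>i\<in>I. cmod (\<Phi> w i - \<Phi> w' i)) = (\<Sum>i\<in>I. cmod (bil \<delta> ?a i + bil ?b \<delta> i)) / 2"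
        by (simp add: norm_divide sum_divide_distrib)
      also have "\<dots> \<le> ((\<Sum>i\<in>I. cmod (bil \<delta> ?a i)) + (\<Sum>i\<in>I. cmod (bil ?b \<delta> i))) / 2"
        unfolding sum.distrib[symmetric] by (intro divide_right_mono sum_mono norm_triangle_ineq) simp
      also have "\<dots> \<le> (K * (N \<delta> * N ?a) + K * (N ?b * N \<delta>)) / 2"
        using bil_bound[of \<delta> ?a] bil_bound[of ?b \<delta>] by simp
      also have "\<dots> = K * N \<delta> * (N ?a + N ?b) / 2" by (simp add: algebra_simps)
      also have "\<dots> \<le> K * (C * nrm (\<lambda>i. w i - w' i)) * ((cmod t * n + C * \<rho>) + (cmod t * n + C * \<rho>)) / 2"
      proof -
        have "N \<delta> \<le> C * nrm (\<lambda>i. w i - w' i)" unfolding \<delta> by (rule R_bound)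
        moreover have "N ?a \<le> cmod t * n + C * \<rho>"
          using arg_bound[of t w] mult_left_mono[OF w nonneg(4)] by (simp add: nrm_def)
        moreover have "N ?b \<le> cmod t * n + C * \<rho>"
          using arg_bound[of t w'] mult_left_mono[OF w' nonneg(4)] by (simp add: nrm_def)
        ultimately show ?thesis using nonneg by (intro divide_right_mono mult_mono add_mono mult_nonneg_nonneg add_nonneg_nonneg) auto
      qed
      also have "\<dots> = (2 * K * C * (cmod t * n + C * \<rho>)) * nrm (\<lambda>i. w i - w' i) / 2" by (simp add: algebra_simps)
      also have "\<dots> \<le> 1 * nrm (\<lambda>i. w i - w' i) / 2"
        using contr_const nonneg by (intro divide_right_mono mult_right_mono) auto
      finally show "(\<Sum>i\<in>I. cmod (\<Phi> w i - \<Phi> w' i)) \<le> (\<Sum>i\<in>I. cmod (w i - w' i)) / 2"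
        by (simp add: nrm_def)
    qed
    then show ?thesis unfolding \<Phi>_def \<rho>_def nrm_def by metis
  qed
  then show ?thesis unfolding nrm_def
    using \<epsilon>(1) nonneg by (intro exI[of _ \<epsilon>] exI[of _ "K * n\<^sup>2"] conjI) auto
qed

lemma quadratic_bound_derivative:
  fixes h :: "complex \<Rightarrow> complex"
  assumes "\<epsilon> > 0" "\<And>t. cmod t \<le> \<epsilon> \<Longrightarrow> cmod (h t) \<le> \<kappa> * (cmod t)\<^sup>2"
  shows "(h has_field_derivative 0) (at 0)"
proof -
  have h0: "h 0 = 0" using assms(2)[of 0] assms(1) by simp
  have "((\<lambda>t. (h (0 + t) - h 0) / t) \<longlongrightarrow> 0) (at 0)"
  proof (rule tendsto_0_le)
    show "((\<lambda>t. t) \<longlongrightarrow> 0) (at (0::complex))" by (rule tendsto_ident_at)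
    have "eventually (\<lambda>t. dist t 0 < \<epsilon> \<and> t \<noteq> 0) (at (0::complex))"
      unfolding eventually_at using assms(1) by (intro exI[of _ \<epsilon>]) auto
    then show "\<forall>\<^sub>F t in at 0. norm ((h (0 + t) - h 0) / t) \<le> norm t * \<bar>\<kappa>\<bar>"
    proof (rule eventually_mono)
      fix t :: complex assume t: "dist t 0 < \<epsilon> \<and> t \<noteq> 0"
      then have "cmod (h t) \<le> \<kappa> * (cmod t)\<^sup>2" using assms(2)[of t] by (simp add: dist_norm)
      also have "\<dots> \<le> \<bar>\<kappa>\<bar> * (cmod t)\<^sup>2" by (intro mult_right_mono) auto
      finally show "norm ((h (0 + t) - h 0) / t) \<le> norm t * \<bar>\<kappa>\<bar>"
        using t h0 by (simp add: norm_divide field_simps power2_eq_square)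
    qed
  qed
  then show ?thesis by (simp add: DERIV_def)
qed

section \<open>Curves of matrices\<close>

definition mderiv :: "nat \<Rightarrow> nat \<Rightarrow> (complex \<Rightarrow> complex mat) \<Rightarrow> complex mat \<Rightarrow> bool" where
  "mderiv n m M M' \<longleftrightarrow> (\<forall>t. M t \<in> carrier_mat n m) \<and> M' \<in> carrier_mat n m \<and>
     (\<forall>i<n. \<forall>j<m. ((\<lambda>t. M t $$ (i, j)) has_field_derivative M' $$ (i, j)) (at 0))"

lemma mderivD:
  assumes "mderiv n m M M'"
  shows "M t \<in> carrier_mat n m" "M' \<in> carrier_mat n m"
    "i < n \<Longrightarrow> j < m \<Longrightarrow> ((\<lambda>t. M t $$ (i, j)) has_field_derivative M' $$ (i, j)) (at 0)"
  using assms unfolding mderiv_def by blast+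

lemma mderiv_const: "C \<in> carrier_mat n m \<Longrightarrow> mderiv n m (\<lambda>_. C) (0\<^sub>m n m)"
  unfolding mderiv_def by simp

lemma mderiv_mult:
  assumes M: "mderiv n m M M'" and N: "mderiv m p N N'"
  shows "mderiv n p (\<lambda>t. M t * N t) (M' * N 0 + M 0 * N')"
  unfolding mderiv_def
proof (intro conjI allI impI)
  note m = mderivD[OF M] and n = mderivD[OF N]
  show "M t * N t \<in> carrier_mat n p" for t by (rule mult_carrier_mat[OF m(1) n(1)])
  show "M' * N 0 + M 0 * N' \<in> carrier_mat n p"
    by (intro add_carrier_mat mult_carrier_mat[OF m(1) n(2)])
  fix i j assume ij: "i < n" "j < p"
  have "((\<lambda>t. \<Sum>l<m. M t $$ (i, l) * N t $$ (l, j)) has_field_derivative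
      (\<Sum>l<m. M' $$ (i, l) * N 0 $$ (l, j) + N' $$ (l, j) * M 0 $$ (i, l))) (at 0)"
    by (intro DERIV_sum DERIV_mult m(3) n(3)) (use ij in auto)
  moreover have "(\<Sum>l<m. M' $$ (i, l) * N 0 $$ (l, j) + N' $$ (l, j) * M 0 $$ (i, l)) = (M' * N 0 + M 0 * N') $$ (i, j)"
  proof -
    have "(M' * N 0 + M 0 * N') $$ (i, j) = (M' * N 0) $$ (i, j) + (M 0 * N') $$ (i, j)"
      using ij m(1)[of 0] n(2) by (intro index_add_mat(1)) auto
    then show ?thesis
      unfolding mult_mat_entry[OF m(2) n(1) ij] mult_mat_entry[OF m(1) n(2) ij] by (simp add: sum.distrib mult.commute)
  qed
  ultimately show "((\<lambda>t. (M t * N t) $$ (i, j)) has_field_derivative (M' * N 0 + M 0 * N') $$ (i, j)) (at 0)"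
    by (simp only: mult_mat_entry[OF m(1) n(1) ij])
qed

lemma mderiv_unique:
  assumes "mderiv n m M M'" "mderiv n m N N'" "\<And>t. M t = N t"
  shows "M' = N'"
proof (rule eq_matI)
  fix i j assume "i < dim_row N'" "j < dim_col N'"
  then have ij: "i < n" "j < m" using mderivD(2)[OF assms(2)] by auto
  show "M' $$ (i, j) = N' $$ (i, j)"
    using mderivD(3)[OF assms(1) ij] mderivD(3)[OF assms(2) ij] unfolding assms(3) by (rule DERIV_unique)
qed (use mderivD(2)[OF assms(1)] mderivD(2)[OF assms(2)] in auto)

lemma mderiv_const_mult:
  assumes "C \<in> carrier_mat p n" "mderiv n m M M'"
  shows "mderiv p m (\<lambda>t. C * M t) (C * M')"
proof -
  have "0\<^sub>m p n * M 0 + C * M' = C * M'"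
    using left_mult_zero_mat[OF mderivD(1)[OF assms(2)]] mult_carrier_mat[OF assms(1) mderivD(2)[OF assms(2)]] by simp
  then show ?thesis using mderiv_mult[OF mderiv_const[OF assms(1)] assms(2)] by simp
qed

lemma mderiv_mult_const:
  assumes "C \<in> carrier_mat m p" "mderiv n m M M'"
  shows "mderiv n p (\<lambda>t. M t * C) (M' * C)"
proof -
  have "M' * C + M 0 * 0\<^sub>m m p = M' * C"
    using right_mult_zero_mat[OF mderivD(1)[OF assms(2)]] mult_carrier_mat[OF mderivD(2)[OF assms(2)] assms(1)] by simp
  then show ?thesis using mderiv_mult[OF assms(2) mderiv_const[OF assms(1)]] by simp
qed

lemma mat_in_mult:
  assumes A: "fun_algebra \<A>" and "mat_in \<A> n m M" "mat_in \<A> m p N"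
  shows "mat_in \<A> n p (\<lambda>x. M x * N x)"
  unfolding mat_in_def
proof (intro conjI allI impI)
  have c: "M x \<in> carrier_mat n m" "N x \<in> carrier_mat m p" for x using assms unfolding mat_in_def by blast+
  show "M x * N x \<in> carrier_mat n p" for x by (rule mult_carrier_mat[OF c])
  fix i j assume ij: "i < n \<and> j < p"
  have "(\<lambda>x. \<Sum>l<m. M x $$ (i, l) * N x $$ (l, j)) \<in> \<A>"
    using assms(2,3) ij unfolding mat_in_def by (intro fun_algebra_sum fun_algebra_mult A) auto
  then show "(\<lambda>x. (M x * N x) $$ (i, j)) \<in> \<A>"
    using mult_mat_entry[OF c conjunct1[OF ij] conjunct2[OF ij]] by (simp only:)
qed

lemma mat_in_const: "fun_algebra \<A> \<Longrightarrow> C \<in> carrier_mat n m \<Longrightarrow> mat_in \<A> n m (\<lambda>_. C)"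
  unfolding mat_in_def using fun_algebra_const by blast

definition diff_at_0 :: "(complex \<Rightarrow> complex) set" where
  "diff_at_0 = {h. \<exists>D. (h has_field_derivative D) (at 0)}"

lemma diff_at_0_algebra: "fun_algebra diff_at_0"
  unfolding fun_algebra_def diff_at_0_def using DERIV_const DERIV_add DERIV_mult by blast

lemma diff_at_0_inverse: "h \<in> diff_at_0 \<Longrightarrow> h 0 \<noteq> 0 \<Longrightarrow> (\<lambda>t. 1 / h t) \<in> diff_at_0"
  unfolding diff_at_0_def using DERIV_divide[OF DERIV_const] by blast

lemma diff_at_0_minv:
  assumes M: "mat_in diff_at_0 n n M" and det: "\<And>t. det (M t) \<noteq> 0"
  shows "mat_in diff_at_0 n n (\<lambda>t. minv (M t))"
  unfolding mat_in_def
proof (intro conjI allI impI)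
  have c: "M t \<in> carrier_mat n n" for t using M unfolding mat_in_def by blast
  show "minv (M t) \<in> carrier_mat n n" for t by (rule minv(1)[OF c det])
  fix i j assume ij: "i < n \<and> j < n"
  have "(\<lambda>t. 1 / det (M t) * adj_mat (M t) $$ (i, j)) \<in> diff_at_0"
    using fun_algebra_adj[OF diff_at_0_algebra M] ij det unfolding mat_in_def
    by (intro fun_algebra_mult diff_at_0_inverse diff_at_0_algebra fun_algebra_det[OF diff_at_0_algebra M]) auto
  then show "(\<lambda>t. minv (M t) $$ (i, j)) \<in> diff_at_0"
    using ij adj_mat(1)[OF c, THEN carrier_matD(1)] adj_mat(1)[OF c, THEN carrier_matD(2)] by (simp add: minv_def)
qed

lemma mat_transpose_terms:
  fixes U P R W :: "complex mat"
  assumes "U \<in> carrier_mat n m" "P \<in> carrier_mat n m" "R \<in> carrier_mat n m" "W \<in> carrier_mat n m" "U + P = R + W"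
  shows "U = W + (R - P)"
proof (rule eq_matI)
  fix i j assume "i < dim_row (W + (R - P))" "j < dim_col (W + (R - P))"
  then have ij: "i < n" "j < m" using assms(2) by auto
  have "(U + P) $$ (i, j) = (R + W) $$ (i, j)" using assms(5) by simp
  then show "U $$ (i, j) = (W + (R - P)) $$ (i, j)" using assms(1-4) ij by (simp add: algebra_simps)
qed (use assms in auto)

context framed_quiver
begin

section \<open>The projection and the induced endomorphisms\<close>

lemma \<pi>_right_inverse:
  assumes "v \<in> verts Q"
  shows "\<exists>\<rho>\<in>carrier_mat (d v) (dhat v). \<pi> v * \<rho> = 1\<^sub>m (dhat v)"
proof -
  have "\<exists>w\<in>carrier_vec (d v). \<pi> v *\<^sub>v w = unit_vec (dhat v) j" for j
    using \<pi>_surj[OF assms] unit_vec_carrier[of "dhat v" j] by (metis imageE)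
  then obtain w where w: "\<And>j. w j \<in> carrier_vec (d v)" "\<And>j. \<pi> v *\<^sub>v w j = unit_vec (dhat v) j"
    by metis
  define \<rho> where "\<rho> = mat (d v) (dhat v) (\<lambda>(i, j). w j $ i)"
  have \<rho>: "\<rho> \<in> carrier_mat (d v) (dhat v)" by (simp add: \<rho>_def)
  have "\<pi> v * \<rho> = 1\<^sub>m (dhat v)"
  proof (rule eq_matI)
    fix i j assume "i < dim_row (1\<^sub>m (dhat v) :: complex mat)" "j < dim_col (1\<^sub>m (dhat v) :: complex mat)"
    then have ij: "i < dhat v" "j < dhat v" by auto
    have "(\<pi> v * \<rho>) $$ (i, j) = (\<pi> v *\<^sub>v w j) $ i"
      unfolding mult_mat_entry[OF \<pi>_carrier[OF assms] \<rho> ij]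
        mult_mat_vec_entry[OF \<pi>_carrier[OF assms] w(1) ij(1)]
      using ij by (intro sum.cong) (auto simp: \<rho>_def)
    then show "(\<pi> v * \<rho>) $$ (i, j) = 1\<^sub>m (dhat v) $$ (i, j)" using ij w(2)[of j] by auto
  qed (use \<pi>_carrier[OF assms] in \<open>auto simp: \<rho>_def\<close>)
  then show ?thesis using \<rho> by blast
qed

text \<open>
  A linear section of \<open>\<pi> v\<close>. It makes the induced endomorphism explicit, as the product
  \<open>\<pi> v * \<xi> * \<rho> v\<close>, so that linearity and differentiability in \<open>\<xi>\<close> become visible.
\<close>

definition \<rho> :: "'v \<Rightarrow> complex mat" where
  "\<rho> v = (SOME M. M \<in> carrier_mat (d v) (dhat v) \<and> \<pi> v * M = 1\<^sub>m (dhat v))"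

lemma \<rho>:
  assumes "v \<in> verts Q"
  shows "\<rho> v \<in> carrier_mat (d v) (dhat v)" "\<pi> v * \<rho> v = 1\<^sub>m (dhat v)"
  using someI_ex[of "\<lambda>M. M \<in> carrier_mat (d v) (dhat v) \<and> \<pi> v * M = 1\<^sub>m (dhat v)"]
    \<pi>_right_inverse[OF assms] unfolding \<rho>_def by blast+

lemma \<pi>_kernel_iff:
  assumes "v \<in> verts Q" "w \<in> carrier_vec (d v)"
  shows "\<pi> v *\<^sub>v w = 0\<^sub>v (dhat v) \<longleftrightarrow> (\<forall>r. k v \<le> r \<and> r < d v \<longrightarrow> w $ r = 0)"
proof -
  have "w \<in> mat_kernel (\<pi> v) \<longleftrightarrow> \<pi> v *\<^sub>v w = 0\<^sub>v (dhat v)"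
    using \<pi>_carrier[OF assms(1)] assms(2) unfolding mat_kernel_def by auto
  then show ?thesis using \<pi>_kernel[OF assms(1)] assms(2) by auto
qed

lemma lieP_carrier: "\<xi> \<in> lieP v \<Longrightarrow> \<xi> \<in> carrier_mat (d v) (d v)"
  by (simp add: lieP_def)

lemma lieP_kernel:
  assumes v: "v \<in> verts Q" and \<xi>: "\<xi> \<in> lieP v" and w: "w \<in> carrier_vec (d v)"
    and "\<pi> v *\<^sub>v w = 0\<^sub>v (dhat v)"
  shows "\<pi> v *\<^sub>v (\<xi> *\<^sub>v w) = 0\<^sub>v (dhat v)"
proof -
  have w0: "w $ r = 0" if "k v \<le> r" "r < d v" for r
    using assms(4) \<pi>_kernel_iff[OF v w] that by blast
  have "(\<xi> *\<^sub>v w) $ r = 0" if "k v \<le> r" "r < d v" for r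
    unfolding mult_mat_vec_entry[OF lieP_carrier[OF \<xi>] w \<open>r < d v\<close>]
  proof (rule sum.neutral, rule ballI)
    fix l assume "l \<in> {..<d v}"
    then show "\<xi> $$ (r, l) * w $ l = 0"
      using \<xi> w0[of l] that unfolding lieP_def by (cases "l < k v") auto
  qed
  then show ?thesis using \<pi>_kernel_iff[OF v, of "\<xi> *\<^sub>v w"] lieP_carrier[OF \<xi>] w by auto
qed

text \<open>
  The vectors \<open>w - \<rho> v (\<pi> v w)\<close> lie in the kernel of \<open>\<pi> v\<close>, which \<open>\<xi>\<close> preserves.
\<close>

lemma \<pi>_\<rho>_\<pi>:
  assumes v: "v \<in> verts Q" and \<xi>: "\<xi> \<in> lieP v"
  shows "\<pi> v * \<xi> * \<rho> v * \<pi> v = \<pi> v * \<xi>"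
proof (rule mat_eqI_of_vec)
  note c = \<pi>_carrier[OF v] \<rho>[OF v] lieP_carrier[OF \<xi>]
  show "\<pi> v * \<xi> * \<rho> v * \<pi> v \<in> carrier_mat (dhat v) (d v)" "\<pi> v * \<xi> \<in> carrier_mat (dhat v) (d v)"
    using c(1,2,4) by auto
  fix w :: "complex vec" assume w: "w \<in> carrier_vec (d v)"
  define u where "u = w - \<rho> v *\<^sub>v (\<pi> v *\<^sub>v w)"
  have c1: "\<pi> v *\<^sub>v w \<in> carrier_vec (dhat v)" "\<rho> v *\<^sub>v (\<pi> v *\<^sub>v w) \<in> carrier_vec (d v)"
    using c w by auto
  have u: "u \<in> carrier_vec (d v)" unfolding u_def using c1 w by auto
  have "\<pi> v *\<^sub>v u = \<pi> v *\<^sub>v w - (\<pi> v * \<rho> v) *\<^sub>v (\<pi> v *\<^sub>v w)"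
    unfolding u_def using c(1,2) c1 w by (simp add: mult_minus_distrib_mat_vec[of _ "dhat v" "d v"])
  also have "\<dots> = 0\<^sub>v (dhat v)" unfolding c(3) using c1(1) by auto
  finally have "\<pi> v *\<^sub>v (\<xi> *\<^sub>v u) = 0\<^sub>v (dhat v)" using lieP_kernel[OF v \<xi> u] by blast
  moreover have "\<xi> *\<^sub>v u = \<xi> *\<^sub>v w - \<xi> *\<^sub>v (\<rho> v *\<^sub>v (\<pi> v *\<^sub>v w))"
    unfolding u_def by (rule mult_minus_distrib_mat_vec[OF c(4) w c1(2)])
  moreover have "\<pi> v *\<^sub>v (\<xi> *\<^sub>v w - \<xi> *\<^sub>v (\<rho> v *\<^sub>v (\<pi> v *\<^sub>v w)))
      = \<pi> v *\<^sub>v (\<xi> *\<^sub>v w) - \<pi> v *\<^sub>v (\<xi> *\<^sub>v (\<rho> v *\<^sub>v (\<pi> v *\<^sub>v w)))"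
    by (rule mult_minus_distrib_mat_vec[OF c(1)]) (use c(4) w c1(2) in auto)
  ultimately have e1: "\<pi> v *\<^sub>v (\<xi> *\<^sub>v w) - \<pi> v *\<^sub>v (\<xi> *\<^sub>v (\<rho> v *\<^sub>v (\<pi> v *\<^sub>v w))) = 0\<^sub>v (dhat v)"
    by simp
  have e2: "(\<pi> v * \<xi> * \<rho> v * \<pi> v) *\<^sub>v w = \<pi> v *\<^sub>v (\<xi> *\<^sub>v (\<rho> v *\<^sub>v (\<pi> v *\<^sub>v w)))"
  proof -
    have "(\<pi> v * \<xi> * \<rho> v * \<pi> v) *\<^sub>v w = (\<pi> v * \<xi> * \<rho> v) *\<^sub>v (\<pi> v *\<^sub>v w)"
      by (rule assoc_mult_mat_vec[of _ "dhat v" "dhat v"]) (use c(1,2,4) c1 w in auto)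
    also have "\<dots> = (\<pi> v * \<xi>) *\<^sub>v (\<rho> v *\<^sub>v (\<pi> v *\<^sub>v w))"
      by (rule assoc_mult_mat_vec[of _ "dhat v" "d v"]) (use c(1,2,4) c1 w in auto)
    also have "\<dots> = \<pi> v *\<^sub>v (\<xi> *\<^sub>v (\<rho> v *\<^sub>v (\<pi> v *\<^sub>v w)))"
      by (rule assoc_mult_mat_vec[of _ "dhat v" "d v"]) (use c(1,2,4) c1 w in auto)
    finally show ?thesis .
  qed
  have e3: "(\<pi> v * \<xi>) *\<^sub>v w = \<pi> v *\<^sub>v (\<xi> *\<^sub>v w)"
    by (rule assoc_mult_mat_vec[of _ "dhat v" "d v"]) (use c(1,2,4) c1 w in auto)
  show "(\<pi> v * \<xi> * \<rho> v * \<pi> v) *\<^sub>v w = (\<pi> v * \<xi>) *\<^sub>v w"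
    unfolding e2 e3
    by (rule vec_eq_of_minus_zero[OF _ _ e1, symmetric]) (use c(1,2,4) c1(2) w in auto)
qed

lemma induced_eq:
  assumes v: "v \<in> verts Q" and \<xi>: "\<xi> \<in> lieP v"
  shows "induced v \<xi> = \<pi> v * \<xi> * \<rho> v"
  unfolding induced_def
proof (rule the_equality)
  note c = \<pi>_carrier[OF v] \<rho>[OF v] lieP_carrier[OF \<xi>]
  show "\<pi> v * \<xi> * \<rho> v \<in> carrier_mat (dhat v) (dhat v) \<and> \<pi> v * \<xi> = \<pi> v * \<xi> * \<rho> v * \<pi> v"
    unfolding \<pi>_\<rho>_\<pi>[OF assms] using c(1,2,4) by simp
  fix \<eta> assume \<eta>: "\<eta> \<in> carrier_mat (dhat v) (dhat v) \<and> \<pi> v * \<xi> = \<eta> * \<pi> v"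
  then have "\<pi> v * \<xi> * \<rho> v = \<eta> * (\<pi> v * \<rho> v)"
    using c assoc_mult_mat[of \<eta> "dhat v" "dhat v" "\<pi> v" "d v" "\<rho> v" "dhat v"] by simp
  moreover have "\<eta> * (\<pi> v * \<rho> v) = \<eta>" unfolding \<rho>(2)[OF v] using conjunct1[OF \<eta>] by (rule right_mult_one_mat)
  ultimately show "\<eta> = \<pi> v * \<xi> * \<rho> v" by simp
qed

lemma
  assumes "v \<in> verts Q" "\<xi> \<in> lieP v"
  shows induced_carrier: "induced v \<xi> \<in> carrier_mat (dhat v) (dhat v)"
    and \<pi>_mult: "\<pi> v * \<xi> = induced v \<xi> * \<pi> v"
proof -
  show "induced v \<xi> \<in> carrier_mat (dhat v) (dhat v)"
    unfolding induced_eq[OF assms] using \<pi>_carrier \<rho>(1) lieP_carrier assms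
    by (intro mult_carrier_mat) blast+
  show "\<pi> v * \<xi> = induced v \<xi> * \<pi> v"
    unfolding induced_eq[OF assms] \<pi>_\<rho>_\<pi>[OF assms] ..
qed

lemma lieP_mult:
  assumes "g \<in> lieP v" "h \<in> lieP v"
  shows "g * h \<in> lieP v"
proof -
  note c = lieP_carrier[OF assms(1)] lieP_carrier[OF assms(2)]
  have "(g * h) $$ (r, s) = 0" if "r < d v" "s < k v" "s < r" for r s
    unfolding mult_mat_entry[OF c \<open>r < d v\<close> less_trans[OF \<open>s < r\<close> \<open>r < d v\<close>]]
  proof (rule sum.neutral, rule ballI)
    fix l assume "l \<in> {..<d v}"
    then show "g $$ (r, l) * h $$ (l, s) = 0"
      using that assms unfolding lieP_def by (cases "s < l") auto
  qed
  moreover have "g * h \<in> carrier_mat (d v) (d v)" using c by simp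
  ultimately show ?thesis unfolding lieP_def by blast
qed

lemma lieP_one: "1\<^sub>m (d v) \<in> lieP v"
  by (auto simp: lieP_def)

text \<open>
  Proceed through the first \<open>k v\<close> columns of \<open>h\<close>. In column \<open>s\<close> of \<open>h * g = 1\<close>, the earlier columns of
  \<open>h\<close> do not contribute to the rows \<open>r \<ge> s\<close>, and the later ones meet zeros of \<open>g\<close>. This leaves
  \<open>h\<^sub>r\<^sub>s g\<^sub>s\<^sub>s\<close>, which is \<open>1\<close> for \<open>r = s\<close> and \<open>0\<close> for \<open>r > s\<close>.
\<close>

lemma lieP_inverse:
  assumes v: "v \<in> verts Q" and g: "g \<in> lieP v" and h: "h \<in> carrier_mat (d v) (d v)" and hg: "h * g = 1\<^sub>m (d v)"
  shows "h \<in> lieP v"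
proof -
  have "\<forall>r<d v. s < r \<longrightarrow> h $$ (r, s) = 0" if "s < k v" for s
    using that
  proof (induction s rule: less_induct)
    case (less s)
    have s: "s < d v" using less.prems k_le_d[OF v] by simp
    have one: "(\<Sum>l<d v. h $$ (r, l) * g $$ (l, s)) = (if r = s then 1 else 0)" if "r < d v" for r
      using mult_mat_entry[OF h lieP_carrier[OF g] that s] hg s that by simp
    have split: "(\<Sum>l<d v. h $$ (r, l) * g $$ (l, s)) = h $$ (r, s) * g $$ (s, s)" if "r < d v" "r \<ge> s" for r
    proof -
      have "(\<Sum>l<d v. h $$ (r, l) * g $$ (l, s)) = (\<Sum>l<d v. if l = s then h $$ (r, l) * g $$ (l, s) else 0)"
      proof (rule sum.cong[OF refl])
        fix l assume l: "l \<in> {..<d v}"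
        consider "l < s" | "l = s" | "l > s" by linarith
        then show "h $$ (r, l) * g $$ (l, s) = (if l = s then h $$ (r, l) * g $$ (l, s) else 0)"
        proof cases
          case 1
          then have "\<forall>r<d v. l < r \<longrightarrow> h $$ (r, l) = 0" using less.IH[of l] less.prems by (meson less_trans)
          then have "h $$ (r, l) = 0" using 1 that by simp
          then show ?thesis using 1 by simp
        next
          case 3
          then have "g $$ (l, s) = 0" using g l less.prems unfolding lieP_def by blast
          then show ?thesis using 3 by simp
        qed simp
      qed
      then show ?thesis using s by simp
    qed
    have gss: "g $$ (s, s) \<noteq> 0" using one[OF s] split[OF s] by auto
    show ?case
    proof (intro allI impI)
      fix r assume r: "r < d v" "s < r"
      then have "h $$ (r, s) * g $$ (s, s) = 0"
        using one[OF r(1)] split[OF r(1)] by simp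
      then show "h $$ (r, s) = 0" using gss by simp
    qed
  qed
  then show ?thesis using h unfolding lieP_def by blast
qed

section \<open>The group\<close>

lemma induced_unique:
  assumes "v \<in> verts Q" "\<xi> \<in> lieP v" "\<eta> \<in> carrier_mat (dhat v) (dhat v)" "\<pi> v * \<xi> = \<eta> * \<pi> v"
  shows "induced v \<xi> = \<eta>"
proof -
  note c = \<pi>_carrier[OF assms(1)] \<rho>[OF assms(1)]
  have "induced v \<xi> = \<eta> * \<pi> v * \<rho> v" unfolding induced_eq[OF assms(1,2)] assms(4) ..
  also have "\<dots> = \<eta> * (\<pi> v * \<rho> v)" using assms(3) c(1,2) by (rule assoc_mult_mat)
  also have "\<dots> = \<eta>" unfolding c(3) using assms(3) by (rule right_mult_one_mat)
  finally show ?thesis .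
qed

lemma induced_mult:
  assumes v: "v \<in> verts Q" and g: "g \<in> lieP v" and h: "h \<in> lieP v"
  shows "induced v (g * h) = induced v g * induced v h"
proof (rule induced_unique[OF v lieP_mult[OF g h]])
  note c = \<pi>_carrier[OF v] lieP_carrier[OF g] lieP_carrier[OF h] induced_carrier[OF v g] induced_carrier[OF v h]
  show "induced v g * induced v h \<in> carrier_mat (dhat v) (dhat v)" using c(4,5) by (rule mult_carrier_mat)
  have "\<pi> v * (g * h) = induced v g * \<pi> v * h"
    unfolding \<pi>_mult[OF v g, symmetric] using c(1-3) by (rule assoc_mult_mat[symmetric])
  also have "\<dots> = induced v g * (induced v h * \<pi> v)"
    unfolding \<pi>_mult[OF v h, symmetric] using c(4,1,3) by (rule assoc_mult_mat)
  also have "\<dots> = induced v g * induced v h * \<pi> v" using c(4,5,1) by (rule assoc_mult_mat[symmetric])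
  finally show "\<pi> v * (g * h) = induced v g * induced v h * \<pi> v" .
qed

lemma induced_one:
  assumes "v \<in> verts Q"
  shows "induced v (1\<^sub>m (d v)) = 1\<^sub>m (dhat v)"
  using \<pi>_carrier[OF assms] by (intro induced_unique[OF assms lieP_one]) simp_all

lemma minv_lieP:
  assumes "v \<in> verts Q" "g \<in> lieP v" "det g \<noteq> 0"
  shows "minv g \<in> lieP v" "minv g * g = 1\<^sub>m (d v)" "g * minv g = 1\<^sub>m (d v)" "det (minv g) \<noteq> 0"
proof -
  note m = minv[OF lieP_carrier[OF assms(2)] assms(3)]
  show "minv g * g = 1\<^sub>m (d v)" "g * minv g = 1\<^sub>m (d v)" by (fact m)+
  show "minv g \<in> lieP v" using lieP_inverse[OF assms(1,2)] m by blast
  show "det (minv g) \<noteq> 0" by (rule det_nonzero_of_inverse[OF m(1) lieP_carrier[OF assms(2)] m(3)])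
qed

lemma
  assumes v: "v \<in> verts Q" and g: "g \<in> lieP v" and "det g \<noteq> 0"
  shows induced_inv_eq: "induced_inv v g = induced v (minv g)"
    and induced_inv_carrier: "induced_inv v g \<in> carrier_mat (dhat v) (dhat v)"
    and induced_inv_left: "induced_inv v g * induced v g = 1\<^sub>m (dhat v)"
    and induced_inv_right: "induced v g * induced_inv v g = 1\<^sub>m (dhat v)"
proof -
  note m = minv_lieP[OF assms]
  have r: "induced v g * induced v (minv g) = 1\<^sub>m (dhat v)"
    using induced_mult[OF v g m(1)] m(3) induced_one[OF v] by simp
  then show eq: "induced_inv v g = induced v (minv g)"
    unfolding induced_inv_def using the_mat_inverse induced_carrier v g m(1) by blast
  show "induced_inv v g \<in> carrier_mat (dhat v) (dhat v)"
    unfolding eq using induced_carrier v m(1) by blast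
  show "induced v g * induced_inv v g = 1\<^sub>m (dhat v)" unfolding eq by (rule r)
  show "induced_inv v g * induced v g = 1\<^sub>m (dhat v)"
    unfolding eq using induced_mult[OF v m(1) g] m(2) induced_one[OF v] by simp
qed

lemma GrpP_iff:
  "g \<in> GrpP \<longleftrightarrow> g \<in> extensional (verts Q) \<and> (\<forall>v\<in>verts Q. g v \<in> lieP v \<and> det (g v) \<noteq> 0)"
proof -
  have "invertible_mat (g v) \<longleftrightarrow> det (g v) \<noteq> 0" if "g v \<in> lieP v" for v
    using invertible_mat_iff_det[OF lieP_carrier[OF that]] .
  then show ?thesis unfolding GrpP_def by (auto simp: PiE_iff)
qed

definition gmul :: "('v \<Rightarrow> complex mat) \<Rightarrow> ('v \<Rightarrow> complex mat) \<Rightarrow> 'v \<Rightarrow> complex mat" where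
  "gmul g h = (\<lambda>v\<in>verts Q. g v * h v)"

definition ginv :: "('v \<Rightarrow> complex mat) \<Rightarrow> 'v \<Rightarrow> complex mat" where
  "ginv g = (\<lambda>v\<in>verts Q. minv (g v))"

definition gunit :: "'v \<Rightarrow> complex mat" where
  "gunit = (\<lambda>v\<in>verts Q. 1\<^sub>m (d v))"

lemma gmul_GrpP: "g \<in> GrpP \<Longrightarrow> h \<in> GrpP \<Longrightarrow> gmul g h \<in> GrpP"
  unfolding GrpP_iff gmul_def
  by (auto simp: lieP_mult det_mult[OF lieP_carrier lieP_carrier])

lemma ginv_GrpP: "g \<in> GrpP \<Longrightarrow> ginv g \<in> GrpP"
  unfolding GrpP_iff ginv_def by (auto simp: minv_lieP)

lemma gunit_GrpP: "gunit \<in> GrpP"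
  unfolding GrpP_iff gunit_def by (auto simp: lieP_one)

lemma gmul_ginv_left: "g \<in> GrpP \<Longrightarrow> gmul (ginv g) g = gunit"
  unfolding GrpP_iff gmul_def ginv_def gunit_def by (auto simp: minv_lieP fun_eq_iff)

text \<open>
  The trailing block of the inverse is an inverse of the trailing block.
\<close>

lemma det_trailing_block_lieP:
  assumes v: "v \<in> verts Q" and g: "g \<in> lieP v" and det: "det g \<noteq> 0" and c: "c < k v"
  shows "det (trailing_block (d v) c g) \<noteq> 0"
proof -
  note m = minv_lieP[OF v g det]
  have cd: "c < d v" using c k_le_d[OF v] by simp
  have gz: "g $$ (r, l) = 0" if "r < d v" "l \<le> c" "c < r" for r l
    using g that c unfolding lieP_def by auto
  have "trailing_block (d v) c g * trailing_block (d v) c (minv g) = trailing_block (d v) c (g * minv g)"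
    by (rule trailing_block_mult[symmetric, OF lieP_carrier[OF g] lieP_carrier[OF m(1)] cd gz])
  then have "trailing_block (d v) c g * trailing_block (d v) c (minv g) = 1\<^sub>m (d v - c - 1)" unfolding m(3) trailing_block_one[OF cd] .
  then show ?thesis by (rule det_nonzero_of_inverse[OF trailing_block_carrier trailing_block_carrier])
qed

section \<open>Coordinates on the representation space\<close>

lemma tail_head_verts: "e \<in> arcs Q \<Longrightarrow> tail Q e \<in> verts Q" "e \<in> arcs Q \<Longrightarrow> head Q e \<in> verts Q"
  by simp_all

lemma
  assumes "y \<in> Rep"
  shows Rep_A: "e \<in> arcs Q \<Longrightarrow> arrA y e \<in> carrier_mat (d (head Q e)) (dhat (tail Q e))"
    and Rep_B: "e \<in> arcs Q \<Longrightarrow> arrB y e \<in> carrier_mat (d (tail Q e)) (dhat (head Q e))"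
    and Rep_I: "v \<in> verts Q \<Longrightarrow> frI y v \<in> carrier_mat (d v) (f v)"
    and Rep_J: "v \<in> verts Q \<Longrightarrow> frJ y v \<in> carrier_mat (f v) (dhat v)"
  using assms unfolding Rep_def by (auto simp: PiE_iff)

lemma RepI:
  assumes "arrA y \<in> extensional (arcs Q)" "arrB y \<in> extensional (arcs Q)"
    "frI y \<in> extensional (verts Q)" "frJ y \<in> extensional (verts Q)"
    "\<And>e. e \<in> arcs Q \<Longrightarrow> arrA y e \<in> carrier_mat (d (head Q e)) (dhat (tail Q e))"
    "\<And>e. e \<in> arcs Q \<Longrightarrow> arrB y e \<in> carrier_mat (d (tail Q e)) (dhat (head Q e))"
    "\<And>v. v \<in> verts Q \<Longrightarrow> frI y v \<in> carrier_mat (d v) (f v)"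
    "\<And>v. v \<in> verts Q \<Longrightarrow> frJ y v \<in> carrier_mat (f v) (dhat v)"
  shows "y \<in> Rep"
  using assms unfolding Rep_def by (auto simp: PiE_iff)

lemma tuple_eqI:
  assumes "y \<in> Rep" "z \<in> Rep"
    "\<And>e. e \<in> arcs Q \<Longrightarrow> arrA y e = arrA z e" "\<And>e. e \<in> arcs Q \<Longrightarrow> arrB y e = arrB z e"
    "\<And>v. v \<in> verts Q \<Longrightarrow> frI y v = frI z v" "\<And>v. v \<in> verts Q \<Longrightarrow> frJ y v = frJ z v"
  shows "y = z"
proof (rule framed_tuple.equality)
  show "arrA y = arrA z"
    by (rule extensionalityI[of _ "arcs Q"]) (use assms in \<open>auto simp: Rep_def PiE_def\<close>)
  show "arrB y = arrB z"
    by (rule extensionalityI[of _ "arcs Q"]) (use assms in \<open>auto simp: Rep_def PiE_def\<close>)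
  show "frI y = frI z"
    by (rule extensionalityI[of _ "verts Q"]) (use assms in \<open>auto simp: Rep_def PiE_def\<close>)
  show "frJ y = frJ z"
    by (rule extensionalityI[of _ "verts Q"]) (use assms in \<open>auto simp: Rep_def PiE_def\<close>)
qed simp

text \<open>
  The matrix entries, as functions on tuples. A component of a tuple is addressed by the coordinate
  function itself, so that the four kinds of blocks share a single index set.
\<close>

definition coords :: "(('v, 'e) framed_tuple \<Rightarrow> complex) set" where
  "coords =
     (\<Union>e\<in>arcs Q. \<Union>r\<in>{..<d (head Q e)}. \<Union>s\<in>{..<dhat (tail Q e)}. {\<lambda>y. arrA y e $$ (r, s)}) \<union>
     (\<Union>e\<in>arcs Q. \<Union>r\<in>{..<d (tail Q e)}. \<Union>s\<in>{..<dhat (head Q e)}. {\<lambda>y. arrB y e $$ (r, s)}) \<union>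
     (\<Union>v\<in>verts Q. \<Union>r\<in>{..<d v}. \<Union>s\<in>{..<f v}. {\<lambda>y. frI y v $$ (r, s)}) \<union>
     (\<Union>v\<in>verts Q. \<Union>r\<in>{..<f v}. \<Union>s\<in>{..<dhat v}. {\<lambda>y. frJ y v $$ (r, s)})"

lemma finite_coords: "finite coords"
  unfolding coords_def by simp

lemma coords_cases:
  assumes "\<xi> \<in> coords"
  obtains e r s where "e \<in> arcs Q" "r < d (head Q e)" "s < dhat (tail Q e)" "\<xi> = (\<lambda>y. arrA y e $$ (r, s))"
  | e r s where "e \<in> arcs Q" "r < d (tail Q e)" "s < dhat (head Q e)" "\<xi> = (\<lambda>y. arrB y e $$ (r, s))"
  | v r s where "v \<in> verts Q" "r < d v" "s < f v" "\<xi> = (\<lambda>y. frI y v $$ (r, s))"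
  | v r s where "v \<in> verts Q" "r < f v" "s < dhat v" "\<xi> = (\<lambda>y. frJ y v $$ (r, s))"
  using assms unfolding coords_def
  by (elim UnE UN_E singletonE; unfold lessThan_iff) (erule (3) that)+

lemma coords_A: "e \<in> arcs Q \<Longrightarrow> r < d (head Q e) \<Longrightarrow> s < dhat (tail Q e) \<Longrightarrow> (\<lambda>y. arrA y e $$ (r, s)) \<in> coords"
  unfolding coords_def by (rule UnI1, rule UnI1, rule UnI1, rule UN_I[of e], assumption, rule UN_I[of r], simp, rule UN_I[of s], simp, rule singletonI)

lemma coords_B: "e \<in> arcs Q \<Longrightarrow> r < d (tail Q e) \<Longrightarrow> s < dhat (head Q e) \<Longrightarrow> (\<lambda>y. arrB y e $$ (r, s)) \<in> coords"
  unfolding coords_def by (rule UnI1, rule UnI1, rule UnI2, rule UN_I[of e], assumption, rule UN_I[of r], simp, rule UN_I[of s], simp, rule singletonI)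

lemma coords_I: "v \<in> verts Q \<Longrightarrow> r < d v \<Longrightarrow> s < f v \<Longrightarrow> (\<lambda>y. frI y v $$ (r, s)) \<in> coords"
  unfolding coords_def by (rule UnI1, rule UnI2, rule UN_I[of v], assumption, rule UN_I[of r], simp, rule UN_I[of s], simp, rule singletonI)

lemma coords_J: "v \<in> verts Q \<Longrightarrow> r < f v \<Longrightarrow> s < dhat v \<Longrightarrow> (\<lambda>y. frJ y v $$ (r, s)) \<in> coords"
  unfolding coords_def by (rule UnI2, rule UN_I[of v], assumption, rule UN_I[of r], simp, rule UN_I[of s], simp, rule singletonI)

lemma coords_polys: "\<xi> \<in> coords \<Longrightarrow> \<xi> \<in> polys"
  by (erule coords_cases) (simp_all add: polys.intros)

text \<open>
  The tuple with prescribed values of the coordinates.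
\<close>

definition mkrep :: "((('v, 'e) framed_tuple \<Rightarrow> complex) \<Rightarrow> complex) \<Rightarrow> ('v, 'e) framed_tuple" where
  "mkrep D =
     \<lparr>arrA = (\<lambda>e\<in>arcs Q. mat (d (head Q e)) (dhat (tail Q e)) (\<lambda>(r, s). D (\<lambda>y. arrA y e $$ (r, s)))),
      arrB = (\<lambda>e\<in>arcs Q. mat (d (tail Q e)) (dhat (head Q e)) (\<lambda>(r, s). D (\<lambda>y. arrB y e $$ (r, s)))),
      frI = (\<lambda>v\<in>verts Q. mat (d v) (f v) (\<lambda>(r, s). D (\<lambda>y. frI y v $$ (r, s)))),
      frJ = (\<lambda>v\<in>verts Q. mat (f v) (dhat v) (\<lambda>(r, s). D (\<lambda>y. frJ y v $$ (r, s))))\<rparr>"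

lemma mkrep_Rep: "mkrep D \<in> Rep"
  by (rule RepI) (simp_all add: mkrep_def)

lemma coord_mkrep: "\<xi> \<in> coords \<Longrightarrow> \<xi> (mkrep D) = D \<xi>"
  by (erule coords_cases) (simp_all add: mkrep_def)

lemma Rep_eqI:
  assumes "y \<in> Rep" "z \<in> Rep" "\<And>\<xi>. \<xi> \<in> coords \<Longrightarrow> \<xi> y = \<xi> z"
  shows "y = z"
proof (rule tuple_eqI[OF assms(1,2)])
  have mat: "M = N" if "M \<in> carrier_mat n m" "N \<in> carrier_mat n m"
    "\<And>r s. r < n \<Longrightarrow> s < m \<Longrightarrow> M $$ (r, s) = N $$ (r, s)" for M N :: "complex mat" and n m
    using that by (intro eq_matI) auto
  show "arrA y e = arrA z e" if "e \<in> arcs Q" for e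
    using assms(3)[OF coords_A[OF that]] by (rule mat[OF Rep_A[OF assms(1) that] Rep_A[OF assms(2) that]])
  show "arrB y e = arrB z e" if "e \<in> arcs Q" for e
    using assms(3)[OF coords_B[OF that]] by (rule mat[OF Rep_B[OF assms(1) that] Rep_B[OF assms(2) that]])
  show "frI y v = frI z v" if "v \<in> verts Q" for v
    using assms(3)[OF coords_I[OF that]] by (rule mat[OF Rep_I[OF assms(1) that] Rep_I[OF assms(2) that]])
  show "frJ y v = frJ z v" if "v \<in> verts Q" for v
    using assms(3)[OF coords_J[OF that]] by (rule mat[OF Rep_J[OF assms(1) that] Rep_J[OF assms(2) that]])
qed

lemma rep_add_Rep: "y \<in> Rep \<Longrightarrow> z \<in> Rep \<Longrightarrow> rep_add y z \<in> Rep"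
  by (rule RepI) (auto simp: rep_add_def Rep_A Rep_B Rep_I Rep_J intro!: add_carrier_mat)

lemma rep_smult_Rep: "y \<in> Rep \<Longrightarrow> rep_smult c y \<in> Rep"
  by (rule RepI) (auto simp: rep_smult_def Rep_A Rep_B Rep_I Rep_J)

lemma coord_add:
  assumes "\<xi> \<in> coords" "y \<in> Rep" "z \<in> Rep"
  shows "\<xi> (rep_add y z) = \<xi> y + \<xi> z"
  using assms(1) by (rule coords_cases)
    (use Rep_A[OF assms(3)] Rep_B[OF assms(3)] Rep_I[OF assms(3)] Rep_J[OF assms(3)] in \<open>force simp: rep_add_def\<close>)+

lemma coord_smult:
  assumes "\<xi> \<in> coords" "y \<in> Rep"
  shows "\<xi> (rep_smult c y) = c * \<xi> y"
  using assms(1) by (rule coords_cases)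
    (use Rep_A[OF assms(2)] Rep_B[OF assms(2)] Rep_I[OF assms(2)] Rep_J[OF assms(2)] in \<open>force simp: rep_smult_def\<close>)+

lemma polys_fun_algebra: "fun_algebra polys"
  unfolding fun_algebra_def by (auto intro: polys.intros)

section \<open>The action\<close>

lemma
  assumes "g \<in> GrpP" "v \<in> verts Q"
  shows GrpP_lieP: "g v \<in> lieP v" and GrpP_det: "det (g v) \<noteq> 0"
    and GrpP_carrier: "g v \<in> carrier_mat (d v) (d v)"
  using assms by (auto simp: GrpP_iff lieP_carrier)

lemma GrpP_inv_carrier:
  "g \<in> GrpP \<Longrightarrow> v \<in> verts Q \<Longrightarrow> induced_inv v (g v) \<in> carrier_mat (dhat v) (dhat v)"
  using induced_inv_carrier GrpP_lieP GrpP_det by blast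

lemma act_Rep:
  assumes "g \<in> GrpP" "y \<in> Rep"
  shows "act g y \<in> Rep"
proof (rule RepI)
  note c = GrpP_carrier[OF assms(1)] GrpP_inv_carrier[OF assms(1)] tail_head_verts
    Rep_A[OF assms(2)] Rep_B[OF assms(2)] Rep_I[OF assms(2)] Rep_J[OF assms(2)]
  show "arrA (act g y) e \<in> carrier_mat (d (head Q e)) (dhat (tail Q e))" if e: "e \<in> arcs Q" for e
    unfolding act_def using e c(1,2)[of "head Q e"] c(1,2)[of "tail Q e"] c(3-6)
    by (auto intro!: mult_carrier_mat)
  show "arrB (act g y) e \<in> carrier_mat (d (tail Q e)) (dhat (head Q e))" if e: "e \<in> arcs Q" for e
    unfolding act_def using e c(1,2)[of "head Q e"] c(1,2)[of "tail Q e"] c(3-6)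
    by (auto intro!: mult_carrier_mat)
  show "frI (act g y) v \<in> carrier_mat (d v) (f v)" if "v \<in> verts Q" for v
    using that mult_carrier_mat[OF c(1)[OF that] c(7)[OF that]] by (simp add: act_def)
  show "frJ (act g y) v \<in> carrier_mat (f v) (dhat v)" if "v \<in> verts Q" for v
    using that mult_carrier_mat[OF c(8)[OF that] c(2)[OF that]] by (simp add: act_def)
qed (simp_all only: act_def framed_tuple.simps restrict_extensional)

lemma induced_inv_gmul:
  assumes g: "g \<in> GrpP" and h: "h \<in> GrpP" and v: "v \<in> verts Q"
  shows "induced_inv v (g v * h v) = induced_inv v (h v) * induced_inv v (g v)"
proof -
  note gv = GrpP_lieP[OF g v] GrpP_det[OF g v] and hv = GrpP_lieP[OF h v] GrpP_det[OF h v]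
  note ig = induced_carrier[OF v gv(1)] induced_inv_carrier[OF v gv] induced_inv_right[OF v gv]
  note ih = induced_carrier[OF v hv(1)] induced_inv_carrier[OF v hv] induced_inv_right[OF v hv]
  have "induced v (g v) * induced v (h v) * (induced_inv v (h v) * induced_inv v (g v))
      = induced v (g v) * (induced v (h v) * induced_inv v (h v)) * induced_inv v (g v)"
    by (rule mult_assoc_middle[OF ig(1) ih(1) ih(2) ig(2)])
  then have "induced v (g v) * induced v (h v) * (induced_inv v (h v) * induced_inv v (g v)) = 1\<^sub>m (dhat v)"
    unfolding ih(3) right_mult_one_mat[OF ig(1)] ig(3) .
  then have "induced v (g v * h v) * (induced_inv v (h v) * induced_inv v (g v)) = 1\<^sub>m (dhat v)"
    unfolding induced_mult[OF v gv(1) hv(1)] .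
  then show ?thesis
    unfolding induced_inv_def[of v "g v * h v"]
    by (rule the_mat_inverse[OF induced_carrier[OF v lieP_mult[OF gv(1) hv(1)]] mult_carrier_mat[OF ih(2) ig(2)]])
qed

lemma conj_assoc:
  fixes g h M a b :: "complex mat"
  assumes "g \<in> carrier_mat n n" "h \<in> carrier_mat n n" "M \<in> carrier_mat n m" "a \<in> carrier_mat m m" "b \<in> carrier_mat m m"
  shows "g * (h * M * a) * b = g * h * M * (a * b)"
  by (simp only: mult_assoc_dim index_mult_mat(2,3) assms[THEN carrier_matD(1)] assms[THEN carrier_matD(2)])

lemma act_act:
  assumes g: "g \<in> GrpP" and h: "h \<in> GrpP" and y: "y \<in> Rep"
  shows "act g (act h y) = act (gmul g h) y"
proof (rule tuple_eqI)
  show "act g (act h y) \<in> Rep" "act (gmul g h) y \<in> Rep" by (intro act_Rep gmul_GrpP g h y)+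
  note c = GrpP_carrier[OF g] GrpP_carrier[OF h] GrpP_inv_carrier[OF g] GrpP_inv_carrier[OF h]
  show "arrA (act g (act h y)) e = arrA (act (gmul g h) y) e" if e: "e \<in> arcs Q" for e
    using e conj_assoc[OF c(1,2) Rep_A[OF y] c(4) c(3)]
    by (simp add: act_def gmul_def induced_inv_gmul[OF g h] tail_head_verts)
  show "arrB (act g (act h y)) e = arrB (act (gmul g h) y) e" if e: "e \<in> arcs Q" for e
    using e conj_assoc[OF c(1,2) Rep_B[OF y] c(4) c(3)]
    by (simp add: act_def gmul_def induced_inv_gmul[OF g h] tail_head_verts)
  show "frI (act g (act h y)) v = frI (act (gmul g h) y) v" if v: "v \<in> verts Q" for v
    using v assoc_mult_mat[OF c(1)[OF v] c(2)[OF v] Rep_I[OF y v]] by (simp add: act_def gmul_def)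
  show "frJ (act g (act h y)) v = frJ (act (gmul g h) y) v" if v: "v \<in> verts Q" for v
    using v assoc_mult_mat[OF Rep_J[OF y v] c(4)[OF v] c(3)[OF v]]
    by (simp add: act_def gmul_def induced_inv_gmul[OF g h v])
qed

lemma induced_inv_one: "v \<in> verts Q \<Longrightarrow> induced_inv v (1\<^sub>m (d v)) = 1\<^sub>m (dhat v)"
  unfolding induced_inv_def by (rule the_mat_inverse[of _ "dhat v"]) (simp_all add: induced_one)

lemma act_one:
  assumes y: "y \<in> Rep"
  shows "act gunit y = y"
proof (rule tuple_eqI[OF act_Rep[OF gunit_GrpP y] y])
  show "arrA (act gunit y) e = arrA y e" "arrB (act gunit y) e = arrB y e" if e: "e \<in> arcs Q" for e
    using e Rep_A[OF y e] Rep_B[OF y e] by (simp_all add: act_def gunit_def induced_inv_one)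
  show "frI (act gunit y) v = frI y v" "frJ (act gunit y) v = frJ y v" if v: "v \<in> verts Q" for v
    using v Rep_I[OF y v] Rep_J[OF y v] by (simp_all add: act_def gunit_def induced_inv_one)
qed

lemma act_ginv:
  assumes "g \<in> GrpP" "y \<in> Rep"
  shows "act (ginv g) (act g y) = y" "act g (act (ginv g) y) = y"
proof -
  show "act (ginv g) (act g y) = y"
    using act_act[OF ginv_GrpP[OF assms(1)] assms] gmul_ginv_left[OF assms(1)] act_one[OF assms(2)] by simp
  have "gmul g (ginv g) = gunit"
    using assms(1) unfolding GrpP_iff gmul_def ginv_def gunit_def by (auto simp: minv_lieP fun_eq_iff)
  then show "act g (act (ginv g) y) = y"
    using act_act[OF assms(1) ginv_GrpP[OF assms(1)] assms(2)] act_one[OF assms(2)] by simp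
qed

lemma orbit_act:
  assumes "g \<in> GrpP" "y \<in> Rep"
  shows "orbit (act g y) = orbit y"
proof
  have "act h (act g y) \<in> orbit y" if "h \<in> GrpP" for h
    unfolding orbit_def act_act[OF that assms] using gmul_GrpP[OF that assms(1)] by (rule imageI)
  then show "orbit (act g y) \<subseteq> orbit y" unfolding orbit_def[of "act g y"] by blast
  have "act h y \<in> orbit (act g y)" if "h \<in> GrpP" for h
  proof -
    have "act h y = act (gmul h (ginv g)) (act g y)"
      using act_act[OF that ginv_GrpP[OF assms(1)] act_Rep[OF assms]] act_ginv[OF assms] by simp
    then show ?thesis unfolding orbit_def[of "act g y"] using gmul_GrpP[OF that ginv_GrpP[OF assms(1)]] by (rule image_eqI)
  qed
  then show "orbit y \<subseteq> orbit (act g y)" unfolding orbit_def[of y] by blast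
qed

lemma orbit_eq_iff:
  assumes "y \<in> Rep" "z \<in> Rep"
  shows "orbit y = orbit z \<longleftrightarrow> (\<exists>g\<in>GrpP. z = act g y)"
proof
  assume "orbit y = orbit z"
  moreover have "z \<in> orbit z" unfolding orbit_def
    by (rule image_eqI[where x = gunit]) (simp_all only: act_one[OF assms(2)] gunit_GrpP)
  ultimately show "\<exists>g\<in>GrpP. z = act g y" unfolding orbit_def by blast
next
  assume "\<exists>g\<in>GrpP. z = act g y"
  then obtain g where "g \<in> GrpP" "z = act g y" by blast
  then show "orbit y = orbit z" using orbit_act[of g y] assms(1) by simp
qed

section \<open>Linear functions on the representation space\<close>

definition lin :: "(('v, 'e) framed_tuple \<Rightarrow> complex) \<Rightarrow> bool" where
  "lin L \<longleftrightarrow> (\<forall>y\<in>Rep. \<forall>z\<in>Rep. L (rep_add y z) = L y + L z) \<and> (\<forall>c. \<forall>y\<in>Rep. L (rep_smult c y) = c * L y)"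

lemma lin_coord: "\<xi> \<in> coords \<Longrightarrow> lin \<xi>"
  unfolding lin_def using coord_add coord_smult by blast

lemma lin_add: "lin L \<Longrightarrow> lin M \<Longrightarrow> lin (\<lambda>y. L y + M y)"
  unfolding lin_def by (simp add: algebra_simps)

lemma lin_diff: "lin L \<Longrightarrow> lin M \<Longrightarrow> lin (\<lambda>y. L y - M y)"
  unfolding lin_def by (simp add: algebra_simps)

lemma lin_cmult: "lin L \<Longrightarrow> lin (\<lambda>y. c * L y)"
  unfolding lin_def by (simp add: algebra_simps)

lemma lin_multc: "lin L \<Longrightarrow> lin (\<lambda>y. L y * c)"
  unfolding lin_def by (simp add: algebra_simps)

lemma lin_sum: "(\<And>i. i \<in> I \<Longrightarrow> lin (L i)) \<Longrightarrow> lin (\<lambda>y. \<Sum>i\<in>I. L i y)"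
  unfolding lin_def by (simp add: sum.distrib sum_distrib_left)

lemma lin_cong:
  assumes "lin L" "\<And>y. y \<in> Rep \<Longrightarrow> M y = L y"
  shows "lin M"
  using assms rep_add_Rep rep_smult_Rep unfolding lin_def by simp

lemma lin_block_mult:
  assumes "\<And>r s. r < n \<Longrightarrow> s < m \<Longrightarrow> lin (\<lambda>y. A y $$ (r, s))" "\<And>y. y \<in> Rep \<Longrightarrow> A y \<in> carrier_mat n m"
  shows "C \<in> carrier_mat m p \<Longrightarrow> r < n \<Longrightarrow> s < p \<Longrightarrow> lin (\<lambda>y. (A y * C) $$ (r, s))"
    and "C \<in> carrier_mat p n \<Longrightarrow> r < p \<Longrightarrow> s < m \<Longrightarrow> lin (\<lambda>y. (C * A y) $$ (r, s))"
proof -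
  assume C: "C \<in> carrier_mat m p" and rs: "r < n" "s < p"
  show "lin (\<lambda>y. (A y * C) $$ (r, s))"
  proof (rule lin_cong)
    show "lin (\<lambda>y. \<Sum>l<m. A y $$ (r, l) * C $$ (l, s))"
      using rs by (intro lin_sum lin_multc assms(1)) auto
  qed (rule mult_mat_entry[OF assms(2) C rs])
next
  assume C: "C \<in> carrier_mat p n" and rs: "r < p" "s < m"
  show "lin (\<lambda>y. (C * A y) $$ (r, s))"
  proof (rule lin_cong)
    show "lin (\<lambda>y. \<Sum>l<n. C $$ (r, l) * A y $$ (l, s))"
      using rs by (intro lin_sum lin_cmult assms(1)) auto
  qed (rule mult_mat_entry[OF C assms(2) rs])
qed

definition unit_rep :: "(('v, 'e) framed_tuple \<Rightarrow> complex) \<Rightarrow> ('v, 'e) framed_tuple" where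
  "unit_rep \<xi> = mkrep (\<lambda>\<eta>. if \<eta> = \<xi> then 1 else 0)"

lemma unit_rep_Rep: "unit_rep \<xi> \<in> Rep"
  unfolding unit_rep_def by (rule mkrep_Rep)

lemma lin_expansion:
  assumes L: "lin L" and y: "y \<in> Rep"
  shows "L y = (\<Sum>\<xi>\<in>coords. \<xi> y * L (unit_rep \<xi>))"
proof -
  have part: "L (mkrep (\<lambda>\<eta>. \<Sum>\<xi>\<in>J. \<xi> y * (if \<eta> = \<xi> then 1 else 0))) = (\<Sum>\<xi>\<in>J. \<xi> y * L (unit_rep \<xi>))"
    if "finite J" for J
    using that
  proof (induction J rule: finite_induct)
    case empty
    have "mkrep (\<lambda>\<eta>. 0) = rep_smult 0 (mkrep (\<lambda>\<eta>. 0))"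
      by (intro Rep_eqI rep_smult_Rep mkrep_Rep) (simp add: coord_smult mkrep_Rep coord_mkrep)
    then have "L (mkrep (\<lambda>\<eta>. 0)) = 0 * L (mkrep (\<lambda>\<eta>. 0))"
      using L mkrep_Rep unfolding lin_def by metis
    then show ?case by simp
  next
    case (insert \<zeta> J)
    let ?m = "mkrep (\<lambda>\<eta>. \<Sum>\<xi>\<in>J. \<xi> y * (if \<eta> = \<xi> then 1 else 0))"
    have "mkrep (\<lambda>\<eta>. \<Sum>\<xi>\<in>insert \<zeta> J. \<xi> y * (if \<eta> = \<xi> then 1 else 0)) = rep_add (rep_smult (\<zeta> y) (unit_rep \<zeta>)) ?m"
      using insert.hyps
      by (intro Rep_eqI rep_add_Rep rep_smult_Rep mkrep_Rep unit_rep_Rep)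
        (simp add: coord_add coord_smult mkrep_Rep coord_mkrep rep_smult_Rep unit_rep_Rep unit_rep_def)
    moreover have "L (rep_add (rep_smult (\<zeta> y) (unit_rep \<zeta>)) ?m) = \<zeta> y * L (unit_rep \<zeta>) + L ?m"
      using L mkrep_Rep unit_rep_Rep rep_smult_Rep unfolding lin_def by simp
    ultimately show ?case using insert.hyps insert.IH by simp
  qed
  have "mkrep (\<lambda>\<eta>. \<Sum>\<xi>\<in>coords. \<xi> y * (if \<eta> = \<xi> then 1 else 0)) = y"
  proof (rule Rep_eqI[OF mkrep_Rep y])
    fix \<eta> assume \<eta>: "\<eta> \<in> coords"
    have "(\<Sum>\<xi>\<in>coords. \<xi> y * (if \<eta> = \<xi> then 1 else 0)) = (\<Sum>\<xi>\<in>coords. if \<eta> = \<xi> then \<xi> y else 0)"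
      by (intro sum.cong) auto
    also have "\<dots> = \<eta> y" using finite_coords \<eta> by simp
    finally show "\<eta> (mkrep (\<lambda>\<eta>. \<Sum>\<xi>\<in>coords. \<xi> y * (if \<eta> = \<xi> then 1 else 0))) = \<eta> y"
      by (simp only: coord_mkrep[OF \<eta>])
  qed
  then show ?thesis using part[OF finite_coords] by simp
qed

section \<open>The differential of the moment map\<close>

lemma dmu_in_term:
  assumes "x \<in> Rep" "u \<in> Rep" "e \<in> arcs Q"
  shows "arrA x e * \<pi> (tail Q e) * arrB u e \<in> carrier_mat (d (head Q e)) (dhat (head Q e))"
    and "arrB x e * \<pi> (head Q e) * arrA u e \<in> carrier_mat (d (tail Q e)) (dhat (tail Q e))"
  using Rep_A[OF assms(1,3)] Rep_B[OF assms(2,3)] Rep_B[OF assms(1,3)] Rep_A[OF assms(2,3)]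
    \<pi>_carrier[OF tail_head_verts(1)[OF assms(3)]] \<pi>_carrier[OF tail_head_verts(2)[OF assms(3)]]
  by (blast intro: mult_carrier_mat)+

lemma dmu_framing_term:
  assumes "x \<in> Rep" "u \<in> Rep" "v \<in> verts Q"
  shows "frI x v * frJ u v \<in> carrier_mat (d v) (dhat v)"
  using Rep_I[OF assms(1,3)] Rep_J[OF assms(2,3)] by (rule mult_carrier_mat)

lemma
  assumes x: "x \<in> Rep" and u: "u \<in> Rep" and v: "v \<in> verts Q"
  shows dmu_carrier: "dmu x u v \<in> carrier_mat (d v) (dhat v)"
    and dmu_entry: "r < d v \<Longrightarrow> c < dhat v \<Longrightarrow> dmu x u v $$ (r, c) =
      (\<Sum>e\<in>in_arcs Q v. (arrA u e * \<pi> (tail Q e) * arrB x e) $$ (r, c) + (arrA x e * \<pi> (tail Q e) * arrB u e) $$ (r, c))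
      - (\<Sum>e\<in>out_arcs Q v. (arrB x e * \<pi> (head Q e) * arrA u e) $$ (r, c) + (arrB u e * \<pi> (head Q e) * arrA x e) $$ (r, c))
      + (frI u v * frJ x v) $$ (r, c) + (frI x v * frJ u v) $$ (r, c)"
proof -
  let ?a = "\<lambda>e. arrA u e * \<pi> (tail Q e) * arrB x e" and ?b = "\<lambda>e. arrA x e * \<pi> (tail Q e) * arrB u e"
  let ?c = "\<lambda>e. arrB x e * \<pi> (head Q e) * arrA u e" and ?f = "\<lambda>e. arrB u e * \<pi> (head Q e) * arrA x e"
  have "?a e \<in> carrier_mat (d v) (dhat v)" "?b e \<in> carrier_mat (d v) (dhat v)" if "e \<in> in_arcs Q v" for e
    using that dmu_in_term(1)[OF u x, of e] dmu_in_term(1)[OF x u, of e] unfolding in_arcs_def by (simp_all del: assoc_mult_mat)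
  note ab = this
  have "?c e \<in> carrier_mat (d v) (dhat v)" "?f e \<in> carrier_mat (d v) (dhat v)" if "e \<in> out_arcs Q v" for e
    using that dmu_in_term(2)[OF u x, of e] dmu_in_term(2)[OF x u, of e] unfolding out_arcs_def by (simp_all del: assoc_mult_mat)
  note cf = this
  have fin: "finite (in_arcs Q v)" "finite (out_arcs Q v)" by (auto simp: in_arcs_def out_arcs_def)
  define M where "M = mat_sum (d v) (dhat v) (\<lambda>e. ?a e + ?b e) (in_arcs Q v)"
  define N where "N = mat_sum (d v) (dhat v) (\<lambda>e. ?c e + ?f e) (out_arcs Q v)"
  have M: "M \<in> carrier_mat (d v) (dhat v)" unfolding M_def using ab by (intro finsum_mat_carrier fin add_carrier_mat) auto
  have N: "N \<in> carrier_mat (d v) (dhat v)" unfolding N_def using cf by (intro finsum_mat_carrier fin add_carrier_mat) auto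
  note ij = dmu_framing_term[OF u x v] dmu_framing_term[OF x u v]
  have eq: "dmu x u v = M - N + frI u v * frJ x v + frI x v * frJ u v"
    unfolding dmu_def M_def N_def using v by simp
  show "dmu x u v \<in> carrier_mat (d v) (dhat v)" unfolding eq using M N ij by auto
  assume rc: "r < d v" "c < dhat v"
  have "M $$ (r, c) = (\<Sum>e\<in>in_arcs Q v. (?a e + ?b e) $$ (r, c))"
    unfolding M_def using ab rc by (intro finsum_mat_entry fin add_carrier_mat) auto
  also have "\<dots> = (\<Sum>e\<in>in_arcs Q v. ?a e $$ (r, c) + ?b e $$ (r, c))"
    by (intro sum.cong refl index_add_mat(1)) (use ab[THEN carrier_matD(1)] ab[THEN carrier_matD(2)] rc in auto)
  finally have M': "M $$ (r, c) = (\<Sum>e\<in>in_arcs Q v. ?a e $$ (r, c) + ?b e $$ (r, c))" .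
  have "N $$ (r, c) = (\<Sum>e\<in>out_arcs Q v. (?c e + ?f e) $$ (r, c))"
    unfolding N_def using cf rc by (intro finsum_mat_entry fin add_carrier_mat) auto
  also have "\<dots> = (\<Sum>e\<in>out_arcs Q v. ?c e $$ (r, c) + ?f e $$ (r, c))"
    by (intro sum.cong refl index_add_mat(1)) (use cf[THEN carrier_matD(1)] cf[THEN carrier_matD(2)] rc in auto)
  finally have N': "N $$ (r, c) = (\<Sum>e\<in>out_arcs Q v. ?c e $$ (r, c) + ?f e $$ (r, c))" .
  have "(M - N + frI u v * frJ x v + frI x v * frJ u v) $$ (r, c)
      = M $$ (r, c) - N $$ (r, c) + (frI u v * frJ x v) $$ (r, c) + (frI x v * frJ u v) $$ (r, c)"
    using rc M N ij[THEN carrier_matD(1)] ij[THEN carrier_matD(2)] by (simp del: index_mult_mat(1))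
  then show "dmu x u v $$ (r, c) =
      (\<Sum>e\<in>in_arcs Q v. ?a e $$ (r, c) + ?b e $$ (r, c)) - (\<Sum>e\<in>out_arcs Q v. ?c e $$ (r, c) + ?f e $$ (r, c))
      + (frI u v * frJ x v) $$ (r, c) + (frI x v * frJ u v) $$ (r, c)"
    unfolding eq M' N' .
qed

lemma dmu_extensional: "dmu x u \<in> extensional (verts Q)"
  unfolding dmu_def by simp

lemma dmu_eqI:
  assumes "x \<in> Rep" "u \<in> Rep" "m \<in> dmu_target"
    "\<And>v r c. v \<in> verts Q \<Longrightarrow> r < d v \<Longrightarrow> c < dhat v \<Longrightarrow> dmu x u v $$ (r, c) = m v $$ (r, c)"
  shows "dmu x u = m"
proof (rule extensionalityI[OF dmu_extensional])
  show "m \<in> extensional (verts Q)" using assms(3) by (auto simp: dmu_target_def PiE_def)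
  fix v assume v: "v \<in> verts Q"
  have "m v \<in> carrier_mat (d v) (dhat v)" using assms(3) v by (auto simp: dmu_target_def)
  then show "dmu x u v = m v"
    using dmu_carrier[OF assms(1,2) v] assms(4)[OF v] by (intro eq_matI) auto
qed

lemma dmu_zero_target: "dmu_zero \<in> dmu_target"
  by (simp add: dmu_zero_def dmu_target_def)

lemma dmu_eq_zero_iff:
  assumes "x \<in> Rep" "u \<in> Rep"
  shows "dmu x u = dmu_zero \<longleftrightarrow> (\<forall>v\<in>verts Q. \<forall>r<d v. \<forall>c<dhat v. dmu x u v $$ (r, c) = 0)"
proof
  assume "dmu x u = dmu_zero"
  then show "\<forall>v\<in>verts Q. \<forall>r<d v. \<forall>c<dhat v. dmu x u v $$ (r, c) = 0" by (simp add: dmu_zero_def)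
next
  assume "\<forall>v\<in>verts Q. \<forall>r<d v. \<forall>c<dhat v. dmu x u v $$ (r, c) = 0"
  then show "dmu x u = dmu_zero"
    by (intro dmu_eqI[OF assms dmu_zero_target]) (simp add: dmu_zero_def)
qed

lemma dmu_lin:
  assumes x: "x \<in> Rep" and v: "v \<in> verts Q" and rc: "r < d v" "c < dhat v"
  shows "lin (\<lambda>u. dmu x u v $$ (r, c))"
proof (rule lin_cong)
  have A: "lin (\<lambda>u. arrA u e $$ (r, s))" if "e \<in> arcs Q" "r < d (head Q e)" "s < dhat (tail Q e)" for e r s
    using lin_coord[OF coords_A[OF that]] .
  have B: "lin (\<lambda>u. arrB u e $$ (r, s))" if "e \<in> arcs Q" "r < d (tail Q e)" "s < dhat (head Q e)" for e r s
    using lin_coord[OF coords_B[OF that]] .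
  have I: "lin (\<lambda>u. frI u v $$ (r, s))" if "r < d v" "s < f v" for r s
    using lin_coord[OF coords_I[OF v that]] .
  have J: "lin (\<lambda>u. frJ u v $$ (r, s))" if "r < f v" "s < dhat v" for r s
    using lin_coord[OF coords_J[OF v that]] .
  have inn: "lin (\<lambda>u. (arrA u e * \<pi> (tail Q e) * arrB x e) $$ (r, c) + (arrA x e * \<pi> (tail Q e) * arrB u e) $$ (r, c))"
    if "e \<in> in_arcs Q v" for e
  proof -
    have e: "e \<in> arcs Q" "head Q e = v" using that by auto
    note t = tail_head_verts(1)[OF e(1)]
    have "lin (\<lambda>u. (arrA u e * (\<pi> (tail Q e) * arrB x e)) $$ (r, c))"
      by (rule lin_block_mult(1)[of "d v" "dhat (tail Q e)" _ _ "dhat v"])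
        (use A[OF e(1)] Rep_A[OF _ e(1)] mult_carrier_mat[OF \<pi>_carrier[OF t] Rep_B[OF x e(1)]] e rc in simp_all)
    moreover have "lin (\<lambda>u. (arrA x e * \<pi> (tail Q e) * arrB u e) $$ (r, c))"
      by (rule lin_block_mult(2)[of "d (tail Q e)" "dhat v" _ _ "d v"])
        (use B[OF e(1)] Rep_B[OF _ e(1)] mult_carrier_mat[OF Rep_A[OF x e(1)] \<pi>_carrier[OF t]] e rc in simp_all)
    ultimately have "lin (\<lambda>u. (arrA u e * (\<pi> (tail Q e) * arrB x e)) $$ (r, c) + (arrA x e * \<pi> (tail Q e) * arrB u e) $$ (r, c))"
      by (rule lin_add)
    then show ?thesis
      by (rule lin_cong) (simp only: assoc_mult_mat[OF Rep_A[OF _ e(1)] \<pi>_carrier[OF t] Rep_B[OF x e(1)]])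
  qed
  have out: "lin (\<lambda>u. (arrB x e * \<pi> (head Q e) * arrA u e) $$ (r, c) + (arrB u e * \<pi> (head Q e) * arrA x e) $$ (r, c))"
    if "e \<in> out_arcs Q v" for e
  proof -
    have e: "e \<in> arcs Q" "tail Q e = v" using that by auto
    note h = tail_head_verts(2)[OF e(1)]
    have "lin (\<lambda>u. (arrB u e * (\<pi> (head Q e) * arrA x e)) $$ (r, c))"
      by (rule lin_block_mult(1)[of "d v" "dhat (head Q e)" _ _ "dhat v"])
        (use B[OF e(1)] Rep_B[OF _ e(1)] mult_carrier_mat[OF \<pi>_carrier[OF h] Rep_A[OF x e(1)]] e rc in simp_all)
    moreover have "lin (\<lambda>u. (arrB x e * \<pi> (head Q e) * arrA u e) $$ (r, c))"
      by (rule lin_block_mult(2)[of "d (head Q e)" "dhat v" _ _ "d v"])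
        (use A[OF e(1)] Rep_A[OF _ e(1)] mult_carrier_mat[OF Rep_B[OF x e(1)] \<pi>_carrier[OF h]] e rc in simp_all)
    ultimately have "lin (\<lambda>u. (arrB x e * \<pi> (head Q e) * arrA u e) $$ (r, c) + (arrB u e * (\<pi> (head Q e) * arrA x e)) $$ (r, c))"
      by (intro lin_add)
    then show ?thesis
      by (rule lin_cong) (simp only: assoc_mult_mat[OF Rep_B[OF _ e(1)] \<pi>_carrier[OF h] Rep_A[OF x e(1)]])
  qed
  show "lin (\<lambda>u. (\<Sum>e\<in>in_arcs Q v. (arrA u e * \<pi> (tail Q e) * arrB x e) $$ (r, c) + (arrA x e * \<pi> (tail Q e) * arrB u e) $$ (r, c))
      - (\<Sum>e\<in>out_arcs Q v. (arrB x e * \<pi> (head Q e) * arrA u e) $$ (r, c) + (arrB u e * \<pi> (head Q e) * arrA x e) $$ (r, c))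
      + (frI u v * frJ x v) $$ (r, c) + (frI x v * frJ u v) $$ (r, c))"
    by (intro lin_add lin_diff lin_sum inn out
        lin_block_mult(1)[OF I Rep_I[OF _ v] Rep_J[OF x v] rc] lin_block_mult(2)[OF J Rep_J[OF _ v] Rep_I[OF x v] rc])
qed (rule dmu_entry[OF x _ v rc])

lemma dmu_sym:
  assumes "x \<in> Rep" "u \<in> Rep" "v \<in> verts Q" "r < d v" "c < dhat v"
  shows "dmu x u v $$ (r, c) = dmu u x v $$ (r, c)"
  unfolding dmu_entry[OF assms] dmu_entry[OF assms(2,1) assms(3-5)]
  by (simp add: add.commute del: index_mult_mat)

text \<open>
  In coordinates, \<open>dmu\<close> is a finite family of bilinear forms with constant coefficients. This is
  the shape required by \<open>quadratic_fixed_point\<close>, and it shows that the moment map is polynomial.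
\<close>

lemma dmu_bilinear_expansion:
  assumes "x \<in> Rep" "u \<in> Rep" "v \<in> verts Q" "r < d v" "c < dhat v"
  shows "dmu x u v $$ (r, c) =
    (\<Sum>\<xi>\<in>coords. \<Sum>\<eta>\<in>coords. dmu (unit_rep \<xi>) (unit_rep \<eta>) v $$ (r, c) * \<xi> x * \<eta> u)"
proof -
  have 1: "dmu x (unit_rep \<eta>) v $$ (r, c) = (\<Sum>\<xi>\<in>coords. \<xi> x * dmu (unit_rep \<xi>) (unit_rep \<eta>) v $$ (r, c))" for \<eta>
    unfolding dmu_sym[OF assms(1) unit_rep_Rep assms(3-5)]
      lin_expansion[OF dmu_lin[OF unit_rep_Rep assms(3-5)] assms(1)] dmu_sym[OF unit_rep_Rep unit_rep_Rep assms(3-5), of \<eta>] ..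
  have "dmu x u v $$ (r, c) = (\<Sum>\<eta>\<in>coords. \<Sum>\<xi>\<in>coords. \<eta> u * (\<xi> x * dmu (unit_rep \<xi>) (unit_rep \<eta>) v $$ (r, c)))"
    unfolding lin_expansion[OF dmu_lin[OF assms(1,3-5)] assms(2)] 1 sum_distrib_left ..
  also have "\<dots> = (\<Sum>\<xi>\<in>coords. \<Sum>\<eta>\<in>coords. \<eta> u * (\<xi> x * dmu (unit_rep \<xi>) (unit_rep \<eta>) v $$ (r, c)))"
    by (rule sum.swap)
  finally show ?thesis by (simp add: mult_ac)
qed

section \<open>The moment map\<close>

text \<open>
  The moment map with its right factor \<open>\<pi> v\<close> removed (\<open>moment_map_\<iota>\<close>). This is the
  quadratic map of which \<open>dmu\<close> is the polarization.
\<close>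

definition mhat :: "('v, 'e) framed_tuple \<Rightarrow> 'v \<Rightarrow> complex mat" where
  "mhat y v = mat_sum (d v) (dhat v) (\<lambda>e. arrA y e * \<pi> (tail Q e) * arrB y e) (in_arcs Q v)
     - mat_sum (d v) (dhat v) (\<lambda>e. arrB y e * \<pi> (head Q e) * arrA y e) (out_arcs Q v)
     + frI y v * frJ y v"

lemma finite_in_out_arcs: "finite (in_arcs Q v)" "finite (out_arcs Q v)"
  by (auto simp: in_arcs_def out_arcs_def)

lemma mhat_term_in:
  assumes "y \<in> Rep"
  shows "\<forall>e\<in>in_arcs Q v. arrA y e * \<pi> (tail Q e) * arrB y e \<in> carrier_mat (d v) (dhat v)"
proof
  fix e assume "e \<in> in_arcs Q v"
  then have "e \<in> arcs Q" "head Q e = v" by auto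
  then show "arrA y e * \<pi> (tail Q e) * arrB y e \<in> carrier_mat (d v) (dhat v)"
    using dmu_in_term(1)[OF assms assms, of e] by (simp only:)
qed

lemma mhat_term_out:
  assumes "y \<in> Rep"
  shows "\<forall>e\<in>out_arcs Q v. arrB y e * \<pi> (head Q e) * arrA y e \<in> carrier_mat (d v) (dhat v)"
proof
  fix e assume "e \<in> out_arcs Q v"
  then have "e \<in> arcs Q" "tail Q e = v" by auto
  then show "arrB y e * \<pi> (head Q e) * arrA y e \<in> carrier_mat (d v) (dhat v)"
    using dmu_in_term(2)[OF assms assms, of e] by (simp only:)
qed

lemma mhat_carrier:
  assumes "y \<in> Rep" "v \<in> verts Q"
  shows "mhat y v \<in> carrier_mat (d v) (dhat v)"
  unfolding mhat_def
  by (intro add_carrier_mat dmu_framing_term[OF assms(1) assms])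

lemma mhat_entry:
  assumes y: "y \<in> Rep" and v: "v \<in> verts Q" and rc: "r < d v" "c < dhat v"
  shows "mhat y v $$ (r, c) =
    (\<Sum>e\<in>in_arcs Q v. (arrA y e * \<pi> (tail Q e) * arrB y e) $$ (r, c))
    - (\<Sum>e\<in>out_arcs Q v. (arrB y e * \<pi> (head Q e) * arrA y e) $$ (r, c))
    + (frI y v * frJ y v) $$ (r, c)"
  unfolding mhat_def
    minus_add_entry[OF finsum_mat_carrier[OF finite_in_out_arcs(1) mhat_term_in[OF y, of v]]
      finsum_mat_carrier[OF finite_in_out_arcs(2) mhat_term_out[OF y, of v]] dmu_framing_term[OF y y v] rc]
    finsum_mat_entry[OF finite_in_out_arcs(1) mhat_term_in[OF y, of v] rc]
    finsum_mat_entry[OF finite_in_out_arcs(2) mhat_term_out[OF y, of v] rc] ..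

lemma dmu_self:
  assumes y: "y \<in> Rep" and v: "v \<in> verts Q" and rc: "r < d v" "c < dhat v"
  shows "dmu y y v $$ (r, c) = 2 * mhat y v $$ (r, c)"
  unfolding dmu_entry[OF y y v rc] mhat_entry[OF y v rc] by (simp add: sum_distrib_left del: index_mult_mat)

lemma moment_map_\<iota>:
  assumes y: "y \<in> Rep" and v: "v \<in> verts Q"
  shows "mat_sum (d v) (d v) (\<lambda>e. arrA (\<iota> y) e * arrB (\<iota> y) e) (in_arcs Q v)
     - mat_sum (d v) (d v) (\<lambda>e. arrB (\<iota> y) e * arrA (\<iota> y) e) (out_arcs Q v)
     + frI (\<iota> y) v * frJ (\<iota> y) v = mhat y v * \<pi> v"
proof -
  let ?a = "\<lambda>e. arrA y e * \<pi> (tail Q e) * arrB y e" and ?b = "\<lambda>e. arrB y e * \<pi> (head Q e) * arrA y e"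
  note \<pi> = \<pi>_carrier[OF v]
  note ta = mhat_term_in[OF y, of v] and tb = mhat_term_out[OF y, of v]
  have "arrA (\<iota> y) e * arrB (\<iota> y) e = ?a e * \<pi> v" if "e \<in> in_arcs Q v" for e
  proof -
    have e: "e \<in> arcs Q" "head Q e = v" using that by auto
    note c = Rep_A[OF y e(1)] Rep_B[OF y e(1)] \<pi>_carrier[OF tail_head_verts(1)[OF e(1)]] \<pi>_carrier[OF tail_head_verts(2)[OF e(1)]]
    have "arrA y e * \<pi> (tail Q e) * (arrB y e * \<pi> (head Q e)) = ?a e * \<pi> (head Q e)"
      by (simp only: mult_assoc_dim index_mult_mat(2,3) c[THEN carrier_matD(1)] c[THEN carrier_matD(2)])
    then show ?thesis using e by (simp add: \<iota>_def del: assoc_mult_mat)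
  qed
  then have 1: "mat_sum (d v) (d v) (\<lambda>e. arrA (\<iota> y) e * arrB (\<iota> y) e) (in_arcs Q v)
      = mat_sum (d v) (d v) (\<lambda>e. ?a e * \<pi> v) (in_arcs Q v)"
    by (intro finsum_mat_cong finite_in_out_arcs ballI mult_carrier_mat[OF bspec[OF ta] \<pi>])
  have "arrB (\<iota> y) e * arrA (\<iota> y) e = ?b e * \<pi> v" if "e \<in> out_arcs Q v" for e
  proof -
    have e: "e \<in> arcs Q" "tail Q e = v" using that by auto
    note c = Rep_A[OF y e(1)] Rep_B[OF y e(1)] \<pi>_carrier[OF tail_head_verts(1)[OF e(1)]] \<pi>_carrier[OF tail_head_verts(2)[OF e(1)]]
    have "arrB y e * \<pi> (head Q e) * (arrA y e * \<pi> (tail Q e)) = ?b e * \<pi> (tail Q e)"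
      by (simp only: mult_assoc_dim index_mult_mat(2,3) c[THEN carrier_matD(1)] c[THEN carrier_matD(2)])
    then show ?thesis using e by (simp add: \<iota>_def del: assoc_mult_mat)
  qed
  then have 2: "mat_sum (d v) (d v) (\<lambda>e. arrB (\<iota> y) e * arrA (\<iota> y) e) (out_arcs Q v)
      = mat_sum (d v) (d v) (\<lambda>e. ?b e * \<pi> v) (out_arcs Q v)"
    by (intro finsum_mat_cong finite_in_out_arcs ballI mult_carrier_mat[OF bspec[OF tb] \<pi>])
  have 3: "frI (\<iota> y) v * frJ (\<iota> y) v = frI y v * frJ y v * \<pi> v"
    using v assoc_mult_mat[OF Rep_I[OF y v] Rep_J[OF y v] \<pi>] by (simp add: \<iota>_def del: assoc_mult_mat)
  note ca = finsum_mat_carrier[OF finite_in_out_arcs(1) ta]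
    and cb = finsum_mat_carrier[OF finite_in_out_arcs(2) tb] and cj = dmu_framing_term[OF y y v]
  show ?thesis
    unfolding 1 2 3 finsum_mat_mult_right[OF finite_in_out_arcs(1) ta \<pi>]
      finsum_mat_mult_right[OF finite_in_out_arcs(2) tb \<pi>]
      minus_mult_distrib_mat[OF ca cb \<pi>, symmetric] mhat_def
    by (rule add_mult_distrib_mat[symmetric, OF minus_carrier_mat[OF cb] cj \<pi>])
qed

text \<open>
  The factor \<open>\<pi> v\<close> can be cancelled since it has the right inverse \<open>\<rho> v\<close>; and the diagonal of \<open>dmu\<close>
  is twice \<open>mhat\<close>.
\<close>

lemma satisfies_moment_map_iff:
  assumes y: "y \<in> Rep"
  shows "satisfies_moment_map (\<iota> y) \<longleftrightarrow> (\<forall>v\<in>verts Q. mhat y v = 0\<^sub>m (d v) (dhat v))"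
    and "satisfies_moment_map (\<iota> y) \<longleftrightarrow> dmu y y = dmu_zero"
proof -
  have "mhat y v * \<pi> v = 0\<^sub>m (d v) (d v) \<longleftrightarrow> mhat y v = 0\<^sub>m (d v) (dhat v)" if v: "v \<in> verts Q" for v
  proof
    assume 0: "mhat y v * \<pi> v = 0\<^sub>m (d v) (d v)"
    have "mhat y v = mhat y v * (\<pi> v * \<rho> v)"
      unfolding \<rho>(2)[OF v] by (rule right_mult_one_mat[symmetric, OF mhat_carrier[OF y v]])
    also have "\<dots> = mhat y v * \<pi> v * \<rho> v"
      by (rule assoc_mult_mat[symmetric, OF mhat_carrier[OF y v] \<pi>_carrier[OF v] \<rho>(1)[OF v]])
    also have "\<dots> = 0\<^sub>m (d v) (dhat v)" unfolding 0 by (rule left_mult_zero_mat[OF \<rho>(1)[OF v]])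
    finally show "mhat y v = 0\<^sub>m (d v) (dhat v)" .
  next
    assume 0: "mhat y v = 0\<^sub>m (d v) (dhat v)"
    show "mhat y v * \<pi> v = 0\<^sub>m (d v) (d v)" unfolding 0 by (rule left_mult_zero_mat[OF \<pi>_carrier[OF v]])
  qed
  then show 1: "satisfies_moment_map (\<iota> y) \<longleftrightarrow> (\<forall>v\<in>verts Q. mhat y v = 0\<^sub>m (d v) (dhat v))"
    unfolding satisfies_moment_map_def by (simp only: moment_map_\<iota>[OF y] cong: ball_cong)
  have "mhat y v = 0\<^sub>m (d v) (dhat v) \<longleftrightarrow> (\<forall>r<d v. \<forall>c<dhat v. dmu y y v $$ (r, c) = 0)" if v: "v \<in> verts Q" for v
  proof
    assume "\<forall>r<d v. \<forall>c<dhat v. dmu y y v $$ (r, c) = 0"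
    then show "mhat y v = 0\<^sub>m (d v) (dhat v)"
      using mhat_carrier[OF y v] dmu_self[OF y v] by (intro eq_matI) auto
  qed (simp add: dmu_self[OF y v])
  then show "satisfies_moment_map (\<iota> y) \<longleftrightarrow> dmu y y = dmu_zero"
    unfolding 1 dmu_eq_zero_iff[OF y y] by blast
qed

section \<open>The infinitesimal action\<close>

lemma LieP_D:
  assumes "\<xi> \<in> LieP" "v \<in> verts Q"
  shows "\<xi> v \<in> lieP v" "\<xi> v \<in> carrier_mat (d v) (d v)" "induced v (\<xi> v) \<in> carrier_mat (dhat v) (dhat v)"
    "\<pi> v * \<xi> v = induced v (\<xi> v) * \<pi> v"
proof -
  show 1: "\<xi> v \<in> lieP v" using assms unfolding LieP_def by auto
  show "\<xi> v \<in> carrier_mat (d v) (d v)" by (rule lieP_carrier[OF 1])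
  show "induced v (\<xi> v) \<in> carrier_mat (dhat v) (dhat v)" by (rule induced_carrier[OF assms(2) 1])
  show "\<pi> v * \<xi> v = induced v (\<xi> v) * \<pi> v" by (rule \<pi>_mult[OF assms(2) 1])
qed

lemma jmap_Rep:
  assumes x: "x \<in> Rep" and \<xi>: "\<xi> \<in> LieP"
  shows "jmap x \<xi> \<in> Rep"
proof (rule RepI)
  note L = LieP_D[OF \<xi>]
  show "arrA (jmap x \<xi>) e \<in> carrier_mat (d (head Q e)) (dhat (tail Q e))" if e: "e \<in> arcs Q" for e
    using e minus_carrier_mat[OF mult_carrier_mat[OF Rep_A[OF x e] L(3)[OF tail_head_verts(1)[OF e]]]]
    by (simp add: jmap_def)
  show "arrB (jmap x \<xi>) e \<in> carrier_mat (d (tail Q e)) (dhat (head Q e))" if e: "e \<in> arcs Q" for e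
    using e minus_carrier_mat[OF mult_carrier_mat[OF Rep_B[OF x e] L(3)[OF tail_head_verts(2)[OF e]]]]
    by (simp add: jmap_def)
  show "frI (jmap x \<xi>) v \<in> carrier_mat (d v) (f v)" if v: "v \<in> verts Q" for v
    using v mult_carrier_mat[OF L(2)[OF v] Rep_I[OF x v]] by (simp add: jmap_def)
  show "frJ (jmap x \<xi>) v \<in> carrier_mat (f v) (dhat v)" if v: "v \<in> verts Q" for v
    using v uminus_carrier_mat[OF mult_carrier_mat[OF Rep_J[OF x v] L(3)[OF v]]] by (simp add: jmap_def)
qed (simp_all only: jmap_def framed_tuple.simps restrict_extensional)

text \<open>
  By the Leibniz rule, each summand \<open>M\<close> of \<open>mhat x v\<close> contributes \<open>\<xi> M - M \<xi>'\<close>, where \<open>\<xi>'\<close> is the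
  endomorphism induced by \<open>\<xi>\<close>. The sum is this expression for \<open>mhat x v\<close>, which vanishes.
\<close>

lemma dmu_jmap:
  assumes x: "x \<in> Rep" and m: "satisfies_moment_map (\<iota> x)" and \<xi>: "\<xi> \<in> LieP"
  shows "dmu x (jmap x \<xi>) = dmu_zero"
proof (rule dmu_eqI[OF x jmap_Rep[OF x \<xi>] dmu_zero_target])
  fix v r c assume v: "v \<in> verts Q" and rc: "r < d v" "c < dhat v"
  let ?a = "\<lambda>e. arrA x e * \<pi> (tail Q e) * arrB x e" and ?b = "\<lambda>e. arrB x e * \<pi> (head Q e) * arrA x e"
  let ?z = "\<xi> v" and ?h = "induced v (\<xi> v)"
  note L = LieP_D[OF \<xi>]
  note ta = mhat_term_in[OF x, of v] and tb = mhat_term_out[OF x, of v] and tj = dmu_framing_term[OF x x v]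
  define com where "com M = (?z * M) $$ (r, c) - (M * ?h) $$ (r, c)" for M
  have comI: "com M = (?z * M - M * ?h) $$ (r, c)" if "M \<in> carrier_mat (d v) (dhat v)" for M
    unfolding com_def using rc that L(2,3)[OF v] by (simp del: index_mult_mat(1))
  have "com M = (\<Sum>l<d v. ?z $$ (r, l) * M $$ (l, c)) - (\<Sum>l<dhat v. M $$ (r, l) * ?h $$ (l, c))"
    if "M \<in> carrier_mat (d v) (dhat v)" for M
    unfolding com_def mult_mat_entry[OF L(2)[OF v] that rc] mult_mat_entry[OF that L(3)[OF v] rc] ..
  note com_entry = this
  have 1: "(arrA (jmap x \<xi>) e * \<pi> (tail Q e) * arrB x e) $$ (r, c) + (arrA x e * \<pi> (tail Q e) * arrB (jmap x \<xi>) e) $$ (r, c)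
      = com (?a e)" if "e \<in> in_arcs Q v" for e
  proof -
    have e: "e \<in> arcs Q" "head Q e = v" using that by auto
    note t = tail_head_verts(1)[OF e(1)]
    have c1: "arrA (jmap x \<xi>) e * \<pi> (tail Q e) * arrB x e \<in> carrier_mat (d v) (dhat v)"
      "arrA x e * \<pi> (tail Q e) * arrB (jmap x \<xi>) e \<in> carrier_mat (d v) (dhat v)"
      using dmu_in_term(1)[OF jmap_Rep[OF x \<xi>] x e(1)] dmu_in_term(1)[OF x jmap_Rep[OF x \<xi>] e(1)] unfolding e(2) by blast+
    have "arrA (jmap x \<xi>) e * \<pi> (tail Q e) * arrB x e + arrA x e * \<pi> (tail Q e) * arrB (jmap x \<xi>) e
        = ?z * ?a e - ?a e * ?h"
      using commutator_product[OF L(2)[OF v] Rep_A[OF x e(1), unfolded e(2)] L(3)[OF t] \<pi>_carrier[OF t] L(2)[OF t]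
        Rep_B[OF x e(1), unfolded e(2)] L(3)[OF v] L(4)[OF t]] e
      by (simp add: jmap_def del: assoc_mult_mat)
    then have "(arrA (jmap x \<xi>) e * \<pi> (tail Q e) * arrB x e + arrA x e * \<pi> (tail Q e) * arrB (jmap x \<xi>) e) $$ (r, c)
        = com (?a e)" using comI ta that by (simp only:)
    then show ?thesis using c1[THEN carrier_matD(1)] c1[THEN carrier_matD(2)] rc by (simp only: index_add_mat)
  qed
  have 2: "(arrB x e * \<pi> (head Q e) * arrA (jmap x \<xi>) e) $$ (r, c) + (arrB (jmap x \<xi>) e * \<pi> (head Q e) * arrA x e) $$ (r, c)
      = com (?b e)" if "e \<in> out_arcs Q v" for e
  proof -
    have e: "e \<in> arcs Q" "tail Q e = v" using that by auto
    note h = tail_head_verts(2)[OF e(1)]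
    have c1: "arrB (jmap x \<xi>) e * \<pi> (head Q e) * arrA x e \<in> carrier_mat (d v) (dhat v)"
      "arrB x e * \<pi> (head Q e) * arrA (jmap x \<xi>) e \<in> carrier_mat (d v) (dhat v)"
      using dmu_in_term(2)[OF jmap_Rep[OF x \<xi>] x e(1)] dmu_in_term(2)[OF x jmap_Rep[OF x \<xi>] e(1)] unfolding e(2) by blast+
    have "arrB (jmap x \<xi>) e * \<pi> (head Q e) * arrA x e + arrB x e * \<pi> (head Q e) * arrA (jmap x \<xi>) e
        = ?z * ?b e - ?b e * ?h"
      using commutator_product[OF L(2)[OF v] Rep_B[OF x e(1), unfolded e(2)] L(3)[OF h] \<pi>_carrier[OF h] L(2)[OF h]
        Rep_A[OF x e(1), unfolded e(2)] L(3)[OF v] L(4)[OF h]] e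
      by (simp add: jmap_def del: assoc_mult_mat)
    then have "(arrB (jmap x \<xi>) e * \<pi> (head Q e) * arrA x e + arrB x e * \<pi> (head Q e) * arrA (jmap x \<xi>) e) $$ (r, c)
        = com (?b e)" using comI tb that by (simp only:)
    then show ?thesis using c1[THEN carrier_matD(1)] c1[THEN carrier_matD(2)] rc by (simp only: index_add_mat add.commute)
  qed
  have 3: "(frI (jmap x \<xi>) v * frJ x v) $$ (r, c) + (frI x v * frJ (jmap x \<xi>) v) $$ (r, c) = com (frI x v * frJ x v)"
  proof -
    note I = Rep_I[OF x v] and J = Rep_J[OF x v] and z = L(2)[OF v] and h = L(3)[OF v]
    have "frI (jmap x \<xi>) v * frJ x v = ?z * (frI x v * frJ x v)"
      using v assoc_mult_mat[OF z I J] by (simp add: jmap_def del: assoc_mult_mat)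
    moreover have "frI x v * frJ (jmap x \<xi>) v = - (frI x v * frJ x v * ?h)"
      using v I J h assoc_mult_mat[OF I J h] uminus_mult_right_mat[of "frI x v" "frJ x v * ?h"]
      by (simp add: jmap_def del: assoc_mult_mat)
    ultimately show ?thesis unfolding com_def using rc I h by (simp del: assoc_mult_mat index_mult_mat(1))
  qed
  have "dmu x (jmap x \<xi>) v $$ (r, c) = (\<Sum>e\<in>in_arcs Q v. com (?a e)) - (\<Sum>e\<in>out_arcs Q v. com (?b e)) + com (frI x v * frJ x v)"
    unfolding dmu_entry[OF x jmap_Rep[OF x \<xi>] v rc] using 1 2 3 by (simp del: index_mult_mat assoc_mult_mat)
  also have "\<dots> = com (mhat x v)"
  proof -
    note ent = mhat_entry[OF x v]
    have sa: "(\<Sum>e\<in>in_arcs Q v. com (?a e)) = (\<Sum>l<d v. ?z $$ (r, l) * (\<Sum>e\<in>in_arcs Q v. ?a e $$ (l, c)))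
        - (\<Sum>l<dhat v. (\<Sum>e\<in>in_arcs Q v. ?a e $$ (r, l)) * ?h $$ (l, c))"
      unfolding sum_distrib_left sum_distrib_right
      by (subst (1 2) sum.swap) (simp add: com_entry ta sum_subtractf del: index_mult_mat assoc_mult_mat)
    have sb: "(\<Sum>e\<in>out_arcs Q v. com (?b e)) = (\<Sum>l<d v. ?z $$ (r, l) * (\<Sum>e\<in>out_arcs Q v. ?b e $$ (l, c)))
        - (\<Sum>l<dhat v. (\<Sum>e\<in>out_arcs Q v. ?b e $$ (r, l)) * ?h $$ (l, c))"
      unfolding sum_distrib_left sum_distrib_right
      by (subst (1 2) sum.swap) (simp add: com_entry tb sum_subtractf del: index_mult_mat assoc_mult_mat)
    have "(\<Sum>l<d v. ?z $$ (r, l) * mhat x v $$ (l, c)) = (\<Sum>l<d v. ?z $$ (r, l) * (\<Sum>e\<in>in_arcs Q v. ?a e $$ (l, c)))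
        - (\<Sum>l<d v. ?z $$ (r, l) * (\<Sum>e\<in>out_arcs Q v. ?b e $$ (l, c))) + (\<Sum>l<d v. ?z $$ (r, l) * (frI x v * frJ x v) $$ (l, c))"
      unfolding sum_subtractf[symmetric] sum.distrib[symmetric] right_diff_distrib[symmetric] distrib_left[symmetric]
      by (intro sum.cong refl) (simp only: ent rc lessThan_iff)
    moreover have "(\<Sum>l<dhat v. mhat x v $$ (r, l) * ?h $$ (l, c)) = (\<Sum>l<dhat v. (\<Sum>e\<in>in_arcs Q v. ?a e $$ (r, l)) * ?h $$ (l, c))
        - (\<Sum>l<dhat v. (\<Sum>e\<in>out_arcs Q v. ?b e $$ (r, l)) * ?h $$ (l, c)) + (\<Sum>l<dhat v. (frI x v * frJ x v) $$ (r, l) * ?h $$ (l, c))"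
      unfolding sum_subtractf[symmetric] sum.distrib[symmetric] left_diff_distrib[symmetric] distrib_right[symmetric]
      by (intro sum.cong refl) (simp only: ent rc lessThan_iff)
    ultimately show ?thesis
      unfolding sa sb com_entry[OF mhat_carrier[OF x v]] com_entry[OF tj] by simp
  qed
  also have "\<dots> = 0"
  proof -
    have "mhat x v = 0\<^sub>m (d v) (dhat v)" using m v satisfies_moment_map_iff(1)[OF x] by blast
    then show ?thesis using com_entry[of "0\<^sub>m (d v) (dhat v)"] rc by simp
  qed
  also have "\<dots> = dmu_zero v $$ (r, c)" using v rc by (simp add: dmu_zero_def)
  finally show "dmu x (jmap x \<xi>) v $$ (r, c) = dmu_zero v $$ (r, c)" .
qed

section \<open>Stability\<close>

lemma \<iota>_A_vec:
  assumes "x \<in> Rep" "e \<in> arcs Q" "w \<in> carrier_vec (d (tail Q e))"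
  shows "arrA (\<iota> x) e *\<^sub>v w = arrA x e *\<^sub>v (\<pi> (tail Q e) *\<^sub>v w)"
  using assms(2) assoc_mult_mat_vec[OF Rep_A[OF assms(1,2)] \<pi>_carrier[OF tail_head_verts(1)[OF assms(2)]] assms(3)]
  by (simp add: \<iota>_def)

lemma \<iota>_B_vec:
  assumes "x \<in> Rep" "e \<in> arcs Q" "w \<in> carrier_vec (d (head Q e))"
  shows "arrB (\<iota> x) e *\<^sub>v w = arrB x e *\<^sub>v (\<pi> (head Q e) *\<^sub>v w)"
  using assms(2) assoc_mult_mat_vec[OF Rep_B[OF assms(1,2)] \<pi>_carrier[OF tail_head_verts(2)[OF assms(2)]] assms(3)]
  by (simp add: \<iota>_def)

lemma \<iota>_I: "frI (\<iota> x) = frI x"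
  by (simp add: \<iota>_def)

text \<open>
  Stability with the map \<open>\<iota>\<close> resolved: the arrows act through \<open>\<pi>\<close>.
\<close>

lemma stable_invariant_full:
  assumes x: "x \<in> Rep" and st: "stable (\<iota> x)"
    and sub: "\<And>v. v \<in> verts Q \<Longrightarrow> D' v \<subseteq> carrier_vec (d v)"
      "\<And>v. v \<in> verts Q \<Longrightarrow> 0\<^sub>v (d v) \<in> D' v"
      "\<And>v a b. v \<in> verts Q \<Longrightarrow> a \<in> D' v \<Longrightarrow> b \<in> D' v \<Longrightarrow> a + b \<in> D' v"
      "\<And>v c a. v \<in> verts Q \<Longrightarrow> a \<in> D' v \<Longrightarrow> c \<cdot>\<^sub>v a \<in> D' v"
    and I: "\<And>v w. v \<in> verts Q \<Longrightarrow> w \<in> carrier_vec (f v) \<Longrightarrow> frI x v *\<^sub>v w \<in> D' v"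
    and A: "\<And>e w. e \<in> arcs Q \<Longrightarrow> w \<in> D' (tail Q e) \<Longrightarrow> arrA x e *\<^sub>v (\<pi> (tail Q e) *\<^sub>v w) \<in> D' (head Q e)"
    and B: "\<And>e w. e \<in> arcs Q \<Longrightarrow> w \<in> D' (head Q e) \<Longrightarrow> arrB x e *\<^sub>v (\<pi> (head Q e) *\<^sub>v w) \<in> D' (tail Q e)"
    and v: "v \<in> verts Q"
  shows "D' v = carrier_vec (d v)"
proof -
  have 1: "\<forall>v\<in>verts Q. VectorSpace.subspace class_ring (D' v) (module_vec TYPE(complex) (d v))"
    using subspace_vecI sub by simp
  have 2: "\<forall>v\<in>verts Q. \<forall>w\<in>carrier_vec (f v). frI (\<iota> x) v *\<^sub>v w \<in> D' v"
    using I by (simp add: \<iota>_I)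
  have 3: "\<forall>e\<in>arcs Q. \<forall>w\<in>D' (tail Q e). arrA (\<iota> x) e *\<^sub>v w \<in> D' (head Q e)"
  proof (intro ballI)
    fix e w assume e: "e \<in> arcs Q" and w: "w \<in> D' (tail Q e)"
    then have "w \<in> carrier_vec (d (tail Q e))" using sub(1)[OF tail_head_verts(1)[OF e]] by blast
    then show "arrA (\<iota> x) e *\<^sub>v w \<in> D' (head Q e)" using \<iota>_A_vec[OF x e] A[OF e w] by simp
  qed
  have 4: "\<forall>e\<in>arcs Q. \<forall>w\<in>D' (head Q e). arrB (\<iota> x) e *\<^sub>v w \<in> D' (tail Q e)"
  proof (intro ballI)
    fix e w assume e: "e \<in> arcs Q" and w: "w \<in> D' (head Q e)"
    then have "w \<in> carrier_vec (d (head Q e))" using sub(1)[OF tail_head_verts(2)[OF e]] by blast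
    then show "arrB (\<iota> x) e *\<^sub>v w \<in> D' (tail Q e)" using \<iota>_B_vec[OF x e] B[OF e w] by simp
  qed
  show ?thesis using st 1 2 3 4 v unfolding stable_def by blast
qed

section \<open>Exactness at the ends\<close>

lemma add_eq_of_minus_eq:
  fixes A B M :: "complex mat"
  assumes "A - B = M" "A \<in> carrier_mat n m" "B \<in> carrier_mat n m"
  shows "A = M + B"
  using assms(2,3) unfolding assms(1)[symmetric] by (intro eq_matI) auto

text \<open>
  The relation determines the value of \<open>\<xi>\<close> on \<open>X (\<pi> w)\<close> from \<open>M\<close> and the value of \<open>z\<close> on \<open>w\<close>. So the
  set of vectors on which two solutions agree is carried along by the arrow \<open>X\<close>.
\<close>

lemma intertwine_step:
  assumes v: "v \<in> verts Q" and c: "\<xi> \<in> carrier_mat n n" "X \<in> carrier_mat n (dhat v)" "z \<in> lieP v" "M \<in> carrier_mat n (dhat v)"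
    "w \<in> carrier_vec (d v)" and eq: "\<xi> * X - X * induced v z = M"
  shows "\<xi> *\<^sub>v (X *\<^sub>v (\<pi> v *\<^sub>v w)) = M *\<^sub>v (\<pi> v *\<^sub>v w) + X *\<^sub>v (\<pi> v *\<^sub>v (z *\<^sub>v w))"
proof -
  note h = induced_carrier[OF v c(3)] and P = \<pi>_carrier[OF v] and z = lieP_carrier[OF c(3)]
  have p: "\<pi> v *\<^sub>v w \<in> carrier_vec (dhat v)" using P c(5) by (rule mult_mat_vec_carrier)
  have "\<xi> *\<^sub>v (X *\<^sub>v (\<pi> v *\<^sub>v w)) = (\<xi> * X) *\<^sub>v (\<pi> v *\<^sub>v w)"
    by (rule assoc_mult_mat_vec[symmetric, OF c(1,2) p])
  also have "\<xi> * X = M + X * induced v z"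
    by (rule add_eq_of_minus_eq[OF eq mult_carrier_mat[OF c(1,2)] mult_carrier_mat[OF c(2) h]])
  also have "(M + X * induced v z) *\<^sub>v (\<pi> v *\<^sub>v w) = M *\<^sub>v (\<pi> v *\<^sub>v w) + (X * induced v z) *\<^sub>v (\<pi> v *\<^sub>v w)"
    by (rule add_mult_distrib_mat_vec[OF c(4) mult_carrier_mat[OF c(2) h] p])
  also have "(X * induced v z) *\<^sub>v (\<pi> v *\<^sub>v w) = X *\<^sub>v (induced v z *\<^sub>v (\<pi> v *\<^sub>v w))"
    by (rule assoc_mult_mat_vec[OF c(2) h p])
  also have "induced v z *\<^sub>v (\<pi> v *\<^sub>v w) = (induced v z * \<pi> v) *\<^sub>v w"
    by (rule assoc_mult_mat_vec[symmetric, OF h P c(5)])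
  also have "\<dots> = \<pi> v *\<^sub>v (z *\<^sub>v w)"
    unfolding \<pi>_mult[OF v c(3), symmetric] by (rule assoc_mult_mat_vec[OF P z c(5)])
  finally show ?thesis .
qed

text \<open>
  The vectors on which two elements with the same image agree form an invariant family of
  subspaces that contains the image of the framing.
\<close>

lemma jmap_inj:
  assumes x: "x \<in> Rep" and st: "stable (\<iota> x)"
  shows "inj_on (jmap x) LieP"
proof (rule inj_onI)
  fix \<xi> \<zeta> assume \<xi>: "\<xi> \<in> LieP" and \<zeta>: "\<zeta> \<in> LieP" and eq: "jmap x \<xi> = jmap x \<zeta>"
  note L = LieP_D[OF \<xi>] and M = LieP_D[OF \<zeta>]
  define D' where "D' v = {w \<in> carrier_vec (d v). \<xi> v *\<^sub>v w = \<zeta> v *\<^sub>v w}" for v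
  have full: "D' v = carrier_vec (d v)" if v: "v \<in> verts Q" for v
  proof (rule stable_invariant_full[OF x st _ _ _ _ _ _ _ v])
    fix v assume v: "v \<in> verts Q"
    note c = L(2)[OF v] M(2)[OF v]
    show "D' v \<subseteq> carrier_vec (d v)" by (auto simp: D'_def)
    show "0\<^sub>v (d v) \<in> D' v" using c[THEN mult_mat_zero_vec] by (simp add: D'_def)
    show "a + b \<in> D' v" if "a \<in> D' v" "b \<in> D' v" for a b
      using that mult_add_distrib_mat_vec[OF c(1)] mult_add_distrib_mat_vec[OF c(2)] by (simp add: D'_def)
    show "t \<cdot>\<^sub>v a \<in> D' v" if "a \<in> D' v" for t a
      using that mult_mat_vec[OF c(1)] mult_mat_vec[OF c(2)] by (simp add: D'_def)
    fix w :: "complex vec" assume w: "w \<in> carrier_vec (f v)"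
    note I = Rep_I[OF x v]
    have "\<xi> v * frI x v = \<zeta> v * frI x v" using arg_cong[OF eq, of "\<lambda>y. frI y v"] v by (simp add: jmap_def)
    then have "\<xi> v *\<^sub>v (frI x v *\<^sub>v w) = \<zeta> v *\<^sub>v (frI x v *\<^sub>v w)"
      using assoc_mult_mat_vec[OF c(1) I w] assoc_mult_mat_vec[OF c(2) I w] by simp
    then show "frI x v *\<^sub>v w \<in> D' v" using mult_mat_vec_carrier[OF I w] by (simp add: D'_def)
  next
    fix e w assume e: "e \<in> arcs Q" and "w \<in> D' (tail Q e)"
    then have w: "w \<in> carrier_vec (d (tail Q e))" "\<xi> (tail Q e) *\<^sub>v w = \<zeta> (tail Q e) *\<^sub>v w" by (auto simp: D'_def)
    note t = tail_head_verts(1)[OF e] and h = tail_head_verts(2)[OF e] and X = Rep_A[OF x e]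
    let ?M = "arrA (jmap x \<zeta>) e"
    have Mc: "?M \<in> carrier_mat (d (head Q e)) (dhat (tail Q e))" by (rule Rep_A[OF jmap_Rep[OF x \<zeta>] e])
    have "\<xi> (head Q e) * arrA x e - arrA x e * induced (tail Q e) (\<xi> (tail Q e)) = ?M"
      unfolding eq[symmetric] using e by (simp add: jmap_def)
    moreover have "\<zeta> (head Q e) * arrA x e - arrA x e * induced (tail Q e) (\<zeta> (tail Q e)) = ?M"
      using e by (simp add: jmap_def)
    note E = calculation this
    show "arrA x e *\<^sub>v (\<pi> (tail Q e) *\<^sub>v w) \<in> D' (head Q e)"
      using intertwine_step[OF t L(2)[OF h] X L(1)[OF t] Mc w(1) E(1)]
        intertwine_step[OF t M(2)[OF h] X M(1)[OF t] Mc w(1) E(2)] w(2)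
        mult_mat_vec_carrier[OF X mult_mat_vec_carrier[OF \<pi>_carrier[OF t] w(1)]]
      by (simp add: D'_def)
  next
    fix e w assume e: "e \<in> arcs Q" and "w \<in> D' (head Q e)"
    then have w: "w \<in> carrier_vec (d (head Q e))" "\<xi> (head Q e) *\<^sub>v w = \<zeta> (head Q e) *\<^sub>v w" by (auto simp: D'_def)
    note t = tail_head_verts(1)[OF e] and h = tail_head_verts(2)[OF e] and X = Rep_B[OF x e]
    let ?M = "arrB (jmap x \<zeta>) e"
    have Mc: "?M \<in> carrier_mat (d (tail Q e)) (dhat (head Q e))" by (rule Rep_B[OF jmap_Rep[OF x \<zeta>] e])
    have "\<xi> (tail Q e) * arrB x e - arrB x e * induced (head Q e) (\<xi> (head Q e)) = ?M"
      unfolding eq[symmetric] using e by (simp add: jmap_def)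
    moreover have "\<zeta> (tail Q e) * arrB x e - arrB x e * induced (head Q e) (\<zeta> (head Q e)) = ?M"
      using e by (simp add: jmap_def)
    note E = calculation this
    show "arrB x e *\<^sub>v (\<pi> (head Q e) *\<^sub>v w) \<in> D' (tail Q e)"
      using intertwine_step[OF h L(2)[OF t] X L(1)[OF h] Mc w(1) E(1)]
        intertwine_step[OF h M(2)[OF t] X M(1)[OF h] Mc w(1) E(2)] w(2)
        mult_mat_vec_carrier[OF X mult_mat_vec_carrier[OF \<pi>_carrier[OF h] w(1)]]
      by (simp add: D'_def)
  qed
  have "\<xi> v = \<zeta> v" if v: "v \<in> verts Q" for v
    by (rule mat_eqI_of_vec[OF L(2)[OF v] M(2)[OF v]]) (use full[OF v] in \<open>auto simp: D'_def\<close>)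
  then show "\<xi> = \<zeta>"
    using \<xi> \<zeta> unfolding LieP_def PiE_def by (auto intro: extensionalityI[of _ "verts Q"])
qed

text \<open>
  The trace of \<open>\<zeta> * M\<close>.
\<close>

definition pairing :: "'v \<Rightarrow> complex mat \<Rightarrow> complex mat \<Rightarrow> complex" where
  "pairing v \<zeta> M = (\<Sum>r<d v. \<Sum>c<dhat v. \<zeta> $$ (c, r) * M $$ (r, c))"

definition rank_one :: "nat \<Rightarrow> nat \<Rightarrow> complex vec \<Rightarrow> nat \<Rightarrow> complex mat" where
  "rank_one n m p q = mat n m (\<lambda>(r, s). if s = q then p $ r else 0)"

text \<open>
  Pairing with matrices of rank one detects the vector \<open>\<zeta> (M p)\<close> entry by entry.
\<close>

lemma pairing_left:
  assumes \<zeta>: "\<zeta> \<in> carrier_mat (dhat v) (d v)" and M: "M \<in> carrier_mat (d v) n" and p: "p \<in> carrier_vec n" and q: "q < dhat v"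
  shows "pairing v \<zeta> (M * rank_one n (dhat v) p q) = (\<zeta> *\<^sub>v (M *\<^sub>v p)) $ q"
proof -
  have R: "rank_one n (dhat v) p q \<in> carrier_mat n (dhat v)" by (simp add: rank_one_def)
  have "(M * rank_one n (dhat v) p q) $$ (r, c) = (if c = q then (M *\<^sub>v p) $ r else 0)" if "r < d v" "c < dhat v" for r c
    unfolding mult_mat_entry[OF M R that] mult_mat_vec_entry[OF M p that(1)] using that by (simp add: rank_one_def)
  then have "pairing v \<zeta> (M * rank_one n (dhat v) p q) = (\<Sum>r<d v. \<Sum>c<dhat v. if c = q then \<zeta> $$ (c, r) * (M *\<^sub>v p) $ r else 0)"
    unfolding pairing_def by (intro sum.cong) (auto simp del: index_mult_mat index_mult_mat_vec)
  also have "\<dots> = (\<Sum>r<d v. \<zeta> $$ (q, r) * (M *\<^sub>v p) $ r)" using q by (simp del: index_mult_mat_vec)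
  also have "\<dots> = (\<zeta> *\<^sub>v (M *\<^sub>v p)) $ q"
    by (rule mult_mat_vec_entry[symmetric, OF \<zeta> mult_mat_vec_carrier[OF M p] q])
  finally show ?thesis .
qed

text \<open>
  By cyclicity of the trace the pairing is an entry of \<open>M * \<zeta>\<close> applied to \<open>p\<close>.
\<close>

lemma pairing_right:
  assumes \<zeta>: "\<zeta> \<in> carrier_mat (dhat v) (d v)" and M: "M \<in> carrier_mat n (dhat v)" and p: "p \<in> carrier_vec (d v)" and q: "q < n"
    and 0: "\<zeta> *\<^sub>v p = 0\<^sub>v (dhat v)"
  shows "pairing v \<zeta> (rank_one (d v) n p q * M) = 0"
proof -
  have R: "rank_one (d v) n p q \<in> carrier_mat (d v) n" by (simp add: rank_one_def)
  have "(rank_one (d v) n p q * M) $$ (r, c) = p $ r * M $$ (q, c)" if "r < d v" "c < dhat v" for r c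
  proof -
    have "(rank_one (d v) n p q * M) $$ (r, c) = (\<Sum>l<n. if l = q then p $ r * M $$ (l, c) else 0)"
      unfolding mult_mat_entry[OF R M that] using that by (intro sum.cong) (auto simp: rank_one_def)
    then show ?thesis using q by simp
  qed
  then have "pairing v \<zeta> (rank_one (d v) n p q * M) = (\<Sum>r<d v. \<Sum>c<dhat v. \<zeta> $$ (c, r) * (p $ r * M $$ (q, c)))"
    unfolding pairing_def by (intro sum.cong) (auto simp del: index_mult_mat index_mult_mat_vec)
  also have "\<dots> = (\<Sum>c<dhat v. \<Sum>r<d v. \<zeta> $$ (c, r) * (p $ r * M $$ (q, c)))" by (rule sum.swap)
  also have "\<dots> = (\<Sum>c<dhat v. (\<Sum>r<d v. \<zeta> $$ (c, r) * p $ r) * M $$ (q, c))"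
    unfolding sum_distrib_right by (simp add: mult.assoc)
  also have "\<dots> = (\<Sum>c<dhat v. (\<zeta> *\<^sub>v p) $ c * M $$ (q, c))"
    by (intro sum.cong refl) (simp only: mult_mat_vec_entry[OF \<zeta> p] lessThan_iff)
  also have "\<dots> = 0" unfolding 0 by simp
  finally show ?thesis .
qed

lemma pairing_zero: "M = 0\<^sub>m (d v) (dhat v) \<Longrightarrow> pairing v \<zeta> M = 0"
  by (simp add: pairing_def)

text \<open>
  The pairing of \<open>\<zeta>\<close> with \<open>dmu x u\<close>, with the terms sorted by arrows instead of by vertices. This
  isolates the contribution of each component of \<open>u\<close>.
\<close>

definition pair_dmu where
  "pair_dmu \<zeta> x u =
    (\<Sum>e\<in>arcs Q. pairing (head Q e) (\<zeta> (head Q e)) (arrA u e * \<pi> (tail Q e) * arrB x e)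
      + pairing (head Q e) (\<zeta> (head Q e)) (arrA x e * \<pi> (tail Q e) * arrB u e))
    - (\<Sum>e\<in>arcs Q. pairing (tail Q e) (\<zeta> (tail Q e)) (arrB x e * \<pi> (head Q e) * arrA u e)
      + pairing (tail Q e) (\<zeta> (tail Q e)) (arrB u e * \<pi> (head Q e) * arrA x e))
    + (\<Sum>v\<in>verts Q. pairing v (\<zeta> v) (frI u v * frJ x v) + pairing v (\<zeta> v) (frI x v * frJ u v))"

lemma pair_dmu:
  assumes x: "x \<in> Rep" and u: "u \<in> Rep"
  shows "(\<Sum>v\<in>verts Q. pairing v (\<zeta> v) (dmu x u v)) = pair_dmu \<zeta> x u"
proof -
  let ?a = "\<lambda>e. arrA u e * \<pi> (tail Q e) * arrB x e" and ?b = "\<lambda>e. arrA x e * \<pi> (tail Q e) * arrB u e"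
  let ?c = "\<lambda>e. arrB x e * \<pi> (head Q e) * arrA u e" and ?f = "\<lambda>e. arrB u e * \<pi> (head Q e) * arrA x e"
  have "pairing v (\<zeta> v) (dmu x u v) = (\<Sum>e\<in>in_arcs Q v. pairing v (\<zeta> v) (?a e) + pairing v (\<zeta> v) (?b e))
      - (\<Sum>e\<in>out_arcs Q v. pairing v (\<zeta> v) (?c e) + pairing v (\<zeta> v) (?f e))
      + (pairing v (\<zeta> v) (frI u v * frJ x v) + pairing v (\<zeta> v) (frI x v * frJ u v))" if v: "v \<in> verts Q" for v
  proof -
    have swap: "(\<Sum>e\<in>S. \<Sum>r<d v. \<Sum>c<dhat v. t e r c) = (\<Sum>r<d v. \<Sum>c<dhat v. \<Sum>e\<in>S. t e r c)"
      for S :: "'e set" and t :: "'e \<Rightarrow> nat \<Rightarrow> nat \<Rightarrow> complex"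
      by (subst sum.swap, intro sum.cong refl, rule sum.swap)
    have "pairing v (\<zeta> v) (dmu x u v) = (\<Sum>r<d v. \<Sum>c<dhat v. \<zeta> v $$ (c, r) *
      ((\<Sum>e\<in>in_arcs Q v. ?a e $$ (r, c) + ?b e $$ (r, c)) - (\<Sum>e\<in>out_arcs Q v. ?c e $$ (r, c) + ?f e $$ (r, c))
      + (frI u v * frJ x v) $$ (r, c) + (frI x v * frJ u v) $$ (r, c)))"
      unfolding pairing_def by (intro sum.cong refl) (simp only: dmu_entry[OF x u v] lessThan_iff)
    also have "\<dots> = (\<Sum>e\<in>in_arcs Q v. pairing v (\<zeta> v) (?a e) + pairing v (\<zeta> v) (?b e))
      - (\<Sum>e\<in>out_arcs Q v. pairing v (\<zeta> v) (?c e) + pairing v (\<zeta> v) (?f e))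
      + (pairing v (\<zeta> v) (frI u v * frJ x v) + pairing v (\<zeta> v) (frI x v * frJ u v))"
      unfolding pairing_def sum.distrib[symmetric] swap sum_subtractf[symmetric]
      by (intro sum.cong refl)
        (simp add: distrib_left right_diff_distrib sum_distrib_left sum.distrib del: index_mult_mat assoc_mult_mat)
    finally show ?thesis .
  qed
  then have "(\<Sum>v\<in>verts Q. pairing v (\<zeta> v) (dmu x u v)) =
      (\<Sum>v\<in>verts Q. \<Sum>e\<in>in_arcs Q v. pairing v (\<zeta> v) (?a e) + pairing v (\<zeta> v) (?b e))
      - (\<Sum>v\<in>verts Q. \<Sum>e\<in>out_arcs Q v. pairing v (\<zeta> v) (?c e) + pairing v (\<zeta> v) (?f e))
      + (\<Sum>v\<in>verts Q. pairing v (\<zeta> v) (frI u v * frJ x v) + pairing v (\<zeta> v) (frI x v * frJ u v))"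
    by (simp only: sum.distrib sum_subtractf cong: sum.cong)
  also have "(\<Sum>v\<in>verts Q. \<Sum>e\<in>in_arcs Q v. pairing v (\<zeta> v) (?a e) + pairing v (\<zeta> v) (?b e))
      = (\<Sum>e\<in>arcs Q. pairing (head Q e) (\<zeta> (head Q e)) (?a e) + pairing (head Q e) (\<zeta> (head Q e)) (?b e))"
    unfolding in_arcs_def by (rule sum_fibres) (use tail_head_verts in simp_all)
  also have "(\<Sum>v\<in>verts Q. \<Sum>e\<in>out_arcs Q v. pairing v (\<zeta> v) (?c e) + pairing v (\<zeta> v) (?f e))
      = (\<Sum>e\<in>arcs Q. pairing (tail Q e) (\<zeta> (tail Q e)) (?c e) + pairing (tail Q e) (\<zeta> (tail Q e)) (?f e))"
    unfolding out_arcs_def by (rule sum_fibres) (use tail_head_verts in simp_all)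
  finally show ?thesis unfolding pair_dmu_def .
qed

definition zero_rep :: "('v, 'e) framed_tuple" where
  "zero_rep = mkrep (\<lambda>_. 0)"

lemma zero_rep:
  "zero_rep \<in> Rep"
  "e \<in> arcs Q \<Longrightarrow> arrA zero_rep e = 0\<^sub>m (d (head Q e)) (dhat (tail Q e))"
  "e \<in> arcs Q \<Longrightarrow> arrB zero_rep e = 0\<^sub>m (d (tail Q e)) (dhat (head Q e))"
  "v \<in> verts Q \<Longrightarrow> frI zero_rep v = 0\<^sub>m (d v) (f v)"
  "v \<in> verts Q \<Longrightarrow> frJ zero_rep v = 0\<^sub>m (f v) (dhat v)"
  unfolding zero_rep_def by (rule mkrep_Rep) (auto simp: mkrep_def)

lemma zero_mult3:
  assumes "B \<in> carrier_mat m p" "C \<in> carrier_mat p q"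
  shows "0\<^sub>m n m * B * C = (0\<^sub>m n q :: complex mat)"
  unfolding left_mult_zero_mat[OF assms(1)] by (rule left_mult_zero_mat[OF assms(2)])

lemma mult3_zero:
  assumes "B \<in> carrier_mat n m" "C \<in> carrier_mat m p"
  shows "B * C * 0\<^sub>m p q = (0\<^sub>m n q :: complex mat)"
  by (rule right_mult_zero_mat[OF mult_carrier_mat[OF assms]])

lemma pairing_zero_arcs:
  assumes x: "x \<in> Rep" and e: "e \<in> arcs Q"
  shows "arrA u e = 0\<^sub>m (d (head Q e)) (dhat (tail Q e)) \<Longrightarrow>
      pairing (head Q e) \<zeta> (arrA u e * \<pi> (tail Q e) * arrB x e) = 0 \<and> pairing (tail Q e) \<zeta>' (arrB x e * \<pi> (head Q e) * arrA u e) = 0"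
    and "arrB u e = 0\<^sub>m (d (tail Q e)) (dhat (head Q e)) \<Longrightarrow>
      pairing (head Q e) \<zeta> (arrA x e * \<pi> (tail Q e) * arrB u e) = 0 \<and> pairing (tail Q e) \<zeta>' (arrB u e * \<pi> (head Q e) * arrA x e) = 0"
  using zero_mult3[OF \<pi>_carrier[OF tail_head_verts(1)[OF e]] Rep_B[OF x e]]
    mult3_zero[OF Rep_B[OF x e] \<pi>_carrier[OF tail_head_verts(2)[OF e]]]
    mult3_zero[OF Rep_A[OF x e] \<pi>_carrier[OF tail_head_verts(1)[OF e]]]
    zero_mult3[OF \<pi>_carrier[OF tail_head_verts(2)[OF e]] Rep_A[OF x e]]
  by (simp_all add: pairing_zero del: assoc_mult_mat)

lemma pairing_zero_verts:
  assumes x: "x \<in> Rep" and v: "v \<in> verts Q"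
  shows "frI u v = 0\<^sub>m (d v) (f v) \<Longrightarrow> pairing v \<zeta> (frI u v * frJ x v) = 0"
    and "frJ u v = 0\<^sub>m (f v) (dhat v) \<Longrightarrow> pairing v \<zeta> (frI x v * frJ u v) = 0"
  using left_mult_zero_mat[OF Rep_J[OF x v]] right_mult_zero_mat[OF Rep_I[OF x v]]
  by (simp_all add: pairing_zero)

lemma sum_single:
  fixes t :: "'a \<Rightarrow> complex"
  assumes "finite S" "a \<in> S" "\<And>b. b \<in> S \<Longrightarrow> b \<noteq> a \<Longrightarrow> t b = 0"
  shows "sum t S = t a"
  using assms by (simp add: sum.remove)

lemma pair_dmu_single_A:
  assumes x: "x \<in> Rep" and e: "e \<in> arcs Q" and E: "E \<in> carrier_mat (d (head Q e)) (dhat (tail Q e))"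
  defines "u \<equiv> zero_rep\<lparr>arrA := (\<lambda>a\<in>arcs Q. if a = e then E else arrA zero_rep a)\<rparr>"
  shows "u \<in> Rep"
    and "pair_dmu \<zeta> x u = pairing (head Q e) (\<zeta> (head Q e)) (E * \<pi> (tail Q e) * arrB x e)
      - pairing (tail Q e) (\<zeta> (tail Q e)) (arrB x e * \<pi> (head Q e) * E)"
proof -
  show "u \<in> Rep"
    by (rule RepI) (use zero_rep E in \<open>auto simp: u_def Rep_def PiE_def\<close>)
  have A: "arrA u a = (if a = e then E else 0\<^sub>m (d (head Q a)) (dhat (tail Q a)))"
    and B: "arrB u a = 0\<^sub>m (d (tail Q a)) (dhat (head Q a))" if "a \<in> arcs Q" for a
    using that zero_rep(2,3) by (simp_all add: u_def)
  have I: "frI u v = 0\<^sub>m (d v) (f v)" and J: "frJ u v = 0\<^sub>m (f v) (dhat v)" if "v \<in> verts Q" for v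
    using that zero_rep(4,5) by (simp_all add: u_def)
  have A': "arrA u a = 0\<^sub>m (d (head Q a)) (dhat (tail Q a))" if "a \<in> arcs Q" "a \<noteq> e" for a
    using A[OF that(1)] that(2) by simp
  note B0 = pairing_zero_arcs(2)[OF x _ B] and A0 = pairing_zero_arcs(1)[OF x _ A']
  have 1: "(\<Sum>a\<in>arcs Q. pairing (head Q a) (\<zeta> (head Q a)) (arrA u a * \<pi> (tail Q a) * arrB x a)
      + pairing (head Q a) (\<zeta> (head Q a)) (arrA x a * \<pi> (tail Q a) * arrB u a))
      = pairing (head Q e) (\<zeta> (head Q e)) (E * \<pi> (tail Q e) * arrB x e)"
    by (subst sum_single[OF finite_arcs e])
      (use e A[OF e] B0 A0 in \<open>simp_all del: assoc_mult_mat\<close>)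
  have 2: "(\<Sum>a\<in>arcs Q. pairing (tail Q a) (\<zeta> (tail Q a)) (arrB x a * \<pi> (head Q a) * arrA u a)
      + pairing (tail Q a) (\<zeta> (tail Q a)) (arrB u a * \<pi> (head Q a) * arrA x a))
      = pairing (tail Q e) (\<zeta> (tail Q e)) (arrB x e * \<pi> (head Q e) * E)"
    by (subst sum_single[OF finite_arcs e])
      (use e A[OF e] B0 A0 in \<open>simp_all del: assoc_mult_mat\<close>)
  have 3: "(\<Sum>v\<in>verts Q. pairing v (\<zeta> v) (frI u v * frJ x v) + pairing v (\<zeta> v) (frI x v * frJ u v)) = 0"
    using pairing_zero_verts(1)[OF x _ I] pairing_zero_verts(2)[OF x _ J] by simp
  show "pair_dmu \<zeta> x u = pairing (head Q e) (\<zeta> (head Q e)) (E * \<pi> (tail Q e) * arrB x e)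
      - pairing (tail Q e) (\<zeta> (tail Q e)) (arrB x e * \<pi> (head Q e) * E)"
    unfolding pair_dmu_def 1 2 3 by simp
qed

lemma pair_dmu_single_B:
  assumes x: "x \<in> Rep" and e: "e \<in> arcs Q" and E: "E \<in> carrier_mat (d (tail Q e)) (dhat (head Q e))"
  defines "u \<equiv> zero_rep\<lparr>arrB := (\<lambda>a\<in>arcs Q. if a = e then E else arrB zero_rep a)\<rparr>"
  shows "u \<in> Rep"
    and "pair_dmu \<zeta> x u = pairing (head Q e) (\<zeta> (head Q e)) (arrA x e * \<pi> (tail Q e) * E)
      - pairing (tail Q e) (\<zeta> (tail Q e)) (E * \<pi> (head Q e) * arrA x e)"
proof -
  show "u \<in> Rep"
    by (rule RepI) (use zero_rep E in \<open>auto simp: u_def Rep_def PiE_def\<close>)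
  have B: "arrB u a = (if a = e then E else 0\<^sub>m (d (tail Q a)) (dhat (head Q a)))"
    and A: "arrA u a = 0\<^sub>m (d (head Q a)) (dhat (tail Q a))" if "a \<in> arcs Q" for a
    using that zero_rep(2,3) by (simp_all add: u_def)
  have I: "frI u v = 0\<^sub>m (d v) (f v)" and J: "frJ u v = 0\<^sub>m (f v) (dhat v)" if "v \<in> verts Q" for v
    using that zero_rep(4,5) by (simp_all add: u_def)
  have B': "arrB u a = 0\<^sub>m (d (tail Q a)) (dhat (head Q a))" if "a \<in> arcs Q" "a \<noteq> e" for a
    using B[OF that(1)] that(2) by simp
  note A0 = pairing_zero_arcs(1)[OF x _ A] and B0 = pairing_zero_arcs(2)[OF x _ B']
  have 1: "(\<Sum>a\<in>arcs Q. pairing (head Q a) (\<zeta> (head Q a)) (arrA u a * \<pi> (tail Q a) * arrB x a)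
      + pairing (head Q a) (\<zeta> (head Q a)) (arrA x a * \<pi> (tail Q a) * arrB u a))
      = pairing (head Q e) (\<zeta> (head Q e)) (arrA x e * \<pi> (tail Q e) * E)"
    by (subst sum_single[OF finite_arcs e])
      (use e B[OF e] B0 A0 in \<open>simp_all del: assoc_mult_mat\<close>)
  have 2: "(\<Sum>a\<in>arcs Q. pairing (tail Q a) (\<zeta> (tail Q a)) (arrB x a * \<pi> (head Q a) * arrA u a)
      + pairing (tail Q a) (\<zeta> (tail Q a)) (arrB u a * \<pi> (head Q a) * arrA x a))
      = pairing (tail Q e) (\<zeta> (tail Q e)) (E * \<pi> (head Q e) * arrA x e)"
    by (subst sum_single[OF finite_arcs e])
      (use e B[OF e] B0 A0 in \<open>simp_all del: assoc_mult_mat\<close>)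
  have 3: "(\<Sum>v\<in>verts Q. pairing v (\<zeta> v) (frI u v * frJ x v) + pairing v (\<zeta> v) (frI x v * frJ u v)) = 0"
    using pairing_zero_verts(1)[OF x _ I] pairing_zero_verts(2)[OF x _ J] by simp
  show "pair_dmu \<zeta> x u = pairing (head Q e) (\<zeta> (head Q e)) (arrA x e * \<pi> (tail Q e) * E)
      - pairing (tail Q e) (\<zeta> (tail Q e)) (E * \<pi> (head Q e) * arrA x e)"
    unfolding pair_dmu_def 1 2 3 by simp
qed

lemma pair_dmu_single_J:
  assumes x: "x \<in> Rep" and v: "v \<in> verts Q" and E: "E \<in> carrier_mat (f v) (dhat v)"
  defines "u \<equiv> zero_rep\<lparr>frJ := (\<lambda>a\<in>verts Q. if a = v then E else frJ zero_rep a)\<rparr>"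
  shows "u \<in> Rep"
    and "pair_dmu \<zeta> x u = pairing v (\<zeta> v) (frI x v * E)"
proof -
  show "u \<in> Rep"
    by (rule RepI) (use zero_rep E in \<open>auto simp: u_def Rep_def PiE_def\<close>)
  have A: "arrA u a = 0\<^sub>m (d (head Q a)) (dhat (tail Q a))"
    and B: "arrB u a = 0\<^sub>m (d (tail Q a)) (dhat (head Q a))" if "a \<in> arcs Q" for a
    using that zero_rep(2,3) by (simp_all add: u_def)
  have I: "frI u a = 0\<^sub>m (d a) (f a)" and J: "frJ u a = (if a = v then E else 0\<^sub>m (f a) (dhat a))" if "a \<in> verts Q" for a
    using that zero_rep(4,5) by (simp_all add: u_def)
  have J': "frJ u a = 0\<^sub>m (f a) (dhat a)" if "a \<in> verts Q" "a \<noteq> v" for a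
    using J[OF that(1)] that(2) by simp
  note A0 = pairing_zero_arcs(1)[OF x _ A] and B0 = pairing_zero_arcs(2)[OF x _ B]
  have 1: "(\<Sum>a\<in>arcs Q. pairing (head Q a) (\<zeta> (head Q a)) (arrA u a * \<pi> (tail Q a) * arrB x a)
      + pairing (head Q a) (\<zeta> (head Q a)) (arrA x a * \<pi> (tail Q a) * arrB u a)) = 0"
    using A0 B0 by (simp del: assoc_mult_mat)
  have 2: "(\<Sum>a\<in>arcs Q. pairing (tail Q a) (\<zeta> (tail Q a)) (arrB x a * \<pi> (head Q a) * arrA u a)
      + pairing (tail Q a) (\<zeta> (tail Q a)) (arrB u a * \<pi> (head Q a) * arrA x a)) = 0"
    using A0 B0 by (simp del: assoc_mult_mat)
  have 3: "(\<Sum>a\<in>verts Q. pairing a (\<zeta> a) (frI u a * frJ x a) + pairing a (\<zeta> a) (frI x a * frJ u a))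
      = pairing v (\<zeta> v) (frI x v * E)"
    by (subst sum_single[OF finite_verts v])
      (use v J[OF v] pairing_zero_verts(1)[OF x _ I] pairing_zero_verts(2)[OF x _ J'] in \<open>simp_all del: assoc_mult_mat\<close>)
  show "pair_dmu \<zeta> x u = pairing v (\<zeta> v) (frI x v * E)"
    unfolding pair_dmu_def 1 2 3 by simp
qed

text \<open>
  The kernels of the \<open>\<zeta> v\<close> form an invariant family of subspaces that contains the image of the
  framing. To see that \<open>arrA x e\<close> preserves them, let \<open>w\<close> be in the kernel at the tail and let \<open>u\<close>
  have \<open>arrB u e\<close> of rank one with image spanned by \<open>w\<close> as its only component. The term of
  \<open>dmu x u\<close> at the tail is then orthogonal to \<open>\<zeta>\<close>, so the term at the head is orthogonal as well,
  and this says that \<open>arrA x e\<close> moves \<open>w\<close> into the kernel at the head.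
\<close>

lemma annihilator_of_dmu_trivial:
  assumes x: "x \<in> Rep" and st: "stable (\<iota> x)" and \<zeta>: "\<And>v. v \<in> verts Q \<Longrightarrow> \<zeta> v \<in> carrier_mat (dhat v) (d v)"
    and ann: "\<And>u. u \<in> Rep \<Longrightarrow> pair_dmu \<zeta> x u = 0" and v: "v \<in> verts Q"
  shows "\<zeta> v = 0\<^sub>m (dhat v) (d v)"
proof -
  define D' where "D' v = {w \<in> carrier_vec (d v). \<zeta> v *\<^sub>v w = 0\<^sub>v (dhat v)}" for v
  have vz: "a = 0\<^sub>v n" if "a \<in> carrier_vec n" "\<And>q. q < n \<Longrightarrow> a $ q = 0" for a :: "complex vec" and n
    using that by (intro eq_vecI) auto
  have "D' v = carrier_vec (d v)"
  proof (rule stable_invariant_full[OF x st _ _ _ _ _ _ _ v])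
    fix v assume v: "v \<in> verts Q"
    show "D' v \<subseteq> carrier_vec (d v)" by (auto simp: D'_def)
    show "0\<^sub>v (d v) \<in> D' v" using mult_mat_zero_vec[OF \<zeta>[OF v]] by (simp add: D'_def)
    show "a + b \<in> D' v" if "a \<in> D' v" "b \<in> D' v" for a b
      using that mult_add_distrib_mat_vec[OF \<zeta>[OF v]] by (simp add: D'_def)
    show "t \<cdot>\<^sub>v a \<in> D' v" if "a \<in> D' v" for t a
      using that mult_mat_vec[OF \<zeta>[OF v]] by (simp add: D'_def smult_zero_vec_complex)
    fix w :: "complex vec" assume w: "w \<in> carrier_vec (f v)"
    note I = Rep_I[OF x v]
    have "(\<zeta> v *\<^sub>v (frI x v *\<^sub>v w)) $ q = 0" if q: "q < dhat v" for q
    proof -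
      have R: "rank_one (f v) (dhat v) w q \<in> carrier_mat (f v) (dhat v)" by (simp add: rank_one_def)
      show ?thesis
        using ann[OF pair_dmu_single_J(1)[OF x v R]]
        unfolding pair_dmu_single_J(2)[OF x v R] pairing_left[OF \<zeta>[OF v] I w q] .
    qed
    then have "\<zeta> v *\<^sub>v (frI x v *\<^sub>v w) = 0\<^sub>v (dhat v)"
      using vz mult_mat_vec_carrier[OF \<zeta>[OF v] mult_mat_vec_carrier[OF I w]] by blast
    then show "frI x v *\<^sub>v w \<in> D' v" using mult_mat_vec_carrier[OF I w] by (simp add: D'_def)
  next
    fix e w assume e: "e \<in> arcs Q" and "w \<in> D' (tail Q e)"
    then have w: "w \<in> carrier_vec (d (tail Q e))" "\<zeta> (tail Q e) *\<^sub>v w = 0\<^sub>v (dhat (tail Q e))" by (auto simp: D'_def)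
    note t = tail_head_verts(1)[OF e] and h = tail_head_verts(2)[OF e] and X = Rep_A[OF x e]
    note Xp = mult_carrier_mat[OF X \<pi>_carrier[OF t]] and pX = mult_carrier_mat[OF \<pi>_carrier[OF h] X]
    have Xw: "arrA x e * \<pi> (tail Q e) *\<^sub>v w = arrA x e *\<^sub>v (\<pi> (tail Q e) *\<^sub>v w)"
      by (rule assoc_mult_mat_vec[OF X \<pi>_carrier[OF t] w(1)])
    have cX: "arrA x e *\<^sub>v (\<pi> (tail Q e) *\<^sub>v w) \<in> carrier_vec (d (head Q e))"
      unfolding Xw[symmetric] using Xp w(1) by (rule mult_mat_vec_carrier)
    have "(\<zeta> (head Q e) *\<^sub>v (arrA x e *\<^sub>v (\<pi> (tail Q e) *\<^sub>v w))) $ q = 0" if q: "q < dhat (head Q e)" for q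
    proof -
      have R: "rank_one (d (tail Q e)) (dhat (head Q e)) w q \<in> carrier_mat (d (tail Q e)) (dhat (head Q e))"
        by (simp add: rank_one_def)
      have "pairing (tail Q e) (\<zeta> (tail Q e)) (rank_one (d (tail Q e)) (dhat (head Q e)) w q * \<pi> (head Q e) * arrA x e) = 0"
        unfolding assoc_mult_mat[OF R \<pi>_carrier[OF h] X]
        by (rule pairing_right[OF \<zeta>[OF t] pX w(1) q w(2)])
      then show ?thesis
        using ann[OF pair_dmu_single_B(1)[OF x e R]]
        unfolding pair_dmu_single_B(2)[OF x e R] pairing_left[OF \<zeta>[OF h] Xp w(1) q] Xw by simp
    qed
    then have "\<zeta> (head Q e) *\<^sub>v (arrA x e *\<^sub>v (\<pi> (tail Q e) *\<^sub>v w)) = 0\<^sub>v (dhat (head Q e))"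
      using vz mult_mat_vec_carrier[OF \<zeta>[OF h] cX] by blast
    then show "arrA x e *\<^sub>v (\<pi> (tail Q e) *\<^sub>v w) \<in> D' (head Q e)" using cX by (simp add: D'_def)
  next
    fix e w assume e: "e \<in> arcs Q" and "w \<in> D' (head Q e)"
    then have w: "w \<in> carrier_vec (d (head Q e))" "\<zeta> (head Q e) *\<^sub>v w = 0\<^sub>v (dhat (head Q e))" by (auto simp: D'_def)
    note t = tail_head_verts(1)[OF e] and h = tail_head_verts(2)[OF e] and X = Rep_B[OF x e]
    note Xp = mult_carrier_mat[OF X \<pi>_carrier[OF h]] and pX = mult_carrier_mat[OF \<pi>_carrier[OF t] X]
    have Xw: "arrB x e * \<pi> (head Q e) *\<^sub>v w = arrB x e *\<^sub>v (\<pi> (head Q e) *\<^sub>v w)"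
      by (rule assoc_mult_mat_vec[OF X \<pi>_carrier[OF h] w(1)])
    have cX: "arrB x e *\<^sub>v (\<pi> (head Q e) *\<^sub>v w) \<in> carrier_vec (d (tail Q e))"
      unfolding Xw[symmetric] using Xp w(1) by (rule mult_mat_vec_carrier)
    have "(\<zeta> (tail Q e) *\<^sub>v (arrB x e *\<^sub>v (\<pi> (head Q e) *\<^sub>v w))) $ q = 0" if q: "q < dhat (tail Q e)" for q
    proof -
      have R: "rank_one (d (head Q e)) (dhat (tail Q e)) w q \<in> carrier_mat (d (head Q e)) (dhat (tail Q e))"
        by (simp add: rank_one_def)
      have "pairing (head Q e) (\<zeta> (head Q e)) (rank_one (d (head Q e)) (dhat (tail Q e)) w q * \<pi> (tail Q e) * arrB x e) = 0"
        unfolding assoc_mult_mat[OF R \<pi>_carrier[OF t] X]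
        by (rule pairing_right[OF \<zeta>[OF h] pX w(1) q w(2)])
      then show ?thesis
        using ann[OF pair_dmu_single_A(1)[OF x e R]]
        unfolding pair_dmu_single_A(2)[OF x e R] pairing_left[OF \<zeta>[OF t] Xp w(1) q] Xw by simp
    qed
    then have "\<zeta> (tail Q e) *\<^sub>v (arrB x e *\<^sub>v (\<pi> (head Q e) *\<^sub>v w)) = 0\<^sub>v (dhat (tail Q e))"
      using vz mult_mat_vec_carrier[OF \<zeta>[OF t] cX] by blast
    then show "arrB x e *\<^sub>v (\<pi> (head Q e) *\<^sub>v w) \<in> D' (tail Q e)" using cX by (simp add: D'_def)
  qed
  then show ?thesis
    by (intro mat_eqI_of_vec[OF \<zeta>[OF v] zero_carrier_mat]) (auto simp: D'_def zero_mat_mult_vec)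
qed

definition dmu_index :: "('v \<times> nat \<times> nat) set" where
  "dmu_index = (SIGMA v:verts Q. {..<d v} \<times> {..<dhat v})"

lemma finite_dmu_index: "finite dmu_index"
  unfolding dmu_index_def by auto

definition dmu_comp :: "('v, 'e) framed_tuple \<Rightarrow> ('v, 'e) framed_tuple \<Rightarrow> 'v \<times> nat \<times> nat \<Rightarrow> complex" where
  "dmu_comp x u = (\<lambda>(v, r, c). dmu x u v $$ (r, c))"

lemma dmu_comp_lin: "x \<in> Rep \<Longrightarrow> \<tau> \<in> dmu_index \<Longrightarrow> lin (\<lambda>u. dmu_comp x u \<tau>)"
  by (auto simp: dmu_comp_def dmu_index_def dmu_lin)

text \<open>
  The image is a subspace, and by \<open>annihilator_of_dmu_trivial\<close> its annihilator is zero.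
\<close>

lemma dmu_comp_surj:
  assumes x: "x \<in> Rep" and st: "stable (\<iota> x)"
  shows "\<exists>u\<in>Rep. \<forall>\<tau>\<in>dmu_index. dmu_comp x u \<tau> = b \<tau>"
proof -
  define S where "S = {s. \<exists>u\<in>Rep. \<forall>\<tau>\<in>dmu_index. s \<tau> = dmu_comp x u \<tau>}"
  note lin = dmu_comp_lin[OF x, unfolded lin_def]
  have "\<exists>s\<in>S. \<forall>\<tau>\<in>dmu_index. s \<tau> = b \<tau>"
  proof (rule full_if_annihilator_trivial[OF finite_dmu_index])
    have "\<forall>\<tau>\<in>dmu_index. 0 = dmu_comp x (rep_smult 0 zero_rep) \<tau>" using lin zero_rep(1) by simp
    then show "(\<lambda>_. 0) \<in> S" unfolding S_def using rep_smult_Rep[OF zero_rep(1)] by blast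
    show "(\<lambda>\<tau>. a \<tau> + b \<tau>) \<in> S" if "a \<in> S" "b \<in> S" for a b
    proof -
      obtain u where u: "u \<in> Rep" "\<forall>\<tau>\<in>dmu_index. a \<tau> = dmu_comp x u \<tau>" using \<open>a \<in> S\<close> unfolding S_def by blast
      obtain w where w: "w \<in> Rep" "\<forall>\<tau>\<in>dmu_index. b \<tau> = dmu_comp x w \<tau>" using \<open>b \<in> S\<close> unfolding S_def by blast
      from u w have "\<forall>\<tau>\<in>dmu_index. a \<tau> + b \<tau> = dmu_comp x (rep_add u w) \<tau>" "rep_add u w \<in> Rep"
        using lin rep_add_Rep by simp_all
      then show ?thesis unfolding S_def by blast
    qed
    show "(\<lambda>\<tau>. c * a \<tau>) \<in> S" if "a \<in> S" for c a
    proof -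
      obtain u where "u \<in> Rep" "\<forall>\<tau>\<in>dmu_index. a \<tau> = dmu_comp x u \<tau>" using \<open>a \<in> S\<close> unfolding S_def by blast
      then have "\<forall>\<tau>\<in>dmu_index. c * a \<tau> = dmu_comp x (rep_smult c u) \<tau>" "rep_smult c u \<in> Rep"
        using lin rep_smult_Rep by simp_all
      then show ?thesis unfolding S_def by blast
    qed
    fix l assume l: "\<And>s. s \<in> S \<Longrightarrow> (\<Sum>\<tau>\<in>dmu_index. l \<tau> * s \<tau>) = 0"
    define \<zeta> where "\<zeta> v = mat (dhat v) (d v) (\<lambda>(c, r). l (v, r, c))" for v
    have ann: "pair_dmu \<zeta> x u = 0" if u: "u \<in> Rep" for u
    proof -
      have "dmu_comp x u \<in> S" unfolding S_def using u by blast
      then have "0 = (\<Sum>\<tau>\<in>dmu_index. l \<tau> * dmu_comp x u \<tau>)" using l by simp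
      also have "\<dots> = (\<Sum>v\<in>verts Q. \<Sum>(r, c)\<in>{..<d v} \<times> {..<dhat v}. l (v, r, c) * dmu x u v $$ (r, c))"
        unfolding dmu_index_def by (subst sum.Sigma) (auto simp: dmu_comp_def split_def)
      also have "\<dots> = (\<Sum>v\<in>verts Q. pairing v (\<zeta> v) (dmu x u v))"
        unfolding sum.cartesian_product[symmetric] pairing_def by (intro sum.cong) (auto simp: \<zeta>_def)
      finally show ?thesis unfolding pair_dmu[OF x u] ..
    qed
    have "\<zeta> v = 0\<^sub>m (dhat v) (d v)" if "v \<in> verts Q" for v
      by (rule annihilator_of_dmu_trivial[OF x st _ ann that]) (simp_all add: \<zeta>_def)
    then have "\<zeta> v $$ (c, r) = 0" if "v \<in> verts Q" "r < d v" "c < dhat v" for v r c using that by simp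
    then show "\<forall>\<tau>\<in>dmu_index. l \<tau> = 0" by (auto simp: dmu_index_def \<zeta>_def)
  qed
  then obtain s where s: "s \<in> S" "\<forall>\<tau>\<in>dmu_index. s \<tau> = b \<tau>" by blast
  then obtain u where "u \<in> Rep" "\<forall>\<tau>\<in>dmu_index. s \<tau> = dmu_comp x u \<tau>" unfolding S_def by blast
  then show ?thesis using s(2) by (intro bexI[of _ u]) auto
qed

lemma dmu_surj:
  assumes x: "x \<in> Rep" and st: "stable (\<iota> x)"
  shows "dmu x ` Rep = dmu_target"
proof
  show "dmu x ` Rep \<subseteq> dmu_target"
    using dmu_carrier[OF x] by (force simp: dmu_target_def PiE_iff extensional_def dmu_def)
  show "dmu_target \<subseteq> dmu x ` Rep"
  proof
    fix m assume m: "m \<in> dmu_target"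
    obtain u where u: "u \<in> Rep" "\<forall>\<tau>\<in>dmu_index. dmu_comp x u \<tau> = (\<lambda>(v, r, c). m v $$ (r, c)) \<tau>"
      using dmu_comp_surj[OF x st] by blast
    have "dmu x u = m"
      using u(2) by (intro dmu_eqI[OF x u(1) m]) (auto simp: dmu_index_def dmu_comp_def)
    then show "m \<in> dmu x ` Rep" using u(1) by blast
  qed
qed

section \<open>Covariants\<close>

text \<open>
  Vector-valued functions of the tuple, built from framing vectors by arrows and linear
  combinations. They are polynomial and equivariant, and their values at \<open>y\<close> form the smallest
  invariant family of subspaces that contains the image of the framing.
\<close>

inductive Cov :: "'v \<Rightarrow> (('v, 'e) framed_tuple \<Rightarrow> complex vec) \<Rightarrow> bool" where
  frame: "v \<in> verts Q \<Longrightarrow> w \<in> carrier_vec (f v) \<Longrightarrow> Cov v (\<lambda>y. frI y v *\<^sub>v w)"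
| along: "e \<in> arcs Q \<Longrightarrow> Cov (tail Q e) F \<Longrightarrow> Cov (head Q e) (\<lambda>y. arrA y e *\<^sub>v (\<pi> (tail Q e) *\<^sub>v F y))"
| against: "e \<in> arcs Q \<Longrightarrow> Cov (head Q e) F \<Longrightarrow> Cov (tail Q e) (\<lambda>y. arrB y e *\<^sub>v (\<pi> (head Q e) *\<^sub>v F y))"
| zero: "v \<in> verts Q \<Longrightarrow> Cov v (\<lambda>y. 0\<^sub>v (d v))"
| add: "Cov v F \<Longrightarrow> Cov v G \<Longrightarrow> Cov v (\<lambda>y. F y + G y)"
| smult: "Cov v F \<Longrightarrow> Cov v (\<lambda>y. c \<cdot>\<^sub>v F y)"

lemma Cov_carrier: "Cov v F \<Longrightarrow> y \<in> Rep \<Longrightarrow> F y \<in> carrier_vec (d v)"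
proof (induction rule: Cov.induct)
  case (frame v w)
  then show ?case using mult_mat_vec_carrier[OF Rep_I] by blast
next
  case (along e F)
  then show ?case
    using mult_mat_vec_carrier[OF Rep_A mult_mat_vec_carrier[OF \<pi>_carrier[OF tail_head_verts(1)]]] by blast
next
  case (against e F)
  then show ?case
    using mult_mat_vec_carrier[OF Rep_B mult_mat_vec_carrier[OF \<pi>_carrier[OF tail_head_verts(2)]]] by blast
qed simp_all

lemma Cov_verts: "Cov v F \<Longrightarrow> v \<in> verts Q"
  by (induction rule: Cov.induct) simp_all

text \<open>
  Functions that agree with a polynomial on \<open>Rep\<close>. Elsewhere the sizes of the matrices are not under
  control, and the entries of a product are not the expected sums.
\<close>

definition Rep_polys :: "(('v, 'e) framed_tuple \<Rightarrow> complex) set" where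
  "Rep_polys = {h. \<exists>p\<in>polys. \<forall>y\<in>Rep. h y = p y}"

lemma Rep_polys_algebra: "fun_algebra Rep_polys"
proof -
  note P = fun_algebra_const[OF polys_fun_algebra] fun_algebra_add[OF polys_fun_algebra] fun_algebra_mult[OF polys_fun_algebra]
  have "(\<lambda>_. c) \<in> Rep_polys" for c unfolding Rep_polys_def by (intro CollectI bexI[OF _ P(1)[of c]]) simp
  moreover have "(\<lambda>y. h y + h' y) \<in> Rep_polys \<and> (\<lambda>y. h y * h' y) \<in> Rep_polys" if "h \<in> Rep_polys" "h' \<in> Rep_polys" for h h'
  proof -
    obtain p q where pq: "p \<in> polys" "\<forall>y\<in>Rep. h y = p y" "q \<in> polys" "\<forall>y\<in>Rep. h' y = q y"
      using \<open>h \<in> Rep_polys\<close> \<open>h' \<in> Rep_polys\<close> unfolding Rep_polys_def by blast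
    have "\<forall>y\<in>Rep. h y + h' y = p y + q y" "\<forall>y\<in>Rep. h y * h' y = p y * q y" using pq by simp_all
    then show ?thesis
      unfolding Rep_polys_def by (intro conjI CollectI bexI[OF _ P(2)[OF pq(1,3)]] bexI[OF _ P(3)[OF pq(1,3)]])
  qed
  ultimately show ?thesis unfolding fun_algebra_def by blast
qed

lemma Rep_polys_coord: "\<xi> \<in> coords \<Longrightarrow> \<xi> \<in> Rep_polys"
  unfolding Rep_polys_def using coords_polys by blast

lemma Rep_polys_cong: "h \<in> Rep_polys \<Longrightarrow> (\<And>y. y \<in> Rep \<Longrightarrow> h' y = h y) \<Longrightarrow> h' \<in> Rep_polys"
  unfolding Rep_polys_def by auto

lemma Rep_polys_mult_mat_vec:
  assumes M: "\<And>y. y \<in> Rep \<Longrightarrow> M y \<in> carrier_mat n m" and F: "\<And>y. y \<in> Rep \<Longrightarrow> F y \<in> carrier_vec m"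
    and "\<And>r s. r < n \<Longrightarrow> s < m \<Longrightarrow> (\<lambda>y. M y $$ (r, s)) \<in> Rep_polys" "\<And>s. s < m \<Longrightarrow> (\<lambda>y. F y $ s) \<in> Rep_polys" and r: "r < n"
  shows "(\<lambda>y. (M y *\<^sub>v F y) $ r) \<in> Rep_polys"
proof (rule Rep_polys_cong)
  show "(\<lambda>y. \<Sum>l<m. M y $$ (r, l) * F y $ l) \<in> Rep_polys"
    using r by (intro fun_algebra_sum fun_algebra_mult Rep_polys_algebra assms(3,4)) auto
qed (rule mult_mat_vec_entry[OF M F r])

lemma Cov_Rep_polys: "Cov v F \<Longrightarrow> r < d v \<Longrightarrow> (\<lambda>y. F y $ r) \<in> Rep_polys"
proof (induction arbitrary: r rule: Cov.induct)
  case (frame v w)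
  show ?case
    by (rule Rep_polys_mult_mat_vec[OF Rep_I[OF _ frame(1)] frame(2)])
      (use frame Rep_polys_coord coords_I fun_algebra_const[OF Rep_polys_algebra] in auto)
next
  case (along e F)
  note t = tail_head_verts(1)[OF along(1)]
  have pF: "(\<lambda>y. (\<pi> (tail Q e) *\<^sub>v F y) $ s) \<in> Rep_polys" if "s < dhat (tail Q e)" for s
    by (rule Rep_polys_mult_mat_vec[OF \<pi>_carrier[OF t] Cov_carrier[OF along(2)]])
      (use along.IH that fun_algebra_const[OF Rep_polys_algebra] in auto)
  show ?case
  proof (rule Rep_polys_mult_mat_vec[where n = "d (head Q e)" and m = "dhat (tail Q e)"])
    show "arrA y e \<in> carrier_mat (d (head Q e)) (dhat (tail Q e))" if "y \<in> Rep" for y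
      by (rule Rep_A[OF that along(1)])
    show "\<pi> (tail Q e) *\<^sub>v F y \<in> carrier_vec (dhat (tail Q e))" if "y \<in> Rep" for y
      by (rule mult_mat_vec_carrier[OF \<pi>_carrier[OF t] Cov_carrier[OF along(2) that]])
    show "(\<lambda>y. arrA y e $$ (r, s)) \<in> Rep_polys" if "r < d (head Q e)" "s < dhat (tail Q e)" for r s
      by (rule Rep_polys_coord[OF coords_A[OF along(1) that]])
  qed (fact pF, fact along.prems)
next
  case (against e F)
  note t = tail_head_verts(2)[OF against(1)]
  have pF: "(\<lambda>y. (\<pi> (head Q e) *\<^sub>v F y) $ s) \<in> Rep_polys" if "s < dhat (head Q e)" for s
    by (rule Rep_polys_mult_mat_vec[OF \<pi>_carrier[OF t] Cov_carrier[OF against(2)]])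
      (use against.IH that fun_algebra_const[OF Rep_polys_algebra] in auto)
  show ?case
  proof (rule Rep_polys_mult_mat_vec[where n = "d (tail Q e)" and m = "dhat (head Q e)"])
    show "arrB y e \<in> carrier_mat (d (tail Q e)) (dhat (head Q e))" if "y \<in> Rep" for y
      by (rule Rep_B[OF that against(1)])
    show "\<pi> (head Q e) *\<^sub>v F y \<in> carrier_vec (dhat (head Q e))" if "y \<in> Rep" for y
      by (rule mult_mat_vec_carrier[OF \<pi>_carrier[OF t] Cov_carrier[OF against(2) that]])
    show "(\<lambda>y. arrB y e $$ (r, s)) \<in> Rep_polys" if "r < d (tail Q e)" "s < dhat (head Q e)" for r s
      by (rule Rep_polys_coord[OF coords_B[OF against(1) that]])
  qed (fact pF, fact against.prems)
next
  case (zero v)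
  then show ?case using fun_algebra_const[OF Rep_polys_algebra, of 0] by simp
next
  case (add v F G)
  show ?case
  proof (rule Rep_polys_cong)
    show "(\<lambda>y. F y $ r + G y $ r) \<in> Rep_polys" using add.IH add.prems by (intro fun_algebra_add Rep_polys_algebra) auto
    show "(F y + G y) $ r = F y $ r + G y $ r" if "y \<in> Rep" for y
      using Cov_carrier[OF add(2) that] add.prems by simp
  qed
next
  case (smult v F c)
  show ?case
  proof (rule Rep_polys_cong)
    show "(\<lambda>y. c * F y $ r) \<in> Rep_polys" using smult.IH smult.prems by (intro fun_algebra_mult fun_algebra_const Rep_polys_algebra) auto
    show "(c \<cdot>\<^sub>v F y) $ r = c * F y $ r" if "y \<in> Rep" for y
      using Cov_carrier[OF smult(1) that] smult.prems by simp
  qed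
qed

text \<open>
  The arrow \<open>M\<close> acts through \<open>\<pi> v\<close>, so the element induced by \<open>g v\<close> cancels against its inverse in
  the transformed arrow.
\<close>

lemma equivariant_step:
  assumes v: "v \<in> verts Q" and g: "g \<in> GrpP" and c: "h \<in> carrier_mat n n" "M \<in> carrier_mat n (dhat v)" "w \<in> carrier_vec (d v)"
  shows "(h * M * induced_inv v (g v)) *\<^sub>v (\<pi> v *\<^sub>v (g v *\<^sub>v w)) = h *\<^sub>v (M *\<^sub>v (\<pi> v *\<^sub>v w))"
proof -
  note G = GrpP_lieP[OF g v] and G' = GrpP_carrier[OF g v] and P = \<pi>_carrier[OF v]
    and I = GrpP_inv_carrier[OF g v] and H = induced_carrier[OF v GrpP_lieP[OF g v]]
  have p: "\<pi> v *\<^sub>v w \<in> carrier_vec (dhat v)" using P c(3) by (rule mult_mat_vec_carrier)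
  have "\<pi> v *\<^sub>v (g v *\<^sub>v w) = (\<pi> v * g v) *\<^sub>v w" by (rule assoc_mult_mat_vec[symmetric, OF P G' c(3)])
  also have "\<dots> = induced v (g v) *\<^sub>v (\<pi> v *\<^sub>v w)" unfolding \<pi>_mult[OF v G] by (rule assoc_mult_mat_vec[OF H P c(3)])
  finally have 1: "\<pi> v *\<^sub>v (g v *\<^sub>v w) = induced v (g v) *\<^sub>v (\<pi> v *\<^sub>v w)" .
  have 2: "induced_inv v (g v) *\<^sub>v (induced v (g v) *\<^sub>v (\<pi> v *\<^sub>v w)) = \<pi> v *\<^sub>v w"
    using assoc_mult_mat_vec[OF I H p] induced_inv_left[OF v G GrpP_det[OF g v]] p by simp
  have "(h * M * induced_inv v (g v)) *\<^sub>v (\<pi> v *\<^sub>v (g v *\<^sub>v w))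
      = (h * M) *\<^sub>v (induced_inv v (g v) *\<^sub>v (induced v (g v) *\<^sub>v (\<pi> v *\<^sub>v w)))"
    unfolding 1 by (rule assoc_mult_mat_vec[OF mult_carrier_mat[OF c(1,2)] I mult_mat_vec_carrier[OF H p]])
  also have "\<dots> = h *\<^sub>v (M *\<^sub>v (\<pi> v *\<^sub>v w))" unfolding 2 by (rule assoc_mult_mat_vec[OF c(1,2) p])
  finally show ?thesis .
qed

lemma Cov_equivariant:
  assumes "Cov v F" and g: "g \<in> GrpP" and y: "y \<in> Rep"
  shows "F (act g y) = g v *\<^sub>v F y"
  using assms(1)
proof (induction rule: Cov.induct)
  case (frame v w)
  then show ?case using assoc_mult_mat_vec[OF GrpP_carrier[OF g frame(1)] Rep_I[OF y frame(1)] frame(2)] by (simp add: act_def)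
next
  case (along e F)
  note e = along(1)
  show ?case
    using equivariant_step[OF tail_head_verts(1)[OF e] g GrpP_carrier[OF g tail_head_verts(2)[OF e]] Rep_A[OF y e] Cov_carrier[OF along(2) y]]
      e along.IH by (simp add: act_def del: assoc_mult_mat_vec assoc_mult_mat)
next
  case (against e F)
  note e = against(1)
  show ?case
    using equivariant_step[OF tail_head_verts(2)[OF e] g GrpP_carrier[OF g tail_head_verts(1)[OF e]] Rep_B[OF y e] Cov_carrier[OF against(2) y]]
      e against.IH by (simp add: act_def del: assoc_mult_mat_vec assoc_mult_mat)
next
  case (zero v)
  show ?case using mult_mat_zero_vec[OF GrpP_carrier[OF g zero]] by simp
next
  case (add v F G)
  show ?case
    using mult_add_distrib_mat_vec[OF GrpP_carrier[OF g Cov_verts[OF add(1)]] Cov_carrier[OF add(1) y] Cov_carrier[OF add(2) y]]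
      add.IH by simp
next
  case (smult v F c)
  show ?case
    using mult_mat_vec[OF GrpP_carrier[OF g Cov_verts[OF smult(1)]] Cov_carrier[OF smult(1) y]] smult.IH by simp
qed

definition cov_at :: "('v, 'e) framed_tuple \<Rightarrow> 'v \<Rightarrow> complex vec set" where
  "cov_at y v = {w. \<exists>F. Cov v F \<and> F y = w}"

lemma cov_atI: "Cov v F \<Longrightarrow> F y = w \<Longrightarrow> w \<in> cov_at y v"
  unfolding cov_at_def by blast

lemma cov_atE:
  assumes "w \<in> cov_at y v"
  obtains F where "Cov v F" "F y = w"
  using assms unfolding cov_at_def by blast

lemma cov_at_carrier: "y \<in> Rep \<Longrightarrow> cov_at y v \<subseteq> carrier_vec (d v)"
  by (auto elim!: cov_atE intro: Cov_carrier)

lemma cov_at_zero: "v \<in> verts Q \<Longrightarrow> 0\<^sub>v (d v) \<in> cov_at y v"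
  by (rule cov_atI[OF Cov.zero]) simp_all

lemma cov_at_add: "a \<in> cov_at y v \<Longrightarrow> b \<in> cov_at y v \<Longrightarrow> a + b \<in> cov_at y v"
  by (elim cov_atE) (rule cov_atI[OF Cov.add], assumption+, simp)

lemma cov_at_smult: "a \<in> cov_at y v \<Longrightarrow> c \<cdot>\<^sub>v a \<in> cov_at y v"
  by (elim cov_atE) (rule cov_atI[OF Cov.smult], assumption+, simp)

text \<open>
  The values of the covariants at \<open>y\<close> are the smallest invariant family that contains the image of
  the framing; stability says that this family is everything.
\<close>

lemma stable_iff_Cov:
  assumes y: "y \<in> Rep"
  shows "stable (\<iota> y) \<longleftrightarrow> (\<forall>v\<in>verts Q. \<forall>w\<in>carrier_vec (d v). \<exists>F. Cov v F \<and> F y = w)"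
proof
  assume st: "stable (\<iota> y)"
  have "cov_at y v = carrier_vec (d v)" if v: "v \<in> verts Q" for v
  proof (rule stable_invariant_full[OF y st cov_at_carrier[OF y] cov_at_zero cov_at_add cov_at_smult _ _ _ v])
    show "frI y v *\<^sub>v w \<in> cov_at y v" if "v \<in> verts Q" "w \<in> carrier_vec (f v)" for v w
      by (rule cov_atI[OF Cov.frame[OF that]]) simp
    show "arrA y e *\<^sub>v (\<pi> (tail Q e) *\<^sub>v w) \<in> cov_at y (head Q e)" if e: "e \<in> arcs Q" and w: "w \<in> cov_at y (tail Q e)" for e w
      using w by (elim cov_atE) (rule cov_atI[OF Cov.along[OF e]], assumption, simp)
    show "arrB y e *\<^sub>v (\<pi> (head Q e) *\<^sub>v w) \<in> cov_at y (tail Q e)" if e: "e \<in> arcs Q" and w: "w \<in> cov_at y (head Q e)" for e w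
      using w by (elim cov_atE) (rule cov_atI[OF Cov.against[OF e]], assumption, simp)
  qed
  then show "\<forall>v\<in>verts Q. \<forall>w\<in>carrier_vec (d v). \<exists>F. Cov v F \<and> F y = w" unfolding cov_at_def by blast
next
  assume full: "\<forall>v\<in>verts Q. \<forall>w\<in>carrier_vec (d v). \<exists>F. Cov v F \<and> F y = w"
  show "stable (\<iota> y)"
    unfolding stable_def
  proof (intro allI impI ballI)
    fix D' v
    assume "(\<forall>v\<in>verts Q. VectorSpace.subspace class_ring (D' v) (module_vec TYPE(complex) (d v))) \<and>
      (\<forall>v\<in>verts Q. \<forall>w\<in>carrier_vec (f v). frI (\<iota> y) v *\<^sub>v w \<in> D' v) \<and>
      (\<forall>e\<in>arcs Q. \<forall>w\<in>D' (tail Q e). arrA (\<iota> y) e *\<^sub>v w \<in> D' (head Q e)) \<and>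
      (\<forall>e\<in>arcs Q. \<forall>w\<in>D' (head Q e). arrB (\<iota> y) e *\<^sub>v w \<in> D' (tail Q e))" and v: "v \<in> verts Q"
    then have sub: "\<And>v. v \<in> verts Q \<Longrightarrow> VectorSpace.subspace class_ring (D' v) (module_vec TYPE(complex) (d v))"
      and I: "\<And>v w. v \<in> verts Q \<Longrightarrow> w \<in> carrier_vec (f v) \<Longrightarrow> frI (\<iota> y) v *\<^sub>v w \<in> D' v"
      and A: "\<And>e w. e \<in> arcs Q \<Longrightarrow> w \<in> D' (tail Q e) \<Longrightarrow> arrA (\<iota> y) e *\<^sub>v w \<in> D' (head Q e)"
      and B: "\<And>e w. e \<in> arcs Q \<Longrightarrow> w \<in> D' (head Q e) \<Longrightarrow> arrB (\<iota> y) e *\<^sub>v w \<in> D' (tail Q e)" by blast+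
    have inn: "F y \<in> D' v" if "Cov v F" for v F
      using that
    proof (induction rule: Cov.induct)
      case (frame v w)
      then show ?case using I by (simp add: \<iota>_I)
    next
      case (along e F)
      then show ?case using A[of e "F y"] \<iota>_A_vec[OF y along(1) Cov_carrier[OF along(2) y]] by simp
    next
      case (against e F)
      then show ?case using B[of e "F y"] \<iota>_B_vec[OF y against(1) Cov_carrier[OF against(2) y]] by simp
    next
      case (zero v)
      then show ?case using subspace_vecD(2)[OF sub] by blast
    next
      case (add v F G)
      then show ?case using subspace_vecD(3)[OF sub[OF Cov_verts[OF add(1)]]] by blast
    next
      case (smult v F c)
      then show ?case using subspace_vecD(4)[OF sub[OF Cov_verts[OF smult(1)]]] by blast
    qed
    show "D' v = carrier_vec (d v)"
    proof
      show "D' v \<subseteq> carrier_vec (d v)" using subspace_vecD(1)[OF sub[OF v]] .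
      show "carrier_vec (d v) \<subseteq> D' v"
      proof
        fix w :: "complex vec" assume "w \<in> carrier_vec (d v)"
        then obtain F where "Cov v F" "F y = w" using full v by blast
        then show "w \<in> D' v" using inn by blast
      qed
    qed
  qed
qed

text \<open>
  This makes stability an open condition: the determinants are polynomials in \<open>y\<close>.
\<close>

lemma stable_if_invertible_covariants:
  assumes y: "y \<in> Rep" and F: "\<And>v c. v \<in> verts Q \<Longrightarrow> c < d v \<Longrightarrow> Cov v (F v c)"
    and det: "\<And>v. v \<in> verts Q \<Longrightarrow> det (mat (d v) (d v) (\<lambda>(r, c). F v c y $ r)) \<noteq> 0"
  shows "stable (\<iota> y)"
  unfolding stable_iff_Cov[OF y]
proof (intro ballI)
  fix v and w :: "complex vec" assume v: "v \<in> verts Q" and w: "w \<in> carrier_vec (d v)"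
  let ?M = "mat (d v) (d v) (\<lambda>(r, c). F v c y $ r)"
  have M: "?M \<in> carrier_mat (d v) (d v)" by simp
  note m = minv[OF M det[OF v]]
  have "?M *\<^sub>v (minv ?M *\<^sub>v w) \<in> cov_at y v"
  proof (rule mult_mat_vec_in_closed[OF M mult_mat_vec_carrier[OF m(1) w] cov_at_zero[OF v] cov_at_add cov_at_smult])
    fix j assume j: "j < d v"
    have "col ?M j = F v j y" using j Cov_carrier[OF F[OF v j] y] by (intro eq_vecI) auto
    then show "col ?M j \<in> cov_at y v" using cov_atI[OF F[OF v j]] by simp
  qed
  moreover have "?M *\<^sub>v (minv ?M *\<^sub>v w) = w"
    using assoc_mult_mat_vec[OF M m(1) w] m(2) w by (simp del: assoc_mult_mat_vec)
  ultimately show "\<exists>F. Cov v F \<and> F y = w" by (simp add: cov_at_def)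
qed

lemma mhat_act:
  assumes g: "g \<in> GrpP" and y: "y \<in> Rep" and v: "v \<in> verts Q"
  shows "mhat (act g y) v = g v * mhat y v * induced_inv v (g v)"
proof -
  note C = GrpP_carrier[OF g] and I = GrpP_inv_carrier[OF g]
  have mid: "induced_inv a (g a) * \<pi> a * g a = \<pi> a" if a: "a \<in> verts Q" for a
  proof -
    note P = \<pi>_carrier[OF a] and H = induced_carrier[OF a GrpP_lieP[OF g a]]
    have "induced_inv a (g a) * \<pi> a * g a = induced_inv a (g a) * (induced a (g a) * \<pi> a)"
      unfolding \<pi>_mult[OF a GrpP_lieP[OF g a], symmetric] by (rule assoc_mult_mat[OF I[OF a] P C[OF a]])
    also have "\<dots> = induced_inv a (g a) * induced a (g a) * \<pi> a"
      by (rule assoc_mult_mat[symmetric, OF I[OF a] H P])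
    also have "\<dots> = \<pi> a" unfolding induced_inv_left[OF a GrpP_lieP[OF g a] GrpP_det[OF g a]]
      by (rule left_mult_one_mat[OF P])
    finally show ?thesis .
  qed
  let ?a = "\<lambda>e. arrA y e * \<pi> (tail Q e) * arrB y e" and ?b = "\<lambda>e. arrB y e * \<pi> (head Q e) * arrA y e"
  note ta = mhat_term_in[OF y, of v] and tb = mhat_term_out[OF y, of v] and tj = dmu_framing_term[OF y y v]
  note ga = mult_carrier_mat[OF C[OF v] bspec[OF ta]] and gb = mult_carrier_mat[OF C[OF v] bspec[OF tb]]
  have 1: "mat_sum (d v) (dhat v) (\<lambda>e. arrA (act g y) e * \<pi> (tail Q e) * arrB (act g y) e) (in_arcs Q v)
      = mat_sum (d v) (dhat v) (\<lambda>e. g v * ?a e * induced_inv v (g v)) (in_arcs Q v)"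
  proof (intro finsum_mat_cong finite_in_out_arcs ballI mult_carrier_mat[OF ga I[OF v]])
    fix e assume e: "e \<in> in_arcs Q v"
    then have e': "e \<in> arcs Q" "head Q e = v" by auto
    note t = tail_head_verts(1)[OF e'(1)]
    show "arrA (act g y) e * \<pi> (tail Q e) * arrB (act g y) e = g v * ?a e * induced_inv v (g v)"
      using conj_term[OF C[OF v] Rep_A[OF y e'(1), unfolded e'(2)] I[OF t] \<pi>_carrier[OF t] C[OF t] Rep_B[OF y e'(1), unfolded e'(2)] I[OF v] mid[OF t]] e'
      by (simp add: act_def del: assoc_mult_mat)
  qed
  have 2: "mat_sum (d v) (dhat v) (\<lambda>e. arrB (act g y) e * \<pi> (head Q e) * arrA (act g y) e) (out_arcs Q v)
      = mat_sum (d v) (dhat v) (\<lambda>e. g v * ?b e * induced_inv v (g v)) (out_arcs Q v)"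
  proof (intro finsum_mat_cong finite_in_out_arcs ballI mult_carrier_mat[OF gb I[OF v]])
    fix e assume e: "e \<in> out_arcs Q v"
    then have e': "e \<in> arcs Q" "tail Q e = v" by auto
    note t = tail_head_verts(2)[OF e'(1)]
    show "arrB (act g y) e * \<pi> (head Q e) * arrA (act g y) e = g v * ?b e * induced_inv v (g v)"
      using conj_term[OF C[OF v] Rep_B[OF y e'(1), unfolded e'(2)] I[OF t] \<pi>_carrier[OF t] C[OF t] Rep_A[OF y e'(1), unfolded e'(2)] I[OF v] mid[OF t]] e'
      by (simp add: act_def del: assoc_mult_mat)
  qed
  have 3: "frI (act g y) v * frJ (act g y) v = g v * (frI y v * frJ y v) * induced_inv v (g v)"
  proof -
    note c = C[OF v] Rep_I[OF y v] Rep_J[OF y v] I[OF v]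
    have "g v * frI y v * (frJ y v * induced_inv v (g v)) = g v * (frI y v * frJ y v) * induced_inv v (g v)"
      by (simp only: mult_assoc_dim index_mult_mat(2,3) c[THEN carrier_matD(1)] c[THEN carrier_matD(2)])
    then show ?thesis using v by (simp add: act_def del: assoc_mult_mat)
  qed
  note ca = finsum_mat_carrier[OF finite_in_out_arcs(1) ta] and cb = finsum_mat_carrier[OF finite_in_out_arcs(2) tb]
  have ga': "\<forall>e\<in>in_arcs Q v. g v * ?a e \<in> carrier_mat (d v) (dhat v)" and gb': "\<forall>e\<in>out_arcs Q v. g v * ?b e \<in> carrier_mat (d v) (dhat v)"
    using ga gb by blast+
  have dist: "h * X * b - h * Y * b + h * Z * b = h * (X - Y + Z) * b"
    if "h \<in> carrier_mat n n" "X \<in> carrier_mat n m" "Y \<in> carrier_mat n m" "Z \<in> carrier_mat n m" "b \<in> carrier_mat m m"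
    for h X Y Z b :: "complex mat" and n m
  proof -
    have "h * (X - Y + Z) = h * X - h * Y + h * Z"
      using mult_add_distrib_mat[OF that(1) minus_carrier_mat[OF that(3)] that(4)] mult_minus_distrib_mat[OF that(1-3)] by simp
    moreover note k = mult_carrier_mat[OF that(1,2)] mult_carrier_mat[OF that(1,3)] mult_carrier_mat[OF that(1,4)]
    have "(h * X - h * Y + h * Z) * b = h * X * b - h * Y * b + h * Z * b"
      using add_mult_distrib_mat[OF minus_carrier_mat[OF k(2)] k(3) that(5)] minus_mult_distrib_mat[OF k(1,2) that(5)] by simp
    ultimately show ?thesis by simp
  qed
  show ?thesis
    unfolding mhat_def 1 2 3 finsum_mat_mult_right[OF finite_in_out_arcs(1) ga' I[OF v]]
      finsum_mat_mult_right[OF finite_in_out_arcs(2) gb' I[OF v]]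
      finsum_mat_mult_left[OF finite_in_out_arcs(1) ta C[OF v]] finsum_mat_mult_left[OF finite_in_out_arcs(2) tb C[OF v]]
    by (rule dist[OF C[OF v] ca cb tj I[OF v]])
qed

lemma Rep_st0_Rep: "y \<in> Rep_st0 \<Longrightarrow> y \<in> Rep"
  by (simp add: Rep_st0_def)

lemma Rep_st0_act:
  assumes g: "g \<in> GrpP" and y: "y \<in> Rep_st0"
  shows "act g y \<in> Rep_st0"
proof -
  note yR = Rep_st0_Rep[OF y] and aR = act_Rep[OF g Rep_st0_Rep[OF y]]
  have "stable (\<iota> (act g y))"
    unfolding stable_iff_Cov[OF aR]
  proof (intro ballI)
    fix v and w :: "complex vec" assume v: "v \<in> verts Q" and w: "w \<in> carrier_vec (d v)"
    note m = minv[OF GrpP_carrier[OF g v] GrpP_det[OF g v]]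
    obtain F where F: "Cov v F" "F y = minv (g v) *\<^sub>v w"
      using y v mult_mat_vec_carrier[OF m(1) w] stable_iff_Cov[OF yR] unfolding Rep_st0_def by blast
    have "F (act g y) = w"
      unfolding Cov_equivariant[OF F(1) g yR] F(2)
      using assoc_mult_mat_vec[OF GrpP_carrier[OF g v] m(1) w] m(2) w by simp
    then show "\<exists>F. Cov v F \<and> F (act g y) = w" using F(1) by blast
  qed
  moreover have "mhat (act g y) v = 0\<^sub>m (d v) (dhat v)" if v: "v \<in> verts Q" for v
  proof -
    have "mhat y v = 0\<^sub>m (d v) (dhat v)"
      using y v satisfies_moment_map_iff(1)[OF yR] unfolding Rep_st0_def by blast
    then show ?thesis
      unfolding mhat_act[OF g yR v]
      using right_mult_zero_mat[OF GrpP_carrier[OF g v], of "dhat v"] left_mult_zero_mat[OF GrpP_inv_carrier[OF g v], of "d v"] by simp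
  qed
  ultimately show ?thesis
    unfolding Rep_st0_def using aR satisfies_moment_map_iff(1)[OF aR] by blast
qed

section \<open>Fractions\<close>

definition fractions :: "('v, 'e) framed_tuple set \<Rightarrow> (('v, 'e) framed_tuple \<Rightarrow> complex) set" where
  "fractions U = {h. \<exists>p r. fraction_on U h p r}"

lemma fraction_on_add:
  "fraction_on U h p r \<Longrightarrow> fraction_on U h' p' r' \<Longrightarrow>
    fraction_on U (\<lambda>y. h y + h' y) (\<lambda>y. p y * r' y + p' y * r y) (\<lambda>y. r y * r' y)"
  unfolding fraction_on_def by (auto intro!: polys.intros simp: field_simps)

lemma fraction_on_mult:
  "fraction_on U h p r \<Longrightarrow> fraction_on U h' p' r' \<Longrightarrow>
    fraction_on U (\<lambda>y. h y * h' y) (\<lambda>y. p y * p' y) (\<lambda>y. r y * r' y)"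
  unfolding fraction_on_def by (auto intro!: polys.intros)

lemma fraction_on_poly: "p \<in> polys \<Longrightarrow> fraction_on U p p (\<lambda>_. 1)"
  unfolding fraction_on_def by (auto intro: polys.intros)

lemma fraction_on_subset: "fraction_on U h p r \<Longrightarrow> V \<subseteq> U \<Longrightarrow> fraction_on V h p r"
  unfolding fraction_on_def by blast

lemma fractions_algebra: "fun_algebra (fractions U)"
  unfolding fun_algebra_def fractions_def
  using fraction_on_add fraction_on_mult fraction_on_poly[OF polys.const] by blast

lemma fractions_inverse:
  assumes "h \<in> fractions U" "\<And>y. y \<in> U \<Longrightarrow> h y \<noteq> 0"
  shows "(\<lambda>y. 1 / h y) \<in> fractions U"
proof -
  obtain p r where "fraction_on U h p r" using assms(1) unfolding fractions_def by blast
  then have "fraction_on U (\<lambda>y. 1 / h y) r p" using assms(2) unfolding fraction_on_def by auto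
  then show ?thesis unfolding fractions_def by blast
qed

lemma fractions_cong: "h \<in> fractions U \<Longrightarrow> (\<And>y. y \<in> U \<Longrightarrow> h' y = h y) \<Longrightarrow> h' \<in> fractions U"
  unfolding fractions_def fraction_on_def by auto

lemma Rep_polys_fractions:
  assumes "h \<in> Rep_polys" "U \<subseteq> Rep"
  shows "h \<in> fractions U"
proof -
  obtain p where p: "p \<in> polys" "\<forall>y\<in>Rep. h y = p y" using assms(1) unfolding Rep_polys_def by blast
  have "p \<in> fractions U" unfolding fractions_def using fraction_on_poly[OF p(1)] by blast
  then show ?thesis by (rule fractions_cong) (use p(2) assms(2) in auto)
qed

definition fraction_mat where
  "fraction_mat U n m M \<longleftrightarrow> (\<forall>y\<in>U. M y \<in> carrier_mat n m) \<and> (\<forall>i<n. \<forall>j<m. (\<lambda>y. M y $$ (i, j)) \<in> fractions U)"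

lemma fraction_mat_mult:
  assumes "fraction_mat U n m M" "fraction_mat U m p N"
  shows "fraction_mat U n p (\<lambda>y. M y * N y)"
  unfolding fraction_mat_def
proof (intro conjI ballI allI impI)
  fix y assume "y \<in> U"
  then show "M y * N y \<in> carrier_mat n p" using assms unfolding fraction_mat_def by (blast intro: mult_carrier_mat)
next
  fix i j assume ij: "i < n" "j < p"
  show "(\<lambda>y. (M y * N y) $$ (i, j)) \<in> fractions U"
  proof (rule fractions_cong)
    show "(\<lambda>y. \<Sum>l<m. M y $$ (i, l) * N y $$ (l, j)) \<in> fractions U"
      using assms ij unfolding fraction_mat_def by (intro fun_algebra_sum fun_algebra_mult fractions_algebra) auto
    show "(M y * N y) $$ (i, j) = (\<Sum>l<m. M y $$ (i, l) * N y $$ (l, j))" if "y \<in> U" for y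
      by (rule mult_mat_entry) (use assms that ij in \<open>auto simp: fraction_mat_def\<close>)
  qed
qed

lemma fraction_mat_const: "M \<in> carrier_mat n m \<Longrightarrow> fraction_mat U n m (\<lambda>_. M)"
  unfolding fraction_mat_def using fun_algebra_const[OF fractions_algebra] by blast

lemma fraction_mat_cong: "fraction_mat U n m M \<Longrightarrow> (\<And>y. y \<in> U \<Longrightarrow> N y = M y) \<Longrightarrow> fraction_mat U n m N"
  unfolding fraction_mat_def using fractions_cong[of "\<lambda>y. M y $$ (i, j)" U "\<lambda>y. N y $$ (i, j)" for i j] by simp

lemma fraction_mat_minv:
  assumes "mat_in (fractions U) n n M" "\<And>y. y \<in> U \<Longrightarrow> det (M y) \<noteq> 0"
  shows "fraction_mat U n n (\<lambda>y. minv (M y))"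
  unfolding fraction_mat_def
proof (intro conjI ballI allI impI)
  have M: "M y \<in> carrier_mat n n" for y using assms(1) by (simp add: mat_in_def)
  show "minv (M y) \<in> carrier_mat n n" if "y \<in> U" for y using minv(1)[OF M assms(2)[OF that]] .
  fix i j assume ij: "i < n" "j < n"
  have adj: "mat_in (fractions U) n n (\<lambda>y. adj_mat (M y))" by (rule fun_algebra_adj[OF fractions_algebra assms(1)])
  have "(\<lambda>y. 1 / det (M y) * adj_mat (M y) $$ (i, j)) \<in> fractions U"
    using adj ij unfolding mat_in_def
    by (intro fun_algebra_mult fractions_algebra fractions_inverse fun_algebra_det[OF fractions_algebra assms(1)] assms(2)) auto
  then show "(\<lambda>y. minv (M y) $$ (i, j)) \<in> fractions U"
    by (rule fractions_cong) (use ij adj_mat(1)[OF M, THEN carrier_matD(1)] adj_mat(1)[OF M, THEN carrier_matD(2)] in \<open>simp add: minv_def\<close>)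
qed

lemma induced_inv_minv:
  assumes "v \<in> verts Q" "g \<in> lieP v" "det g \<noteq> 0"
  shows "induced_inv v (minv g) = induced v g"
  unfolding induced_inv_eq[OF assms(1) minv_lieP(1)[OF assms] minv_lieP(4)[OF assms]]
    minv_unique[OF lieP_carrier[OF minv_lieP(1)[OF assms]] lieP_carrier[OF assms(2)] minv_lieP(2)[OF assms]] ..

section \<open>Homology classes\<close>

definition lie_comb :: "complex \<Rightarrow> ('v \<Rightarrow> complex mat) \<Rightarrow> ('v \<Rightarrow> complex mat) \<Rightarrow> 'v \<Rightarrow> complex mat" where
  "lie_comb t \<xi> \<zeta> = (\<lambda>v\<in>verts Q. \<xi> v + t \<cdot>\<^sub>m \<zeta> v)"

lemma lie_comb_lieP: "a \<in> lieP v \<Longrightarrow> b \<in> lieP v \<Longrightarrow> v \<in> verts Q \<Longrightarrow> a + t \<cdot>\<^sub>m b \<in> lieP v"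
  using k_le_d[of v] unfolding lieP_def by auto

lemma lie_comb_LieP: "\<xi> \<in> LieP \<Longrightarrow> \<zeta> \<in> LieP \<Longrightarrow> lie_comb t \<xi> \<zeta> \<in> LieP"
  unfolding LieP_def lie_comb_def using lie_comb_lieP by (auto simp: PiE_iff)

lemma induced_comb:
  assumes v: "v \<in> verts Q" and a: "a \<in> lieP v" and b: "b \<in> lieP v"
  shows "induced v (a + t \<cdot>\<^sub>m b) = induced v a + t \<cdot>\<^sub>m induced v b"
proof (rule induced_unique[OF v lie_comb_lieP[OF a b v]])
  note P = \<pi>_carrier[OF v] and ia = induced_carrier[OF v a] and ib = induced_carrier[OF v b] and ca = lieP_carrier[OF a] and cb = lieP_carrier[OF b]
  show "induced v a + t \<cdot>\<^sub>m induced v b \<in> carrier_mat (dhat v) (dhat v)" using ia ib by simp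
  have "\<pi> v * (a + t \<cdot>\<^sub>m b) = \<pi> v * a + t \<cdot>\<^sub>m (\<pi> v * b)"
    using mult_add_distrib_mat[OF P ca, of "t \<cdot>\<^sub>m b"] mult_smult_distrib[OF P cb] cb by simp
  also have "\<dots> = (induced v a + t \<cdot>\<^sub>m induced v b) * \<pi> v"
    unfolding \<pi>_mult[OF v a] \<pi>_mult[OF v b]
    using add_mult_distrib_mat[OF ia _ P, of "t \<cdot>\<^sub>m induced v b"] mult_smult_assoc_mat[OF ib P] ib by simp
  finally show "\<pi> v * (a + t \<cdot>\<^sub>m b) = (induced v a + t \<cdot>\<^sub>m induced v b) * \<pi> v" .
qed

lemma jmap_comb:
  assumes x: "x \<in> Rep" and \<xi>: "\<xi> \<in> LieP" and \<zeta>: "\<zeta> \<in> LieP"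
  shows "jmap x (lie_comb t \<xi> \<zeta>) = rep_add (jmap x \<xi>) (rep_smult t (jmap x \<zeta>))"
proof (rule tuple_eqI)
  show "jmap x (lie_comb t \<xi> \<zeta>) \<in> Rep" "rep_add (jmap x \<xi>) (rep_smult t (jmap x \<zeta>)) \<in> Rep"
    by (intro jmap_Rep rep_add_Rep rep_smult_Rep lie_comb_LieP x \<xi> \<zeta>)+
  note L = LieP_D[OF \<xi>] and M = LieP_D[OF \<zeta>]
  show "arrA (jmap x (lie_comb t \<xi> \<zeta>)) e = arrA (rep_add (jmap x \<xi>) (rep_smult t (jmap x \<zeta>))) e" if e: "e \<in> arcs Q" for e
    using e tail_head_verts[OF e] linear_relation_entries[OF L(2) M(2) Rep_A[OF x e] L(3) M(3)]
      induced_comb[OF _ L(1) M(1)] by (simp add: jmap_def rep_add_def rep_smult_def lie_comb_def)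
  show "arrB (jmap x (lie_comb t \<xi> \<zeta>)) e = arrB (rep_add (jmap x \<xi>) (rep_smult t (jmap x \<zeta>))) e" if e: "e \<in> arcs Q" for e
    using e tail_head_verts[OF e] linear_relation_entries[OF L(2) M(2) Rep_B[OF x e] L(3) M(3)]
      induced_comb[OF _ L(1) M(1)] by (simp add: jmap_def rep_add_def rep_smult_def lie_comb_def)
  show "frI (jmap x (lie_comb t \<xi> \<zeta>)) v = frI (rep_add (jmap x \<xi>) (rep_smult t (jmap x \<zeta>))) v" if v: "v \<in> verts Q" for v
    using v add_mult_distrib_mat[OF L(2)[OF v] _ Rep_I[OF x v], of "t \<cdot>\<^sub>m \<zeta> v"] mult_smult_assoc_mat[OF M(2)[OF v] Rep_I[OF x v]] M(2)[OF v]
    by (simp add: jmap_def rep_add_def rep_smult_def lie_comb_def)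
  show "frJ (jmap x (lie_comb t \<xi> \<zeta>)) v = frJ (rep_add (jmap x \<xi>) (rep_smult t (jmap x \<zeta>))) v" if v: "v \<in> verts Q" for v
  proof -
    note J = Rep_J[OF x v]
    have "frJ x v * (induced v (\<xi> v) + t \<cdot>\<^sub>m induced v (\<zeta> v)) = frJ x v * induced v (\<xi> v) + t \<cdot>\<^sub>m (frJ x v * induced v (\<zeta> v))"
      using mult_add_distrib_mat[OF J L(3)[OF v], of "t \<cdot>\<^sub>m induced v (\<zeta> v)"] mult_smult_distrib[OF J M(3)[OF v]] M(3)[OF v] by simp
    moreover have "- (P + t \<cdot>\<^sub>m R) = - P + t \<cdot>\<^sub>m (- R)" if "P \<in> carrier_mat (f v) (dhat v)" "R \<in> carrier_mat (f v) (dhat v)" for P R :: "complex mat"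
      using that by (intro eq_matI) auto
    moreover note mult_carrier_mat[OF J L(3)[OF v]] mult_carrier_mat[OF J M(3)[OF v]]
    ultimately show ?thesis
      using v induced_comb[OF v L(1)[OF v] M(1)[OF v]]
      by (simp add: jmap_def rep_add_def rep_smult_def lie_comb_def)
  qed
qed

lemma boundaries_Rep: "x \<in> Rep \<Longrightarrow> b \<in> boundaries x \<Longrightarrow> b \<in> Rep"
  unfolding boundaries_def using jmap_Rep by blast

lemma boundaries_comb:
  assumes "x \<in> Rep" "b \<in> boundaries x" "c \<in> boundaries x"
  shows "rep_add b (rep_smult t c) \<in> boundaries x"
proof -
  obtain \<xi> \<zeta> where "\<xi> \<in> LieP" "b = jmap x \<xi>" "\<zeta> \<in> LieP" "c = jmap x \<zeta>"
    using assms(2,3) unfolding boundaries_def by blast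
  then have "rep_add b (rep_smult t c) = jmap x (lie_comb t \<xi> \<zeta>)" "lie_comb t \<xi> \<zeta> \<in> LieP"
    using jmap_comb[OF assms(1)] lie_comb_LieP by simp_all
  then show ?thesis unfolding boundaries_def by blast
qed

lemma zero_in_boundaries:
  assumes x: "x \<in> Rep"
  shows "\<exists>b\<in>boundaries x. \<forall>u\<in>Rep. rep_add u b = u"
proof -
  have "(\<lambda>v\<in>verts Q. 0\<^sub>m (d v) (d v)) \<in> LieP" using k_le_d by (auto simp: LieP_def lieP_def)
  then obtain b where b: "b \<in> boundaries x" unfolding boundaries_def by blast
  note bR = boundaries_Rep[OF x b]
  have "rep_add u (rep_add b (rep_smult (- 1) b)) = u" if "u \<in> Rep" for u
    by (rule Rep_eqI) (simp_all add: rep_add_Rep rep_smult_Rep that bR coord_add coord_smult)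
  then show ?thesis using boundaries_comb[OF x b b] by blast
qed

lemma hclass_self:
  assumes "x \<in> Rep" "u \<in> Rep"
  shows "u \<in> hclass x u"
proof -
  obtain b where b: "b \<in> boundaries x" "rep_add u b = u" using zero_in_boundaries[OF assms(1)] assms(2) by blast
  show ?thesis unfolding hclass_def using rev_image_eqI[of b "boundaries x" u "rep_add u"] b by simp
qed

lemma hclass_eqI:
  assumes x: "x \<in> Rep" and w: "w \<in> Rep" and b: "b \<in> boundaries x"
  shows "hclass x (rep_add w b) = hclass x w"
proof
  note bR = boundaries_Rep[OF x b]
  show "hclass x (rep_add w b) \<subseteq> hclass x w"
  proof
    fix u assume "u \<in> hclass x (rep_add w b)"
    then obtain c where c: "c \<in> boundaries x" "u = rep_add (rep_add w b) c" unfolding hclass_def by blast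
    have "u = rep_add w (rep_add b (rep_smult 1 c))" unfolding c(2)
      by (rule Rep_eqI) (simp_all add: rep_add_Rep rep_smult_Rep w bR boundaries_Rep[OF x c(1)] coord_add coord_smult)
    then show "u \<in> hclass x w" unfolding hclass_def using boundaries_comb[OF x b c(1)] by blast
  qed
  show "hclass x w \<subseteq> hclass x (rep_add w b)"
  proof
    fix u assume "u \<in> hclass x w"
    then obtain c where c: "c \<in> boundaries x" "u = rep_add w c" unfolding hclass_def by blast
    have "u = rep_add (rep_add w b) (rep_add c (rep_smult (- 1) b))" unfolding c(2)
      by (rule Rep_eqI) (simp_all add: rep_add_Rep rep_smult_Rep w bR boundaries_Rep[OF x c(1)] coord_add coord_smult)
    then show "u \<in> hclass x (rep_add w b)" unfolding hclass_def using boundaries_comb[OF x c(1) b] by blast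
  qed
qed

lemma cycles_Rep: "u \<in> cycles x \<Longrightarrow> u \<in> Rep"
  by (simp add: cycles_def)

lemma cycles_comb:
  assumes x: "x \<in> Rep" and u: "u \<in> cycles x" and w: "w \<in> cycles x"
  shows "rep_add (rep_smult c u) w \<in> cycles x"
proof -
  have R: "u \<in> Rep" "w \<in> Rep" using u w by (simp_all add: cycles_def)
  have "dmu x u = dmu_zero" "dmu x w = dmu_zero" using u w by (simp_all add: cycles_def)
  then have 0: "dmu x u v $$ (r, s) = 0" "dmu x w v $$ (r, s) = 0" if "v \<in> verts Q" "r < d v" "s < dhat v" for v r s
    using that by (simp_all add: dmu_zero_def)
  have "dmu x (rep_add (rep_smult c u) w) v $$ (r, s) = 0" if "v \<in> verts Q" "r < d v" "s < dhat v" for v r s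
    using dmu_lin[OF x that] 0[OF that] R rep_smult_Rep unfolding lin_def by simp
  then show ?thesis
    unfolding cycles_def using dmu_eq_zero_iff[OF x] rep_add_Rep[OF rep_smult_Rep[OF R(1)] R(2)] by simp
qed

section \<open>The Zariski topology and the local sections\<close>

text \<open>
  Products of the defining polynomials define the intersection.
\<close>

lemma zopen_Int:
  assumes "zopen U" "zopen V"
  shows "zopen (U \<inter> V)"
proof -
  obtain S T where S: "S \<subseteq> polys" "U = {y \<in> Rep_st0. \<exists>p\<in>S. p y \<noteq> 0}" and T: "T \<subseteq> polys" "V = {y \<in> Rep_st0. \<exists>p\<in>T. p y \<noteq> 0}"
    using assms unfolding zopen_def by blast
  define ST where "ST = {\<lambda>y. p y * q y |p q. p \<in> S \<and> q \<in> T}"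
  have "ST \<subseteq> polys" unfolding ST_def using S(1) T(1) polys.mult by blast
  moreover have "U \<inter> V = {y \<in> Rep_st0. \<exists>p\<in>ST. p y \<noteq> 0}"
  proof (rule equalityI; rule subsetI)
    fix y assume "y \<in> U \<inter> V"
    then have y: "y \<in> Rep_st0" "\<exists>p\<in>S. p y \<noteq> 0" "\<exists>q\<in>T. q y \<noteq> 0" unfolding S(2) T(2) by simp_all
    obtain p where p: "p \<in> S" "p y \<noteq> 0" using y(2) by (rule bexE)
    obtain q where q: "q \<in> T" "q y \<noteq> 0" using y(3) by (rule bexE)
    have "(\<lambda>y. p y * q y) \<in> ST" unfolding ST_def using p(1) q(1) by blast
    then have "\<exists>l\<in>ST. l y \<noteq> 0" by (rule bexI[rotated]) (simp add: p(2) q(2))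
    then show "y \<in> {y \<in> Rep_st0. \<exists>p\<in>ST. p y \<noteq> 0}" using y(1) by simp
  next
    fix y assume "y \<in> {y \<in> Rep_st0. \<exists>p\<in>ST. p y \<noteq> 0}"
    then have y: "y \<in> Rep_st0" "\<exists>l\<in>ST. l y \<noteq> 0" by simp_all
    obtain l where l: "l \<in> ST" "l y \<noteq> 0" using y(2) by (rule bexE)
    obtain p q where pq: "l = (\<lambda>y. p y * q y)" "p \<in> S" "q \<in> T" using l(1) unfolding ST_def by blast
    have "p y \<noteq> 0" "q y \<noteq> 0" using l(2) unfolding pq(1) by simp_all
    then have "y \<in> U" "y \<in> V" unfolding S(2) T(2) using y(1) pq(2,3) by auto
    then show "y \<in> U \<inter> V" by (rule IntI)
  qed
  ultimately show ?thesis unfolding zopen_def by blast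
qed

lemma preim_Int: "preim (V \<inter> W) = preim V \<inter> preim W"
  unfolding preim_def by blast

lemma mopen_Int: "mopen V \<Longrightarrow> mopen W \<Longrightarrow> mopen (V \<inter> W)"
  unfolding mopen_def preim_Int using zopen_Int by blast

lemma regular_onD:
  assumes "regular_on U h" "y \<in> U"
  obtains V p r where "zopen V" "y \<in> V" "V \<subseteq> U" "fraction_on V h p r"
  using assms unfolding regular_on_def by blast

text \<open>
  Regularity is local, so it suffices to combine quotients of polynomials on a common domain.
\<close>

lemma regular_on_binary:
  assumes "regular_on U g" "regular_on U h"
    and fractions: "\<And>V. g \<in> fractions V \<Longrightarrow> h \<in> fractions V \<Longrightarrow> l \<in> fractions V"
  shows "regular_on U l"
  unfolding regular_on_def
proof
  fix y assume y: "y \<in> U"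
  obtain V p r where V: "zopen V" "y \<in> V" "V \<subseteq> U" "fraction_on V g p r" by (rule regular_onD[OF assms(1) y])
  obtain V' p' r' where V': "zopen V'" "y \<in> V'" "V' \<subseteq> U" "fraction_on V' h p' r'" by (rule regular_onD[OF assms(2) y])
  have "g \<in> fractions (V \<inter> V')" using fraction_on_subset[OF V(4), of "V \<inter> V'"] unfolding fractions_def by blast
  moreover have "h \<in> fractions (V \<inter> V')" using fraction_on_subset[OF V'(4), of "V \<inter> V'"] unfolding fractions_def by blast
  ultimately have "l \<in> fractions (V \<inter> V')" by (rule fractions)
  then obtain q s where "fraction_on (V \<inter> V') l q s" unfolding fractions_def by blast
  moreover have "y \<in> V \<inter> V'" "V \<inter> V' \<subseteq> U" using V V' by blast+
  ultimately show "\<exists>U' p r. zopen U' \<and> y \<in> U' \<and> U' \<subseteq> U \<and> fraction_on U' l p r"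
    using zopen_Int[OF V(1) V'(1)] by blast
qed

lemma regular_on_subset:
  assumes "regular_on U h" "zopen V" "V \<subseteq> U"
  shows "regular_on V h"
  unfolding regular_on_def
proof
  fix y assume y: "y \<in> V"
  then have "y \<in> U" using assms(3) by blast
  then obtain V' p r where V': "zopen V'" "y \<in> V'" "V' \<subseteq> U" "fraction_on V' h p r" by (rule regular_onD[OF assms(1)])
  then show "\<exists>U' p r. zopen U' \<and> y \<in> U' \<and> U' \<subseteq> V \<and> fraction_on U' h p r"
    using zopen_Int[OF V'(1) assms(2)] fraction_on_subset[OF V'(4), of "V' \<inter> V"] y by blast
qed

lemma sections_add:
  assumes "(W, g) \<in> sections m" "(W, h) \<in> sections m"
  shows "(W, \<lambda>n. g n + h n) \<in> sections m"
proof -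
  have "regular_on (preim W) (\<lambda>y. g (orbit y) + h (orbit y))"
    by (rule regular_on_binary[of _ "g \<circ> orbit" "h \<circ> orbit"])
      (use assms in \<open>simp_all add: sections_def mregular_on_def comp_def fun_algebra_add[OF fractions_algebra]\<close>)
  then show ?thesis using assms by (simp add: sections_def mregular_on_def comp_def)
qed

lemma sections_mult:
  assumes "(W, g) \<in> sections m" "(W, h) \<in> sections m"
  shows "(W, \<lambda>n. g n * h n) \<in> sections m"
proof -
  have "regular_on (preim W) (\<lambda>y. g (orbit y) * h (orbit y))"
    by (rule regular_on_binary[of _ "g \<circ> orbit" "h \<circ> orbit"])
      (use assms in \<open>simp_all add: sections_def mregular_on_def comp_def fun_algebra_mult[OF fractions_algebra]\<close>)
  then show ?thesis using assms by (simp add: sections_def mregular_on_def comp_def)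
qed

lemma sections_cmult:
  assumes "(W, h) \<in> sections m"
  shows "(W, \<lambda>n. c * h n) \<in> sections m"
proof -
  have "regular_on (preim W) (\<lambda>y. c * h (orbit y))"
    by (rule regular_on_binary[of _ "h \<circ> orbit" "h \<circ> orbit"])
      (use assms in \<open>simp_all add: sections_def mregular_on_def comp_def fun_algebra_mult[OF fractions_algebra] fun_algebra_const[OF fractions_algebra]\<close>)
  then show ?thesis using assms by (simp add: sections_def mregular_on_def comp_def)
qed

lemma sections_restrict:
  assumes "(W, h) \<in> sections m" "mopen V" "m \<in> V" "V \<subseteq> W"
  shows "(V, h) \<in> sections m"
proof -
  have "preim V \<subseteq> preim W" using assms(4) unfolding preim_def by blast
  then have "regular_on (preim V) (h \<circ> orbit)"
    using assms regular_on_subset[of "preim W" "h \<circ> orbit" "preim V"] by (simp add: sections_def mregular_on_def mopen_def)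
  then show ?thesis using assms by (simp add: sections_def mregular_on_def)
qed

lemma germ_subset:
  assumes "mopen V" "m \<in> V" "V \<subseteq> W \<inter> W'" "\<And>n. n \<in> V \<Longrightarrow> h n = h' n"
  shows "germ m W h \<subseteq> germ m W' h'"
proof
  fix s assume s: "s \<in> germ m W h"
  obtain W1 h1 where s1: "s = (W1, h1)" by (cases s)
  obtain V1 where V1: "(W1, h1) \<in> sections m" "mopen V1" "m \<in> V1" "V1 \<subseteq> W \<inter> W1" "\<forall>n\<in>V1. h n = h1 n"
    using s unfolding germ_def s1 by blast
  have "mopen (V \<inter> V1)" "m \<in> V \<inter> V1" "V \<inter> V1 \<subseteq> W' \<inter> W1" "\<forall>n\<in>V \<inter> V1. h' n = h1 n"
    using mopen_Int[OF assms(1) V1(2)] assms V1 by auto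
  then show "s \<in> germ m W' h'" unfolding germ_def s1 using V1(1) by blast
qed

lemma germ_eqI:
  assumes "mopen V" "m \<in> V" "V \<subseteq> W \<inter> W'" "\<And>n. n \<in> V \<Longrightarrow> h n = h' n"
  shows "germ m W h = germ m W' h'"
  using germ_subset[OF assms] germ_subset[OF assms(1,2), of W' W h' h] assms(3,4) by (simp add: Int_commute subset_antisym)

lemma germ_eqD:
  assumes "germ m W h = germ m W' h'" "(W', h') \<in> sections m"
  obtains V where "mopen V" "m \<in> V" "V \<subseteq> W \<inter> W'" "\<And>n. n \<in> V \<Longrightarrow> h n = h' n"
proof -
  have "(W', h') \<in> germ m W' h'" using assms(2) unfolding germ_def sections_def by blast
  then have "(W', h') \<in> germ m W h" using assms(1) by simp
  then show ?thesis using that unfolding germ_def by blast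
qed

lemma germ_in_stalk: "(W, h) \<in> sections m \<Longrightarrow> germ m W h \<in> stalk m"
  unfolding stalk_def by blast

lemma stalkE:
  assumes "\<gamma> \<in> stalk m"
  obtains W h where "(W, h) \<in> sections m" "\<gamma> = germ m W h"
  using assms unfolding stalk_def by blast

end

locale framed_point = framed_quiver Q d f k \<pi>
  for Q :: "('v, 'e) pre_digraph" and d f k :: "'v \<Rightarrow> nat" and \<pi> :: "'v \<Rightarrow> complex mat" +
  fixes x :: "('v, 'e) framed_tuple"
  assumes x: "x \<in> Rep_st0"
begin

section \<open>The slice\<close>

lemma xR: "x \<in> Rep" and x_stable: "stable (\<iota> x)" and x_moment: "satisfies_moment_map (\<iota> x)"
  using x by (simp_all add: Rep_st0_def)

text \<open>
  By stability of \<open>x\<close> there are covariants with prescribed values at \<open>x\<close>.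
\<close>

definition frame_cov :: "'v \<Rightarrow> nat \<Rightarrow> ('v, 'e) framed_tuple \<Rightarrow> complex vec" where
  "frame_cov v c = (SOME F. Cov v F \<and> F x = unit_vec (d v) c)"

lemma frame_cov: "v \<in> verts Q \<Longrightarrow> Cov v (frame_cov v c)" "v \<in> verts Q \<Longrightarrow> frame_cov v c x = unit_vec (d v) c"
proof -
  assume v: "v \<in> verts Q"
  have "\<exists>F. Cov v F \<and> F x = unit_vec (d v) c"
    using x_stable v unit_vec_carrier unfolding stable_iff_Cov[OF xR] by blast
  from someI_ex[OF this] show "Cov v (frame_cov v c)" "frame_cov v c x = unit_vec (d v) c" unfolding frame_cov_def by blast+
qed

definition frame_mat :: "'v \<Rightarrow> ('v, 'e) framed_tuple \<Rightarrow> complex mat" where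
  "frame_mat v y = mat (d v) (d v) (\<lambda>(r, c). frame_cov v c y $ r)"

lemma frame_mat_carrier: "frame_mat v y \<in> carrier_mat (d v) (d v)"
  by (simp add: frame_mat_def)

lemma frame_mat_x: "v \<in> verts Q \<Longrightarrow> frame_mat v x = 1\<^sub>m (d v)"
  by (intro eq_matI) (auto simp: frame_mat_def frame_cov)

lemma frame_mat_act:
  assumes g: "g \<in> GrpP" and y: "y \<in> Rep" and v: "v \<in> verts Q"
  shows "frame_mat v (act g y) = g v * frame_mat v y"
proof (rule eq_matI)
  note G = GrpP_carrier[OF g v]
  fix r c assume "r < dim_row (g v * frame_mat v y)" "c < dim_col (g v * frame_mat v y)"
  then have rc: "r < d v" "c < d v" using G by (simp_all add: frame_mat_def)
  have "frame_mat v (act g y) $$ (r, c) = (g v *\<^sub>v frame_cov v c y) $ r"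
    using rc Cov_equivariant[OF frame_cov(1)[OF v] g y] by (simp add: frame_mat_def del: index_mult_mat_vec)
  also have "\<dots> = (g v * frame_mat v y) $$ (r, c)"
    unfolding mult_mat_vec_entry[OF G Cov_carrier[OF frame_cov(1)[OF v] y] rc(1)] mult_mat_entry[OF G frame_mat_carrier rc]
    using rc by (intro sum.cong) (auto simp: frame_mat_def)
  finally show "frame_mat v (act g y) $$ (r, c) = (g v * frame_mat v y) $$ (r, c)" .
qed (use GrpP_carrier[OF g v] in \<open>simp_all add: frame_mat_def\<close>)

lemma frame_mat_Rep_polys: "v \<in> verts Q \<Longrightarrow> mat_in Rep_polys (d v) (d v) (frame_mat v)"
  unfolding mat_in_def using Cov_Rep_polys[OF frame_cov(1)] by (simp add: frame_mat_def)

text \<open>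
  The product of the minors that column reduction inverts.
\<close>

definition \<Delta> :: "('v, 'e) framed_tuple \<Rightarrow> complex" where
  "\<Delta> y = (\<Prod>v\<in>verts Q. \<Prod>c<k v. det (trailing_block (d v) c (frame_mat v y)))"

lemma trailing_block_frame_mat_Rep_polys:
  assumes v: "v \<in> verts Q" and c: "c < d v"
  shows "mat_in Rep_polys (d v - c - 1) (d v - c - 1) (\<lambda>y. trailing_block (d v) c (frame_mat v y))"
proof -
  have "(\<lambda>y. frame_mat v y $$ (i, j)) \<in> Rep_polys" if "i < d v" "j < d v" for i j
    using frame_mat_Rep_polys[OF v] that unfolding mat_in_def by blast
  note ent = this
  show ?thesis
    unfolding mat_in_def
  proof (intro conjI allI impI trailing_block_carrier)
    fix i j assume ij: "i < d v - c - 1 \<and> j < d v - c - 1"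
    have "(\<lambda>y. frame_mat v y $$ (c + 1 + i, c + 1 + j)) \<in> Rep_polys" by (rule ent) (use ij in auto)
    then show "(\<lambda>y. trailing_block (d v) c (frame_mat v y) $$ (i, j)) \<in> Rep_polys" using ij by (simp add: trailing_block_def)
  qed
qed

lemma \<Delta>_Rep_polys: "\<Delta> \<in> Rep_polys"
  unfolding \<Delta>_def
proof (intro fun_algebra_prod Rep_polys_algebra fun_algebra_det)
  fix v c assume "v \<in> verts Q" "c \<in> {..<k v}"
  then show "mat_in Rep_polys (d v - c - 1) (d v - c - 1) (\<lambda>y. trailing_block (d v) c (frame_mat v y))"
    using trailing_block_frame_mat_Rep_polys k_le_d[of v] by simp
qed

lemma \<Delta>_nonzero: "\<Delta> y \<noteq> 0 \<longleftrightarrow> (\<forall>v\<in>verts Q. \<forall>c<k v. det (trailing_block (d v) c (frame_mat v y)) \<noteq> 0)"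
  unfolding \<Delta>_def by (auto simp: Ball_def)

text \<open>
  The component at \<open>v\<close> of an equivariant map to the group, defined near \<open>x\<close> and with value \<open>1\<close> there. The group acts on
  frames by multiplication from the left, and column reduction is compatible with this action.
\<close>

definition phi :: "'v \<Rightarrow> ('v, 'e) framed_tuple \<Rightarrow> complex mat" where
  "phi v y = column_reduced (d v) (k v) (frame_mat v y)"

definition slice_dom :: "('v, 'e) framed_tuple set" where
  "slice_dom = {y \<in> Rep_st0. \<Delta> y \<noteq> 0 \<and> (\<forall>v\<in>verts Q. det (phi v y) \<noteq> 0)}"

definition \<phi> :: "('v, 'e) framed_tuple \<Rightarrow> 'v \<Rightarrow> complex mat" where
  "\<phi> y = (\<lambda>v\<in>verts Q. phi v y)"

lemma phi_carrier: "phi v y \<in> carrier_mat (d v) (d v)"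
  unfolding phi_def by (rule column_reduced_carrier)

lemma phi_lieP:
  assumes v: "v \<in> verts Q" and "\<Delta> y \<noteq> 0"
  shows "phi v y \<in> lieP v"
  using assms phi_carrier column_reduced_zero unfolding lieP_def phi_def \<Delta>_nonzero by auto

lemma \<phi>_GrpP: "y \<in> slice_dom \<Longrightarrow> \<phi> y \<in> GrpP"
  unfolding GrpP_iff slice_dom_def by (auto simp: \<phi>_def phi_lieP)

lemma phi_act:
  assumes g: "g \<in> GrpP" and y: "y \<in> Rep" and D: "\<Delta> y \<noteq> 0" and v: "v \<in> verts Q"
  shows "phi v (act g y) = g v * phi v y"
  unfolding phi_def frame_mat_act[OF g y v]
proof (rule column_reduced_mult[OF GrpP_carrier[OF g v] frame_mat_carrier])
  fix c assume c: "c < k v" "c < d v"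
  show "column_coeffs (d v) c (g v * frame_mat v y) = column_coeffs (d v) c (frame_mat v y)"
  proof (rule column_coeffs_mult[OF GrpP_carrier[OF g v] frame_mat_carrier c(2)])
    show "g v $$ (r, l) = 0" if "r < d v" "l \<le> c" "c < r" for r l
      using GrpP_lieP[OF g v] that c unfolding lieP_def by auto
    show "det (trailing_block (d v) c (g v)) \<noteq> 0" by (rule det_trailing_block_lieP[OF v GrpP_lieP[OF g v] GrpP_det[OF g v] c(1)])
    show "det (trailing_block (d v) c (frame_mat v y)) \<noteq> 0" using D v c unfolding \<Delta>_nonzero by blast
  qed
qed

lemma \<Delta>_act:
  assumes g: "g \<in> GrpP" and y: "y \<in> Rep" and D: "\<Delta> y \<noteq> 0"
  shows "\<Delta> (act g y) \<noteq> 0"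
  unfolding \<Delta>_nonzero
proof (intro ballI allI impI)
  fix v c assume v: "v \<in> verts Q" and c: "c < k v"
  have cd: "c < d v" using c k_le_d[OF v] by simp
  have "trailing_block (d v) c (frame_mat v (act g y)) = trailing_block (d v) c (g v) * trailing_block (d v) c (frame_mat v y)"
    unfolding frame_mat_act[OF g y v]
    by (rule trailing_block_mult[OF GrpP_carrier[OF g v] frame_mat_carrier cd]) (use GrpP_lieP[OF g v] c in \<open>auto simp: lieP_def\<close>)
  then show "det (trailing_block (d v) c (frame_mat v (act g y))) \<noteq> 0"
    using det_mult[OF trailing_block_carrier trailing_block_carrier, of "d v" c "g v" "frame_mat v y"]
      det_trailing_block_lieP[OF v GrpP_lieP[OF g v] GrpP_det[OF g v] c] D v c unfolding \<Delta>_nonzero by simp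
qed

lemma slice_dom_Rep: "y \<in> slice_dom \<Longrightarrow> y \<in> Rep"
  by (simp add: slice_dom_def Rep_st0_def)

lemma slice_dom_act:
  assumes g: "g \<in> GrpP" and y: "y \<in> slice_dom"
  shows "act g y \<in> slice_dom"
proof -
  have y': "y \<in> Rep" "\<Delta> y \<noteq> 0" "\<And>v. v \<in> verts Q \<Longrightarrow> det (phi v y) \<noteq> 0" "y \<in> Rep_st0"
    using y slice_dom_Rep by (auto simp: slice_dom_def)
  show ?thesis
    unfolding slice_dom_def
    using Rep_st0_act[OF g y'(4)] \<Delta>_act[OF g y'(1,2)] y'(3) GrpP_det[OF g] phi_act[OF g y'(1,2)]
      det_mult[OF GrpP_carrier[OF g] phi_carrier] by simp
qed

lemma \<phi>_act:
  assumes "g \<in> GrpP" "y \<in> slice_dom"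
  shows "\<phi> (act g y) = gmul g (\<phi> y)"
  using phi_act[OF assms(1) slice_dom_Rep[OF assms(2)]] assms(2)
  by (auto simp: \<phi>_def gmul_def slice_dom_def fun_eq_iff)

lemma phi_x: "v \<in> verts Q \<Longrightarrow> phi v x = 1\<^sub>m (d v)"
  unfolding phi_def by (simp add: frame_mat_x column_reduced_one)

lemma x_slice_dom: "x \<in> slice_dom"
proof -
  have "det (trailing_block (d v) c (frame_mat v x)) \<noteq> 0" if "v \<in> verts Q" "c < k v" for v c
    using frame_mat_x[OF that(1)] trailing_block_one[of c "d v"] that k_le_d[OF that(1)] by simp
  then have "\<Delta> x \<noteq> 0" unfolding \<Delta>_nonzero by blast
  then show ?thesis unfolding slice_dom_def using x by (simp add: phi_x)
qed

lemma \<phi>_x: "\<phi> x = gunit"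
  by (auto simp: \<phi>_def gunit_def phi_x fun_eq_iff)

text \<open>
  The denominators are the minors that occur in \<open>\<Delta>\<close>.
\<close>

lemma phi_fractions:
  assumes v: "v \<in> verts Q" and U: "U \<subseteq> {y \<in> Rep_st0. \<Delta> y \<noteq> 0}"
  shows "mat_in (fractions U) (d v) (d v) (phi v)"
  unfolding mat_in_def
proof (intro conjI allI impI phi_carrier)
  have UR: "U \<subseteq> Rep" using U Rep_st0_Rep by blast
  fix r c assume "r < d v \<and> c < d v"
  then have rc: "r < d v" "c < d v" by auto
  have fr: "(\<lambda>y. frame_mat v y $$ (i, j)) \<in> fractions U" if "i < d v" "j < d v" for i j
    using frame_mat_Rep_polys[OF v] that Rep_polys_fractions[OF _ UR] unfolding mat_in_def by blast
  show "(\<lambda>y. phi v y $$ (r, c)) \<in> fractions U"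
  proof (cases "c < k v")
    case True
    have T: "mat_in (fractions U) (d v - c - 1) (d v - c - 1) (\<lambda>y. trailing_block (d v) c (frame_mat v y))"
      using trailing_block_frame_mat_Rep_polys[OF v rc(2)] Rep_polys_fractions[OF _ UR] unfolding mat_in_def by blast
    have "fraction_mat U (d v - c - 1) (d v - c - 1) (\<lambda>y. minv (trailing_block (d v) c (frame_mat v y)))"
      by (rule fraction_mat_minv[OF T]) (use U True v \<Delta>_nonzero in blast)
    then have m: "(\<lambda>y. minv (trailing_block (d v) c (frame_mat v y)) $$ (s, t)) \<in> fractions U"
      and mc: "y \<in> U \<Longrightarrow> minv (trailing_block (d v) c (frame_mat v y)) \<in> carrier_mat (d v - c - 1) (d v - c - 1)"
      if "s < d v - c - 1" "t < d v - c - 1" for s t y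
      using that unfolding fraction_mat_def by blast+
    have u: "(\<lambda>y. column_coeffs (d v) c (frame_mat v y) $ s) \<in> fractions U" if s: "s < d v - c - 1" for s
    proof (rule fractions_cong)
      show "(\<lambda>y. \<Sum>t<d v - c - 1. minv (trailing_block (d v) c (frame_mat v y)) $$ (s, t) * frame_mat v y $$ (c + 1 + t, c)) \<in> fractions U"
        using s rc by (intro fun_algebra_sum fun_algebra_mult fractions_algebra m fr) auto
      show "column_coeffs (d v) c (frame_mat v y) $ s = (\<Sum>t<d v - c - 1. minv (trailing_block (d v) c (frame_mat v y)) $$ (s, t) * frame_mat v y $$ (c + 1 + t, c))"
        if "y \<in> U" for y
        unfolding column_coeffs_def mult_mat_vec_entry[OF mc[OF s s that] trailing_column_carrier s]
        by (intro sum.cong) (auto simp: trailing_column_def)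
    qed
    have "(\<lambda>y. frame_mat v y $$ (r, c) + - (\<Sum>s<d v - c - 1. frame_mat v y $$ (r, c + 1 + s) * column_coeffs (d v) c (frame_mat v y) $ s)) \<in> fractions U"
      using rc by (intro fun_algebra_sum fun_algebra_mult fun_algebra_add fun_algebra_uminus fractions_algebra fr u) auto
    then show ?thesis using rc True by (simp add: phi_def column_reduced_def)
  next
    case False
    then show ?thesis using fr[OF rc] rc by (simp add: phi_def column_reduced_def)
  qed
qed

text \<open>
  Where \<open>\<Delta>\<close> does not vanish, the determinants of \<open>phi\<close> are quotients of polynomials, and their
  zeros are those of the numerators.
\<close>

lemma zopen_slice_dom: "zopen slice_dom"
proof -
  let ?U = "{y \<in> Rep_st0. \<Delta> y \<noteq> 0}"
  have "(\<lambda>y. \<Prod>v\<in>verts Q. det (phi v y)) \<in> fractions ?U"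
    by (rule fun_algebra_prod[OF fractions_algebra], rule fun_algebra_det[OF fractions_algebra phi_fractions[OF _ order_refl]])
  then obtain p r where pr: "fraction_on ?U (\<lambda>y. \<Prod>v\<in>verts Q. det (phi v y)) p r" unfolding fractions_def by blast
  obtain q where q: "q \<in> polys" "\<forall>y\<in>Rep. \<Delta> y = q y" using \<Delta>_Rep_polys unfolding Rep_polys_def by blast
  have "y \<in> slice_dom \<longleftrightarrow> y \<in> Rep_st0 \<and> q y * p y \<noteq> 0" for y
  proof -
    have "(\<forall>v\<in>verts Q. det (phi v y) \<noteq> 0) \<longleftrightarrow> p y \<noteq> 0" if "y \<in> Rep_st0" "\<Delta> y \<noteq> 0"
    proof -
      have "(\<Prod>v\<in>verts Q. det (phi v y)) = p y / r y" "r y \<noteq> 0" using pr that unfolding fraction_on_def by auto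
      then have "(\<Prod>v\<in>verts Q. det (phi v y)) \<noteq> 0 \<longleftrightarrow> p y \<noteq> 0" by simp
      then show ?thesis unfolding prod_zero_iff[OF finite_verts] by blast
    qed
    moreover have "\<Delta> y = q y" if "y \<in> Rep_st0" using q(2) Rep_st0_Rep[OF that] by blast
    ultimately show ?thesis unfolding slice_dom_def mem_Collect_eq mult_eq_0_iff by metis
  qed
  then have "slice_dom = {y \<in> Rep_st0. \<exists>p\<in>{\<lambda>y. q y * p y}. p y \<noteq> 0}" by auto
  moreover have "{\<lambda>y. q y * p y} \<subseteq> polys" using q(1) pr polys.mult unfolding fraction_on_def by auto
  ultimately show ?thesis unfolding zopen_def by blast
qed

text \<open>
  Moves \<open>y\<close> within its orbit to the point where \<open>\<phi>\<close> is \<open>1\<close>.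
\<close>

definition \<sigma> :: "('v, 'e) framed_tuple \<Rightarrow> ('v, 'e) framed_tuple" where
  "\<sigma> y = act (ginv (\<phi> y)) y"

lemma \<sigma>_slice_dom: "y \<in> slice_dom \<Longrightarrow> \<sigma> y \<in> slice_dom"
  unfolding \<sigma>_def by (intro slice_dom_act ginv_GrpP \<phi>_GrpP)

lemma act_\<phi>_\<sigma>: "y \<in> slice_dom \<Longrightarrow> act (\<phi> y) (\<sigma> y) = y"
  unfolding \<sigma>_def by (intro act_ginv(2) \<phi>_GrpP slice_dom_Rep)

lemma \<sigma>_x: "\<sigma> x = x"
  using act_\<phi>_\<sigma>[OF x_slice_dom] act_one[OF slice_dom_Rep[OF \<sigma>_slice_dom[OF x_slice_dom]]] unfolding \<phi>_x by simp

lemma orbit_\<sigma>: "y \<in> slice_dom \<Longrightarrow> orbit (\<sigma> y) = orbit y"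
  unfolding \<sigma>_def by (intro orbit_act ginv_GrpP \<phi>_GrpP slice_dom_Rep)

lemma \<sigma>_act:
  assumes g: "g \<in> GrpP" and y: "y \<in> slice_dom"
  shows "\<sigma> (act g y) = \<sigma> y"
proof -
  note gy = slice_dom_act[OF g y] and yR = slice_dom_Rep[OF y] and sR = slice_dom_Rep[OF \<sigma>_slice_dom[OF y]]
  note p = \<phi>_GrpP[OF y] and q = \<phi>_GrpP[OF slice_dom_act[OF g y]]
  have "act (\<phi> (act g y)) (\<sigma> y) = act g (act (\<phi> y) (\<sigma> y))"
    unfolding \<phi>_act[OF g y] by (rule act_act[symmetric, OF g p sR])
  then have "act (\<phi> (act g y)) (\<sigma> y) = act g y" unfolding act_\<phi>_\<sigma>[OF y] .
  then have "act (ginv (\<phi> (act g y))) (act (\<phi> (act g y)) (\<sigma> y)) = \<sigma> (act g y)" unfolding \<sigma>_def[of "act g y"] by simp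
  then show ?thesis unfolding act_ginv(1)[OF q sR] ..
qed

text \<open>
  The action of the inverse of \<open>\<phi> y\<close> involves \<open>minv (phi v y)\<close> on the left and the endomorphism
  induced by \<open>phi v y\<close> on the right.
\<close>

lemma coord_\<sigma>_fractions:
  assumes "\<xi> \<in> coords"
  shows "(\<lambda>y. \<xi> (\<sigma> y)) \<in> fractions slice_dom"
proof -
  have sub: "slice_dom \<subseteq> {y \<in> Rep_st0. \<Delta> y \<noteq> 0}" and R: "slice_dom \<subseteq> Rep"
    using slice_dom_Rep by (auto simp: slice_dom_def)
  have det: "det (phi v y) \<noteq> 0" if "v \<in> verts Q" "y \<in> slice_dom" for v y using that by (simp add: slice_dom_def)
  have lie: "phi v y \<in> lieP v" if "v \<in> verts Q" "y \<in> slice_dom" for v y using that phi_lieP by (simp add: slice_dom_def)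
  have m: "fraction_mat slice_dom (d v) (d v) (\<lambda>y. minv (phi v y))" if "v \<in> verts Q" for v
    by (rule fraction_mat_minv[OF phi_fractions[OF that sub] det[OF that]])
  have i: "fraction_mat slice_dom (dhat v) (dhat v) (\<lambda>y. induced_inv v (minv (phi v y)))" if v: "v \<in> verts Q" for v
  proof (rule fraction_mat_cong)
    have "fraction_mat slice_dom (d v) (d v) (phi v)" using phi_fractions[OF v sub] unfolding mat_in_def fraction_mat_def by blast
    then show "fraction_mat slice_dom (dhat v) (dhat v) (\<lambda>y. \<pi> v * phi v y * \<rho> v)"
      by (rule fraction_mat_mult[OF fraction_mat_mult[OF fraction_mat_const[OF \<pi>_carrier[OF v]]] fraction_mat_const[OF \<rho>(1)[OF v]]])
    show "induced_inv v (minv (phi v y)) = \<pi> v * phi v y * \<rho> v" if "y \<in> slice_dom" for y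
      unfolding induced_inv_minv[OF v lie[OF v that] det[OF v that]] by (rule induced_eq[OF v lie[OF v that]])
  qed
  have entry: "(\<lambda>y. M y $$ (r, s)) \<in> fractions slice_dom" if "fraction_mat slice_dom n m M" "r < n" "s < m" for n m M r s
    using that unfolding fraction_mat_def by blast
  have cFR: "\<eta> \<in> fractions slice_dom" if "\<eta> \<in> coords" for \<eta> by (rule Rep_polys_fractions[OF Rep_polys_coord[OF that] R])
  from assms show ?thesis
  proof (cases rule: coords_cases)
    case (1 e r s)
    note t = tail_head_verts(1)[OF 1(1)] and h = tail_head_verts(2)[OF 1(1)]
    have "fraction_mat slice_dom (d (head Q e)) (dhat (tail Q e)) (\<lambda>y. arrA y e)"
      unfolding fraction_mat_def using Rep_A[OF slice_dom_Rep 1(1)] cFR[OF coords_A[OF 1(1)]] by blast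
    then have "fraction_mat slice_dom (d (head Q e)) (dhat (tail Q e)) (\<lambda>y. minv (phi (head Q e) y) * arrA y e * induced_inv (tail Q e) (minv (phi (tail Q e) y)))"
      by (intro fraction_mat_mult[OF fraction_mat_mult[OF m[OF h]] i[OF t]])
    from entry[OF this 1(2,3)] show ?thesis
      unfolding 1(4) \<sigma>_def act_def ginv_def \<phi>_def using 1(1) t h by simp
  next
    case (2 e r s)
    note t = tail_head_verts(1)[OF 2(1)] and h = tail_head_verts(2)[OF 2(1)]
    have "fraction_mat slice_dom (d (tail Q e)) (dhat (head Q e)) (\<lambda>y. arrB y e)"
      unfolding fraction_mat_def using Rep_B[OF slice_dom_Rep 2(1)] cFR[OF coords_B[OF 2(1)]] by blast
    then have "fraction_mat slice_dom (d (tail Q e)) (dhat (head Q e)) (\<lambda>y. minv (phi (tail Q e) y) * arrB y e * induced_inv (head Q e) (minv (phi (head Q e) y)))"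
      by (intro fraction_mat_mult[OF fraction_mat_mult[OF m[OF t]] i[OF h]])
    from entry[OF this 2(2,3)] show ?thesis
      unfolding 2(4) \<sigma>_def act_def ginv_def \<phi>_def using 2(1) t h by simp
  next
    case (3 v r s)
    have "fraction_mat slice_dom (d v) (f v) (\<lambda>y. frI y v)"
      unfolding fraction_mat_def using Rep_I[OF slice_dom_Rep 3(1)] cFR[OF coords_I[OF 3(1)]] by blast
    then have "fraction_mat slice_dom (d v) (f v) (\<lambda>y. minv (phi v y) * frI y v)"
      by (intro fraction_mat_mult[OF m[OF 3(1)]])
    from entry[OF this 3(2,3)] show ?thesis
      unfolding 3(4) \<sigma>_def act_def ginv_def \<phi>_def using 3(1) by simp
  next
    case (4 v r s)
    have "fraction_mat slice_dom (f v) (dhat v) (\<lambda>y. frJ y v)"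
      unfolding fraction_mat_def using Rep_J[OF slice_dom_Rep 4(1)] cFR[OF coords_J[OF 4(1)]] by blast
    then have "fraction_mat slice_dom (f v) (dhat v) (\<lambda>y. frJ y v * induced_inv v (minv (phi v y)))"
      by (intro fraction_mat_mult[OF _ i[OF 4(1)]])
    from entry[OF this 4(2,3)] show ?thesis
      unfolding 4(4) \<sigma>_def act_def ginv_def \<phi>_def using 4(1) by simp
  qed
qed

lemma poly_\<sigma>_fractions:
  assumes "p \<in> polys"
  shows "(\<lambda>y. p (\<sigma> y)) \<in> fractions slice_dom"
  using assms
proof (induction rule: polys.induct)
  case (add p q)
  then show ?case by (intro fun_algebra_add[OF fractions_algebra])
next
  case (mult p q)
  then show ?case by (intro fun_algebra_mult[OF fractions_algebra])
next
  case (const c)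
  show ?case by (rule fun_algebra_const[OF fractions_algebra])
next
  case (coordA e r s)
  show ?case by (rule coord_\<sigma>_fractions[OF coords_A[OF coordA]])
next
  case (coordB e r s)
  show ?case by (rule coord_\<sigma>_fractions[OF coords_B[OF coordB]])
next
  case (coordI v r s)
  show ?case by (rule coord_\<sigma>_fractions[OF coords_I[OF coordI]])
next
  case (coordJ v r s)
  show ?case by (rule coord_\<sigma>_fractions[OF coords_J[OF coordJ]])
qed

section \<open>Directional derivatives\<close>

text \<open>
  The velocity is taken at \<open>0\<close> and nothing is required elsewhere, so that a curve that is controlled
  for small \<open>t\<close> can be continued by a constant.
\<close>

definition curve :: "(complex \<Rightarrow> ('v, 'e) framed_tuple) \<Rightarrow> ('v, 'e) framed_tuple \<Rightarrow> bool" where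
  "curve \<gamma> u \<longleftrightarrow> \<gamma> 0 = x \<and> (\<forall>\<xi>\<in>coords. ((\<lambda>t. \<xi> (\<gamma> t)) has_field_derivative \<xi> u) (at 0))"

text \<open>
  One gradient serves all curves through \<open>x\<close>. Hence the derivative depends on the velocity only, and
  linearly.
\<close>

lemma polys_gradient:
  assumes "p \<in> polys"
  shows "\<exists>c. \<forall>\<gamma> u. curve \<gamma> u \<longrightarrow> ((\<lambda>t. p (\<gamma> t)) has_field_derivative (\<Sum>\<xi>\<in>coords. c \<xi> * \<xi> u)) (at 0)"
proof -
  have coord: "\<exists>c. \<forall>\<gamma> u. curve \<gamma> u \<longrightarrow> ((\<lambda>t. \<eta> (\<gamma> t)) has_field_derivative (\<Sum>\<xi>\<in>coords. c \<xi> * \<xi> u)) (at 0)"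
    if "\<eta> \<in> coords" for \<eta>
  proof (intro exI allI impI)
    fix \<gamma> u assume "curve \<gamma> u"
    moreover have "(\<Sum>\<xi>\<in>coords. (if \<xi> = \<eta> then 1 else 0) * \<xi> u) = (\<Sum>\<xi>\<in>coords. if \<xi> = \<eta> then \<xi> u else 0)"
      by (intro sum.cong) auto
    ultimately show "((\<lambda>t. \<eta> (\<gamma> t)) has_field_derivative (\<Sum>\<xi>\<in>coords. (if \<xi> = \<eta> then 1 else 0) * \<xi> u)) (at 0)"
      using that finite_coords by (simp add: curve_def)
  qed
  show ?thesis
    using assms
  proof (induction rule: polys.induct)
    case (const c)
    show ?case by (intro exI[of _ "\<lambda>_. 0"]) simp
  next
    case (add p q)
    then obtain c c' where "\<forall>\<gamma> u. curve \<gamma> u \<longrightarrow> ((\<lambda>t. p (\<gamma> t)) has_field_derivative (\<Sum>\<xi>\<in>coords. c \<xi> * \<xi> u)) (at 0)"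
      "\<forall>\<gamma> u. curve \<gamma> u \<longrightarrow> ((\<lambda>t. q (\<gamma> t)) has_field_derivative (\<Sum>\<xi>\<in>coords. c' \<xi> * \<xi> u)) (at 0)" by blast
    then show ?case
      by (intro exI[of _ "\<lambda>\<xi>. c \<xi> + c' \<xi>"]) (auto intro!: DERIV_add simp: distrib_right sum.distrib)
  next
    case (mult p q)
    then obtain c c' where c: "\<forall>\<gamma> u. curve \<gamma> u \<longrightarrow> ((\<lambda>t. p (\<gamma> t)) has_field_derivative (\<Sum>\<xi>\<in>coords. c \<xi> * \<xi> u)) (at 0)"
      "\<forall>\<gamma> u. curve \<gamma> u \<longrightarrow> ((\<lambda>t. q (\<gamma> t)) has_field_derivative (\<Sum>\<xi>\<in>coords. c' \<xi> * \<xi> u)) (at 0)" by blast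
    show ?case
    proof (intro exI allI impI)
      fix \<gamma> u assume \<gamma>: "curve \<gamma> u"
      then have "\<gamma> 0 = x" by (simp add: curve_def)
      moreover have "(\<Sum>\<xi>\<in>coords. (c \<xi> * q x + c' \<xi> * p x) * \<xi> u) = (\<Sum>\<xi>\<in>coords. c \<xi> * \<xi> u) * q x + (\<Sum>\<xi>\<in>coords. c' \<xi> * \<xi> u) * p x"
        unfolding sum_distrib_right sum.distrib[symmetric] by (intro sum.cong) (auto simp: algebra_simps)
      ultimately show "((\<lambda>t. p (\<gamma> t) * q (\<gamma> t)) has_field_derivative (\<Sum>\<xi>\<in>coords. (c \<xi> * q x + c' \<xi> * p x) * \<xi> u)) (at 0)"
        using DERIV_mult[OF c(1)[rule_format, OF \<gamma>] c(2)[rule_format, OF \<gamma>]] by simp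
    qed
  qed (use coord coords_A coords_B coords_I coords_J in blast)+
qed

definition dir_deriv :: "(('v, 'e) framed_tuple \<Rightarrow> complex) \<Rightarrow> ('v, 'e) framed_tuple \<Rightarrow> complex" where
  "dir_deriv p u = (\<Sum>\<xi>\<in>coords. (SOME c. \<forall>\<gamma> u. curve \<gamma> u \<longrightarrow>
     ((\<lambda>t. p (\<gamma> t)) has_field_derivative (\<Sum>\<xi>\<in>coords. c \<xi> * \<xi> u)) (at 0)) \<xi> * \<xi> u)"

lemma dir_deriv:
  assumes "p \<in> polys" "curve \<gamma> u"
  shows "((\<lambda>t. p (\<gamma> t)) has_field_derivative dir_deriv p u) (at 0)"
  using someI_ex[OF polys_gradient[OF assms(1)]] assms(2) unfolding dir_deriv_def by blast

lemma dir_deriv_lin: "lin (dir_deriv p)"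
  unfolding dir_deriv_def by (intro lin_sum lin_cmult lin_coord)

lemma curve_line:
  assumes "u \<in> Rep"
  shows "curve (\<lambda>t. rep_add x (rep_smult t u)) u"
  unfolding curve_def
proof (intro conjI ballI)
  show "rep_add x (rep_smult 0 u) = x"
    by (intro Rep_eqI rep_add_Rep rep_smult_Rep xR assms) (simp add: coord_add coord_smult xR assms rep_smult_Rep)
  fix \<xi> assume "\<xi> \<in> coords"
  then have "(\<lambda>t. \<xi> (rep_add x (rep_smult t u))) = (\<lambda>t. \<xi> x + t * \<xi> u)"
    by (simp add: coord_add coord_smult xR assms rep_smult_Rep)
  moreover have "((\<lambda>t. \<xi> x + t * \<xi> u) has_field_derivative \<xi> u) (at 0)"
    by (auto intro!: derivative_eq_intros)
  ultimately show "((\<lambda>t. \<xi> (rep_add x (rep_smult t u))) has_field_derivative \<xi> u) (at 0)" by simp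
qed

text \<open>
  The quotient rule for \<open>p / r\<close> at \<open>x\<close>.
\<close>

definition quot_deriv where
  "quot_deriv p r u = (dir_deriv p u * r x - p x * dir_deriv r u) / (r x * r x)"

lemma quot_deriv:
  assumes "p \<in> polys" "r \<in> polys" "r x \<noteq> 0" "curve \<gamma> u"
  shows "((\<lambda>t. p (\<gamma> t) / r (\<gamma> t)) has_field_derivative quot_deriv p r u) (at 0)"
proof -
  have "\<gamma> 0 = x" using assms(4) by (simp add: curve_def)
  then show ?thesis
    using DERIV_divide[OF dir_deriv[OF assms(1,4)] dir_deriv[OF assms(2,4)]] assms(3) by (simp add: quot_deriv_def)
qed

lemma quot_deriv_lin: "lin (quot_deriv p r)"
  using dir_deriv_lin[of p] dir_deriv_lin[of r] unfolding quot_deriv_def lin_def by (simp add: field_simps add_divide_distrib diff_divide_distrib)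

section \<open>Curves in the zero locus of the moment map\<close>

text \<open>
  The zero locus of the moment map is smooth at \<open>x\<close>: every cycle \<open>u\<close> is the velocity of a curve in it.
  The curve is \<open>x + z\<close> with \<open>z = t u + (\<Sum>\<alpha>. w \<alpha> (b \<alpha>))\<close>, where \<open>dmu x\<close> maps the \<open>b \<alpha>\<close> to the unit
  vectors, hence \<open>z\<close> to \<open>w\<close>. Since \<open>dmu x x = 0\<close>, the condition is \<open>2 w + dmu z z = 0\<close>, which has a
  solution \<open>w\<close> of order \<open>t\<^sup>2\<close>.
\<close>

lemma tangent_curve:
  assumes u: "u \<in> cycles x" and U: "zopen U" "x \<in> U"
  shows "\<exists>\<gamma>. curve \<gamma> u \<and> (\<forall>t. \<gamma> t \<in> U)"
proof -
  have uR: "u \<in> Rep" and du: "dmu x u = dmu_zero" using u by (auto simp: cycles_def)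
  have "\<exists>w\<in>Rep. \<forall>\<tau>\<in>dmu_index. dmu_comp x w \<tau> = (if \<tau> = \<alpha> then 1 else 0)" for \<alpha>
    by (rule dmu_comp_surj[OF xR x_stable])
  then obtain b where b: "\<And>\<alpha>. b \<alpha> \<in> Rep" "\<And>\<alpha> \<tau>. \<tau> \<in> dmu_index \<Longrightarrow> dmu_comp x (b \<alpha>) \<tau> = (if \<tau> = \<alpha> then 1 else 0)"
    by metis
  define cf where "cf \<tau> \<xi> \<eta> = dmu_comp (unit_rep \<xi>) (unit_rep \<eta>) \<tau>" for \<tau> \<xi> \<eta>
  define z where "z t w = mkrep (\<lambda>\<xi>. t * \<xi> u + (\<Sum>\<alpha>\<in>dmu_index. w \<alpha> * \<xi> (b \<alpha>)))" for t w
  have zR: "z t w \<in> Rep" for t w unfolding z_def by (rule mkrep_Rep)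
  have zc: "\<xi> (z t w) = t * \<xi> u + (\<Sum>\<alpha>\<in>dmu_index. w \<alpha> * \<xi> (b \<alpha>))" if "\<xi> \<in> coords" for \<xi> t w
    unfolding z_def by (rule coord_mkrep[OF that])
  have expand: "dmu_comp a c \<tau> = (\<Sum>\<xi>\<in>coords. \<Sum>\<eta>\<in>coords. cf \<tau> \<xi> \<eta> * \<xi> a * \<eta> c)"
    if "a \<in> Rep" "c \<in> Rep" "\<tau> \<in> dmu_index" for a c \<tau>
    using that dmu_bilinear_expansion[OF that(1,2)] by (auto simp: dmu_index_def dmu_comp_def cf_def)
  \<comment> \<open>The linear part of the equation; \<open>u\<close> does not contribute because it is a cycle.\<close>
  have xz: "dmu_comp x (z t w) \<tau> = w \<tau>" if \<tau>: "\<tau> \<in> dmu_index" for t w \<tau>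
  proof -
    note L = dmu_comp_lin[OF xR \<tau>]
    let ?L = "\<lambda>\<xi>. dmu_comp x (unit_rep \<xi>) \<tau>"
    have "dmu_comp x (z t w) \<tau> = (\<Sum>\<xi>\<in>coords. (t * \<xi> u + (\<Sum>\<alpha>\<in>dmu_index. w \<alpha> * \<xi> (b \<alpha>))) * ?L \<xi>)"
      unfolding lin_expansion[OF L zR] by (intro sum.cong refl) (simp only: zc)
    also have "\<dots> = t * (\<Sum>\<xi>\<in>coords. \<xi> u * ?L \<xi>) + (\<Sum>\<xi>\<in>coords. \<Sum>\<alpha>\<in>dmu_index. w \<alpha> * (\<xi> (b \<alpha>) * ?L \<xi>))"
      by (simp add: distrib_right sum.distrib sum_distrib_left sum_distrib_right mult.assoc)
    also have "(\<Sum>\<xi>\<in>coords. \<xi> u * ?L \<xi>) = dmu_comp x u \<tau>" by (rule lin_expansion[OF L uR, symmetric])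
    also have "\<dots> = 0" using \<tau> by (auto simp: dmu_comp_def du dmu_zero_def dmu_index_def)
    also have "(\<Sum>\<xi>\<in>coords. \<Sum>\<alpha>\<in>dmu_index. w \<alpha> * (\<xi> (b \<alpha>) * ?L \<xi>)) = (\<Sum>\<alpha>\<in>dmu_index. w \<alpha> * (\<Sum>\<xi>\<in>coords. \<xi> (b \<alpha>) * ?L \<xi>))"
      unfolding sum_distrib_left by (rule sum.swap)
    also have "\<dots> = (\<Sum>\<alpha>\<in>dmu_index. if \<tau> = \<alpha> then w \<alpha> else 0)"
      by (intro sum.cong refl) (simp add: lin_expansion[OF L b(1), symmetric] b(2)[OF \<tau>])
    also have "\<dots> = w \<tau>" using \<tau> finite_dmu_index by simp
    finally show ?thesis by simp
  qed
  obtain \<epsilon> \<kappa> where \<epsilon>: "\<epsilon> > 0" "\<kappa> \<ge> 0" and "\<forall>t. cmod t \<le> \<epsilon> \<longrightarrow>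
    (\<exists>w. (\<Sum>i\<in>dmu_index. cmod (w i)) \<le> \<kappa> * (cmod t)\<^sup>2 \<and> (\<forall>i\<in>dmu_index. w i =
      - ((\<Sum>\<xi>\<in>coords. \<Sum>\<eta>\<in>coords. cf i \<xi> \<eta> * (t * \<xi> u + (\<Sum>\<alpha>\<in>dmu_index. w \<alpha> * \<xi> (b \<alpha>))) * (t * \<eta> u + (\<Sum>\<alpha>\<in>dmu_index. w \<alpha> * \<eta> (b \<alpha>)))) / 2)))"
    using quadratic_fixed_point[OF finite_dmu_index finite_coords, of cf "\<lambda>\<xi>. \<xi> u" "\<lambda>\<alpha> \<xi>. \<xi> (b \<alpha>)"] by blast
  then have "\<forall>t. \<exists>w. cmod t \<le> \<epsilon> \<longrightarrow> (\<Sum>i\<in>dmu_index. cmod (w i)) \<le> \<kappa> * (cmod t)\<^sup>2 \<and> (\<forall>i\<in>dmu_index. w i = - (dmu_comp (z t w) (z t w) i / 2))"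
    by (simp add: expand[OF zR zR] zc cong: sum.cong)
  then obtain w where w: "\<And>t. cmod t \<le> \<epsilon> \<Longrightarrow> (\<Sum>i\<in>dmu_index. cmod (w t i)) \<le> \<kappa> * (cmod t)\<^sup>2"
    "\<And>t i. cmod t \<le> \<epsilon> \<Longrightarrow> i \<in> dmu_index \<Longrightarrow> w t i = - (dmu_comp (z t (w t)) (z t (w t)) i / 2)" by metis
  define \<gamma>0 where "\<gamma>0 t = rep_add x (z t (w t))" for t
  have \<gamma>0R: "\<gamma>0 t \<in> Rep" for t unfolding \<gamma>0_def by (intro rep_add_Rep xR zR)
  have \<gamma>0c: "\<xi> (\<gamma>0 t) = \<xi> x + (t * \<xi> u + (\<Sum>\<alpha>\<in>dmu_index. w t \<alpha> * \<xi> (b \<alpha>)))" if "\<xi> \<in> coords" for \<xi> t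
    unfolding \<gamma>0_def coord_add[OF that xR zR] zc[OF that] ..
  have wle: "cmod (w t i) \<le> \<kappa> * (cmod t)\<^sup>2" if "i \<in> dmu_index" "cmod t \<le> \<epsilon>" for t i
    using w(1)[OF that(2)] member_le_sum[OF that(1), of "\<lambda>i. cmod (w t i)"] finite_dmu_index by simp
  have wderiv: "((\<lambda>t. w t i) has_field_derivative 0) (at 0)" if "i \<in> dmu_index" for i
    by (rule quadratic_bound_derivative[OF \<epsilon>(1) wle[OF that]])
  have w0: "w 0 i = 0" if "i \<in> dmu_index" for i using wle[OF that, of 0] \<epsilon>(1) by simp
  have c0: "curve \<gamma>0 u"
    unfolding curve_def
  proof (intro conjI ballI)
    show "\<gamma>0 0 = x" by (rule Rep_eqI[OF \<gamma>0R xR]) (simp add: \<gamma>0c w0)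
    fix \<xi> assume \<xi>: "\<xi> \<in> coords"
    have "((\<lambda>t. \<xi> x + (t * \<xi> u + (\<Sum>\<alpha>\<in>dmu_index. w t \<alpha> * \<xi> (b \<alpha>)))) has_field_derivative
        (0 + (1 * \<xi> u + (\<Sum>\<alpha>\<in>dmu_index. 0 * \<xi> (b \<alpha>))))) (at 0)"
      by (intro DERIV_add DERIV_const DERIV_cmult_right DERIV_ident DERIV_sum wderiv)
    then show "((\<lambda>t. \<xi> (\<gamma>0 t)) has_field_derivative \<xi> u) (at 0)" by (simp add: \<gamma>0c[OF \<xi>])
  qed
  have moment: "dmu (\<gamma>0 t) (\<gamma>0 t) = dmu_zero" if t: "cmod t \<le> \<epsilon>" for t
    unfolding dmu_eq_zero_iff[OF \<gamma>0R \<gamma>0R]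
  proof (intro ballI allI impI)
    fix v r c assume v: "v \<in> verts Q" and r: "r < d v" and c: "c < dhat v"
    let ?\<tau> = "(v, r, c)" and ?z = "z t (w t)"
    have \<tau>: "?\<tau> \<in> dmu_index" using v r c by (simp add: dmu_index_def)
    have add: "dmu_comp a (rep_add x ?z) ?\<tau> = dmu_comp a x ?\<tau> + dmu_comp a ?z ?\<tau>" if "a \<in> Rep" for a
      using dmu_comp_lin[OF that \<tau>] xR zR unfolding lin_def by blast
    have sym: "dmu_comp a c' ?\<tau> = dmu_comp c' a ?\<tau>" if "a \<in> Rep" "c' \<in> Rep" for a c'
      using dmu_sym[OF that v r c] by (simp add: dmu_comp_def)
    have "dmu_comp x x ?\<tau> = 0"
      using satisfies_moment_map_iff(2)[OF xR] x_moment v r c by (simp add: dmu_comp_def dmu_zero_def)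
    moreover have "dmu_comp (\<gamma>0 t) (\<gamma>0 t) ?\<tau> = dmu_comp x x ?\<tau> + 2 * dmu_comp x ?z ?\<tau> + dmu_comp ?z ?z ?\<tau>"
      unfolding \<gamma>0_def add[OF rep_add_Rep[OF xR zR]] sym[OF rep_add_Rep[OF xR zR] xR] sym[OF rep_add_Rep[OF xR zR] zR] add[OF xR] add[OF zR]
      using sym[OF zR xR] by simp
    moreover have "dmu_comp x ?z ?\<tau> = - (dmu_comp ?z ?z ?\<tau> / 2)" unfolding xz[OF \<tau>] using w(2)[OF t \<tau>] by simp
    ultimately show "dmu (\<gamma>0 t) (\<gamma>0 t) v $$ (r, c) = 0" by (simp add: dmu_comp_def)
  qed
  \<comment> \<open>Stability and membership in \<open>U\<close> are the nonvanishing of polynomials, so they persist near \<open>t = 0\<close>.\<close>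
  obtain S where S: "S \<subseteq> polys" "U = {y \<in> Rep_st0. \<exists>p\<in>S. p y \<noteq> 0}" using U(1) unfolding zopen_def by blast
  then obtain p where p: "p \<in> S" "p x \<noteq> 0" using U(2) by blast
  have "(\<lambda>y. \<Prod>v\<in>verts Q. det (frame_mat v y)) \<in> Rep_polys"
    by (rule fun_algebra_prod[OF Rep_polys_algebra], rule fun_algebra_det[OF Rep_polys_algebra frame_mat_Rep_polys])
  then obtain q where q: "q \<in> polys" "\<forall>y\<in>Rep. (\<Prod>v\<in>verts Q. det (frame_mat v y)) = q y" unfolding Rep_polys_def by blast
  have qx: "q x \<noteq> 0" using q(2) xR by (simp add: frame_mat_x flip: q(2)[rule_format, OF xR])
  have pq: "(\<lambda>y. p y * q y) \<in> polys" using p(1) S(1) q(1) by (intro polys.mult) auto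
  have "isCont (\<lambda>t. p (\<gamma>0 t) * q (\<gamma>0 t)) 0" using DERIV_isCont[OF dir_deriv[OF pq c0]] .
  moreover have "p (\<gamma>0 0) * q (\<gamma>0 0) \<noteq> 0" using c0 p(2) qx by (simp add: curve_def)
  ultimately have "eventually (\<lambda>t. p (\<gamma>0 t) * q (\<gamma>0 t) \<noteq> 0) (at 0)"
    unfolding isCont_def by (rule tendsto_imp_eventually_ne)
  then obtain \<epsilon>' where \<epsilon>': "\<epsilon>' > 0" "\<And>t. t \<noteq> 0 \<Longrightarrow> cmod t < \<epsilon>' \<Longrightarrow> p (\<gamma>0 t) * q (\<gamma>0 t) \<noteq> 0"
    unfolding eventually_at by (auto simp: dist_norm)
  have inU: "\<gamma>0 t \<in> U" if t: "t \<noteq> 0" "cmod t < min \<epsilon> \<epsilon>'" for t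
  proof -
    have ne: "p (\<gamma>0 t) \<noteq> 0" "q (\<gamma>0 t) \<noteq> 0" using \<epsilon>'(2)[of t] t by auto
    then have "det (frame_mat v (\<gamma>0 t)) \<noteq> 0" if "v \<in> verts Q" for v
      using q(2) \<gamma>0R[of t] that prod_zero_iff[OF finite_verts, of "\<lambda>v. det (frame_mat v (\<gamma>0 t))"] by auto
    then have "stable (\<iota> (\<gamma>0 t))"
      by (intro stable_if_invertible_covariants[OF \<gamma>0R, of frame_cov] frame_cov(1)) (simp_all add: frame_mat_def)
    moreover have "satisfies_moment_map (\<iota> (\<gamma>0 t))"
      using moment[of t] t satisfies_moment_map_iff(2)[OF \<gamma>0R] by simp
    ultimately show ?thesis using S(2) p(1) ne \<gamma>0R by (auto simp: Rep_st0_def)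
  qed
  \<comment> \<open>Away from \<open>0\<close> the curve may be constant.\<close>
  define \<gamma> where "\<gamma> t = (if cmod t < min \<epsilon> \<epsilon>' then \<gamma>0 t else x)" for t
  have "\<gamma> t \<in> U" for t
    using inU[of t] U(2) c0 by (cases "t = 0") (auto simp: \<gamma>_def curve_def)
  moreover have "curve \<gamma> u"
    unfolding curve_def
  proof (intro conjI ballI)
    show "\<gamma> 0 = x" using c0 \<epsilon>(1) \<epsilon>'(1) by (simp add: \<gamma>_def curve_def)
    fix \<xi> assume \<xi>: "\<xi> \<in> coords"
    have "eventually (\<lambda>t. \<gamma> t = \<gamma>0 t) (nhds 0)"
      unfolding eventually_nhds_metric using \<epsilon>(1) \<epsilon>'(1) by (intro exI[of _ "min \<epsilon> \<epsilon>'"]) (auto simp: \<gamma>_def dist_norm)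
    then have ev: "eventually (\<lambda>t. \<xi> (\<gamma> t) = \<xi> (\<gamma>0 t)) (nhds 0)" by (rule eventually_mono) simp
    show "((\<lambda>t. \<xi> (\<gamma> t)) has_field_derivative \<xi> u) (at 0)"
      unfolding DERIV_cong_ev[OF refl ev refl] using c0 \<xi> by (simp add: curve_def)
  qed
  ultimately show ?thesis by blast
qed

section \<open>Curves in the group\<close>

lemma curve_blocks:
  assumes \<gamma>: "curve \<gamma> u" and R: "\<And>t. \<gamma> t \<in> Rep" and u: "u \<in> Rep"
  shows "e \<in> arcs Q \<Longrightarrow> mderiv (d (head Q e)) (dhat (tail Q e)) (\<lambda>t. arrA (\<gamma> t) e) (arrA u e)"
    and "e \<in> arcs Q \<Longrightarrow> mderiv (d (tail Q e)) (dhat (head Q e)) (\<lambda>t. arrB (\<gamma> t) e) (arrB u e)"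
    and "v \<in> verts Q \<Longrightarrow> mderiv (d v) (f v) (\<lambda>t. frI (\<gamma> t) v) (frI u v)"
    and "v \<in> verts Q \<Longrightarrow> mderiv (f v) (dhat v) (\<lambda>t. frJ (\<gamma> t) v) (frJ u v)"
proof -
  have der: "((\<lambda>t. \<xi> (\<gamma> t)) has_field_derivative \<xi> u) (at 0)" if "\<xi> \<in> coords" for \<xi>
    using \<gamma> that by (simp add: curve_def)
  show "mderiv (d (head Q e)) (dhat (tail Q e)) (\<lambda>t. arrA (\<gamma> t) e) (arrA u e)" if "e \<in> arcs Q"
    unfolding mderiv_def using Rep_A[OF R that] Rep_A[OF u that] der[OF coords_A[OF that]] by blast
  show "mderiv (d (tail Q e)) (dhat (head Q e)) (\<lambda>t. arrB (\<gamma> t) e) (arrB u e)" if "e \<in> arcs Q"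
    unfolding mderiv_def using Rep_B[OF R that] Rep_B[OF u that] der[OF coords_B[OF that]] by blast
  show "mderiv (d v) (f v) (\<lambda>t. frI (\<gamma> t) v) (frI u v)" if "v \<in> verts Q"
    unfolding mderiv_def using Rep_I[OF R that] Rep_I[OF u that] der[OF coords_I[OF that]] by blast
  show "mderiv (f v) (dhat v) (\<lambda>t. frJ (\<gamma> t) v) (frJ u v)" if "v \<in> verts Q"
    unfolding mderiv_def using Rep_J[OF R that] Rep_J[OF u that] der[OF coords_J[OF that]] by blast
qed

text \<open>
  The Leibniz rule for \<open>Z H = G Y\<close> at a point where \<open>G\<close> and \<open>H\<close> are the identity.
\<close>

lemma act_block_derivative:
  assumes v: "v \<in> verts Q" and b: "b \<in> carrier_mat n n"
    and Z: "mderiv n (dhat v) Z Z'" and Y: "mderiv n (dhat v) Y Y'" and G: "mderiv n n G b" and H: "mderiv (dhat v) (dhat v) H h"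
    and 0: "Z 0 = X" "Y 0 = X" "G 0 = 1\<^sub>m n" "H 0 = 1\<^sub>m (dhat v)"
    and eq: "\<And>t. Z t * H t = G t * Y t"
  shows "Z' = Y' + (b * X - X * h)"
proof -
  have X: "X \<in> carrier_mat n (dhat v)" using mderivD(1)[OF Z] 0(1) by metis
  note z = mderivD(2)[OF Z] and y = mderivD(2)[OF Y] and h = mderivD(2)[OF H]
  have "Z' * H 0 + Z 0 * h = b * Y 0 + G 0 * Y'"
    by (rule mderiv_unique[OF mderiv_mult[OF Z H] mderiv_mult[OF G Y] eq])
  then have "Z' + X * h = b * X + Y'"
    unfolding 0 right_mult_one_mat[OF z] left_mult_one_mat[OF y] .
  then show ?thesis by (rule mat_transpose_terms[OF z mult_carrier_mat[OF X h] mult_carrier_mat[OF b X] y])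
qed

text \<open>
  Differentiate \<open>z t = g t (y t)\<close> at \<open>t = 0\<close>. Moving the inverse of the induced element to the other
  side turns each block into an identity between products, and no inverse has to be differentiated.
\<close>

lemma curve_act:
  assumes g: "\<And>t. g t \<in> GrpP" "g 0 = gunit" and \<xi>: "\<xi> \<in> LieP"
    and dg: "\<And>v. v \<in> verts Q \<Longrightarrow> mderiv (d v) (d v) (\<lambda>t. g t v) (\<xi> v)"
    and y: "curve y u1" "u1 \<in> Rep" "\<And>t. y t \<in> Rep"
    and z: "curve z u2" "u2 \<in> Rep" "\<And>t. z t = act (g t) (y t)"
  shows "u2 = rep_add u1 (jmap x \<xi>)"
proof (rule tuple_eqI[OF z(2) rep_add_Rep[OF y(2) jmap_Rep[OF xR \<xi>]]])
  have zR: "z t \<in> Rep" for t unfolding z(3) by (rule act_Rep[OF g(1) y(3)])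
  note Y = curve_blocks[OF y(1,3,2)] and Z = curve_blocks[OF z(1) zR z(2)] and L = LieP_D[OF \<xi>]
  have y0: "y 0 = x" and z0: "z 0 = x" using y(1) z(1) by (simp_all add: curve_def)
  have g0: "g 0 v = 1\<^sub>m (d v)" if "v \<in> verts Q" for v using that by (simp add: g(2) gunit_def)
  have dh: "mderiv (dhat v) (dhat v) (\<lambda>t. induced v (g t v)) (induced v (\<xi> v))" if v: "v \<in> verts Q" for v
    using mderiv_mult_const[OF \<rho>(1)[OF v] mderiv_const_mult[OF \<pi>_carrier[OF v] dg[OF v]]]
    by (simp only: induced_eq[OF v GrpP_lieP[OF g(1) v]] induced_eq[OF v L(1)[OF v]])
  have h0: "induced v (g 0 v) = 1\<^sub>m (dhat v)" if "v \<in> verts Q" for v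
    using that by (simp add: g0 induced_one)
  have cancel: "G * N * induced_inv v (g t v) * induced v (g t v) = G * N"
    if "v \<in> verts Q" "G \<in> carrier_mat n p" "N \<in> carrier_mat p (dhat v)" for G N v t n p
    unfolding assoc_mult_mat[OF mult_carrier_mat[OF that(2,3)] GrpP_inv_carrier[OF g(1) that(1)] induced_carrier[OF that(1) GrpP_lieP[OF g(1) that(1)]]]
      induced_inv_left[OF that(1) GrpP_lieP[OF g(1) that(1)] GrpP_det[OF g(1) that(1)]]
    by (rule right_mult_one_mat[OF mult_carrier_mat[OF that(2,3)]])
  show "arrA u2 e = arrA (rep_add u1 (jmap x \<xi>)) e" if e: "e \<in> arcs Q" for e
  proof -
    note t = tail_head_verts(1)[OF e] and h = tail_head_verts(2)[OF e]
    have "arrA (z s) e * induced (tail Q e) (g s (tail Q e)) = g s (head Q e) * arrA (y s) e" for s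
      using e cancel[OF t GrpP_carrier[OF g(1) h] Rep_A[OF y(3) e]] by (simp add: z(3) act_def del: assoc_mult_mat)
    then have "arrA u2 e = arrA u1 e + (\<xi> (head Q e) * arrA x e - arrA x e * induced (tail Q e) (\<xi> (tail Q e)))"
      by (intro act_block_derivative[OF t L(2)[OF h] Z(1)[OF e] Y(1)[OF e] dg[OF h] dh[OF t] _ _ g0[OF h] h0[OF t]]) (simp_all add: y0 z0)
    then show ?thesis using e by (simp add: rep_add_def jmap_def)
  qed
  show "arrB u2 e = arrB (rep_add u1 (jmap x \<xi>)) e" if e: "e \<in> arcs Q" for e
  proof -
    note t = tail_head_verts(1)[OF e] and h = tail_head_verts(2)[OF e]
    have "arrB (z s) e * induced (head Q e) (g s (head Q e)) = g s (tail Q e) * arrB (y s) e" for s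
      using e cancel[OF h GrpP_carrier[OF g(1) t] Rep_B[OF y(3) e]] by (simp add: z(3) act_def del: assoc_mult_mat)
    then have "arrB u2 e = arrB u1 e + (\<xi> (tail Q e) * arrB x e - arrB x e * induced (head Q e) (\<xi> (head Q e)))"
      by (intro act_block_derivative[OF h L(2)[OF t] Z(2)[OF e] Y(2)[OF e] dg[OF t] dh[OF h] _ _ g0[OF t] h0[OF h]]) (simp_all add: y0 z0)
    then show ?thesis using e by (simp add: rep_add_def jmap_def)
  qed
  show "frI u2 v = frI (rep_add u1 (jmap x \<xi>)) v" if v: "v \<in> verts Q" for v
  proof -
    have "frI (z s) v = g s v * frI (y s) v" for s using v by (simp add: z(3) act_def)
    then have "frI u2 v = \<xi> v * frI (y 0) v + g 0 v * frI u1 v"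
      by (rule mderiv_unique[OF Z(3)[OF v] mderiv_mult[OF dg[OF v] Y(3)[OF v]]])
    also have "\<dots> = \<xi> v * frI x v + frI u1 v" unfolding y0 g0[OF v] left_mult_one_mat[OF Rep_I[OF y(2) v]] ..
    also have "\<dots> = frI u1 v + \<xi> v * frI x v" by (rule comm_add_mat[OF mult_carrier_mat[OF L(2)[OF v] Rep_I[OF xR v]] Rep_I[OF y(2) v]])
    finally show ?thesis using v by (simp add: rep_add_def jmap_def)
  qed
  show "frJ u2 v = frJ (rep_add u1 (jmap x \<xi>)) v" if v: "v \<in> verts Q" for v
  proof -
    note J = Rep_J[OF xR v] and u2J = Rep_J[OF z(2) v] and u1J = Rep_J[OF y(2) v]
    have "frJ (z s) v * induced v (g s v) = frJ (y s) v" for s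
      using v assoc_mult_mat[OF Rep_J[OF y(3) v] GrpP_inv_carrier[OF g(1) v] induced_carrier[OF v GrpP_lieP[OF g(1) v]]]
        induced_inv_left[OF v GrpP_lieP[OF g(1) v] GrpP_det[OF g(1) v]] right_mult_one_mat[OF Rep_J[OF y(3) v]]
      by (simp add: z(3) act_def del: assoc_mult_mat)
    then have "frJ u2 v * induced v (g 0 v) + frJ (z 0) v * induced v (\<xi> v) = frJ u1 v"
      by (rule mderiv_unique[OF mderiv_mult[OF Z(4)[OF v] dh[OF v]] Y(4)[OF v]])
    then have eq: "frJ u2 v + frJ x v * induced v (\<xi> v) = frJ u1 v"
      unfolding h0[OF v] z0 right_mult_one_mat[OF u2J] .
    have "frJ u2 v = frJ u1 v + - (frJ x v * induced v (\<xi> v))"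
      unfolding eq[symmetric] using u2J mult_carrier_mat[OF J L(3)[OF v]] by (intro eq_matI) (auto simp del: index_mult_mat(1))
    then show ?thesis using v by (simp add: rep_add_def jmap_def)
  qed
qed

lemma coord_zero_rep: "\<xi> \<in> coords \<Longrightarrow> \<xi> zero_rep = 0"
  unfolding zero_rep_def by (simp add: coord_mkrep)

lemma zero_rep_add:
  assumes "u \<in> Rep"
  shows "rep_add zero_rep u = u"
  by (rule Rep_eqI[OF rep_add_Rep[OF zero_rep(1) assms] assms]) (simp add: coord_add zero_rep(1) assms coord_zero_rep)

text \<open>
  The curve is the orbit of \<open>x\<close> under \<open>1 + t \<xi>\<close>, which lies in the group for small \<open>t\<close>.
\<close>

lemma orbit_curve:
  assumes \<xi>: "\<xi> \<in> LieP"
  shows "\<exists>\<gamma>. curve \<gamma> (jmap x \<xi>) \<and> (\<forall>t. \<exists>g\<in>GrpP. \<gamma> t = act g x)"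
proof -
  note L = LieP_D[OF \<xi>]
  define one where "one v t = 1\<^sub>m (d v) + t \<cdot>\<^sub>m \<xi> v" for v t
  have onec: "one v t \<in> carrier_mat (d v) (d v)" if "v \<in> verts Q" for v t
    using L(2)[OF that] by (simp add: one_def)
  have one_entry: "one v t $$ (i, j) = 1\<^sub>m (d v) $$ (i, j) + t * \<xi> v $$ (i, j)" if "v \<in> verts Q" "i < d v" "j < d v" for v t i j
    using L(2)[OF that(1)] that by (simp add: one_def)
  have one_lieP: "one v t \<in> lieP v" if "v \<in> verts Q" for v t
    using onec[OF that] one_entry[OF that] L(1)[OF that] k_le_d[OF that] unfolding lieP_def by auto
  have one_deriv: "mderiv (d v) (d v) (one v) (\<xi> v)" if v: "v \<in> verts Q" for v
    unfolding mderiv_def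
  proof (intro conjI allI impI onec[OF v] L(2)[OF v])
    fix i j assume ij: "i < d v" "j < d v"
    have "((\<lambda>t. 1\<^sub>m (d v) $$ (i, j) + t * \<xi> v $$ (i, j)) has_field_derivative \<xi> v $$ (i, j)) (at 0)"
      by (auto intro!: derivative_eq_intros)
    then show "((\<lambda>t. one v t $$ (i, j)) has_field_derivative \<xi> v $$ (i, j)) (at 0)" by (simp only: one_entry[OF v ij])
  qed
  have one0: "one v 0 = 1\<^sub>m (d v)" if "v \<in> verts Q" for v
    using L(2)[OF that] by (intro eq_matI) (auto simp: one_def)
  have "mat_in diff_at_0 (d v) (d v) (one v)" if "v \<in> verts Q" for v
    using mderivD[OF one_deriv[OF that]] unfolding mat_in_def diff_at_0_def by blast
  then have "eventually (\<lambda>t. det (one v t) \<noteq> 0) (at 0)" if "v \<in> verts Q" for v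
  proof -
    assume *: "\<And>v. v \<in> verts Q \<Longrightarrow> mat_in diff_at_0 (d v) (d v) (one v)"
    have "(\<lambda>t. det (one v t)) \<in> diff_at_0" by (rule fun_algebra_det[OF diff_at_0_algebra *[OF that]])
    then have "isCont (\<lambda>t. det (one v t)) 0" unfolding diff_at_0_def using DERIV_isCont by blast
    then show ?thesis unfolding isCont_def by (rule tendsto_imp_eventually_ne) (simp add: one0[OF that])
  qed
  then have "eventually (\<lambda>t. \<forall>v\<in>verts Q. det (one v t) \<noteq> 0) (at 0)"
    using eventually_ball_finite[OF finite_verts, of "\<lambda>t v. det (one v t) \<noteq> 0" "at 0"] by blast
  then obtain \<epsilon> where \<epsilon>: "\<epsilon> > 0" "\<And>t. t \<noteq> 0 \<Longrightarrow> cmod t < \<epsilon> \<Longrightarrow> \<forall>v\<in>verts Q. det (one v t) \<noteq> 0"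
    unfolding eventually_at by (auto simp: dist_norm)
  \<comment> \<open>The group element is \<open>1 + t \<xi>\<close> only where this is invertible.\<close>
  define g where "g t = (\<lambda>v\<in>verts Q. if cmod t < \<epsilon> then one v t else 1\<^sub>m (d v))" for t
  have g0: "g 0 = gunit" using \<epsilon>(1) by (auto simp: g_def gunit_def one0 fun_eq_iff)
  have gG: "g t \<in> GrpP" for t
  proof (cases "t = 0")
    case True
    then show ?thesis using g0 gunit_GrpP by simp
  next
    case False
    then show ?thesis unfolding GrpP_iff g_def using \<epsilon>(2)[OF False] one_lieP lieP_one by auto
  qed
  have dg: "mderiv (d v) (d v) (\<lambda>t. g t v) (\<xi> v)" if v: "v \<in> verts Q" for v
    unfolding mderiv_def
  proof (intro conjI allI impI GrpP_carrier[OF gG v] L(2)[OF v])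
    fix i j assume ij: "i < d v" "j < d v"
    have "eventually (\<lambda>t. g t v = one v t) (nhds 0)"
      unfolding eventually_nhds_metric using \<epsilon>(1) v by (intro exI[of _ \<epsilon>]) (auto simp: g_def dist_norm)
    then have ev: "eventually (\<lambda>t. g t v $$ (i, j) = one v t $$ (i, j)) (nhds 0)" by (rule eventually_mono) simp
    show "((\<lambda>t. g t v $$ (i, j)) has_field_derivative \<xi> v $$ (i, j)) (at 0)"
      unfolding DERIV_cong_ev[OF refl ev refl] by (rule mderivD(3)[OF one_deriv[OF v] ij])
  qed
  define \<gamma> where "\<gamma> t = act (g t) x" for t
  have \<gamma>R: "\<gamma> t \<in> Rep" for t unfolding \<gamma>_def by (rule act_Rep[OF gG xR])
  have gd: "mat_in diff_at_0 (d v) (d v) (\<lambda>t. g t v)" if "v \<in> verts Q" for v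
    using mderivD[OF dg[OF that]] unfolding mat_in_def diff_at_0_def by blast
  have hd: "mat_in diff_at_0 (dhat v) (dhat v) (\<lambda>t. induced_inv v (g t v))" if v: "v \<in> verts Q" for v
  proof -
    have "mat_in diff_at_0 (dhat v) (dhat v) (\<lambda>t. \<pi> v * minv (g t v) * \<rho> v)"
      by (rule mat_in_mult[OF diff_at_0_algebra mat_in_mult[OF diff_at_0_algebra mat_in_const[OF diff_at_0_algebra \<pi>_carrier[OF v]]
            diff_at_0_minv[OF gd[OF v] GrpP_det[OF gG v]]] mat_in_const[OF diff_at_0_algebra \<rho>(1)[OF v]]])
    then show ?thesis
      by (simp only: induced_inv_eq[OF v GrpP_lieP[OF gG v] GrpP_det[OF gG v]]
        induced_eq[OF v minv_lieP(1)[OF v GrpP_lieP[OF gG v] GrpP_det[OF gG v]]])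
  qed
  have entry: "(\<lambda>t. M t $$ (r, s)) \<in> diff_at_0" if "mat_in diff_at_0 n m M" "r < n" "s < m" for n m M r s
    using that unfolding mat_in_def by blast
  \<comment> \<open>The entries of the curve are differentiable; which velocity it has is left to \<open>curve_act\<close>.\<close>
  note A = diff_at_0_algebra
  have "(\<lambda>t. \<eta> (\<gamma> t)) \<in> diff_at_0" if "\<eta> \<in> coords" for \<eta>
    using that
  proof (cases rule: coords_cases)
    case (1 e r s)
    note t = tail_head_verts(1)[OF 1(1)] and h = tail_head_verts(2)[OF 1(1)]
    from entry[OF mat_in_mult[OF A mat_in_mult[OF A gd[OF h] mat_in_const[OF A Rep_A[OF xR 1(1)]]] hd[OF t]] 1(2,3)]
    show ?thesis unfolding 1(4) \<gamma>_def act_def using 1(1) by simp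
  next
    case (2 e r s)
    note t = tail_head_verts(1)[OF 2(1)] and h = tail_head_verts(2)[OF 2(1)]
    from entry[OF mat_in_mult[OF A mat_in_mult[OF A gd[OF t] mat_in_const[OF A Rep_B[OF xR 2(1)]]] hd[OF h]] 2(2,3)]
    show ?thesis unfolding 2(4) \<gamma>_def act_def using 2(1) by simp
  next
    case (3 v r s)
    from entry[OF mat_in_mult[OF A gd[OF 3(1)] mat_in_const[OF A Rep_I[OF xR 3(1)]]] 3(2,3)]
    show ?thesis unfolding 3(4) \<gamma>_def act_def using 3(1) by simp
  next
    case (4 v r s)
    from entry[OF mat_in_mult[OF A mat_in_const[OF A Rep_J[OF xR 4(1)]] hd[OF 4(1)]] 4(2,3)]
    show ?thesis unfolding 4(4) \<gamma>_def act_def using 4(1) by simp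
  qed
  then have "\<exists>D. \<forall>\<eta>\<in>coords. ((\<lambda>t. \<eta> (\<gamma> t)) has_field_derivative D \<eta>) (at 0)"
    unfolding diff_at_0_def by (intro bchoice ballI) auto
  then obtain D where D: "\<forall>\<eta>\<in>coords. ((\<lambda>t. \<eta> (\<gamma> t)) has_field_derivative D \<eta>) (at 0)" by blast
  have c: "curve \<gamma> (mkrep D)"
    unfolding curve_def using D act_one[OF xR] by (simp add: coord_mkrep \<gamma>_def g0)
  have c0: "curve (\<lambda>_. x) zero_rep"
    unfolding curve_def by (simp add: coord_zero_rep)
  have "mkrep D = rep_add zero_rep (jmap x \<xi>)"
    by (rule curve_act[OF gG g0 \<xi> dg c0 zero_rep(1) xR c mkrep_Rep]) (simp_all add: \<gamma>_def)
  then have "mkrep D = jmap x \<xi>" using zero_rep_add[OF jmap_Rep[OF xR \<xi>]] by simp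
  then show ?thesis using c gG unfolding \<gamma>_def by (intro exI[of _ "\<lambda>t. act (g t) x"]) auto
qed

lemma fractions_curve_derivative:
  assumes "h \<in> fractions U" "curve \<gamma> u" "\<And>t. \<gamma> t \<in> U"
  shows "\<exists>D. ((\<lambda>t. h (\<gamma> t)) has_field_derivative D) (at 0)"
proof -
  obtain p r where pr: "p \<in> polys" "r \<in> polys" "\<forall>y\<in>U. r y \<noteq> 0 \<and> h y = p y / r y"
    using assms(1) unfolding fractions_def fraction_on_def by blast
  have "\<gamma> 0 = x" using assms(2) by (simp add: curve_def)
  then have "r x \<noteq> 0" using assms(3)[of 0] pr(3) by auto
  moreover have "(\<lambda>t. h (\<gamma> t)) = (\<lambda>t. p (\<gamma> t) / r (\<gamma> t))" using pr(3) assms(3) by auto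
  ultimately show ?thesis using quot_deriv[OF pr(1,2) _ assms(2)] by auto
qed

text \<open>
  If \<open>\<sigma>\<close> is constant to first order along \<open>\<gamma>\<close>, then \<open>\<gamma> = \<phi>(\<gamma>) \<sigma>(\<gamma>)\<close> moves to first order by the
  derivative of \<open>\<phi>(\<gamma>)\<close>, an element of the Lie algebra.
\<close>

lemma slice_kernel:
  assumes \<gamma>: "curve \<gamma> u" and dom: "\<And>t. \<gamma> t \<in> slice_dom" and u: "u \<in> Rep"
    and zero: "\<And>\<eta>. \<eta> \<in> coords \<Longrightarrow> ((\<lambda>t. \<eta> (\<sigma> (\<gamma> t))) has_field_derivative 0) (at 0)"
  shows "u \<in> boundaries x"
proof -
  have sub: "slice_dom \<subseteq> {y \<in> Rep_st0. \<Delta> y \<noteq> 0}" by (auto simp: slice_dom_def)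
  have \<gamma>0: "\<gamma> 0 = x" using \<gamma> by (simp add: curve_def)
  have "\<exists>D. ((\<lambda>t. phi v (\<gamma> t) $$ (r, c)) has_field_derivative D) (at 0)" if "v \<in> verts Q" "r < d v" "c < d v" for v r c
    using fractions_curve_derivative[OF _ \<gamma> dom] phi_fractions[OF that(1) sub] that unfolding mat_in_def by blast
  then obtain D where D: "\<And>v r c. v \<in> verts Q \<Longrightarrow> r < d v \<Longrightarrow> c < d v \<Longrightarrow> ((\<lambda>t. phi v (\<gamma> t) $$ (r, c)) has_field_derivative D v r c) (at 0)"
    by metis
  define \<zeta> where "\<zeta> = (\<lambda>v\<in>verts Q. mat (d v) (d v) (\<lambda>(r, c). D v r c))"
  \<comment> \<open>The entries that are required to be zero vanish identically along the curve.\<close>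
  have \<zeta>: "\<zeta> \<in> LieP"
    unfolding LieP_def lieP_def
  proof (intro PiE_I CollectI conjI allI impI)
    fix v r c assume v: "v \<in> verts Q" and rc: "r < d v \<and> c < k v \<and> c < r"
    have "(\<lambda>t. phi v (\<gamma> t) $$ (r, c)) = (\<lambda>_. 0)"
      using phi_lieP[OF v] dom rc unfolding slice_dom_def lieP_def by auto
    then have "((\<lambda>t. phi v (\<gamma> t) $$ (r, c)) has_field_derivative 0) (at 0)" by simp
    then have "D v r c = 0" using D[OF v, of r c] rc DERIV_unique by fastforce
    then show "\<zeta> v $$ (r, c) = 0" using v rc by (simp add: \<zeta>_def)
  qed (auto simp: \<zeta>_def)
  have "u = rep_add zero_rep (jmap x \<zeta>)"
  proof (rule curve_act[of "\<lambda>t. \<phi> (\<gamma> t)" \<zeta> "\<lambda>t. \<sigma> (\<gamma> t)" zero_rep \<gamma> u])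
    show "\<phi> (\<gamma> t) \<in> GrpP" for t by (rule \<phi>_GrpP[OF dom])
    show "\<phi> (\<gamma> 0) = gunit" unfolding \<gamma>0 by (rule \<phi>_x)
    show "mderiv (d v) (d v) (\<lambda>t. \<phi> (\<gamma> t) v) (\<zeta> v)" if "v \<in> verts Q" for v
      unfolding mderiv_def using that D[OF that] phi_carrier by (simp add: \<phi>_def \<zeta>_def)
    show "curve (\<lambda>t. \<sigma> (\<gamma> t)) zero_rep"
      unfolding curve_def using zero by (simp add: \<gamma>0 \<sigma>_x coord_zero_rep)
    show "\<sigma> (\<gamma> t) \<in> Rep" for t by (rule slice_dom_Rep[OF \<sigma>_slice_dom[OF dom]])
    show "\<gamma> t = act (\<phi> (\<gamma> t)) (\<sigma> (\<gamma> t))" for t by (rule act_\<phi>_\<sigma>[OF dom, symmetric])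
  qed (fact \<zeta> zero_rep(1) \<gamma> u)+
  then show ?thesis
    using zero_rep_add[OF jmap_Rep[OF xR \<zeta>]] \<zeta> unfolding boundaries_def by simp
qed

section \<open>Tangent vectors as derivations\<close>

text \<open>
  Near \<open>x\<close> the pullback of the germ \<open>\<gamma>\<close> to the representation space is the quotient \<open>p / r\<close>.
\<close>

definition presents where
  "presents \<gamma> p r \<longleftrightarrow> (\<exists>W h U. (W, h) \<in> sections (orbit x) \<and> \<gamma> = germ (orbit x) W h \<and>
     zopen U \<and> x \<in> U \<and> U \<subseteq> preim W \<and> fraction_on U (h \<circ> orbit) p r)"

text \<open>
  The derivative of the germ \<open>\<gamma>\<close> in the direction \<open>u\<close>, by means of one presentation that is chosen
  for all \<open>u\<close> simultaneously; this keeps it linear in \<open>u\<close>. For cycles \<open>u\<close> the choice does not matter,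
  by \<open>presents_unique\<close>.
\<close>

definition germ_deriv where
  "germ_deriv u \<gamma> = (let pr = SOME pr. presents \<gamma> (fst pr) (snd pr) in quot_deriv (fst pr) (snd pr) u)"

lemma germ_deriv_lin: "lin (\<lambda>u. germ_deriv u \<gamma>)"
  unfolding germ_deriv_def Let_def by (rule quot_deriv_lin)

lemma x_preim: "orbit x \<in> W \<Longrightarrow> x \<in> preim W"
  using x by (simp add: preim_def)

lemma section_fraction:
  assumes "(W, h) \<in> sections (orbit x)"
  obtains U p r where "zopen U" "x \<in> U" "U \<subseteq> preim W" "fraction_on U (h \<circ> orbit) p r"
proof -
  have "regular_on (preim W) (h \<circ> orbit)" "x \<in> preim W"
    using assms x_preim by (simp_all add: sections_def mregular_on_def)
  then obtain U p r where "zopen U" "x \<in> U" "U \<subseteq> preim W" "fraction_on U (h \<circ> orbit) p r" by (rule regular_onD)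
  then show ?thesis by (rule that)
qed

lemma fraction_curve:
  assumes "fraction_on U h p r" "curve \<gamma> u" "\<And>t. \<gamma> t \<in> U"
  shows "((\<lambda>t. h (\<gamma> t)) has_field_derivative quot_deriv p r u) (at 0)"
proof -
  have pr: "p \<in> polys" "r \<in> polys" "\<forall>y\<in>U. r y \<noteq> 0 \<and> h y = p y / r y"
    using assms(1) unfolding fraction_on_def by blast+
  have "\<gamma> 0 = x" using assms(2) by (simp add: curve_def)
  then have "r x \<noteq> 0" using assms(3)[of 0] pr(3) by auto
  moreover have "(\<lambda>t. h (\<gamma> t)) = (\<lambda>t. p (\<gamma> t) / r (\<gamma> t))" using pr(3) assms(3) by auto
  ultimately show ?thesis using quot_deriv[OF pr(1,2) _ assms(2)] by simp
qed

text \<open>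
  Two presentations of a germ agree near \<open>x\<close> on \<open>Rep_st0\<close> only, so their derivatives can be
  compared just in directions that are tangent to it. A curve in \<open>Rep_st0\<close> with velocity \<open>u\<close> does so.
\<close>

lemma presents_unique:
  assumes u: "u \<in> cycles x" and "presents \<gamma> p r" "presents \<gamma> p' r'"
  shows "quot_deriv p r u = quot_deriv p' r' u"
proof -
  obtain W h U where 1: "(W, h) \<in> sections (orbit x)" "\<gamma> = germ (orbit x) W h" "zopen U" "x \<in> U" "U \<subseteq> preim W" "fraction_on U (h \<circ> orbit) p r"
    using assms(2) unfolding presents_def by blast
  obtain W' h' U' where 2: "(W', h') \<in> sections (orbit x)" "\<gamma> = germ (orbit x) W' h'" "zopen U'" "x \<in> U'" "U' \<subseteq> preim W'" "fraction_on U' (h' \<circ> orbit) p' r'"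
    using assms(3) unfolding presents_def by blast
  have "germ (orbit x) W h = germ (orbit x) W' h'" using 1(2) 2(2) by simp
  then obtain V where V: "mopen V" "orbit x \<in> V" "V \<subseteq> W \<inter> W'" "\<And>n. n \<in> V \<Longrightarrow> h n = h' n"
    by (rule germ_eqD[OF _ 2(1)]) blast
  have "zopen (U \<inter> U' \<inter> preim V)" "x \<in> U \<inter> U' \<inter> preim V"
    using zopen_Int[OF zopen_Int[OF 1(3) 2(3)], of "preim V"] V(1,2) 1(4) 2(4) x_preim unfolding mopen_def by blast+
  from tangent_curve[OF u this] obtain \<gamma>' where \<gamma>': "curve \<gamma>' u" "\<And>t. \<gamma>' t \<in> U \<inter> U' \<inter> preim V" by blast
  have "(\<lambda>t. (h \<circ> orbit) (\<gamma>' t)) = (\<lambda>t. (h' \<circ> orbit) (\<gamma>' t))"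
    using \<gamma>'(2) V(4) by (auto simp: preim_def)
  moreover have "((\<lambda>t. (h \<circ> orbit) (\<gamma>' t)) has_field_derivative quot_deriv p r u) (at 0)"
    by (rule fraction_curve[OF 1(6) \<gamma>'(1)]) (use \<gamma>'(2) in blast)
  moreover have "((\<lambda>t. (h' \<circ> orbit) (\<gamma>' t)) has_field_derivative quot_deriv p' r' u) (at 0)"
    by (rule fraction_curve[OF 2(6) \<gamma>'(1)]) (use \<gamma>'(2) in blast)
  ultimately show ?thesis using DERIV_unique by metis
qed

lemma germ_deriv_eq:
  assumes u: "u \<in> cycles x" and pr: "presents \<gamma> p r"
  shows "germ_deriv u \<gamma> = quot_deriv p r u"
proof -
  have "presents \<gamma> (fst (p, r)) (snd (p, r))" using pr by simp
  then have "presents \<gamma> (fst (SOME pr. presents \<gamma> (fst pr) (snd pr))) (snd (SOME pr. presents \<gamma> (fst pr) (snd pr)))"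
    by (rule someI)
  then show ?thesis unfolding germ_deriv_def Let_def by (rule presents_unique[OF u _ pr])
qed

lemma germ_deriv_curve:
  assumes u: "u \<in> cycles x" and "(W, h) \<in> sections (orbit x)" and "zopen U" "x \<in> U" "U \<subseteq> preim W" "fraction_on U (h \<circ> orbit) p r"
    and \<gamma>: "curve \<gamma> u" "\<And>t. \<gamma> t \<in> U"
  shows "((\<lambda>t. h (orbit (\<gamma> t))) has_field_derivative germ_deriv u (germ (orbit x) W h)) (at 0)"
proof -
  have "presents (germ (orbit x) W h) p r" unfolding presents_def using assms(2-6) by blast
  then show ?thesis using fraction_curve[OF assms(6) \<gamma>] germ_deriv_eq[OF u] by (simp add: comp_def)
qed

text \<open>
  The pullback of a function on the quotient is constant along the orbit of \<open>x\<close>.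
\<close>

lemma quot_deriv_boundary:
  assumes b: "b \<in> boundaries x" and U: "zopen U" "x \<in> U" and fr: "fraction_on U (h \<circ> orbit) p r"
  shows "quot_deriv p r b = 0"
proof -
  obtain \<xi> where \<xi>: "\<xi> \<in> LieP" "b = jmap x \<xi>" using b unfolding boundaries_def by blast
  obtain \<gamma> where \<gamma>: "curve \<gamma> b" "\<And>t. \<exists>g\<in>GrpP. \<gamma> t = act g x" using orbit_curve[OF \<xi>(1)] \<xi>(2) by blast
  have pr: "p \<in> polys" "r \<in> polys" "\<forall>y\<in>U. r y \<noteq> 0 \<and> (h \<circ> orbit) y = p y / r y"
    using fr unfolding fraction_on_def by blast+
  have \<gamma>0: "\<gamma> 0 = x" using \<gamma>(1) by (simp add: curve_def)
  obtain S where S: "S \<subseteq> polys" "U = {y \<in> Rep_st0. \<exists>q\<in>S. q y \<noteq> 0}" using U(1) unfolding zopen_def by blast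
  then obtain q where q: "q \<in> S" "q x \<noteq> 0" using U(2) by blast
  have "isCont (\<lambda>t. q (\<gamma> t)) 0" using DERIV_isCont[OF dir_deriv[OF _ \<gamma>(1)]] q(1) S(1) by blast
  then have "eventually (\<lambda>t. q (\<gamma> t) \<noteq> 0) (at 0)"
    unfolding isCont_def by (rule tendsto_imp_eventually_ne) (simp add: \<gamma>0 q(2))
  then have "eventually (\<lambda>t. q (\<gamma> t) \<noteq> 0) (nhds 0)"
    unfolding eventually_nhds_conv_at using q(2) \<gamma>0 by simp
  then have ev: "eventually (\<lambda>t. p (\<gamma> t) / r (\<gamma> t) = h (orbit x)) (nhds 0)"
  proof (rule eventually_mono)
    fix t assume ne: "q (\<gamma> t) \<noteq> 0"
    obtain g where g: "g \<in> GrpP" "\<gamma> t = act g x" using \<gamma>(2) by blast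
    have "\<gamma> t \<in> U" unfolding S(2) using ne q(1) Rep_st0_act[OF g(1) x] g(2) by auto
    then show "p (\<gamma> t) / r (\<gamma> t) = h (orbit x)"
      using pr(3) orbit_act[OF g(1) xR] g(2) by (metis comp_apply)
  qed
  have "((\<lambda>t. p (\<gamma> t) / r (\<gamma> t)) has_field_derivative 0) (at 0)"
    unfolding DERIV_cong_ev[OF refl ev refl] by (rule DERIV_const)
  moreover have "((\<lambda>t. p (\<gamma> t) / r (\<gamma> t)) has_field_derivative quot_deriv p r b) (at 0)"
    by (rule quot_deriv[OF pr(1,2) _ \<gamma>(1)]) (use pr(3) U(2) in blast)
  ultimately show ?thesis using DERIV_unique by metis
qed

lemma germ_deriv_boundary:
  assumes "b \<in> boundaries x" "\<gamma> \<in> stalk (orbit x)"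
  shows "germ_deriv b \<gamma> = 0"
proof -
  obtain \<xi> where \<xi>: "\<xi> \<in> LieP" "b = jmap x \<xi>" using assms(1) unfolding boundaries_def by blast
  \<comment> \<open>Independence of the presentation is available for cycles, and boundaries are cycles.\<close>
  have "b \<in> cycles x" using dmu_jmap[OF xR x_moment \<xi>(1)] jmap_Rep[OF xR \<xi>(1)] \<xi>(2) by (simp add: cycles_def)
  moreover obtain W h where s: "(W, h) \<in> sections (orbit x)" "\<gamma> = germ (orbit x) W h" using assms(2) by (rule stalkE)
  moreover obtain U p r where U: "zopen U" "x \<in> U" "U \<subseteq> preim W" "fraction_on U (h \<circ> orbit) p r" by (rule section_fraction[OF s(1)])
  moreover have "presents \<gamma> p r" unfolding presents_def using s U by blast
  ultimately show ?thesis using germ_deriv_eq quot_deriv_boundary[OF assms(1) U(1,2,4)] by simp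
qed

definition \<Psi> where
  "\<Psi> C = (\<lambda>\<gamma>\<in>stalk (orbit x). germ_deriv (SOME u. u \<in> cycles x \<and> hclass x u = C) \<gamma>)"

lemma \<Psi>_extensional: "\<Psi> C \<in> extensional (stalk (orbit x))"
  by (simp only: \<Psi>_def restrict_extensional)

text \<open>
  Two representatives of a class differ by a boundary, on which every derivative vanishes.
\<close>

lemma \<Psi>_hclass:
  assumes u: "u \<in> cycles x" and \<gamma>: "\<gamma> \<in> stalk (orbit x)"
  shows "\<Psi> (hclass x u) \<gamma> = germ_deriv u \<gamma>"
proof -
  define w where "w = (SOME w. w \<in> cycles x \<and> hclass x w = hclass x u)"
  have "w \<in> cycles x \<and> hclass x w = hclass x u" unfolding w_def by (rule someI[of _ u]) (simp add: u)
  then have w: "w \<in> cycles x" "hclass x w = hclass x u" by auto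
  have "w \<in> hclass x u" using hclass_self[OF xR cycles_Rep[OF w(1)]] w(2) by simp
  then obtain b where b: "b \<in> boundaries x" "w = rep_add u b" unfolding hclass_def by blast
  have "germ_deriv w \<gamma> = germ_deriv u \<gamma> + germ_deriv b \<gamma>"
    unfolding b(2) using germ_deriv_lin[of \<gamma>] cycles_Rep[OF u] boundaries_Rep[OF xR b(1)] unfolding lin_def by blast
  then show ?thesis unfolding \<Psi>_def using \<gamma> germ_deriv_boundary[OF b(1) \<gamma>] by (simp add: w_def)
qed

text \<open>
  The germs involved in a rule are differentiated along one common curve, where the rule is that
  for functions of one variable.
\<close>

lemma \<Psi>_tangent:
  assumes u: "u \<in> cycles x"
  shows "\<Psi> (hclass x u) \<in> tangent_space (orbit x)"
proof -
  let ?m = "orbit x"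
  have P: "\<Psi> (hclass x u) (germ ?m W h) = germ_deriv u (germ ?m W h)" if "(W, h) \<in> sections ?m" for W h
    by (rule \<Psi>_hclass[OF u germ_in_stalk[OF that]])
  have c: "\<exists>\<gamma>. curve \<gamma> u \<and> ((\<lambda>t. g (orbit (\<gamma> t))) has_field_derivative germ_deriv u (germ ?m W g)) (at 0)
      \<and> ((\<lambda>t. h (orbit (\<gamma> t))) has_field_derivative germ_deriv u (germ ?m W h)) (at 0)
      \<and> ((\<lambda>t. l (orbit (\<gamma> t))) has_field_derivative germ_deriv u (germ ?m W l)) (at 0)"
    if g: "(W, g) \<in> sections ?m" and h: "(W, h) \<in> sections ?m" and l: "(W, l) \<in> sections ?m" for W g h l
  proof -
    obtain U1 p1 r1 where 1: "zopen U1" "x \<in> U1" "U1 \<subseteq> preim W" "fraction_on U1 (g \<circ> orbit) p1 r1" by (rule section_fraction[OF g])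
    obtain U2 p2 r2 where 2: "zopen U2" "x \<in> U2" "U2 \<subseteq> preim W" "fraction_on U2 (h \<circ> orbit) p2 r2" by (rule section_fraction[OF h])
    obtain U3 p3 r3 where 3: "zopen U3" "x \<in> U3" "U3 \<subseteq> preim W" "fraction_on U3 (l \<circ> orbit) p3 r3" by (rule section_fraction[OF l])
    have "zopen (U1 \<inter> U2 \<inter> U3)" "x \<in> U1 \<inter> U2 \<inter> U3" using zopen_Int[OF zopen_Int[OF 1(1) 2(1)] 3(1)] 1 2 3 by blast+
    from tangent_curve[OF u this] obtain \<gamma> where \<gamma>: "curve \<gamma> u" "\<And>t. \<gamma> t \<in> U1 \<inter> U2 \<inter> U3" by blast
    have in1: "\<gamma> t \<in> U1" and in2: "\<gamma> t \<in> U2" and in3: "\<gamma> t \<in> U3" for t using \<gamma>(2) by blast+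
    show ?thesis
      using germ_deriv_curve[OF u g 1 \<gamma>(1) in1] germ_deriv_curve[OF u h 2 \<gamma>(1) in2] germ_deriv_curve[OF u l 3 \<gamma>(1) in3] \<gamma>(1) by blast
  qed
  show ?thesis
    unfolding tangent_space_def
  proof (intro CollectI conjI allI impI)
    show "\<Psi> (hclass x u) \<in> extensional (stalk ?m)" by (rule \<Psi>_extensional)
  next
    fix W g h assume "(W, g) \<in> sections ?m \<and> (W, h) \<in> sections ?m"
    then have s: "(W, g) \<in> sections ?m" "(W, h) \<in> sections ?m" by auto
    note s3 = sections_add[OF s]
    obtain \<gamma> where \<gamma>: "((\<lambda>t. g (orbit (\<gamma> t))) has_field_derivative germ_deriv u (germ ?m W g)) (at 0)"
      "((\<lambda>t. h (orbit (\<gamma> t))) has_field_derivative germ_deriv u (germ ?m W h)) (at 0)"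
      "((\<lambda>t. g (orbit (\<gamma> t)) + h (orbit (\<gamma> t))) has_field_derivative germ_deriv u (germ ?m W (\<lambda>n. g n + h n))) (at 0)"
      using c[OF s s3] by blast
    have "germ_deriv u (germ ?m W (\<lambda>n. g n + h n)) = germ_deriv u (germ ?m W g) + germ_deriv u (germ ?m W h)"
      by (rule DERIV_unique[OF \<gamma>(3) DERIV_add[OF \<gamma>(1,2)]])
    then show "\<Psi> (hclass x u) (germ ?m W (\<lambda>n. g n + h n)) = \<Psi> (hclass x u) (germ ?m W g) + \<Psi> (hclass x u) (germ ?m W h)"
      unfolding P[OF s(1)] P[OF s(2)] P[OF s3] .
  next
    fix W g h assume "(W, g) \<in> sections ?m \<and> (W, h) \<in> sections ?m"
    then have s: "(W, g) \<in> sections ?m" "(W, h) \<in> sections ?m" by auto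
    note s3 = sections_mult[OF s]
    obtain \<gamma> where \<gamma>: "((\<lambda>t. g (orbit (\<gamma> t))) has_field_derivative germ_deriv u (germ ?m W g)) (at 0)"
      "((\<lambda>t. h (orbit (\<gamma> t))) has_field_derivative germ_deriv u (germ ?m W h)) (at 0)"
      "((\<lambda>t. g (orbit (\<gamma> t)) * h (orbit (\<gamma> t))) has_field_derivative germ_deriv u (germ ?m W (\<lambda>n. g n * h n))) (at 0)" "curve \<gamma> u"
      using c[OF s s3] by blast
    have "\<gamma> 0 = x" using \<gamma>(4) by (simp add: curve_def)
    then have "germ_deriv u (germ ?m W (\<lambda>n. g n * h n)) = germ_deriv u (germ ?m W g) * h ?m + g ?m * germ_deriv u (germ ?m W h)"
      using DERIV_unique[OF \<gamma>(3) DERIV_mult[OF \<gamma>(1,2)]] by (simp add: mult.commute)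
    then show "\<Psi> (hclass x u) (germ ?m W (\<lambda>n. g n * h n)) = \<Psi> (hclass x u) (germ ?m W g) * h ?m + g ?m * \<Psi> (hclass x u) (germ ?m W h)"
      unfolding P[OF s(1)] P[OF s(2)] P[OF s3] .
  next
    fix W h t assume s: "(W, h) \<in> sections ?m"
    note s3 = sections_cmult[OF s, of t]
    obtain \<gamma> where \<gamma>: "((\<lambda>t. h (orbit (\<gamma> t))) has_field_derivative germ_deriv u (germ ?m W h)) (at 0)"
      "((\<lambda>s. t * h (orbit (\<gamma> s))) has_field_derivative germ_deriv u (germ ?m W (\<lambda>n. t * h n))) (at 0)"
      using c[OF s s s3] by blast
    have "germ_deriv u (germ ?m W (\<lambda>n. t * h n)) = t * germ_deriv u (germ ?m W h)"
      by (rule DERIV_unique[OF \<gamma>(2) DERIV_cmult[OF \<gamma>(1)]])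
    then show "\<Psi> (hclass x u) (germ ?m W (\<lambda>n. t * h n)) = t * \<Psi> (hclass x u) (germ ?m W h)"
      unfolding P[OF s] P[OF s3] .
  qed
qed

section \<open>Functions on the slice\<close>

definition slice_orbits :: "('v, 'e) framed_tuple set set" where
  "slice_orbits = orbit ` slice_dom"

text \<open>
  The function \<open>p \<circ> \<sigma>\<close>, viewed as a function on the quotient.
\<close>

definition slice_fun :: "(('v, 'e) framed_tuple \<Rightarrow> complex) \<Rightarrow> ('v, 'e) framed_tuple set \<Rightarrow> complex" where
  "slice_fun p n = p (\<sigma> (SOME y. y \<in> slice_dom \<and> orbit y = n))"

lemma slice_dom_orbit_eq:
  assumes y: "y \<in> slice_dom" and z: "z \<in> Rep" "orbit y = orbit z"
  shows "z \<in> slice_dom" "\<sigma> z = \<sigma> y"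
proof -
  obtain g where "g \<in> GrpP" "z = act g y" using orbit_eq_iff[OF slice_dom_Rep[OF y] z(1)] z(2) by blast
  then show "z \<in> slice_dom" "\<sigma> z = \<sigma> y" using slice_dom_act \<sigma>_act y by auto
qed

lemma slice_fun:
  assumes y: "y \<in> slice_dom"
  shows "slice_fun p (orbit y) = p (\<sigma> y)"
proof -
  let ?z = "SOME z. z \<in> slice_dom \<and> orbit z = orbit y"
  have "?z \<in> slice_dom \<and> orbit ?z = orbit y" by (rule someI[of _ y]) (simp add: y)
  then have "\<sigma> y = \<sigma> ?z" using slice_dom_orbit_eq(2)[of ?z y] slice_dom_Rep[OF y] by blast
  then show ?thesis unfolding slice_fun_def by simp
qed

lemma slice_fun_x: "slice_fun p (orbit x) = p x"
  using slice_fun[OF x_slice_dom] \<sigma>_x by simp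

lemma preim_slice_orbits: "preim slice_orbits = slice_dom"
proof (rule equalityI; rule subsetI)
  fix z assume "z \<in> preim slice_orbits"
  then obtain y where "z \<in> Rep_st0" "y \<in> slice_dom" "orbit z = orbit y" unfolding preim_def slice_orbits_def by blast
  then show "z \<in> slice_dom" using slice_dom_orbit_eq(1)[of y z] Rep_st0_Rep by simp
next
  fix z assume "z \<in> slice_dom"
  then show "z \<in> preim slice_orbits" unfolding preim_def slice_orbits_def slice_dom_def by blast
qed

lemma mopen_slice_orbits: "mopen slice_orbits"
proof -
  have "slice_dom \<subseteq> Rep_st0" unfolding slice_dom_def by blast
  then have "slice_orbits \<subseteq> moduli" unfolding slice_orbits_def moduli_def by blast
  then show ?thesis unfolding mopen_def preim_slice_orbits using zopen_slice_dom by blast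
qed

lemma x_slice_orbits: "orbit x \<in> slice_orbits"
  unfolding slice_orbits_def using x_slice_dom by blast

lemma slice_fun_fraction:
  assumes "p \<in> polys"
  shows "\<exists>q r. fraction_on slice_dom (slice_fun p \<circ> orbit) q r"
  using fractions_cong[OF poly_\<sigma>_fractions[OF assms], of "slice_fun p \<circ> orbit"] slice_fun unfolding fractions_def by simp

lemma slice_fun_section:
  assumes "p \<in> polys"
  shows "(slice_orbits, slice_fun p) \<in> sections (orbit x)"
proof -
  have "regular_on slice_dom (slice_fun p \<circ> orbit)"
    unfolding regular_on_def using slice_fun_fraction[OF assms] zopen_slice_dom by blast
  then show ?thesis unfolding sections_def mregular_on_def using mopen_slice_orbits x_slice_orbits by (simp add: preim_slice_orbits)
qed

text \<open>
  The difference \<open>s\<close> of two representatives differentiates all functions \<open>slice_fun \<eta>\<close> to \<open>0\<close>, so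
  \<open>slice_kernel\<close> applies to a curve with velocity \<open>s\<close>.
\<close>

lemma \<Psi>_inj: "inj_on \<Psi> (homology x)"
proof (rule inj_onI)
  fix C D assume "C \<in> homology x" "D \<in> homology x" and eq: "\<Psi> C = \<Psi> D"
  then obtain u w where u: "u \<in> cycles x" "C = hclass x u" and w: "w \<in> cycles x" "D = hclass x w"
    unfolding homology_def by blast
  note uR = cycles_Rep[OF u(1)] and wR = cycles_Rep[OF w(1)]
  define s where "s = rep_add (rep_smult (- 1) w) u"
  have s: "s \<in> cycles x" unfolding s_def by (rule cycles_comb[OF xR w(1) u(1)])
  note sR = cycles_Rep[OF s]
  have val0: "germ_deriv s \<gamma> = 0" if "\<gamma> \<in> stalk (orbit x)" for \<gamma>
  proof -
    have "germ_deriv u \<gamma> = germ_deriv w \<gamma>" using eq \<Psi>_hclass[OF u(1) that] \<Psi>_hclass[OF w(1) that] unfolding u(2) w(2) by simp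
    moreover have "germ_deriv s \<gamma> = - 1 * germ_deriv w \<gamma> + germ_deriv u \<gamma>"
      unfolding s_def using germ_deriv_lin[of \<gamma>] uR wR rep_smult_Rep[OF wR] unfolding lin_def by simp
    ultimately show ?thesis by simp
  qed
  obtain \<gamma> where \<gamma>: "curve \<gamma> s" "\<And>t. \<gamma> t \<in> slice_dom" using tangent_curve[OF s zopen_slice_dom x_slice_dom] by blast
  have "s \<in> boundaries x"
  proof (rule slice_kernel[OF \<gamma> sR])
    fix \<eta> assume "\<eta> \<in> coords"
    then have p: "\<eta> \<in> polys" by (rule coords_polys)
    obtain q r where fr: "fraction_on slice_dom (slice_fun \<eta> \<circ> orbit) q r" using slice_fun_fraction[OF p] by blast
    note sec = slice_fun_section[OF p]
    have "((\<lambda>t. slice_fun \<eta> (orbit (\<gamma> t))) has_field_derivative germ_deriv s (germ (orbit x) slice_orbits (slice_fun \<eta>))) (at 0)"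
      by (rule germ_deriv_curve[OF s sec zopen_slice_dom x_slice_dom _ fr \<gamma>]) (simp add: preim_slice_orbits)
    then show "((\<lambda>t. \<eta> (\<sigma> (\<gamma> t))) has_field_derivative 0) (at 0)"
      using val0[OF germ_in_stalk[OF sec]] by (simp add: slice_fun[OF \<gamma>(2)])
  qed
  moreover have "u = rep_add w s"
    unfolding s_def by (rule Rep_eqI) (simp_all add: rep_add_Rep rep_smult_Rep uR wR coord_add coord_smult)
  ultimately show "C = D" unfolding u(2) w(2) using hclass_eqI[OF xR wR] by simp
qed

text \<open>
  The composition of a polynomial with \<open>\<sigma>\<close> is a quotient of polynomials, whose zeros are those of
  its numerator.
\<close>

lemma zopen_slice_preimage:
  assumes "zopen U"
  shows "zopen {y \<in> slice_dom. \<sigma> y \<in> U}"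
proof -
  obtain S where S: "S \<subseteq> polys" "U = {y \<in> Rep_st0. \<exists>p\<in>S. p y \<noteq> 0}" using assms unfolding zopen_def by blast
  have "\<exists>n. n \<in> polys \<and> (\<forall>y\<in>slice_dom. q (\<sigma> y) \<noteq> 0 \<longleftrightarrow> n y \<noteq> 0)" if "q \<in> S" for q
  proof -
    have "q \<in> polys" using S(1) that by blast
    from poly_\<sigma>_fractions[OF this] obtain n r where "fraction_on slice_dom (\<lambda>y. q (\<sigma> y)) n r" unfolding fractions_def by blast
    then show ?thesis unfolding fraction_on_def by (intro exI[of _ n]) auto
  qed
  then have "\<exists>n. \<forall>q\<in>S. n q \<in> polys \<and> (\<forall>y\<in>slice_dom. q (\<sigma> y) \<noteq> 0 \<longleftrightarrow> n q y \<noteq> 0)" by (intro bchoice ballI)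
  then obtain n where n: "\<forall>q\<in>S. n q \<in> polys \<and> (\<forall>y\<in>slice_dom. q (\<sigma> y) \<noteq> 0 \<longleftrightarrow> n q y \<noteq> 0)" by (rule exE)
  have dom: "y \<in> Rep_st0" if "y \<in> slice_dom" for y using that unfolding slice_dom_def by simp
  have "n ` S \<subseteq> polys" using n by blast
  then have zN: "zopen {y \<in> Rep_st0. \<exists>p\<in>n ` S. p y \<noteq> 0}" unfolding zopen_def by (intro exI[of _ "n ` S"] conjI refl)
  have "{y \<in> slice_dom. \<sigma> y \<in> U} = slice_dom \<inter> {y \<in> Rep_st0. \<exists>p\<in>n ` S. p y \<noteq> 0}"
  proof (rule equalityI; rule subsetI)
    fix y assume "y \<in> {y \<in> slice_dom. \<sigma> y \<in> U}"
    then have y: "y \<in> slice_dom" "\<exists>q\<in>S. q (\<sigma> y) \<noteq> 0" unfolding S(2) by simp_all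
    obtain q where q: "q \<in> S" "q (\<sigma> y) \<noteq> 0" using y(2) by (rule bexE)
    have "n q y \<noteq> 0" using n q y(1) by blast
    then have "\<exists>p\<in>n ` S. p y \<noteq> 0" using q(1) by (intro bexI[of _ "n q"]) simp_all
    then show "y \<in> slice_dom \<inter> {y \<in> Rep_st0. \<exists>p\<in>n ` S. p y \<noteq> 0}" using y(1) dom by simp
  next
    fix y assume "y \<in> slice_dom \<inter> {y \<in> Rep_st0. \<exists>p\<in>n ` S. p y \<noteq> 0}"
    then have y: "y \<in> slice_dom" "\<exists>p\<in>n ` S. p y \<noteq> 0" by simp_all
    obtain q where q: "q \<in> S" "n q y \<noteq> 0" using y(2) by (elim bexE imageE) simp
    have "q (\<sigma> y) \<noteq> 0" using n q y(1) by blast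
    then have "\<exists>q\<in>S. q (\<sigma> y) \<noteq> 0" using q(1) by (intro bexI[of _ q])
    then show "y \<in> {y \<in> slice_dom. \<sigma> y \<in> U}" unfolding S(2) using y(1) dom[OF \<sigma>_slice_dom[OF y(1)]] by simp
  qed
  then show ?thesis using zopen_Int[OF zopen_slice_dom zN] by (simp only:)
qed

section \<open>Derivations come from tangent vectors\<close>

lemma dir_deriv_eqI:
  assumes "p \<in> polys" "u \<in> Rep" "((\<lambda>t. p (rep_add x (rep_smult t u))) has_field_derivative D) (at 0)"
  shows "dir_deriv p u = D"
  by (rule DERIV_unique[OF dir_deriv[OF assms(1) curve_line[OF assms(2)]] assms(3)])

lemma moment_polynomial:
  assumes "\<tau> \<in> dmu_index"
  shows "\<exists>p\<in>polys. \<forall>y\<in>Rep. dmu_comp y y \<tau> = p y"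
proof -
  let ?c = "\<lambda>\<xi> \<eta>. dmu_comp (unit_rep \<xi>) (unit_rep \<eta>) \<tau>"
  have "(\<lambda>y. \<Sum>\<xi>\<in>coords. \<Sum>\<eta>\<in>coords. ?c \<xi> \<eta> * \<xi> y * \<eta> y) \<in> polys"
  proof (rule fun_algebra_sum[OF polys_fun_algebra], rule fun_algebra_sum[OF polys_fun_algebra])
    fix \<xi> \<eta> assume \<xi>: "\<xi> \<in> coords" and \<eta>: "\<eta> \<in> coords"
    show "(\<lambda>y. ?c \<xi> \<eta> * \<xi> y * \<eta> y) \<in> polys"
      by (rule polys.mult[OF polys.mult[OF polys.const coords_polys[OF \<xi>]] coords_polys[OF \<eta>]])
  qed
  moreover have "dmu_comp y y \<tau> = (\<Sum>\<xi>\<in>coords. \<Sum>\<eta>\<in>coords. ?c \<xi> \<eta> * \<xi> y * \<eta> y)" if "y \<in> Rep" for y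
  proof -
    obtain v r c where "\<tau> = (v, r, c)" "v \<in> verts Q" "r < d v" "c < dhat v" using assms unfolding dmu_index_def by auto
    then show ?thesis using dmu_bilinear_expansion[OF that that, of v r c] unfolding dmu_comp_def by simp
  qed
  ultimately show ?thesis by (intro bexI[where x = "\<lambda>y. \<Sum>\<xi>\<in>coords. \<Sum>\<eta>\<in>coords. ?c \<xi> \<eta> * \<xi> y * \<eta> y"] ballI)
qed

text \<open>
  Applying \<open>\<delta>\<close> to \<open>p \<circ> \<sigma>\<close> is a derivation on polynomials at \<open>x\<close>, hence the derivative along the
  vector \<open>u\<close> formed by its values on the coordinates. It kills the moment map, which vanishes on the
  slice; so \<open>u\<close> is a cycle. If \<open>h\<close> is \<open>p / r\<close> near \<open>x\<close>, then \<open>(r \<circ> \<sigma>) h = p \<circ> \<sigma>\<close> near the orbit,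
  and the product rule for \<open>\<delta>\<close> determines its value at the germ of \<open>h\<close> as that of the quotient rule.
\<close>

lemma \<Psi>_surj:
  assumes \<delta>: "\<delta> \<in> tangent_space (orbit x)"
  shows "\<exists>u\<in>cycles x. \<Psi> (hclass x u) = \<delta>"
proof -
  let ?m = "orbit x"
  have \<delta>_ext: "\<delta> \<in> extensional (stalk ?m)"
    using \<delta> unfolding tangent_space_def by simp
  have \<delta>_add: "\<delta> (germ ?m W (\<lambda>n. g n + h n)) = \<delta> (germ ?m W g) + \<delta> (germ ?m W h)"
    and \<delta>_mult: "\<delta> (germ ?m W (\<lambda>n. g n * h n)) = \<delta> (germ ?m W g) * h ?m + g ?m * \<delta> (germ ?m W h)"
    and \<delta>_smult: "\<delta> (germ ?m W (\<lambda>n. c * g n)) = c * \<delta> (germ ?m W g)"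
    if "(W, g) \<in> sections ?m" "(W, h) \<in> sections ?m" for W g h c
    using \<delta> that unfolding tangent_space_def by blast+
  define D where "D p = \<delta> (germ ?m slice_orbits (slice_fun p))" for p
  note sec = slice_fun_section
  have D_add: "D (\<lambda>y. p y + q y) = D p + D q" if "p \<in> polys" "q \<in> polys" for p q
  proof -
    have "slice_fun (\<lambda>y. p y + q y) = (\<lambda>n. slice_fun p n + slice_fun q n)" by (simp add: slice_fun_def fun_eq_iff)
    then show ?thesis using \<delta>_add[OF sec[OF that(1)] sec[OF that(2)]] by (simp add: D_def)
  qed
  have D_mult: "D (\<lambda>y. p y * q y) = D p * q x + p x * D q" if "p \<in> polys" "q \<in> polys" for p q
  proof -
    have "slice_fun (\<lambda>y. p y * q y) = (\<lambda>n. slice_fun p n * slice_fun q n)" by (simp add: slice_fun_def fun_eq_iff)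
    then show ?thesis using \<delta>_mult[OF sec[OF that(1)] sec[OF that(2)]] unfolding slice_fun_x by (simp add: D_def)
  qed
  have D_one: "D (\<lambda>_. 1) = 0" using D_mult[OF polys.const[of 1] polys.const[of 1]] by simp
  have D_const: "D (\<lambda>_. c) = 0" for c
  proof -
    have "slice_fun (\<lambda>_. c) = (\<lambda>n. c * slice_fun (\<lambda>_. 1) n)" by (simp add: slice_fun_def fun_eq_iff)
    then show ?thesis using \<delta>_smult[OF sec[OF polys.const[of 1]] sec[OF polys.const[of 1]], of c] D_one by (simp add: D_def)
  qed
  define u where "u = mkrep D"
  have uR: "u \<in> Rep" unfolding u_def by (rule mkrep_Rep)
  have D_coord: "D \<eta> = dir_deriv \<eta> u" if "\<eta> \<in> coords" for \<eta>
  proof -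
    have "dir_deriv \<eta> u = \<eta> u"
      by (rule dir_deriv_eqI[OF coords_polys[OF that] uR]) (use curve_line[OF uR] that in \<open>simp add: curve_def\<close>)
    then show ?thesis unfolding u_def by (simp add: coord_mkrep[OF that])
  qed
  have x0: "rep_add x (rep_smult 0 u) = x" using curve_line[OF uR] by (simp add: curve_def)
  have D_dir_deriv: "D p = dir_deriv p u" if "p \<in> polys" for p
    using that
  proof (induction rule: polys.induct)
    case (const c)
    have "dir_deriv (\<lambda>_. c) u = 0" by (rule dir_deriv_eqI[OF polys.const uR]) simp
    then show ?case using D_const by simp
  next
    case (add p q)
    have "dir_deriv (\<lambda>y. p y + q y) u = dir_deriv p u + dir_deriv q u"
      by (rule dir_deriv_eqI[OF polys.add[OF add(1,2)] uR]) (intro DERIV_add dir_deriv add(1,2) curve_line uR)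
    then show ?case using D_add[OF add(1,2)] add.IH by simp
  next
    case (mult p q)
    have "dir_deriv (\<lambda>y. p y * q y) u = dir_deriv p u * q x + dir_deriv q u * p x"
      by (rule dir_deriv_eqI[OF polys.mult[OF mult(1,2)] uR])
        (use DERIV_mult[OF dir_deriv[OF mult(1) curve_line[OF uR]] dir_deriv[OF mult(2) curve_line[OF uR]]] x0 in simp)
    then show ?case using D_mult[OF mult(1,2)] mult.IH by simp
  qed (intro D_coord coords_A coords_B coords_I coords_J; assumption)+
  have u: "u \<in> cycles x"
  proof -
    have "dmu_comp x u \<tau> = 0" if \<tau>: "\<tau> \<in> dmu_index" for \<tau>
    proof -
      obtain p where p: "p \<in> polys" "\<And>y. y \<in> Rep \<Longrightarrow> dmu_comp y y \<tau> = p y" using moment_polynomial[OF \<tau>] by blast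
      have "slice_fun p n = slice_fun (\<lambda>_. 0) n" if n: "n \<in> slice_orbits" for n
      proof -
        obtain y where y: "y \<in> slice_dom" "n = orbit y" using n unfolding slice_orbits_def by blast
        have s: "\<sigma> y \<in> Rep_st0" "\<sigma> y \<in> Rep" using \<sigma>_slice_dom[OF y(1)] slice_dom_Rep by (auto simp: slice_dom_def)
        then have "dmu (\<sigma> y) (\<sigma> y) = dmu_zero" using satisfies_moment_map_iff(2)[OF s(2)] unfolding Rep_st0_def by blast
        then have "p (\<sigma> y) = 0" using p(2)[OF s(2)] \<tau> by (auto simp: dmu_comp_def dmu_zero_def dmu_index_def)
        then show ?thesis unfolding y(2) slice_fun[OF y(1)] .
      qed
      then have "germ ?m slice_orbits (slice_fun p) = germ ?m slice_orbits (slice_fun (\<lambda>_. 0))"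
        by (intro germ_eqI[OF mopen_slice_orbits x_slice_orbits]) auto
      then have "D p = 0" using D_const[of 0] by (simp add: D_def)
      then have d0: "dir_deriv p u = 0" using D_dir_deriv[OF p(1)] by simp
      \<comment> \<open>The derivative of the moment map in the direction \<open>u\<close> is \<open>2 * dmu x u\<close>.\<close>
      note L = dmu_comp_lin[OF _ \<tau>]
      have sym: "dmu_comp a b \<tau> = dmu_comp b a \<tau>" if "a \<in> Rep" "b \<in> Rep" for a b
        using dmu_sym[OF that] \<tau> by (auto simp: dmu_comp_def dmu_index_def)
      have "p (rep_add x (rep_smult t u)) = dmu_comp x x \<tau> + 2 * t * dmu_comp x u \<tau> + t * t * dmu_comp u u \<tau>" for t
      proof -
        note tu = rep_smult_Rep[OF uR, of t]
        let ?y = "rep_add x (rep_smult t u)"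
        have yR: "?y \<in> Rep" by (rule rep_add_Rep[OF xR tu])
        have e: "dmu_comp a ?y \<tau> = dmu_comp a x \<tau> + t * dmu_comp a u \<tau>" if "a \<in> Rep" for a
          using L[OF that] xR tu uR unfolding lin_def by simp
        have "p ?y = dmu_comp ?y x \<tau> + t * dmu_comp ?y u \<tau>" using e[OF yR] p(2)[OF yR] by simp
        also have "\<dots> = dmu_comp x ?y \<tau> + t * dmu_comp u ?y \<tau>" using sym[OF yR xR] sym[OF yR uR] by simp
        finally show ?thesis unfolding e[OF xR] e[OF uR] using sym[OF uR xR] by (simp add: algebra_simps)
      qed
      moreover have "((\<lambda>t. dmu_comp x x \<tau> + 2 * t * dmu_comp x u \<tau> + t * t * dmu_comp u u \<tau>) has_field_derivative 2 * dmu_comp x u \<tau>) (at 0)"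
        by (auto intro!: derivative_eq_intros)
      ultimately have "dir_deriv p u = 2 * dmu_comp x u \<tau>" by (intro dir_deriv_eqI[OF p(1) uR]) simp
      then show ?thesis using d0 by simp
    qed
    then have "dmu x u v $$ (r, c) = 0" if "v \<in> verts Q" "r < d v" "c < dhat v" for v r c
      using that by (force simp: dmu_comp_def dmu_index_def)
    then show ?thesis unfolding cycles_def using dmu_eq_zero_iff[OF xR uR] uR by blast
  qed
  have "\<Psi> (hclass x u) \<gamma> = \<delta> \<gamma>" if \<gamma>: "\<gamma> \<in> stalk ?m" for \<gamma>
  proof -
    obtain W h where s: "(W, h) \<in> sections ?m" "\<gamma> = germ ?m W h" using \<gamma> by (rule stalkE)
    obtain U p r where U: "zopen U" "x \<in> U" "U \<subseteq> preim W" "fraction_on U (h \<circ> orbit) p r" by (rule section_fraction[OF s(1)])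
    have pr: "p \<in> polys" "r \<in> polys" "\<And>y. y \<in> U \<Longrightarrow> r y \<noteq> 0" "\<And>y. y \<in> U \<Longrightarrow> h (orbit y) = p y / r y"
      using U(4) unfolding fraction_on_def by auto
    have "presents \<gamma> p r" unfolding presents_def using s U by blast
    then have germ_deriv: "\<Psi> (hclass x u) \<gamma> = quot_deriv p r u" using \<Psi>_hclass[OF u \<gamma>] germ_deriv_eq[OF u] by simp
    \<comment> \<open>On \<open>Y\<close> the retraction lands in \<open>U\<close>, so that the presentation of \<open>h\<close> can be evaluated on the slice.\<close>
    define Y where "Y = {y \<in> slice_dom. \<sigma> y \<in> U}"
    define V where "V = orbit ` Y"
    have preV: "preim V = Y"
    proof
      show "Y \<subseteq> preim V" unfolding V_def preim_def Y_def slice_dom_def by blast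
      show "preim V \<subseteq> Y"
      proof
        fix z assume "z \<in> preim V"
        then have z: "z \<in> Rep_st0" "orbit z \<in> orbit ` Y" unfolding preim_def V_def by simp_all
        obtain y where y: "orbit z = orbit y" "y \<in> Y" using z(2) by (rule imageE)
        have y': "y \<in> slice_dom" "\<sigma> y \<in> U" using y(2) unfolding Y_def by simp_all
        show "z \<in> Y"
          unfolding Y_def using slice_dom_orbit_eq[OF y'(1) Rep_st0_Rep[OF z(1)] y(1)[symmetric]] y'(2) by simp
      qed
    qed
    have "zopen Y" unfolding Y_def by (rule zopen_slice_preimage[OF U(1)])
    moreover have "V \<subseteq> moduli" unfolding V_def Y_def moduli_def slice_dom_def by blast
    ultimately have V: "mopen V" unfolding mopen_def preV by blast
    have xV: "?m \<in> V" unfolding V_def Y_def using x_slice_dom \<sigma>_x U(2) by auto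
    have VW: "V \<subseteq> slice_orbits" unfolding V_def Y_def slice_orbits_def by blast
    have VW': "V \<subseteq> W"
    proof
      fix n assume "n \<in> V"
      then obtain y where y: "y \<in> slice_dom" "\<sigma> y \<in> U" "n = orbit y" unfolding V_def Y_def by blast
      then have "orbit (\<sigma> y) \<in> W" using U(3) unfolding preim_def by blast
      then show "n \<in> W" using orbit_\<sigma>[OF y(1)] y(3) by simp
    qed
    have prod: "slice_fun r n * h n = slice_fun p n" if n: "n \<in> V" for n
    proof -
      obtain y where y: "y \<in> slice_dom" "\<sigma> y \<in> U" "n = orbit y" using n unfolding V_def Y_def by blast
      have "h n = p (\<sigma> y) / r (\<sigma> y)" using pr(4)[OF y(2)] orbit_\<sigma>[OF y(1)] y(3) by simp
      then show ?thesis using pr(3)[OF y(2)] unfolding y(3) slice_fun[OF y(1)] by simp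
    qed
    note sh = sections_restrict[OF s(1) V xV VW'] and sr = sections_restrict[OF sec[OF pr(2)] V xV VW]
    have gh: "germ ?m V h = \<gamma>" unfolding s(2) by (rule germ_eqI[OF V xV]) (use VW' in auto)
    have gs: "germ ?m V (slice_fun q) = germ ?m slice_orbits (slice_fun q)" for q by (rule germ_eqI[OF V xV]) (use VW in auto)
    have "germ ?m V (\<lambda>n. slice_fun r n * h n) = germ ?m slice_orbits (slice_fun p)"
      by (rule germ_eqI[OF V xV]) (use VW prod in auto)
    then have "D p = D r * h ?m + r x * \<delta> \<gamma>"
      using \<delta>_mult[OF sr sh] unfolding gs gh slice_fun_x by (simp add: D_def)
    moreover have "h ?m = p x / r x" "r x \<noteq> 0" using pr(3,4)[OF U(2)] by auto
    ultimately have "quot_deriv p r u = \<delta> \<gamma>"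
      unfolding quot_deriv_def D_dir_deriv[OF pr(1), symmetric] D_dir_deriv[OF pr(2), symmetric] by (simp add: field_simps)
    then show ?thesis using germ_deriv by simp
  qed
  then have "\<Psi> (hclass x u) = \<delta>"
    by (rule extensionalityI[OF \<Psi>_extensional \<delta>_ext])
  then show ?thesis using u by blast
qed

lemma \<Psi>_bij: "bij_betw \<Psi> (homology x) (tangent_space (orbit x))"
  unfolding bij_betw_def
proof (intro conjI \<Psi>_inj equalityI subsetI)
  fix \<delta> assume "\<delta> \<in> \<Psi> ` homology x"
  then show "\<delta> \<in> tangent_space (orbit x)" unfolding homology_def using \<Psi>_tangent by blast
next
  fix \<delta> assume "\<delta> \<in> tangent_space (orbit x)"
  then obtain u where u: "u \<in> cycles x" "\<Psi> (hclass x u) = \<delta>" using \<Psi>_surj by blast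
  then show "\<delta> \<in> \<Psi> ` homology x" unfolding homology_def by blast
qed

lemma \<Psi>_linear: "linear_on_homology x \<Psi>"
  unfolding linear_on_homology_def
proof (intro ballI allI)
  fix u w c \<gamma> assume u: "u \<in> cycles x" and w: "w \<in> cycles x" and \<gamma>: "\<gamma> \<in> stalk (orbit x)"
  have "germ_deriv (rep_add (rep_smult c u) w) \<gamma> = c * germ_deriv u \<gamma> + germ_deriv w \<gamma>"
    using germ_deriv_lin[of \<gamma>] cycles_Rep[OF u] cycles_Rep[OF w] rep_smult_Rep[OF cycles_Rep[OF u]] unfolding lin_def by simp
  then show "\<Psi> (hclass x (rep_add (rep_smult c u) w)) \<gamma> = c * \<Psi> (hclass x u) \<gamma> + \<Psi> (hclass x w) \<gamma>"
    unfolding \<Psi>_hclass[OF u \<gamma>] \<Psi>_hclass[OF w \<gamma>] \<Psi>_hclass[OF cycles_comb[OF xR u w] \<gamma>] .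
qed

lemma \<Psi>_induced: "induced_by_quotient_map x \<Psi>"
  unfolding induced_by_quotient_map_def
proof (intro ballI allI impI)
  fix u W h U p r
  assume u: "u \<in> cycles x" and a: "(W, h) \<in> sections (orbit x) \<and> zopen U \<and> x \<in> U \<and> U \<subseteq> preim W \<and> fraction_on U (h \<circ> orbit) p r"
  then have "presents (germ (orbit x) W h) p r" unfolding presents_def by blast
  then have "\<Psi> (hclass x u) (germ (orbit x) W h) = quot_deriv p r u"
    using \<Psi>_hclass[OF u germ_in_stalk] germ_deriv_eq[OF u] a by simp
  moreover have "p \<in> polys" "r \<in> polys" "r x \<noteq> 0" using a unfolding fraction_on_def by auto
  ultimately show "((\<lambda>t. p (rep_add x (rep_smult t u)) / r (rep_add x (rep_smult t u))) has_field_derivative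
      \<Psi> (hclass x u) (germ (orbit x) W h)) (at 0)"
    using quot_deriv[OF _ _ _ curve_line[OF cycles_Rep[OF u]]] by simp
qed

end

theorem theorem2p23:
  fixes Q :: "('v, 'e) pre_digraph"
    and d f k :: "'v \<Rightarrow> nat"
    and \<pi> :: "'v \<Rightarrow> complex mat"
    and x :: "('v, 'e) framed_tuple"
  assumes "framed_quiver Q d k \<pi>"
    and "x \<in> framed_quiver.Rep_st0 Q d f k \<pi>"
  shows "(framed_quiver.jmap Q d k \<pi> x \<in> framed_quiver.LieP Q d k \<rightarrow> framed_quiver.Rep Q d f k \<and>
      inj_on (framed_quiver.jmap Q d k \<pi> x) (framed_quiver.LieP Q d k) \<and>
      framed_quiver.dmu Q d k \<pi> x ` framed_quiver.Rep Q d f k = framed_quiver.dmu_target Q d k)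
    \<and> (\<forall>\<xi>\<in>framed_quiver.LieP Q d k.
        framed_quiver.dmu Q d k \<pi> x (framed_quiver.jmap Q d k \<pi> x \<xi>) = framed_quiver.dmu_zero Q d k)
    \<and> (\<exists>\<Psi>. bij_betw \<Psi> (framed_quiver.homology Q d f k \<pi> x)
              (framed_quiver.tangent_space Q d f k \<pi> (framed_quiver.orbit Q d k \<pi> x)) \<and>
            framed_quiver.linear_on_homology Q d f k \<pi> x \<Psi> \<and>
            framed_quiver.induced_by_quotient_map Q d f k \<pi> x \<Psi>)"
proof -
  interpret framed_quiver Q d f k \<pi> by fact
  interpret framed_point Q d f k \<pi> x by unfold_locales fact
  show ?thesis
    using jmap_Rep[OF xR] jmap_inj[OF xR x_stable] dmu_surj[OF xR x_stable] dmu_jmap[OF xR x_moment]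
      \<Psi>_bij \<Psi>_linear \<Psi>_induced by blast
qed

end
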